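(* Let $p$ be a prime, $W$ a $p$-adically complete ring and $R=W[[q-1]]$. The category of $R$-modules endowed with a $\mathbb{\Delta}$-hyperstratification is isomorphic to the category of $R$-modules endowed with a $\mathbb{\Delta}$-Taylor map.
   Context: $(n)_q=1+q+\cdots+q^{n-1}$; $(n)_{q^p}$, $\binom nk_{q^p}$ are Gaussian integers and binomials at $q^p$. All $R$-modules carry the $(p,q-1)$-adic topology and completions are for it. $R\langle\omega\rangle_{\mathbb{\Delta}}$ is the commutative $R$-algebra free as a module on $(\omega^{\{n\}_{\mathbb{\Delta}}})_{n\in\mathbb N}$, with unit $\omega^{\{0\}_{\mathbb{\Delta}}}$, $\omega:=\omega^{\{1\}_{\mathbb{\Delta}}}$ and $$\omega^{\{n_1\}_{\mathbb{\Delta}}}\omega^{\{n_2\}_{\mathbb{\Delta}}}=\sum_{0\le i\le\min(n_1,n_2)}q^{\frac{pi(i-1)}2}\binom{n_1+n_2-i}{n_1}_{q^p}\binom{n_1}{i}_{q^p}(q-1)^iq^i\,\omega^{\{n_1+n_2-i\}_{\mathbb{\Delta}}}.$$ The Taylor map $\theta_R:R\to\widehat{R\langle\omega\rangle}_{\mathbb{\Delta}}$ is the unique continuous $W$-algebra morphism with $\theta_R(q)=q+(p)_q\omega$; $\otimes'_R$ means that the left factor is viewed as an $R$-module via $\theta_R$. The augmentation $e:\widehat{R\langle\omega\rangle}_{\mathbb{\Delta}}\to R$ sends $\omega^{\{n\}_{\mathbb{\Delta}}}$ to $0$ for $n>0$. The comultiplication $\Delta:\widehat{R\langle\omega\rangle}_{\mathbb{\Delta}}\to\widehat{R\langle\omega\rangle}_{\mathbb{\Delta}}\widehat\otimes'_R\widehat{R\langle\omega\rangle}_{\mathbb{\Delta}}$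 is the unique $R$-algebra morphism extending (via $\xi\mapsto(p)_q\omega$) the map $R[[\xi]]\to R[[\xi]]\widehat\otimes'_RR[[\xi]]$, $\xi\mapsto1\otimes\xi+\xi\otimes1$. A $\mathbb{\Delta}$-hyperstratification on $M$ is an $\widehat{R\langle\omega\rangle}_{\mathbb{\Delta}}$-linear isomorphism $\epsilon_M:\widehat{R\langle\omega\rangle}_{\mathbb{\Delta}}\widehat\otimes'_RM\simeq M\widehat\otimes_R\widehat{R\langle\omega\rangle}_{\mathbb{\Delta}}$ such that $(\epsilon_M\otimes\mathrm{Id})\circ(\mathrm{Id}\otimes\epsilon_M)\circ(\Delta\otimes\mathrm{Id}_M)=(\mathrm{Id}_M\otimes\Delta)\circ\epsilon_M$. A $\mathbb{\Delta}$-Taylor map on $M$ is an additive map $\theta_M:M\to M\widehat\otimes_R\widehat{R\langle\omega\rangle}_{\mathbb{\Delta}}$ that is semilinear, i.e. $\theta_M(\alpha s)=\theta_R(\alpha)\theta_M(s)$ for $\alpha\in R$, $s\in M$, and such that $(\mathrm{Id}_M\otimes e)\circ\theta_M=\mathrm{Id}_M$ (as maps into the completion of $M$) and $(\theta_M\otimes\mathrm{Id})\circ\theta_M=(\mathrm{Id}_M\otimes\Delta)\circ\theta_M$. Morphisms in both categories are the $R$-linear maps compatible with the extra structure. *)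

theory Defs
  imports
    "HOL-Algebra.Free_Abelian_Groups"
    "HOL-Algebra.QuotRing"
    "HOL-Algebra.Algebraic_Closure_Type"
    "HOL-Computational_Algebra.Formal_Power_Series"
begin

section \<open>Categories and isomorphisms of categories\<close>

text \<open>Composition takes the three objects as arguments: \<open>Cmp C x y z g f\<close> is
  $g \circ f$ for $f : x \to y$ and $g : y \to z$.\<close>

record ('o, 'f) cat =
  Ob :: "'o set"
  Arr :: "'o \<Rightarrow> 'o \<Rightarrow> 'f set"
  Ide :: "'o \<Rightarrow> 'f"
  Cmp :: "'o \<Rightarrow> 'o \<Rightarrow> 'o \<Rightarrow> 'f \<Rightarrow> 'f \<Rightarrow> 'f"

definition is_category :: "('o, 'f) cat \<Rightarrow> bool" where
  "is_category C \<longleftrightarrow>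
    (\<forall>x\<in>Ob C. Ide C x \<in> Arr C x x) \<and>
    (\<forall>x\<in>Ob C. \<forall>y\<in>Ob C. \<forall>z\<in>Ob C. \<forall>f\<in>Arr C x y. \<forall>g\<in>Arr C y z.
        Cmp C x y z g f \<in> Arr C x z) \<and>
    (\<forall>x\<in>Ob C. \<forall>y\<in>Ob C. \<forall>f\<in>Arr C x y.
        Cmp C x x y f (Ide C x) = f \<and> Cmp C x y y (Ide C y) f = f) \<and>
    (\<forall>x\<in>Ob C. \<forall>y\<in>Ob C. \<forall>z\<in>Ob C. \<forall>t\<in>Ob C.
        \<forall>f\<in>Arr C x y. \<forall>g\<in>Arr C y z. \<forall>h\<in>Arr C z t.
        Cmp C x z t h (Cmp C x y z g f) = Cmp C x y t (Cmp C y z t h g) f)"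

definition is_functor ::
  "('o, 'f) cat \<Rightarrow> ('o2, 'f2) cat \<Rightarrow> ('o \<Rightarrow> 'o2) \<Rightarrow> ('o \<Rightarrow> 'o \<Rightarrow> 'f \<Rightarrow> 'f2) \<Rightarrow> bool" where
  "is_functor C D F F' \<longleftrightarrow>
    (\<forall>x\<in>Ob C. F x \<in> Ob D) \<and>
    (\<forall>x\<in>Ob C. \<forall>y\<in>Ob C. \<forall>f\<in>Arr C x y. F' x y f \<in> Arr D (F x) (F y)) \<and>
    (\<forall>x\<in>Ob C. F' x x (Ide C x) = Ide D (F x)) \<and>
    (\<forall>x\<in>Ob C. \<forall>y\<in>Ob C. \<forall>z\<in>Ob C. \<forall>f\<in>Arr C x y. \<forall>g\<in>Arr C y z.
        F' x z (Cmp C x y z g f) = Cmp D (F x) (F y) (F z) (F' y z g) (F' x y f))"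

definition isomorphic_categories :: "('o, 'f) cat \<Rightarrow> ('o2, 'f2) cat \<Rightarrow> bool" where
  "isomorphic_categories C D \<longleftrightarrow> is_category C \<and> is_category D \<and>
    (\<exists>F F' G G'. is_functor C D F F' \<and> is_functor D C G G' \<and>
      (\<forall>x\<in>Ob C. G (F x) = x) \<and>
      (\<forall>x\<in>Ob C. \<forall>y\<in>Ob C. \<forall>f\<in>Arr C x y. G' (F x) (F y) (F' x y f) = f) \<and>
      (\<forall>x\<in>Ob D. F (G x) = x) \<and>
      (\<forall>x\<in>Ob D. \<forall>y\<in>Ob D. \<forall>f\<in>Arr D x y. F' (G x) (G y) (G' x y f) = f))"


section \<open>The base ring $R = W[[q-1]]$ and its modules\<close>

text \<open>Complete includes separated: $W \to \varprojlim W/p^n$ is bijective.\<close>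

definition p_adically_complete :: "nat \<Rightarrow> 'w::comm_ring_1 itself \<Rightarrow> bool" where
  "p_adically_complete p W \<longleftrightarrow>
    (\<forall>a::'w. (\<forall>n. of_nat p ^ n dvd a) \<longrightarrow> a = 0) \<and>
    (\<forall>f::nat \<Rightarrow> 'w. (\<forall>n. of_nat p ^ n dvd f (Suc n) - f n) \<longrightarrow>
        (\<exists>a. \<forall>n. of_nat p ^ n dvd a - f n))"

text \<open>$R$ is the type \<open>'w fps\<close>, whose variable \<open>fps_X\<close> is $q-1$.\<close>

abbreviation (input) qq :: "'w::comm_ring_1 fps" where
  "qq \<equiv> 1 + fps_X"

definition qint :: "'a::comm_ring_1 \<Rightarrow> nat \<Rightarrow> 'a" where
  "qint t n = (\<Sum>i<n. t ^ i)"

fun qbinom :: "'a::comm_ring_1 \<Rightarrow> nat \<Rightarrow> nat \<Rightarrow> 'a" where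
  "qbinom t n 0 = 1"
| "qbinom t 0 (Suc k) = 0"
| "qbinom t (Suc n) (Suc k) = qbinom t n k + t ^ Suc k * qbinom t n (Suc k)"

abbreviation base_ring :: "'w::comm_ring_1 fps ring" where
  "base_ring \<equiv> ring_of_type_algebra"

definition base_algebra :: "('w::comm_ring_1 fps, 'w fps) module" where
  "base_algebra = ring.extend base_ring (module.fields (*))"

text \<open>In a \<open>module\<close> record that is not meant to be an algebra, the fields \<open>mult\<close> and \<open>one\<close>
  carry no information.\<close>

definition linear_maps ::
  "('w::comm_ring_1 fps, 'a, 'y) module_scheme \<Rightarrow> ('w fps, 'b, 'z) module_scheme \<Rightarrow> ('a \<Rightarrow> 'b) set"
  where
  "linear_maps A B = {f \<in> carrier A \<rightarrow>\<^sub>E carrier B.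
    (\<forall>x\<in>carrier A. \<forall>y\<in>carrier A. f (x \<oplus>\<^bsub>A\<^esub> y) = f x \<oplus>\<^bsub>B\<^esub> f y) \<and>
    (\<forall>r. \<forall>x\<in>carrier A. f (r \<odot>\<^bsub>A\<^esub> x) = r \<odot>\<^bsub>B\<^esub> f x)}"

definition algebra_maps ::
  "('w::comm_ring_1 fps, 'a, 'y) module_scheme \<Rightarrow> ('w fps, 'b, 'z) module_scheme \<Rightarrow> ('a \<Rightarrow> 'b) set"
  where
  "algebra_maps A B = ring_hom A B \<inter> linear_maps A B"


section \<open>The $(p,q-1)$-adic topology and completion\<close>

text \<open>\<open>adic p A n\<close> is $I^n A$ for $I = (p, q-1)$, computed as
  $I^{n+1}A = I \cdot I^n A = p\,I^nA + (q-1)\,I^nA$.\<close>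

primrec adic :: "nat \<Rightarrow> ('w::comm_ring_1 fps, 'a, 'z) module_scheme \<Rightarrow> nat \<Rightarrow> 'a set" where
  "adic p A 0 = carrier A"
| "adic p A (Suc n) =
    {of_nat p \<odot>\<^bsub>A\<^esub> a \<oplus>\<^bsub>A\<^esub> fps_X \<odot>\<^bsub>A\<^esub> b | a b. a \<in> adic p A n \<and> b \<in> adic p A n}"

definition continuous_maps :: "nat \<Rightarrow>
    ('w::comm_ring_1 fps, 'a, 'y) module_scheme \<Rightarrow> ('w fps, 'b, 'z) module_scheme \<Rightarrow> ('a \<Rightarrow> 'b) set"
  where
  "continuous_maps p A B = {h \<in> carrier A \<rightarrow>\<^sub>E carrier B.
    (\<forall>x\<in>carrier A. \<forall>y\<in>carrier A. h (x \<oplus>\<^bsub>A\<^esub> y) = h x \<oplus>\<^bsub>B\<^esub> h y) \<and>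
    (\<forall>n. \<exists>m. h ` adic p A m \<subseteq> adic p B n)}"

text \<open>The completion is $\varprojlim_n A/I^nA$: its elements are the sequences of cosets
  $x_n \in A/I^nA$ with $x_{n+1} \subseteq x_n$. The multiplication and unit are meaningful when
  \<open>A\<close> is an algebra.\<close>

type_synonym 'a compl = "nat \<Rightarrow> 'a set"

definition completion ::
  "nat \<Rightarrow> ('w::comm_ring_1 fps, 'a, 'z) module_scheme \<Rightarrow> ('w fps, 'a compl) module" where
  "completion p A =
    \<lparr>carrier = {x. \<forall>n. x n \<in> a_rcosets\<^bsub>A\<^esub> (adic p A n) \<and> x (Suc n) \<subseteq> x n},
     monoid.mult = (\<lambda>x y n. rcoset_mult A (adic p A n) (x n) (y n)),
     one = (\<lambda>n. adic p A n +>\<^bsub>A\<^esub> \<one>\<^bsub>A\<^esub>),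
     ring.zero = (\<lambda>n. adic p A n),
     add = (\<lambda>x y n. x n <+>\<^bsub>A\<^esub> y n),
     module.smult = (\<lambda>r x n. \<Union>a\<in>x n. adic p A n +>\<^bsub>A\<^esub> (r \<odot>\<^bsub>A\<^esub> a))\<rparr>"

definition to_completion ::
  "nat \<Rightarrow> ('w::comm_ring_1 fps, 'a, 'z) module_scheme \<Rightarrow> 'a \<Rightarrow> 'a compl" where
  "to_completion p A a = (\<lambda>n. adic p A n +>\<^bsub>A\<^esub> a)"


section \<open>Bimodules and completed tensor products\<close>

text \<open>The tensor products \<open>\<otimes>'\<close> and \<open>\<otimes>\<close> over $R$ are both instances of the tensor product of
  $R$-$R$-bimodules, which balances the right action on the left factor against the left action
  on the right factor. On $\widehat{R\langle\omega\rangle}$ the left action is the structural one and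
  the right action is through $\theta_R$; on an $R$-module both actions agree. The field
  \<open>smult\<close> is the left action; it defines the $R$-module structure and hence the topology.\<close>

record ('r, 'a) bimodule = "('r, 'a) module" +
  rsmult :: "'a \<Rightarrow> 'r \<Rightarrow> 'a"

definition symmetric_bimodule :: "('r, 'a) module \<Rightarrow> ('r, 'a) bimodule" where
  "symmetric_bimodule M = module.extend M (bimodule.fields (\<lambda>x r. r \<odot>\<^bsub>M\<^esub> x))"

definition bimodule_completion ::
  "nat \<Rightarrow> ('w::comm_ring_1 fps, 'a) bimodule \<Rightarrow> ('w fps, 'a compl) bimodule" where
  "bimodule_completion p A = module.extend (completion p A)
    (bimodule.fields (\<lambda>x r n. \<Union>a\<in>x n. adic p A n +>\<^bsub>A\<^esub> rsmult A a r))"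

text \<open>The algebraic tensor product is the free abelian group on \<open>carrier A \<times> carrier B\<close> modulo
  the bilinearity and balancing relations. The free abelian group and its quotient are
  multiplicatively written in HOL-Algebra, hence \<open>#>\<close> for its cosets.\<close>

type_synonym ('a, 'b) tens = "(('a \<times> 'b) \<Rightarrow>\<^sub>0 int) set"

type_synonym ('a, 'b) ctens = "('a, 'b) tens compl"

abbreviation pairs_group ::
  "('r, 'a) bimodule \<Rightarrow> ('r, 'b) bimodule \<Rightarrow> (('a \<times> 'b) \<Rightarrow>\<^sub>0 int) monoid" where
  "pairs_group A B \<equiv> free_Abelian_group (carrier A \<times> carrier B)"

definition tensor_relations ::
  "('r, 'a) bimodule \<Rightarrow> ('r, 'b) bimodule \<Rightarrow> (('a \<times> 'b) \<Rightarrow>\<^sub>0 int) set" where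
  "tensor_relations A B =
    {frag_of (a \<oplus>\<^bsub>A\<^esub> a', b) - frag_of (a, b) - frag_of (a', b) | a a' b.
       a \<in> carrier A \<and> a' \<in> carrier A \<and> b \<in> carrier B} \<union>
    {frag_of (a, b \<oplus>\<^bsub>B\<^esub> b') - frag_of (a, b) - frag_of (a, b') | a b b'.
       a \<in> carrier A \<and> b \<in> carrier B \<and> b' \<in> carrier B} \<union>
    {frag_of (rsmult A a r, b) - frag_of (a, r \<odot>\<^bsub>B\<^esub> b) | a r b.
       a \<in> carrier A \<and> b \<in> carrier B}"

definition tensor_null ::
  "('r, 'a) bimodule \<Rightarrow> ('r, 'b) bimodule \<Rightarrow> (('a \<times> 'b) \<Rightarrow>\<^sub>0 int) set" where
  "tensor_null A B = generate (pairs_group A B) (tensor_relations A B)"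

definition tensor_class ::
  "('r, 'a) bimodule \<Rightarrow> ('r, 'b) bimodule \<Rightarrow> (('a \<times> 'b) \<Rightarrow>\<^sub>0 int) \<Rightarrow> ('a, 'b) tens" where
  "tensor_class A B u = tensor_null A B #>\<^bsub>pairs_group A B\<^esub> u"

text \<open>The multiplication $(a\otimes b)(c\otimes d) = ac\otimes bd$ and the unit are meaningful when
  both factors are algebras whose right action is compatible with the multiplication.\<close>

definition tensor ::
  "('r, 'a) bimodule \<Rightarrow> ('r, 'b) bimodule \<Rightarrow> ('r, ('a, 'b) tens) bimodule" where
  "tensor A B =
    \<lparr>carrier = carrier (pairs_group A B Mod tensor_null A B),
     monoid.mult = (\<lambda>U V. \<Union>u\<in>U. \<Union>v\<in>V. tensor_class A B
        (frag_extend (\<lambda>(a, b). frag_extend (\<lambda>(c, d). frag_of (a \<otimes>\<^bsub>A\<^esub> c, b \<otimes>\<^bsub>B\<^esub> d)) v) u)),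
     one = tensor_class A B (frag_of (\<one>\<^bsub>A\<^esub>, \<one>\<^bsub>B\<^esub>)),
     ring.zero = \<one>\<^bsub>pairs_group A B Mod tensor_null A B\<^esub>,
     add = monoid.mult (pairs_group A B Mod tensor_null A B),
     module.smult = (\<lambda>r U. \<Union>u\<in>U. tensor_class A B
        (frag_extend (\<lambda>(a, b). frag_of (r \<odot>\<^bsub>A\<^esub> a, b)) u)),
     rsmult = (\<lambda>U r. \<Union>u\<in>U. tensor_class A B
        (frag_extend (\<lambda>(a, b). frag_of (a, rsmult B b r)) u))\<rparr>"

definition ctensor :: "nat \<Rightarrow> ('w::comm_ring_1 fps, 'a) bimodule \<Rightarrow> ('w fps, 'b) bimodule \<Rightarrow>
    ('w fps, ('a, 'b) ctens) bimodule" where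
  "ctensor p A B = bimodule_completion p (tensor A B)"

definition cpure :: "nat \<Rightarrow> ('w::comm_ring_1 fps, 'a) bimodule \<Rightarrow> ('w fps, 'b) bimodule \<Rightarrow>
    'a \<Rightarrow> 'b \<Rightarrow> ('a, 'b) ctens" where
  "cpure p A B a b = to_completion p (tensor A B) (tensor_class A B (frag_of (a, b)))"

text \<open>The continuous additive map out of a completed tensor product with prescribed values
  on the pure tensors.\<close>

definition ctensor_lift :: "nat \<Rightarrow> ('w::comm_ring_1 fps, 'a) bimodule \<Rightarrow> ('w fps, 'b) bimodule \<Rightarrow>
    ('w fps, 'c, 'z) module_scheme \<Rightarrow> ('a \<Rightarrow> 'b \<Rightarrow> 'c) \<Rightarrow> ('a, 'b) ctens \<Rightarrow> 'c" where
  "ctensor_lift p A B C \<beta> = (THE h. h \<in> continuous_maps p (ctensor p A B) C \<and>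
    (\<forall>a\<in>carrier A. \<forall>b\<in>carrier B. h (cpure p A B a b) = \<beta> a b))"

definition ctensor_map :: "nat \<Rightarrow> ('w::comm_ring_1 fps, 'a) bimodule \<Rightarrow> ('w fps, 'b) bimodule \<Rightarrow>
    ('w fps, 'c) bimodule \<Rightarrow> ('w fps, 'd) bimodule \<Rightarrow> ('a \<Rightarrow> 'c) \<Rightarrow> ('b \<Rightarrow> 'd) \<Rightarrow>
    ('a, 'b) ctens \<Rightarrow> ('c, 'd) ctens" where
  "ctensor_map p A B A' B' f g =
    ctensor_lift p A B (ctensor p A' B') (\<lambda>a b. cpure p A' B' (f a) (g b))"

definition assoc_r :: "nat \<Rightarrow> ('w::comm_ring_1 fps, 'a) bimodule \<Rightarrow> ('w fps, 'b) bimodule \<Rightarrow>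
    ('w fps, 'c) bimodule \<Rightarrow> (('a, 'b) ctens, 'c) ctens \<Rightarrow> ('a, ('b, 'c) ctens) ctens" where
  "assoc_r p A B C =
    (let D = ctensor p A (ctensor p B C) in
     ctensor_lift p (ctensor p A B) C D
       (\<lambda>x c. ctensor_lift p A B D (\<lambda>a b. cpure p A (ctensor p B C) a (cpure p B C b c)) x))"

definition assoc_l :: "nat \<Rightarrow> ('w::comm_ring_1 fps, 'a) bimodule \<Rightarrow> ('w fps, 'b) bimodule \<Rightarrow>
    ('w fps, 'c) bimodule \<Rightarrow> ('a, ('b, 'c) ctens) ctens \<Rightarrow> (('a, 'b) ctens, 'c) ctens" where
  "assoc_l p A B C =
    (let D = ctensor p (ctensor p A B) C in
     ctensor_lift p A (ctensor p B C) D
       (\<lambda>a y. ctensor_lift p B C D (\<lambda>b c. cpure p (ctensor p A B) C (cpure p A B a b) c) y))"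


section \<open>The twisted divided power algebra and its groupoid structure\<close>

text \<open>The basis element $\omega^{\{n\}}$ is \<open>Poly_Mapping.single n 1\<close>.\<close>

definition omega_coeff :: "nat \<Rightarrow> nat \<Rightarrow> nat \<Rightarrow> nat \<Rightarrow> 'w::comm_ring_1 fps" where
  "omega_coeff p m n i = qq ^ (p * (i * (i - 1) div 2)) *
     qbinom (qq ^ p) (m + n - i) m * qbinom (qq ^ p) m i * fps_X ^ i * qq ^ i"

definition omega_alg :: "nat \<Rightarrow> ('w::comm_ring_1 fps, nat \<Rightarrow>\<^sub>0 'w fps) module" where
  "omega_alg p =
    \<lparr>carrier = UNIV,
     monoid.mult = (\<lambda>f g. \<Sum>m\<in>Poly_Mapping.keys f. \<Sum>n\<in>Poly_Mapping.keys g. \<Sum>i\<le>min m n.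
        Poly_Mapping.single (m + n - i)
          (Poly_Mapping.lookup f m * Poly_Mapping.lookup g n * omega_coeff p m n i)),
     one = Poly_Mapping.single 0 1,
     ring.zero = 0,
     add = (+),
     module.smult = (\<lambda>r. Poly_Mapping.map ((*) r))\<rparr>"

type_synonym 'w omega = "(nat \<Rightarrow>\<^sub>0 'w fps) compl"

definition omega_hat :: "nat \<Rightarrow> ('w::comm_ring_1 fps, 'w omega) module" where
  "omega_hat p = completion p (omega_alg p)"

definition omega_pow :: "nat \<Rightarrow> nat \<Rightarrow> 'w::comm_ring_1 omega" where
  "omega_pow p n = to_completion p (omega_alg p) (Poly_Mapping.single n 1)"

text \<open>The image $(p)_q\omega$ of $\xi$.\<close>

definition xi :: "nat \<Rightarrow> 'w::comm_ring_1 omega" where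
  "xi p = qint qq p \<odot>\<^bsub>omega_hat p\<^esub> omega_pow p 1"

definition is_Taylor_hom :: "nat \<Rightarrow> ('w::comm_ring_1 fps \<Rightarrow> 'w omega) \<Rightarrow> bool" where
  "is_Taylor_hom p \<theta> \<longleftrightarrow>
    \<theta> \<in> ring_hom base_ring (omega_hat p) \<and>
    \<theta> \<in> continuous_maps p base_algebra (omega_hat p) \<and>
    (\<forall>c. \<theta> (fps_const c) = fps_const c \<odot>\<^bsub>omega_hat p\<^esub> \<one>\<^bsub>omega_hat p\<^esub>) \<and>
    \<theta> qq = qq \<odot>\<^bsub>omega_hat p\<^esub> \<one>\<^bsub>omega_hat p\<^esub> \<oplus>\<^bsub>omega_hat p\<^esub> xi p"

definition omega_bimodule ::
  "nat \<Rightarrow> ('w::comm_ring_1 fps \<Rightarrow> 'w omega) \<Rightarrow> ('w fps, 'w omega) bimodule" where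
  "omega_bimodule p \<theta> =
    module.extend (omega_hat p) (bimodule.fields (\<lambda>x r. x \<otimes>\<^bsub>omega_hat p\<^esub> \<theta> r))"

definition augmentation :: "nat \<Rightarrow> 'w::comm_ring_1 omega \<Rightarrow> 'w fps" where
  "augmentation p = (THE e. e \<in> algebra_maps (omega_hat p) base_algebra \<and>
    (\<forall>n>0. e (omega_pow p n) = 0))"

text \<open>A morphism of $R$-algebras out of $\widehat{R\langle\omega\rangle}$ is automatically
  continuous, so that extending the continuous morphism $\xi \mapsto 1\otimes\xi + \xi\otimes 1$
  on $R[[\xi]]$ is a condition on the image $(p)_q\omega$ of $\xi$ only.\<close>

definition is_comultiplication :: "nat \<Rightarrow> ('w::comm_ring_1 fps \<Rightarrow> 'w omega) \<Rightarrow>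
    ('w omega \<Rightarrow> ('w omega, 'w omega) ctens) \<Rightarrow> bool" where
  "is_comultiplication p \<theta> \<Delta> \<longleftrightarrow>
    (let P = omega_bimodule p \<theta>; PP = ctensor p P P in
     \<Delta> \<in> algebra_maps P PP \<and>
     \<Delta> (xi p) = cpure p P P \<one>\<^bsub>P\<^esub> (xi p) \<oplus>\<^bsub>PP\<^esub> cpure p P P (xi p) \<one>\<^bsub>P\<^esub>)"


section \<open>Hyperstratifications and Taylor maps\<close>

definition act_left :: "nat \<Rightarrow> ('w::comm_ring_1 fps \<Rightarrow> 'w omega) \<Rightarrow> ('w fps, 'm) module \<Rightarrow>
    'w omega \<Rightarrow> ('w omega, 'm) ctens \<Rightarrow> ('w omega, 'm) ctens" where
  "act_left p \<theta> M a =
    (let P = omega_bimodule p \<theta>; S = symmetric_bimodule M in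
     ctensor_map p P S P S (\<lambda>b. a \<otimes>\<^bsub>P\<^esub> b) (\<lambda>s. s))"

definition act_right :: "nat \<Rightarrow> ('w::comm_ring_1 fps \<Rightarrow> 'w omega) \<Rightarrow> ('w fps, 'm) module \<Rightarrow>
    'w omega \<Rightarrow> ('m, 'w omega) ctens \<Rightarrow> ('m, 'w omega) ctens" where
  "act_right p \<theta> M a =
    (let P = omega_bimodule p \<theta>; S = symmetric_bimodule M in
     ctensor_map p S P S P (\<lambda>s. s) (\<lambda>b. a \<otimes>\<^bsub>P\<^esub> b))"

definition is_hyperstratification :: "nat \<Rightarrow> ('w::comm_ring_1 fps \<Rightarrow> 'w omega) \<Rightarrow>
    ('w omega \<Rightarrow> ('w omega, 'w omega) ctens) \<Rightarrow> ('w fps, 'm) module \<Rightarrow>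
    (('w omega, 'm) ctens \<Rightarrow> ('m, 'w omega) ctens) \<Rightarrow> bool" where
  "is_hyperstratification p \<theta> \<Delta> M \<epsilon> \<longleftrightarrow>
    (let P = omega_bimodule p \<theta>; S = symmetric_bimodule M;
         PP = ctensor p P P; PS = ctensor p P S; SP = ctensor p S P in
     \<epsilon> \<in> carrier PS \<rightarrow>\<^sub>E carrier SP \<and>
     bij_betw \<epsilon> (carrier PS) (carrier SP) \<and>
     (\<forall>x\<in>carrier PS. \<forall>y\<in>carrier PS. \<epsilon> (x \<oplus>\<^bsub>PS\<^esub> y) = \<epsilon> x \<oplus>\<^bsub>SP\<^esub> \<epsilon> y) \<and>
     (\<forall>a\<in>carrier P. \<forall>x\<in>carrier PS. \<epsilon> (act_left p \<theta> M a x) = act_right p \<theta> M a (\<epsilon> x)) \<and>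
     (\<forall>x\<in>carrier PS.
        assoc_r p S P P
          (ctensor_map p PS P SP P \<epsilon> (\<lambda>b. b)
            (assoc_l p P S P
              (ctensor_map p P PS P SP (\<lambda>b. b) \<epsilon>
                (assoc_r p P P S
                  (ctensor_map p P S PP S \<Delta> (\<lambda>s. s) x)))))
        = ctensor_map p S P S PP (\<lambda>s. s) \<Delta> (\<epsilon> x)))"

text \<open>The map $\mathrm{Id}_M\otimes e$, with values in $M\widehat\otimes_R R = \widehat M$.\<close>

definition id_tensor_augmentation :: "nat \<Rightarrow> ('w::comm_ring_1 fps \<Rightarrow> 'w omega) \<Rightarrow>
    ('w fps, 'm) module \<Rightarrow> ('m, 'w omega) ctens \<Rightarrow> 'm compl" where
  "id_tensor_augmentation p \<theta> M =
    ctensor_lift p (symmetric_bimodule M) (omega_bimodule p \<theta>) (completion p M)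
      (\<lambda>s a. to_completion p M (augmentation p a \<odot>\<^bsub>M\<^esub> s))"

definition is_Taylor_map :: "nat \<Rightarrow> ('w::comm_ring_1 fps \<Rightarrow> 'w omega) \<Rightarrow>
    ('w omega \<Rightarrow> ('w omega, 'w omega) ctens) \<Rightarrow> ('w fps, 'm) module \<Rightarrow>
    ('m \<Rightarrow> ('m, 'w omega) ctens) \<Rightarrow> bool" where
  "is_Taylor_map p \<theta> \<Delta> M T \<longleftrightarrow>
    (let P = omega_bimodule p \<theta>; S = symmetric_bimodule M;
         PP = ctensor p P P; SP = ctensor p S P in
     T \<in> carrier M \<rightarrow>\<^sub>E carrier SP \<and>
     (\<forall>s\<in>carrier M. \<forall>t\<in>carrier M. T (s \<oplus>\<^bsub>M\<^esub> t) = T s \<oplus>\<^bsub>SP\<^esub> T t) \<and>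
     (\<forall>r. \<forall>s\<in>carrier M. T (r \<odot>\<^bsub>M\<^esub> s) = act_right p \<theta> M (\<theta> r) (T s)) \<and>
     (\<forall>s\<in>carrier M. id_tensor_augmentation p \<theta> M (T s) = to_completion p M s) \<and>
     (\<forall>s\<in>carrier M.
        assoc_r p S P P (ctensor_map p S P SP P T (\<lambda>b. b) (T s))
        = ctensor_map p S P S PP (\<lambda>s. s) \<Delta> (T s)))"

text \<open>For a type \<open>'m\<close>, the modules considered are those whose carrier is a subset of \<open>'m\<close>.\<close>

definition hyperstratified_modules :: "nat \<Rightarrow> ('w::comm_ring_1 fps \<Rightarrow> 'w omega) \<Rightarrow>
    ('w omega \<Rightarrow> ('w omega, 'w omega) ctens) \<Rightarrow> 'm itself \<Rightarrow>
    (('w fps, 'm) module \<times> (('w omega, 'm) ctens \<Rightarrow> ('m, 'w omega) ctens), 'm \<Rightarrow> 'm) cat" where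
  "hyperstratified_modules p \<theta> \<Delta> TM =
    (let P = omega_bimodule p \<theta> in
    \<lparr>Ob = {(M, \<epsilon>). Module.module base_ring M \<and> is_hyperstratification p \<theta> \<Delta> M \<epsilon>},
     Arr = (\<lambda>(M, \<epsilon>) (N, \<eta>). {f \<in> linear_maps M N.
       (let S = symmetric_bimodule M; S' = symmetric_bimodule N in
        \<forall>x\<in>carrier (ctensor p P S).
          ctensor_map p S P S' P f (\<lambda>b. b) (\<epsilon> x) = \<eta> (ctensor_map p P S P S' (\<lambda>b. b) f x))}),
     Ide = (\<lambda>(M, _). \<lambda>s\<in>carrier M. s),
     Cmp = (\<lambda>(M, _) _ _ g f. compose (carrier M) g f)\<rparr>)"

definition Taylor_modules :: "nat \<Rightarrow> ('w::comm_ring_1 fps \<Rightarrow> 'w omega) \<Rightarrow>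
    ('w omega \<Rightarrow> ('w omega, 'w omega) ctens) \<Rightarrow> 'm itself \<Rightarrow>
    (('w fps, 'm) module \<times> ('m \<Rightarrow> ('m, 'w omega) ctens), 'm \<Rightarrow> 'm) cat" where
  "Taylor_modules p \<theta> \<Delta> TM =
    (let P = omega_bimodule p \<theta> in
    \<lparr>Ob = {(M, T). Module.module base_ring M \<and> is_Taylor_map p \<theta> \<Delta> M T},
     Arr = (\<lambda>(M, T) (N, U). {f \<in> linear_maps M N.
       (let S = symmetric_bimodule M; S' = symmetric_bimodule N in
        \<forall>s\<in>carrier M. ctensor_map p S P S' P f (\<lambda>b. b) (T s) = U (f s))}),
     Ide = (\<lambda>(M, _). \<lambda>s\<in>carrier M. s),
     Cmp = (\<lambda>(M, _) _ _ g f. compose (carrier M) g f)\<rparr>)"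

end

(*
  A hyperstratification is linear over the completed twisted divided power algebra, hence determined
  by its values on the elements 1 (x) s, and these values form the Taylor map; a semilinear Taylor
  map is extended back by linearity. Both cocycle conditions correspond to each other through
  multiplication by Delta(a). The counit condition follows from the cocycle condition and the
  surjectivity of the hyperstratification. Conversely, bijectivity follows from the counit and cocycle
  conditions because the completed algebra carries an antipode S: the inverse is the linear extension
  of s |-> (Taylor map of s, then s (x) b |-> S(b) (x) s).
  The existence of S is the main computation. Put E_n = (p)_q^n (n)_{q^p}!. Then E_n omega^{n} is the
  product of the theta(q) - q^(pj+1), j < n, so S has to send it to the product of the
  q - theta(q)^(pj+1), and this has to be divisible by theta(E_n). The elements theta(E_n) and E_n
  differ by a unit and are regular; divisibility is obtained by induction on n from the integrality of
  Delta(omega^{n}).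
*)
theory Submission
  imports Defs
begin

text \<open>\<open>W\<close> may have zero divisors, and \<open>p\<close> may be one of them, so
  every division is the cancellation of an element known to be regular; that q^N - 1 is regular
  comes from p-adic separatedness. The ring axioms of the twisted divided powers are transported
  from \<open>R\<close> through the characters sending q + (p)_q \<omega> to q^(pj+1), one for each
  j, which are jointly injective. The comultiplication is known only through its value on (p)_q
  \<omega>. This is enough because E_n \<omega>^{n} is a polynomial in \<theta>(q) over
  \<open>R\<close>: maps that treat \<open>R\<close> and \<theta>(q) alike agree once they agree at
  1, after E_n is cancelled. Divisibility is extracted before any antipode exists. Arbitrary values
  b_n on the divided powers extend to a \<theta>-semilinear map, and contracting
  \<Delta>(\<omega>^{n}) with it exhibits an explicit expression as a multiple of E_n; two choices
  of b_n give the unit and the induction step. The counit of a Taylor map lands in the completion of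
  \<open>M\<close>, and \<open>M\<close> need not be complete, so insertions m |-> m \<otimes> a are
  extended to the completion before they are compared.\<close>

lemma base_ring_simps [simp]:
  "carrier base_ring = UNIV" "r \<otimes>\<^bsub>base_ring\<^esub> s = r * s" "r \<oplus>\<^bsub>base_ring\<^esub> s = r + s"
  "\<one>\<^bsub>base_ring\<^esub> = 1" "\<zero>\<^bsub>base_ring\<^esub> = 0"
  by (simp_all add: ring_of_type_algebra_def)

lemma cring_base_ring: "cring base_ring"
  by (rule cring_from_type_algebra)

section \<open>Modules over the base ring\<close>

abbreviation rmod :: "('w::comm_ring_1 fps, 'a, 'z) module_scheme \<Rightarrow> bool" where
  "rmod A \<equiv> Module.module base_ring A"

text \<open>Additive inverses are supplied by the scalar \<open>-1\<close>; this is the purpose of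
  the law \<open>0 \<odot> x = \<zero>\<close> among the premises.\<close>

lemma rmodI:
  fixes A :: "('w::comm_ring_1 fps, 'a, 'z) module_scheme" (structure)
  assumes "\<And>x y. x \<in> carrier A \<Longrightarrow> y \<in> carrier A \<Longrightarrow> x \<oplus> y \<in> carrier A"
    and "\<zero> \<in> carrier A"
    and "\<And>x y z. x \<in> carrier A \<Longrightarrow> y \<in> carrier A \<Longrightarrow> z \<in> carrier A \<Longrightarrow> x \<oplus> y \<oplus> z = x \<oplus> (y \<oplus> z)"
    and "\<And>x y. x \<in> carrier A \<Longrightarrow> y \<in> carrier A \<Longrightarrow> x \<oplus> y = y \<oplus> x"
    and "\<And>x. x \<in> carrier A \<Longrightarrow> \<zero> \<oplus> x = x"
    and "\<And>r x. x \<in> carrier A \<Longrightarrow> r \<odot> x \<in> carrier A"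
    and "\<And>r s x. x \<in> carrier A \<Longrightarrow> (r + s) \<odot> x = r \<odot> x \<oplus> s \<odot> x"
    and "\<And>r x y. x \<in> carrier A \<Longrightarrow> y \<in> carrier A \<Longrightarrow> r \<odot> (x \<oplus> y) = r \<odot> x \<oplus> r \<odot> y"
    and "\<And>r s x. x \<in> carrier A \<Longrightarrow> (r * s) \<odot> x = r \<odot> (s \<odot> x)"
    and "\<And>x. x \<in> carrier A \<Longrightarrow> 1 \<odot> x = x"
    and "\<And>x. x \<in> carrier A \<Longrightarrow> 0 \<odot> x = \<zero>"
  shows "rmod A"
proof (rule moduleI[OF cring_base_ring])
  show "abelian_group A"
  proof (rule abelian_groupI)
    fix x assume x: "x \<in> carrier A"
    have "(- 1 + 1) \<odot> x = (- 1) \<odot> x \<oplus> 1 \<odot> x"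
      using assms(7) x by blast
    then have "(- 1) \<odot> x \<oplus> x = \<zero>"
      using x assms by simp
    then show "\<exists>y\<in>carrier A. y \<oplus> x = \<zero>"
      using assms(6)[OF x] by blast
  qed (use assms in auto)
qed (use assms in auto)

locale rmodule =
  fixes A :: "('w::comm_ring_1 fps, 'a, 'z) module_scheme" (structure)
  assumes module: "rmod A"

sublocale rmodule \<subseteq> abelian_group A
  by (rule Module.module.axioms(2)[OF module])

sublocale rmodule \<subseteq> M: Module.module base_ring A
  by (rule module)

context rmodule
begin

lemma smult_closed' [simp, intro]: "x \<in> carrier A \<Longrightarrow> r \<odot> x \<in> carrier A"
  using M.smult_closed[of r x] by simp

lemma smult_add_l: "x \<in> carrier A \<Longrightarrow> (r + s) \<odot> x = r \<odot> x \<oplus> s \<odot> x"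
  using M.smult_l_distr[of r s x] by simp

lemma smult_add_r: "\<lbrakk>x \<in> carrier A; y \<in> carrier A\<rbrakk> \<Longrightarrow> r \<odot> (x \<oplus> y) = r \<odot> x \<oplus> r \<odot> y"
  using M.smult_r_distr[of r x y] by simp

lemma smult_smult: "x \<in> carrier A \<Longrightarrow> r \<odot> (s \<odot> x) = (r * s) \<odot> x"
  using M.smult_assoc1[of r s x] by simp

lemma smult_1 [simp]: "x \<in> carrier A \<Longrightarrow> 1 \<odot> x = x"
  using M.smult_one[of x] by simp

lemma smult_0 [simp]: "x \<in> carrier A \<Longrightarrow> 0 \<odot> x = \<zero>"
  using M.smult_l_null[of x] by simp

lemma smult_zero [simp]: "r \<odot> \<zero> = \<zero>"
  using M.smult_r_null[of r] by simp

lemma smult_neg: "x \<in> carrier A \<Longrightarrow> r \<odot> (\<ominus> x) = \<ominus> (r \<odot> x)"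
  using M.smult_r_minus[of r x] by simp

lemma neg_eq_smult: "x \<in> carrier A \<Longrightarrow> \<ominus> x = (- 1) \<odot> x"
proof -
  assume x: "x \<in> carrier A"
  have "(- 1) \<odot> x \<oplus> x = (- 1 + 1) \<odot> x" using x smult_add_l[of x "-1" 1] by simp
  then have "(- 1) \<odot> x \<oplus> x = \<zero>" using x by simp
  then show ?thesis using x by (metis minus_equality smult_closed')
qed

lemma smult_diff: "\<lbrakk>x \<in> carrier A; y \<in> carrier A\<rbrakk> \<Longrightarrow> r \<odot> (x \<ominus> y) = r \<odot> x \<ominus> r \<odot> y"
  by (simp add: minus_eq smult_add_r smult_neg)

lemma diff_closed [simp, intro]: "\<lbrakk>x \<in> carrier A; y \<in> carrier A\<rbrakk> \<Longrightarrow> x \<ominus> y \<in> carrier A"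
  by (simp add: minus_eq)

lemma diff_self [simp]: "x \<in> carrier A \<Longrightarrow> x \<ominus> x = \<zero>"
  by (simp add: minus_eq r_neg)

lemma diff_zero [simp]: "x \<in> carrier A \<Longrightarrow> x \<ominus> \<zero> = x"
  by (simp add: minus_eq)

lemma diff_eq_zero_iff: "\<lbrakk>x \<in> carrier A; y \<in> carrier A\<rbrakk> \<Longrightarrow> x \<ominus> y = \<zero> \<longleftrightarrow> x = y"
  by (metis add.inv_closed minus_eq minus_equality minus_minus r_neg)

lemma neg_diff: "\<lbrakk>x \<in> carrier A; y \<in> carrier A\<rbrakk> \<Longrightarrow> \<ominus> (x \<ominus> y) = y \<ominus> x"
  by (simp add: minus_eq minus_add a_comm)

lemma diff_diff_diff: "\<lbrakk>x \<in> carrier A; y \<in> carrier A; z \<in> carrier A\<rbrakk> \<Longrightarrow> (x \<ominus> y) \<oplus> (y \<ominus> z) = x \<ominus> z"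
proof -
  assume h: "x \<in> carrier A" "y \<in> carrier A" "z \<in> carrier A"
  have "(x \<oplus> \<ominus> y) \<oplus> (y \<oplus> \<ominus> z) = x \<oplus> (\<ominus> y \<oplus> y) \<oplus> \<ominus> z"
    using h by (metis a_assoc a_closed a_inv_closed)
  then show ?thesis using h by (simp add: minus_eq l_neg)
qed

lemma diff_add_diff: "\<lbrakk>x \<in> carrier A; y \<in> carrier A; z \<in> carrier A; w \<in> carrier A\<rbrakk> \<Longrightarrow>
   (x \<oplus> y) \<ominus> (z \<oplus> w) = (x \<ominus> z) \<oplus> (y \<ominus> w)"
  by (simp add: minus_eq minus_add a_ac)

lemma add_diff_cancel: "\<lbrakk>x \<in> carrier A; y \<in> carrier A\<rbrakk> \<Longrightarrow> (x \<ominus> y) \<oplus> y = x"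
  by (simp add: minus_eq a_assoc l_neg)

end

text \<open>Only additivity is demanded, because \<theta>, the antipode and Taylor maps are
  semilinear but not linear over \<open>R\<close>.\<close>

definition additive ::
  "('w::comm_ring_1 fps, 'a, 'y) module_scheme \<Rightarrow> ('w fps, 'b, 'z) module_scheme \<Rightarrow> ('a \<Rightarrow> 'b) \<Rightarrow> bool"
  where
  "additive A C h \<longleftrightarrow> h \<in> carrier A \<rightarrow> carrier C \<and>
    (\<forall>x\<in>carrier A. \<forall>y\<in>carrier A. h (x \<oplus>\<^bsub>A\<^esub> y) = h x \<oplus>\<^bsub>C\<^esub> h y)"

lemma additiveI:
  assumes "\<And>x. x \<in> carrier A \<Longrightarrow> h x \<in> carrier C"
    and "\<And>x y. x \<in> carrier A \<Longrightarrow> y \<in> carrier A \<Longrightarrow> h (x \<oplus>\<^bsub>A\<^esub> y) = h x \<oplus>\<^bsub>C\<^esub> h y"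
  shows "additive A C h"
  using assms by (auto simp: additive_def)

lemma additive_closed: "additive A C h \<Longrightarrow> x \<in> carrier A \<Longrightarrow> h x \<in> carrier C"
  by (auto simp: additive_def)

lemma additive_add: "\<lbrakk>additive A C h; x \<in> carrier A; y \<in> carrier A\<rbrakk> \<Longrightarrow> h (x \<oplus>\<^bsub>A\<^esub> y) = h x \<oplus>\<^bsub>C\<^esub> h y"
  by (auto simp: additive_def)

lemma additive_zero:
  assumes "additive A C h" "rmod A" "rmod C"
  shows "h \<zero>\<^bsub>A\<^esub> = \<zero>\<^bsub>C\<^esub>"
proof -
  interpret A: rmodule A by (rule rmodule.intro) fact
  interpret C: rmodule C by (rule rmodule.intro) fact
  have "h \<zero>\<^bsub>A\<^esub> \<oplus>\<^bsub>C\<^esub> h \<zero>\<^bsub>A\<^esub> = h \<zero>\<^bsub>A\<^esub>"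
    using additive_add[OF assms(1), of "\<zero>\<^bsub>A\<^esub>" "\<zero>\<^bsub>A\<^esub>"] by simp
  then show ?thesis
    using additive_closed[OF assms(1), of "\<zero>\<^bsub>A\<^esub>"] by (simp add: C.add.l_cancel_one')
qed

lemma additive_neg:
  assumes "additive A C h" "rmod A" "rmod C" "x \<in> carrier A"
  shows "h (\<ominus>\<^bsub>A\<^esub> x) = \<ominus>\<^bsub>C\<^esub> (h x)"
proof -
  interpret A: rmodule A by (rule rmodule.intro) fact
  interpret C: rmodule C by (rule rmodule.intro) fact
  have "h (\<ominus>\<^bsub>A\<^esub> x) \<oplus>\<^bsub>C\<^esub> h x = \<zero>\<^bsub>C\<^esub>"
    using additive_add[OF assms(1), of "\<ominus>\<^bsub>A\<^esub> x" x] additive_zero[OF assms(1-3)] assms(4)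
    by (simp add: A.l_neg)
  then show ?thesis
    using additive_closed[OF assms(1)] assms(4) by (metis A.a_inv_closed C.minus_equality)
qed

lemma additive_diff:
  assumes "additive A C h" "rmod A" "rmod C" "x \<in> carrier A" "y \<in> carrier A"
  shows "h (x \<ominus>\<^bsub>A\<^esub> y) = h x \<ominus>\<^bsub>C\<^esub> h y"
proof -
  interpret A: rmodule A by (rule rmodule.intro) fact
  interpret C: rmodule C by (rule rmodule.intro) fact
  show ?thesis
    using assms by (simp add: A.minus_eq C.minus_eq additive_add additive_neg)
qed

text \<open>Multiplication by \<open>p\<close> is repeated addition, so the generator
  \<open>p\<close> of the ideal is respected by every additive map; it is q - 1 that requires an
  argument.\<close>

lemma additive_of_nat:
  assumes "additive A C h" "rmod A" "rmod C" "x \<in> carrier A"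
  shows "h (of_nat n \<odot>\<^bsub>A\<^esub> x) = of_nat n \<odot>\<^bsub>C\<^esub> h x"
proof -
  interpret A: rmodule A by (rule rmodule.intro) fact
  interpret C: rmodule C by (rule rmodule.intro) fact
  show ?thesis
    by (induction n)
      (use assms additive_closed[OF assms(1)] in
        \<open>auto simp: A.smult_add_l C.smult_add_l additive_zero additive_add\<close>)
qed

lemma additive_comp: "additive A B f \<Longrightarrow> additive B C g \<Longrightarrow> additive A C (\<lambda>x. g (f x))"
  by (simp add: additive_def Pi_iff)

lemma additive_plus:
  assumes "additive A C f" "additive A C g" "rmod C"
  shows "additive A C (\<lambda>x. f x \<oplus>\<^bsub>C\<^esub> g x)"
proof -
  interpret C: rmodule C by (rule rmodule.intro) fact
  show ?thesis
  proof (rule additiveI)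
    fix x y assume xy: "x \<in> carrier A" "y \<in> carrier A"
    then have "f x \<in> carrier C" "f y \<in> carrier C" "g x \<in> carrier C" "g y \<in> carrier C"
      using assms additive_closed by metis+
    then show "f (x \<oplus>\<^bsub>A\<^esub> y) \<oplus>\<^bsub>C\<^esub> g (x \<oplus>\<^bsub>A\<^esub> y) = f x \<oplus>\<^bsub>C\<^esub> g x \<oplus>\<^bsub>C\<^esub> (f y \<oplus>\<^bsub>C\<^esub> g y)"
      using xy by (simp add: additive_add[OF assms(1)] additive_add[OF assms(2)] C.a_ac)
  qed (simp add: additive_closed[OF assms(1)] additive_closed[OF assms(2)])
qed

section \<open>The adic filtration\<close>

context rmodule
begin

lemma adic_closed: "x \<in> adic p A n \<Longrightarrow> x \<in> carrier A"
  by (induction n arbitrary: x) auto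

lemma adic_subset: "adic p A n \<subseteq> carrier A"
  using adic_closed by blast

lemma adic_SucI: "\<lbrakk>a \<in> adic p A n; b \<in> adic p A n\<rbrakk> \<Longrightarrow>
    of_nat p \<odot> a \<oplus> fps_X \<odot> b \<in> adic p A (Suc n)"
  by auto

declare adic.simps(2) [simp del]

lemma adic_SucE:
  assumes "x \<in> adic p A (Suc n)"
  obtains a b where "a \<in> adic p A n" "b \<in> adic p A n" "x = of_nat p \<odot> a \<oplus> fps_X \<odot> b"
    "a \<in> carrier A" "b \<in> carrier A"
  using assms adic_closed by (auto simp: adic.simps(2))

lemma adic_zero [simp, intro]: "\<zero> \<in> adic p A n"
proof (induction n)
  case (Suc n)
  then show ?case using adic_SucI[of \<zero> p n \<zero>] by simp
qed simp

lemma adic_add [intro]: "\<lbrakk>x \<in> adic p A n; y \<in> adic p A n\<rbrakk> \<Longrightarrow> x \<oplus> y \<in> adic p A n"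
proof (induction n arbitrary: x y)
  case (Suc n)
  obtain a b c d where ab: "a \<in> adic p A n" "b \<in> adic p A n" "x = of_nat p \<odot> a \<oplus> fps_X \<odot> b"
    "a \<in> carrier A" "b \<in> carrier A" and cd: "c \<in> adic p A n" "d \<in> adic p A n"
    "y = of_nat p \<odot> c \<oplus> fps_X \<odot> d" "c \<in> carrier A" "d \<in> carrier A"
    using Suc.prems by (meson adic_SucE)
  have "x \<oplus> y = of_nat p \<odot> (a \<oplus> c) \<oplus> fps_X \<odot> (b \<oplus> d)"
    using ab cd by (simp add: smult_add_r a_ac)
  then show ?case
    using adic_SucI[OF Suc.IH[OF ab(1) cd(1)] Suc.IH[OF ab(2) cd(2)]] by metis
qed simp

lemma adic_smult [intro]: "x \<in> adic p A n \<Longrightarrow> r \<odot> x \<in> adic p A n"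
proof (induction n arbitrary: x)
  case (Suc n)
  obtain a b where ab: "a \<in> adic p A n" "b \<in> adic p A n" "x = of_nat p \<odot> a \<oplus> fps_X \<odot> b"
    "a \<in> carrier A" "b \<in> carrier A"
    using Suc.prems by (meson adic_SucE)
  have "r \<odot> x = of_nat p \<odot> (r \<odot> a) \<oplus> fps_X \<odot> (r \<odot> b)"
    using ab by (simp add: smult_add_r smult_smult mult.commute)
  then show ?case using adic_SucI[OF Suc.IH[OF ab(1)] Suc.IH[OF ab(2)]] by metis
qed simp

lemma adic_neg [intro]: "x \<in> adic p A n \<Longrightarrow> \<ominus> x \<in> adic p A n"
  using neg_eq_smult[of x] adic_closed[of x p n] adic_smult[of x p n "-1"] by simp

lemma adic_Suc_subset: "adic p A (Suc n) \<subseteq> adic p A n"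
  by (auto elim!: adic_SucE)

lemma adic_antimono: "m \<le> n \<Longrightarrow> adic p A n \<subseteq> adic p A m"
  by (rule lift_Suc_antimono_le[of "adic p A"]) (use adic_Suc_subset in auto)

lemma adic_p: "x \<in> adic p A n \<Longrightarrow> of_nat p \<odot> x \<in> adic p A (Suc n)"
  using adic_SucI[of x p n \<zero>] adic_closed[of x p n] by simp

lemma adic_X: "x \<in> adic p A n \<Longrightarrow> fps_X \<odot> x \<in> adic p A (Suc n)"
  using adic_SucI[of \<zero> p n x] adic_closed[of x p n] by simp

lemma adic_diff_swap: "\<lbrakk>x \<in> carrier A; y \<in> carrier A; x \<ominus> y \<in> adic p A n\<rbrakk> \<Longrightarrow> y \<ominus> x \<in> adic p A n"
  using adic_neg[of "x \<ominus> y" p n] by (simp add: neg_diff)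

lemma adic_diff_trans: "\<lbrakk>x \<in> carrier A; y \<in> carrier A; z \<in> carrier A; x \<ominus> y \<in> adic p A n;
    y \<ominus> z \<in> adic p A n\<rbrakk> \<Longrightarrow> x \<ominus> z \<in> adic p A n"
  using adic_add[of "x \<ominus> y" p n "y \<ominus> z"] by (simp add: diff_diff_diff)

lemma adic_diff_add: "\<lbrakk>x \<in> carrier A; y \<in> carrier A; z \<in> carrier A; w \<in> carrier A;
    x \<ominus> z \<in> adic p A n; y \<ominus> w \<in> adic p A n\<rbrakk> \<Longrightarrow> (x \<oplus> y) \<ominus> (z \<oplus> w) \<in> adic p A n"
  by (simp add: diff_add_diff adic_add)

lemma adic_of_diff: "\<lbrakk>x \<in> carrier A; x \<ominus> y \<in> adic p A n; y \<in> adic p A n\<rbrakk> \<Longrightarrow> x \<in> adic p A n"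
  using adic_add[of "x \<ominus> y" p n y] adic_closed[of y p n] by (simp add: add_diff_cancel)

end

lemma adic_cong:
  assumes "carrier A = carrier B" "add A = add B" "module.smult A = module.smult B"
  shows "adic p A n = adic p B n"
  by (induction n) (use assms in \<open>simp_all add: adic.simps(2)\<close>)

text \<open>Stronger than continuity: step n of the filtration goes into step n without loss. The
  maps built below have this property because \<theta>(q - 1) lies in the ideal (p, q - 1) of the
  algebra, and it lets them be extended to completions step by step.\<close>

definition fmap :: "nat \<Rightarrow> ('w::comm_ring_1 fps, 'a, 'y) module_scheme \<Rightarrow>
    ('w fps, 'b, 'z) module_scheme \<Rightarrow> ('a \<Rightarrow> 'b) \<Rightarrow> bool"
  where "fmap p A C h \<longleftrightarrow> additive A C h \<and> (\<forall>n. h ` adic p A n \<subseteq> adic p C n)"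

lemma fmap_additive: "fmap p A C h \<Longrightarrow> additive A C h"
  by (simp add: fmap_def)

lemma fmap_closed: "fmap p A C h \<Longrightarrow> x \<in> carrier A \<Longrightarrow> h x \<in> carrier C"
  by (auto simp: fmap_def intro: additive_closed)

lemma fmap_add: "\<lbrakk>fmap p A C h; x \<in> carrier A; y \<in> carrier A\<rbrakk> \<Longrightarrow> h (x \<oplus>\<^bsub>A\<^esub> y) = h x \<oplus>\<^bsub>C\<^esub> h y"
  by (auto simp: fmap_def intro: additive_add)

lemma fmap_adic: "fmap p A C h \<Longrightarrow> x \<in> adic p A n \<Longrightarrow> h x \<in> adic p C n"
  by (auto simp: fmap_def)

lemma fmap_comp: "fmap p A B f \<Longrightarrow> fmap p B C g \<Longrightarrow> fmap p A C (\<lambda>x. g (f x))"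
  unfolding fmap_def using additive_comp by (metis image_image image_mono order_trans)

lemma fmap_id: "fmap p A A (\<lambda>x. x)"
  by (simp add: fmap_def additive_def)

lemma fmap_cong:
  assumes "fmap p A C f" "rmod A" "\<And>x. x \<in> carrier A \<Longrightarrow> f x = g x"
  shows "fmap p A C g"
proof -
  interpret A: rmodule A by (rule rmodule.intro) fact
  have "g x \<in> adic p C n" if "x \<in> adic p A n" for x n
    using fmap_adic[OF assms(1) that] assms(3)[OF A.adic_closed[OF that]] by simp
  moreover have "additive A C g"
    using fmap_additive[OF assms(1)] assms(3) by (simp add: additive_def Pi_iff)
  ultimately show ?thesis by (auto simp: fmap_def)
qed

text \<open>Induction on the step of the filtration: \<open>p\<close> passes through by additivity,
  and \<open>Y\<close> is what multiplication by q - 1 turns into, for instance multiplication by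
  \<theta>(q - 1) or the right action.\<close>

lemma fmap_semilinear:
  assumes h: "additive A C h" and A: "rmod A" and C: "rmod C"
    and X: "\<And>x. x \<in> carrier A \<Longrightarrow> h (fps_X \<odot>\<^bsub>A\<^esub> x) = Y (h x)"
    and Y: "\<And>c n. c \<in> adic p C n \<Longrightarrow> Y c \<in> adic p C (Suc n)"
  shows "fmap p A C h"
proof -
  interpret A: rmodule A by (rule rmodule.intro) fact
  interpret C: rmodule C by (rule rmodule.intro) fact
  have "h x \<in> adic p C n" if "x \<in> adic p A n" for x n
    using that
  proof (induction n arbitrary: x)
    case 0
    then show ?case using additive_closed[OF h] by simp
  next
    case (Suc n)
    obtain a b where ab: "a \<in> adic p A n" "b \<in> adic p A n"
      "x = of_nat p \<odot>\<^bsub>A\<^esub> a \<oplus>\<^bsub>A\<^esub> fps_X \<odot>\<^bsub>A\<^esub> b" "a \<in> carrier A" "b \<in> carrier A"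
      using Suc.prems by (meson A.adic_SucE)
    have "h x = of_nat p \<odot>\<^bsub>C\<^esub> h a \<oplus>\<^bsub>C\<^esub> Y (h b)"
      using ab by (simp add: additive_add[OF h] additive_of_nat[OF h A C] X)
    then show ?case
      using C.adic_add[OF C.adic_p[OF Suc.IH[OF ab(1)]] Y[OF Suc.IH[OF ab(2)]]] by simp
  qed
  then show ?thesis using h by (auto simp: fmap_def)
qed

lemma fmap_linear:
  assumes "additive A C h" "rmod A" "rmod C"
    and "\<And>r x. x \<in> carrier A \<Longrightarrow> h (r \<odot>\<^bsub>A\<^esub> x) = r \<odot>\<^bsub>C\<^esub> h x"
  shows "fmap p A C h"
proof -
  interpret C: rmodule C by (rule rmodule.intro) fact
  show ?thesis
    by (rule fmap_semilinear[OF assms(1-3), where Y = "\<lambda>c. fps_X \<odot>\<^bsub>C\<^esub> c"]) (use assms(4) C.adic_X in blast)+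
qed

section \<open>Separated and complete modules\<close>

definition separated :: "nat \<Rightarrow> ('w::comm_ring_1 fps, 'a, 'z) module_scheme \<Rightarrow> bool" where
  "separated p C \<longleftrightarrow> (\<forall>x\<in>carrier C. (\<forall>n. x \<in> adic p C n) \<longrightarrow> x = \<zero>\<^bsub>C\<^esub>)"

text \<open>The rate is prescribed, so that the n-th term determines the class modulo step n; such
  sequences are exactly the representatives of elements of the inverse limit.\<close>

definition cauchy :: "nat \<Rightarrow> ('w::comm_ring_1 fps, 'a, 'z) module_scheme \<Rightarrow> (nat \<Rightarrow> 'a) \<Rightarrow> bool" where
  "cauchy p A f \<longleftrightarrow> (\<forall>n. f n \<in> carrier A \<and> f (Suc n) \<ominus>\<^bsub>A\<^esub> f n \<in> adic p A n)"

definition complete :: "nat \<Rightarrow> ('w::comm_ring_1 fps, 'a, 'z) module_scheme \<Rightarrow> bool" where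
  "complete p C \<longleftrightarrow> rmod C \<and> separated p C \<and>
     (\<forall>f. cauchy p C f \<longrightarrow> (\<exists>a\<in>carrier C. \<forall>n. a \<ominus>\<^bsub>C\<^esub> f n \<in> adic p C n))"

lemma complete_rmod: "complete p C \<Longrightarrow> rmod C"
  by (simp add: complete_def)

lemma complete_separated: "complete p C \<Longrightarrow> separated p C"
  by (simp add: complete_def)

lemma cauchyD: "cauchy p A f \<Longrightarrow> f n \<in> carrier A" "cauchy p A f \<Longrightarrow> f (Suc n) \<ominus>\<^bsub>A\<^esub> f n \<in> adic p A n"
  by (simp_all add: cauchy_def)

lemma separated_eqI:
  assumes "separated p C" "rmod C" "x \<in> carrier C" "y \<in> carrier C"
    "\<And>n. x \<ominus>\<^bsub>C\<^esub> y \<in> adic p C n"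
  shows "x = y"
proof -
  interpret C: rmodule C by (rule rmodule.intro) fact
  have "x \<ominus>\<^bsub>C\<^esub> y = \<zero>\<^bsub>C\<^esub>"
    using assms(1,5) C.diff_closed[OF assms(3,4)] unfolding separated_def by blast
  then show ?thesis using C.diff_eq_zero_iff[OF assms(3,4)] by simp
qed

lemma (in rmodule) cauchy_mono:
  assumes "cauchy p A f" "m \<le> n" shows "f n \<ominus> f m \<in> adic p A m"
  using assms(2)
proof (induction n rule: dec_induct)
  case base
  then show ?case using cauchyD[OF assms(1)] by simp
next
  case (step n)
  have "f (Suc n) \<ominus> f n \<in> adic p A m"
    using cauchyD(2)[OF assms(1), of n] adic_antimono[OF step.hyps(1)] by blast
  from adic_diff_trans[OF _ _ _ this step.IH] show ?case using cauchyD(1)[OF assms(1)] by blast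
qed

section \<open>Completion\<close>

context rmodule
begin

lemma add_diff_left: "\<lbrakk>x \<in> carrier A; y \<in> carrier A\<rbrakk> \<Longrightarrow> (x \<oplus> y) \<ominus> x = y"
  by (metis a_comm a_assoc minus_eq r_neg r_zero a_inv_closed)

lemma adic_subgroup: "abelian_subgroup (adic p A n) A"
proof (rule abelian_subgroupI3)
  show "additive_subgroup (adic p A n) A"
  proof (rule additive_subgroup.intro, rule subgroup.intro)
    fix x assume x: "x \<in> adic p A n"
    show "inv\<^bsub>add_monoid A\<^esub> x \<in> adic p A n"
      using adic_neg[OF x] by (simp add: a_inv_def)
  qed (auto intro: adic_closed)
  show "abelian_group A" by (rule abelian_group_axioms)
qed

lemma coset_mem_iff: "\<lbrakk>x \<in> carrier A; y \<in> carrier A\<rbrakk> \<Longrightarrow> y \<in> adic p A n +> x \<longleftrightarrow> y \<ominus> x \<in> adic p A n"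
  using abelian_subgroup.a_rcos_module[OF adic_subgroup, of x y p n] by (simp add: minus_eq)

lemma coset_closed: "\<lbrakk>x \<in> carrier A; y \<in> adic p A n +> x\<rbrakk> \<Longrightarrow> y \<in> carrier A"
  using a_r_coset_subset_G[OF adic_subset] by blast

lemma coset_eq_iff: "\<lbrakk>x \<in> carrier A; y \<in> carrier A\<rbrakk> \<Longrightarrow>
    adic p A n +> x = adic p A n +> y \<longleftrightarrow> x \<ominus> y \<in> adic p A n"
  using abelian_subgroup.a_repr_independence'[OF adic_subgroup, of x p n y] coset_mem_iff[of y x p n]
    abelian_subgroup.a_rcos_self[OF adic_subgroup, of x p n] by blast

lemma coset_zero: "adic p A n +> \<zero> = adic p A n"
  by (rule a_coset_add_zero[OF adic_subset])

text \<open>The operations of \<open>completion\<close> are unions over cosets. Once all members of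
  such a union are equal, it is their common value, and well-definedness becomes a computation
  rule.\<close>

lemma coset_UN:
  assumes "x \<in> carrier A" "\<And>y. y \<in> carrier A \<Longrightarrow> y \<ominus> x \<in> adic p A n \<Longrightarrow> g y = c"
  shows "(\<Union>a\<in>adic p A n +> x. g a) = c"
proof -
  have "x \<in> adic p A n +> x" using assms(1) by (simp add: coset_mem_iff)
  moreover have "g a = c" if "a \<in> adic p A n +> x" for a
    using that assms(2)[of a] coset_closed[OF assms(1) that] coset_mem_iff[OF assms(1), of a p n] by blast
  ultimately show ?thesis by blast
qed

end

section \<open>Elements of the completion as classes of Cauchy sequences\<close>

definition clim :: "nat \<Rightarrow> ('w::comm_ring_1 fps, 'a, 'z) module_scheme \<Rightarrow> (nat \<Rightarrow> 'a) \<Rightarrow> 'a compl" where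
  "clim p A f = (\<lambda>n. adic p A n +>\<^bsub>A\<^esub> f n)"

lemma to_completion_eq: "to_completion p A a = clim p A (\<lambda>_. a)"
  by (simp add: to_completion_def clim_def)

context rmodule
begin

lemma cauchy_const: "a \<in> carrier A \<Longrightarrow> cauchy p A (\<lambda>_. a)"
  by (simp add: cauchy_def)

lemma cauchy_add: "\<lbrakk>cauchy p A f; cauchy p A g\<rbrakk> \<Longrightarrow> cauchy p A (\<lambda>n. f n \<oplus> g n)"
  by (simp add: cauchy_def adic_diff_add)

lemma cauchy_smult: "cauchy p A f \<Longrightarrow> cauchy p A (\<lambda>n. r \<odot> f n)"
  using adic_smult by (simp add: cauchy_def smult_diff[symmetric])

lemma cauchy_fmap:
  assumes "fmap p A C h" "rmod C" "cauchy p A f" shows "cauchy p C (\<lambda>n. h (f n))"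
  using assms(3) fmap_closed[OF assms(1)] fmap_adic[OF assms(1)]
    additive_diff[OF fmap_additive[OF assms(1)] module assms(2)]
  by (metis cauchy_def)

text \<open>A representative of the smaller coset lies in the larger one, which is precisely the
  estimate \<open>f (Suc n) \<ominus> f n \<in> adic p A n\<close>; nested cosets and Cauchy
  sequences are thus the same data.\<close>

lemma carrier_completion:
  "x \<in> carrier (completion p A) \<longleftrightarrow> (\<exists>f. cauchy p A f \<and> x = clim p A f)"
proof
  assume x: "x \<in> carrier (completion p A)"
  then have "\<forall>n. \<exists>a\<in>carrier A. x n = adic p A n +> a"
    by (auto simp: completion_def A_RCOSETS_def RCOSETS_def a_r_coset_def)
  then obtain f where f: "\<And>n. f n \<in> carrier A" "\<And>n. x n = adic p A n +> f n"
    by metis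
  have "f (Suc n) \<ominus> f n \<in> adic p A n" for n
  proof -
    have "f (Suc n) \<in> x (Suc n)" using f by (simp add: coset_mem_iff)
    then have "f (Suc n) \<in> x n" using x by (auto simp: completion_def)
    then show ?thesis using f by (simp add: coset_mem_iff)
  qed
  then show "\<exists>f. cauchy p A f \<and> x = clim p A f"
    using f by (intro exI[of _ f]) (simp add: cauchy_def clim_def fun_eq_iff)
next
  assume "\<exists>f. cauchy p A f \<and> x = clim p A f"
  then obtain f where f: "cauchy p A f" and x: "x = clim p A f" by blast
  note fc = cauchyD(1)[OF f] and fd = cauchyD(2)[OF f]
  have "x (Suc n) \<subseteq> x n" for n
  proof
    fix y assume y: "y \<in> x (Suc n)"
    then have yc: "y \<in> carrier A" using coset_closed[OF fc] by (simp add: x clim_def)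
    have "y \<ominus> f (Suc n) \<in> adic p A n"
      using y yc fc adic_Suc_subset by (auto simp: x clim_def coset_mem_iff)
    then show "y \<in> x n"
      using adic_diff_trans[OF yc fc fc _ fd] yc fc by (simp add: x clim_def coset_mem_iff)
  qed
  moreover have "x n \<in> a_rcosets (adic p A n)" for n
    using a_rcosetsI[OF adic_subset fc] by (simp add: x clim_def)
  ultimately show "x \<in> carrier (completion p A)"
    by (simp add: completion_def)
qed

lemma clim_closed: "cauchy p A f \<Longrightarrow> clim p A f \<in> carrier (completion p A)"
  using carrier_completion by blast

lemma completion_cases:
  assumes "x \<in> carrier (completion p A)"
  obtains f where "cauchy p A f" "x = clim p A f"
  using assms carrier_completion by blast

lemma clim_eq_iff: "\<lbrakk>cauchy p A f; cauchy p A g\<rbrakk> \<Longrightarrow>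
    clim p A f = clim p A g \<longleftrightarrow> (\<forall>n. f n \<ominus> g n \<in> adic p A n)"
  by (simp add: clim_def fun_eq_iff coset_eq_iff cauchyD)

lemma clim_add: "\<lbrakk>cauchy p A f; cauchy p A g\<rbrakk> \<Longrightarrow>
    clim p A f \<oplus>\<^bsub>completion p A\<^esub> clim p A g = clim p A (\<lambda>n. f n \<oplus> g n)"
  by (simp add: clim_def completion_def abelian_subgroup.a_rcos_sum[OF adic_subgroup] cauchyD)

lemma clim_zero: "\<zero>\<^bsub>completion p A\<^esub> = clim p A (\<lambda>n. \<zero>)"
  by (simp add: clim_def completion_def coset_zero)

lemma clim_smult:
  assumes "cauchy p A f"
  shows "r \<odot>\<^bsub>completion p A\<^esub> clim p A f = clim p A (\<lambda>n. r \<odot> f n)"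
proof -
  have "(\<Union>a\<in>adic p A n +> f n. adic p A n +> r \<odot> a) = adic p A n +> r \<odot> f n" for n
    using cauchyD[OF assms] adic_smult
    by (intro coset_UN) (auto simp: coset_eq_iff smult_diff[symmetric])
  then show ?thesis by (simp add: clim_def completion_def)
qed

lemma rmod_completion: "rmod (completion p A)"
proof (rule rmodI)
  fix x assume "x \<in> carrier (completion p A)"
  then obtain f where f: "cauchy p A f" "x = clim p A f" by (rule completion_cases)
  note fs = f cauchyD[OF f(1)] cauchy_smult[OF f(1)]
  show "\<zero>\<^bsub>completion p A\<^esub> \<oplus>\<^bsub>completion p A\<^esub> x = x"
    using fs by (simp add: clim_zero clim_add cauchy_const)
  show "1 \<odot>\<^bsub>completion p A\<^esub> x = x" "0 \<odot>\<^bsub>completion p A\<^esub> x = \<zero>\<^bsub>completion p A\<^esub>"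
    using fs by (simp_all add: clim_zero clim_smult)
  fix r s
  show "r \<odot>\<^bsub>completion p A\<^esub> x \<in> carrier (completion p A)"
    using fs by (simp add: clim_smult clim_closed)
  show "(r + s) \<odot>\<^bsub>completion p A\<^esub> x = r \<odot>\<^bsub>completion p A\<^esub> x \<oplus>\<^bsub>completion p A\<^esub> s \<odot>\<^bsub>completion p A\<^esub> x"
    using fs by (simp add: clim_smult clim_add smult_add_l)
  show "(r * s) \<odot>\<^bsub>completion p A\<^esub> x = r \<odot>\<^bsub>completion p A\<^esub> (s \<odot>\<^bsub>completion p A\<^esub> x)"
    using fs by (simp add: clim_smult smult_smult)
  fix y assume "y \<in> carrier (completion p A)"
  then obtain g where g: "cauchy p A g" "y = clim p A g" by (rule completion_cases)
  note gs = fs g cauchyD[OF g(1)] cauchy_smult[OF g(1)]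
  show "x \<oplus>\<^bsub>completion p A\<^esub> y \<in> carrier (completion p A)"
    using gs by (simp add: clim_add clim_closed cauchy_add)
  show "x \<oplus>\<^bsub>completion p A\<^esub> y = y \<oplus>\<^bsub>completion p A\<^esub> x"
    using gs by (simp add: clim_add a_comm)
  show "r \<odot>\<^bsub>completion p A\<^esub> (x \<oplus>\<^bsub>completion p A\<^esub> y) =
      r \<odot>\<^bsub>completion p A\<^esub> x \<oplus>\<^bsub>completion p A\<^esub> r \<odot>\<^bsub>completion p A\<^esub> y"
    using gs by (simp add: clim_add clim_smult cauchy_add smult_add_r)
  fix z assume "z \<in> carrier (completion p A)"
  then obtain h where h: "cauchy p A h" "z = clim p A h" by (rule completion_cases)
  show "x \<oplus>\<^bsub>completion p A\<^esub> y \<oplus>\<^bsub>completion p A\<^esub> z =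
      x \<oplus>\<^bsub>completion p A\<^esub> (y \<oplus>\<^bsub>completion p A\<^esub> z)"
    using gs h cauchyD[OF h(1)] by (simp add: clim_add cauchy_add a_assoc)
next
  show "\<zero>\<^bsub>completion p A\<^esub> \<in> carrier (completion p A)"
    by (simp add: clim_zero clim_closed cauchy_const)
qed

lemma clim_diff:
  assumes "cauchy p A f" "cauchy p A g"
  shows "clim p A f \<ominus>\<^bsub>completion p A\<^esub> clim p A g = clim p A (\<lambda>n. f n \<ominus> g n)"
proof -
  interpret C: rmodule "completion p A" by (rule rmodule.intro, rule rmod_completion)
  have "\<ominus>\<^bsub>completion p A\<^esub> clim p A g = clim p A (\<lambda>n. \<ominus> g n)"
    using assms by (simp add: C.neg_eq_smult clim_closed clim_smult neg_eq_smult cauchyD)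
  moreover have "cauchy p A (\<lambda>n. \<ominus> g n)"
    using cauchy_smult[OF assms(2), of "- 1"] assms by (simp add: neg_eq_smult cauchyD)
  ultimately show ?thesis
    using assms by (simp add: C.minus_eq clim_add minus_eq)
qed

lemma cauchy_diff: "\<lbrakk>cauchy p A f; cauchy p A g\<rbrakk> \<Longrightarrow> cauchy p A (\<lambda>n. f n \<ominus> g n)"
  using cauchy_add[of p f "\<lambda>n. (- 1) \<odot> g n"] cauchy_smult[of p g "-1"]
  by (simp add: minus_eq neg_eq_smult cauchyD)

lemma adic_completion_imp:
  assumes "x \<in> adic p (completion p A) n"
  shows "\<exists>f. cauchy p A f \<and> x = clim p A f \<and> f n \<in> adic p A n"
  using assms
proof (induction n arbitrary: x)
  case 0
  then show ?case by (simp add: carrier_completion) (metis cauchyD(1))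
next
  case (Suc n)
  interpret C: rmodule "completion p A" by (rule rmodule.intro, rule rmod_completion)
  obtain a b where ab: "a \<in> adic p (completion p A) n" "b \<in> adic p (completion p A) n"
    "x = of_nat p \<odot>\<^bsub>completion p A\<^esub> a \<oplus>\<^bsub>completion p A\<^esub> fps_X \<odot>\<^bsub>completion p A\<^esub> b"
    using Suc.prems by (meson C.adic_SucE)
  obtain f g where f: "cauchy p A f" "a = clim p A f" "f n \<in> adic p A n"
    and g: "cauchy p A g" "b = clim p A g" "g n \<in> adic p A n"
    using Suc.IH[OF ab(1)] Suc.IH[OF ab(2)] by blast
  let ?h = "\<lambda>k. of_nat p \<odot> f k \<oplus> fps_X \<odot> g k"
  \<comment> \<open>The induction hypothesis speaks of index \<open>n\<close>, the goal of index
    \<open>Suc n\<close>. The Cauchy estimate carries membership in step \<open>n\<close> from one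
    to the other before the generators raise the step.\<close>
  have "f (Suc n) \<in> adic p A n" "g (Suc n) \<in> adic p A n"
    using adic_of_diff[OF cauchyD(1)[OF f(1)] cauchyD(2)[OF f(1)] f(3)]
      adic_of_diff[OF cauchyD(1)[OF g(1)] cauchyD(2)[OF g(1)] g(3)] by blast+
  then have "?h (Suc n) \<in> adic p A (Suc n)" by (rule adic_SucI)
  moreover have "x = clim p A ?h" "cauchy p A ?h"
    using f g ab by (simp_all add: clim_smult clim_add cauchy_smult cauchy_add)
  ultimately show ?case by blast
qed

lemma cauchy_adic_antimono:
  assumes "cauchy p A f" "f n \<in> adic p A n" "m \<le> n" shows "f m \<in> adic p A m"
proof -
  have "f m \<ominus> f n \<in> adic p A m"
    using adic_diff_swap[OF _ _ cauchy_mono[OF assms(1,3)]] cauchyD(1)[OF assms(1)] by blast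
  then show ?thesis
    using adic_of_diff[OF cauchyD(1)[OF assms(1)]] assms(2) adic_antimono[OF assms(3)] by blast
qed

text \<open>Here it matters that the ideal $(p, q-1)$ is finitely generated: the increments
  $f_{k+1} - f_k \in I^{k}A$ of a Cauchy sequence are divided by the generators one by one.\<close>

lemma adic_completion_clim:
  assumes "cauchy p A f" "f n \<in> adic p A n"
  shows "clim p A f \<in> adic p (completion p A) n"
  using assms
proof (induction n arbitrary: f)
  case 0
  then show ?case by (simp add: clim_closed)
next
  case (Suc n)
  interpret C: rmodule "completion p A" by (rule rmodule.intro, rule rmod_completion)
  \<comment> \<open>The first term is all of \<open>f (Suc n)\<close>, which lies in step
    \<open>Suc n\<close>; the later ones are increments. Partial sums starting at \<open>n\<close>
    telescope to \<open>f (Suc m)\<close>.\<close>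
  define d where "d k = (if k = n then f (Suc n) else f (Suc k) \<ominus> f k)" for k
  have d: "d k \<in> adic p A (Suc n)" if "k = n" for k
    using that Suc.prems by (simp add: d_def)
  \<comment> \<open>Division by the generators costs one step: an increment in step \<open>k\<close>
    has coefficients in step \<open>k - 1\<close>. The k-th coefficient is the increment of the
    partial sums from \<open>k - 1\<close> to \<open>k\<close>, so these are again Cauchy at the
    prescribed rate.\<close>
  have "\<exists>a b. a \<in> carrier A \<and> b \<in> carrier A \<and> (k \<ge> n \<longrightarrow> a \<in> adic p A (if k = n then n else k - 1) \<and>
      b \<in> adic p A (if k = n then n else k - 1) \<and> d k = of_nat p \<odot> a \<oplus> fps_X \<odot> b)" for k
  proof (cases "k \<ge> n")
    case True
    have "d k \<in> adic p A (Suc (if k = n then n else k - 1))"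
    proof (cases "k = n")
      case True
      then show ?thesis using Suc.prems(2) by (simp add: d_def)
    next
      case False
      then have "Suc (k - 1) = k" using True by simp
      then show ?thesis using False cauchyD(2)[OF Suc.prems(1), of k] by (simp add: d_def)
    qed
    then obtain a b where "a \<in> adic p A (if k = n then n else k - 1)"
      "b \<in> adic p A (if k = n then n else k - 1)" "d k = of_nat p \<odot> a \<oplus> fps_X \<odot> b"
      "a \<in> carrier A" "b \<in> carrier A"
      by (rule adic_SucE)
    then show ?thesis by blast
  qed auto
  then obtain a b where ab: "\<And>k. a k \<in> carrier A" "\<And>k. b k \<in> carrier A"
    "\<And>k. k \<ge> n \<Longrightarrow> a k \<in> adic p A (if k = n then n else k - 1)"
    "\<And>k. k \<ge> n \<Longrightarrow> b k \<in> adic p A (if k = n then n else k - 1)"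
    "\<And>k. k \<ge> n \<Longrightarrow> d k = of_nat p \<odot> a k \<oplus> fps_X \<odot> b k"
    by metis
  define S where "S c m = finsum A c {n..m}" for c :: "nat \<Rightarrow> 'a" and m
  have Sc: "S c m \<in> carrier A" if "\<And>k. c k \<in> carrier A" for c m
    using that by (simp add: S_def)
  have S_Suc: "S c (Suc m) = S c m \<oplus> c (Suc m)" if "\<And>k. c k \<in> carrier A" "m \<ge> n" for c m
  proof -
    have "{n..Suc m} = insert (Suc m) {n..m}" using that by auto
    then show ?thesis using that by (simp add: S_def a_comm)
  qed
  have S_n: "S c n = c n" if "\<And>k. c k \<in> carrier A" for c
    using that by (simp add: S_def)
  have Scau: "cauchy p A (S c)"
    if c: "\<And>k. c k \<in> carrier A" "\<And>k. k \<ge> n \<Longrightarrow> c k \<in> adic p A (if k = n then n else k - 1)" for c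
    unfolding cauchy_def
  proof (intro allI conjI)
    fix m
    show "S c m \<in> carrier A" using c Sc by blast
    show "S c (Suc m) \<ominus> S c m \<in> adic p A m"
    proof (cases "m \<ge> n")
      case True
      have "S c (Suc m) \<ominus> S c m = c (Suc m)"
        using S_Suc[of c m, OF c(1) True] Sc[of c m, OF c(1)] c(1)[of "Suc m"]
        by (simp add: add_diff_left)
      then show ?thesis using True c(2)[of "Suc m"] by simp
    next
      case False
      show ?thesis
      proof (cases "Suc m = n")
        case True
        then have "S c m = \<zero>" by (simp add: S_def)
        then have "S c (Suc m) \<ominus> S c m = c n"
          using True S_n[of c, OF c(1)] c(1)[of n] by simp
        then show ?thesis using True c(2)[of n] adic_antimono[of m n p] by auto
      qed (use False in \<open>simp add: S_def\<close>)
    qed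
  qed
  have A: "clim p A (S a) \<in> adic p (completion p A) n" "clim p A (S b) \<in> adic p (completion p A) n"
    using Suc.IH Scau ab(1-4) S_n[OF ab(1)] S_n[OF ab(2)] ab(3,4)[of n] by simp_all
  have Sd: "of_nat p \<odot> S a m \<oplus> fps_X \<odot> S b m = f (Suc m)" if "m \<ge> n" for m
    using that
  proof (induction m rule: dec_induct)
    case base
    then show ?case using ab(5)[of n] by (simp add: S_n[OF ab(1)] S_n[OF ab(2)] d_def)
  next
    case (step m)
    have "of_nat p \<odot> S a (Suc m) \<oplus> fps_X \<odot> S b (Suc m) =
        (of_nat p \<odot> S a m \<oplus> fps_X \<odot> S b m) \<oplus> (of_nat p \<odot> a (Suc m) \<oplus> fps_X \<odot> b (Suc m))"
      using step.hyps ab(1,2) Sc by (simp add: S_Suc smult_add_r a_ac)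
    also have "\<dots> = f (Suc m) \<oplus> (f (Suc (Suc m)) \<ominus> f (Suc m))"
      using step ab(5)[of "Suc m"] by (simp add: d_def)
    also have "\<dots> = f (Suc (Suc m))"
      using cauchyD(1)[OF Suc.prems(1)] by (metis a_comm add_diff_cancel diff_closed)
    finally show ?case .
  qed
  \<comment> \<open>The sums represent the shifted sequence \<open>f (Suc m)\<close>, which has the
    same class as \<open>f\<close>. Below \<open>n\<close> the sums are empty and \<open>f m\<close>
    itself lies in step \<open>m\<close>.\<close>
  have "clim p A f = clim p A (\<lambda>m. of_nat p \<odot> S a m \<oplus> fps_X \<odot> S b m)"
  proof (subst clim_eq_iff)
    show "cauchy p A f" by fact
    show "cauchy p A (\<lambda>m. of_nat p \<odot> S a m \<oplus> fps_X \<odot> S b m)"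
      using Scau ab(1-4) by (simp add: cauchy_add cauchy_smult)
    show "\<forall>m. f m \<ominus> (of_nat p \<odot> S a m \<oplus> fps_X \<odot> S b m) \<in> adic p A m"
    proof
      fix m
      show "f m \<ominus> (of_nat p \<odot> S a m \<oplus> fps_X \<odot> S b m) \<in> adic p A m"
      proof (cases "m \<ge> n")
        case True
        show ?thesis unfolding Sd[OF True]
          by (rule adic_diff_swap[OF _ _ cauchyD(2)[OF Suc.prems(1)]]) (rule cauchyD(1)[OF Suc.prems(1)])+
      next
        case False
        then have "f m \<in> adic p A m"
          using cauchy_adic_antimono[OF Suc.prems] by simp
        moreover have "S a m = \<zero>" "S b m = \<zero>" using False by (simp_all add: S_def)
        ultimately show ?thesis using cauchyD(1)[OF Suc.prems(1)] by simp
      qed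
    qed
  qed
  also have "\<dots> = of_nat p \<odot>\<^bsub>completion p A\<^esub> clim p A (S a) \<oplus>\<^bsub>completion p A\<^esub>
      fps_X \<odot>\<^bsub>completion p A\<^esub> clim p A (S b)"
    using Scau ab(1-4) by (simp add: clim_add clim_smult cauchy_smult)
  finally show ?case using C.adic_SucI[OF A] by (simp only:)
qed

text \<open>Step n of the completion is thus the kernel of the projection to \<open>A\<close> modulo
  step n, and the adic topology of the completion is the inverse limit topology. For ideals that are
  not finitely generated this can fail.\<close>

lemma adic_completion_iff:
  assumes "cauchy p A f"
  shows "clim p A f \<in> adic p (completion p A) n \<longleftrightarrow> f n \<in> adic p A n"
proof
  assume "clim p A f \<in> adic p (completion p A) n"
  then obtain g where g: "cauchy p A g" "clim p A f = clim p A g" "g n \<in> adic p A n"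
    using adic_completion_imp by metis
  then have "f n \<ominus> g n \<in> adic p A n" using clim_eq_iff[OF assms g(1)] by simp
  then show "f n \<in> adic p A n" by (rule adic_of_diff[OF cauchyD(1)[OF assms] _ g(3)])
qed (rule adic_completion_clim[OF assms])

section \<open>The canonical map to the completion and its universal property\<close>

lemma to_completion_closed: "a \<in> carrier A \<Longrightarrow> to_completion p A a \<in> carrier (completion p A)"
  by (simp add: to_completion_eq clim_closed cauchy_const)

lemma to_completion_add: "\<lbrakk>a \<in> carrier A; b \<in> carrier A\<rbrakk> \<Longrightarrow>
   to_completion p A (a \<oplus> b) = to_completion p A a \<oplus>\<^bsub>completion p A\<^esub> to_completion p A b"
  by (simp add: to_completion_eq clim_add cauchy_const)

lemma to_completion_smult: "a \<in> carrier A \<Longrightarrow>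
   to_completion p A (r \<odot> a) = r \<odot>\<^bsub>completion p A\<^esub> to_completion p A a"
  by (simp add: to_completion_eq clim_smult cauchy_const)

lemma to_completion_fmap: "fmap p A (completion p A) (to_completion p A)"
  by (rule fmap_linear)
    (simp_all add: additive_def to_completion_closed to_completion_add rmod_completion module
      to_completion_smult Pi_iff)

lemma completion_approx:
  assumes "cauchy p A f"
  shows "clim p A f \<ominus>\<^bsub>completion p A\<^esub> to_completion p A (f n) \<in> adic p (completion p A) n"
proof -
  have c: "cauchy p A (\<lambda>_. f n)" using assms by (simp add: cauchy_const cauchyD)
  show ?thesis
    unfolding to_completion_eq clim_diff[OF assms c]
    by (subst adic_completion_iff[OF cauchy_diff[OF assms c]]) (simp add: cauchyD[OF assms])
qed

lemma completion_dense:
  assumes "x \<in> carrier (completion p A)"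
  shows "\<exists>a\<in>carrier A. x \<ominus>\<^bsub>completion p A\<^esub> to_completion p A a \<in> adic p (completion p A) n"
proof -
  obtain f where f: "cauchy p A f" "x = clim p A f" using completion_cases[OF assms] .
  show ?thesis using completion_approx[OF f(1)] cauchyD(1)[OF f(1)] f(2) by (intro bexI[of _ "f n"]) auto
qed

text \<open>A diagonal argument: \<open>F n\<close> is approximated to order \<open>n\<close> by an
  element \<open>g n\<close> of \<open>A\<close>, and the class of \<open>g\<close> is the
  limit.\<close>

lemma complete_completion: "complete p (completion p A)"
  unfolding complete_def
proof (intro conjI allI impI)
  interpret C: rmodule "completion p A" by (rule rmodule.intro, rule rmod_completion)
  show "rmod (completion p A)" by (rule rmod_completion)
  show "separated p (completion p A)"
    unfolding separated_def
  proof (intro ballI impI)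
    fix x assume x: "x \<in> carrier (completion p A)" "\<forall>n. x \<in> adic p (completion p A) n"
    obtain f where f: "cauchy p A f" "x = clim p A f" using completion_cases[OF x(1)] .
    then have "\<forall>n. f n \<in> adic p A n" using x(2) adic_completion_iff[OF f(1)] by simp
    then show "x = \<zero>\<^bsub>completion p A\<^esub>"
      using f by (simp add: clim_zero clim_eq_iff cauchy_const cauchyD)
  qed
  fix F assume F: "cauchy p (completion p A) F"
  have "\<forall>n. \<exists>a\<in>carrier A. F n \<ominus>\<^bsub>completion p A\<^esub> to_completion p A a \<in> adic p (completion p A) n"
    using completion_dense[OF cauchyD(1)[OF F]] by simp
  then obtain g where g: "\<And>n. g n \<in> carrier A"
    "\<And>n. F n \<ominus>\<^bsub>completion p A\<^esub> to_completion p A (g n) \<in> adic p (completion p A) n"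
    by metis
  have Fc: "F n \<in> carrier (completion p A)" for n using cauchyD(1)[OF F] .
  note tc = to_completion_closed[OF g(1)]
  have gc: "cauchy p A g"
    unfolding cauchy_def
  proof (intro allI conjI)
    fix n
    have "to_completion p A (g (Suc n)) \<ominus>\<^bsub>completion p A\<^esub> F (Suc n) \<in> adic p (completion p A) n"
      by (rule subsetD[OF C.adic_Suc_subset C.adic_diff_swap[OF Fc tc g(2)]])
    then have "to_completion p A (g (Suc n)) \<ominus>\<^bsub>completion p A\<^esub> F n \<in> adic p (completion p A) n"
      by (rule C.adic_diff_trans[OF tc Fc Fc _ cauchyD(2)[OF F]])
    then have "to_completion p A (g (Suc n)) \<ominus>\<^bsub>completion p A\<^esub> to_completion p A (g n)
        \<in> adic p (completion p A) n"
      by (rule C.adic_diff_trans[OF tc Fc tc _ g(2)])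
    then have "clim p A (\<lambda>_. g (Suc n) \<ominus> g n) \<in> adic p (completion p A) n"
      using g(1) by (simp add: to_completion_eq clim_diff cauchy_const)
    then show "g (Suc n) \<ominus> g n \<in> adic p A n"
      using g(1) by (simp add: adic_completion_iff cauchy_const)
  qed (rule g)
  show "\<exists>a\<in>carrier (completion p A). \<forall>n. a \<ominus>\<^bsub>completion p A\<^esub> F n \<in> adic p (completion p A) n"
  proof (intro bexI allI)
    fix n
    show "clim p A g \<ominus>\<^bsub>completion p A\<^esub> F n \<in> adic p (completion p A) n"
      using C.adic_diff_trans[OF clim_closed[OF gc] tc Fc completion_approx[OF gc]
          C.adic_diff_swap[OF Fc tc g(2)]] .
  qed (rule clim_closed[OF gc])
qed

text \<open>The value at a class is the limit of \<open>h0\<close> along representatives.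
  \<open>Q\<close> asks for the estimate along every representative, so that additivity and the
  filtration can be read off on whichever one is convenient.\<close>

lemma completion_lift:
  assumes C: "complete p C" and h0: "fmap p A C h0"
  shows "\<exists>h. fmap p (completion p A) C h \<and> (\<forall>a\<in>carrier A. h (to_completion p A a) = h0 a)"
proof -
  interpret C: rmodule C by (rule rmodule.intro, rule complete_rmod[OF C])
  interpret K: rmodule "completion p A" by (rule rmodule.intro, rule rmod_completion)
  define Q where "Q x c \<longleftrightarrow> c \<in> carrier C \<and> (\<forall>f. cauchy p A f \<longrightarrow> x = clim p A f \<longrightarrow>
      (\<forall>n. c \<ominus>\<^bsub>C\<^esub> h0 (f n) \<in> adic p C n))" for x c
  have ex: "\<exists>c. Q x c" if x: "x \<in> carrier (completion p A)" for x
  proof -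
    obtain f where f: "cauchy p A f" "x = clim p A f" using completion_cases[OF x] .
    have "cauchy p C (\<lambda>n. h0 (f n))" by (rule cauchy_fmap[OF h0 C.module f(1)])
    then obtain c where c: "c \<in> carrier C" "\<And>n. c \<ominus>\<^bsub>C\<^esub> h0 (f n) \<in> adic p C n"
      using C by (auto simp: complete_def)
    have "c \<ominus>\<^bsub>C\<^esub> h0 (g n) \<in> adic p C n" if g: "cauchy p A g" "x = clim p A g" for g n
    proof -
      have gf: "f n \<ominus> g n \<in> adic p A n" using f g clim_eq_iff by blast
      have cl: "f n \<in> carrier A" "g n \<in> carrier A" using f g cauchyD by blast+
      have "h0 (f n) \<ominus>\<^bsub>C\<^esub> h0 (g n) \<in> adic p C n"
        using fmap_adic[OF h0 gf] additive_diff[OF fmap_additive[OF h0] module C.module] cl by simp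
      then show ?thesis
        using C.adic_diff_trans[OF c(1) _ _ c(2)] fmap_closed[OF h0] cl by blast
    qed
    then show ?thesis using c(1) by (auto simp: Q_def)
  qed
  define h where "h x = (SOME c. Q x c)" for x
  have hQ: "Q x (h x)" if "x \<in> carrier (completion p A)" for x
    unfolding h_def by (rule someI_ex[OF ex[OF that]])
  have hc: "h x \<in> carrier C" if "x \<in> carrier (completion p A)" for x
    using hQ[OF that] by (simp add: Q_def)
  have hl: "h (clim p A f) \<ominus>\<^bsub>C\<^esub> h0 (f n) \<in> adic p C n" if "cauchy p A f" for f n
    using hQ[OF clim_closed[OF that]] that by (auto simp: Q_def)
  have h0c: "h0 (f n) \<in> carrier C" if "cauchy p A f" for f n
    using fmap_closed[OF h0] cauchyD(1)[OF that] by blast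
  have "additive (completion p A) C h"
  proof (rule additiveI)
    fix x y assume xy: "x \<in> carrier (completion p A)" "y \<in> carrier (completion p A)"
    obtain f where f: "cauchy p A f" "x = clim p A f" using completion_cases[OF xy(1)] .
    obtain g where g: "cauchy p A g" "y = clim p A g" using completion_cases[OF xy(2)] .
    show "h (x \<oplus>\<^bsub>completion p A\<^esub> y) = h x \<oplus>\<^bsub>C\<^esub> h y"
    proof (rule separated_eqI[OF complete_separated[OF C] C.module])
      fix n
      have 1: "h (x \<oplus>\<^bsub>completion p A\<^esub> y) \<ominus>\<^bsub>C\<^esub> h0 (f n \<oplus> g n) \<in> adic p C n"
        using hl[OF cauchy_add[OF f(1) g(1)]] f g by (simp add: clim_add)
      have 2: "h0 (f n \<oplus> g n) = h0 (f n) \<oplus>\<^bsub>C\<^esub> h0 (g n)"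
        using fmap_add[OF h0] cauchyD(1) f g by blast
      have 3: "(h x \<oplus>\<^bsub>C\<^esub> h y) \<ominus>\<^bsub>C\<^esub> (h0 (f n) \<oplus>\<^bsub>C\<^esub> h0 (g n)) \<in> adic p C n"
        using C.adic_diff_add[OF hc[OF xy(1)] hc[OF xy(2)] h0c[OF f(1)] h0c[OF g(1)]] hl f g by blast
      show "h (x \<oplus>\<^bsub>completion p A\<^esub> y) \<ominus>\<^bsub>C\<^esub> (h x \<oplus>\<^bsub>C\<^esub> h y) \<in> adic p C n"
        using C.adic_diff_trans[OF _ _ _ 1[unfolded 2] C.adic_diff_swap[OF _ _ 3]]
          hc xy h0c[OF f(1)] h0c[OF g(1)] by simp
    qed (use hc xy in auto)
  qed (rule hc)
  moreover have "h x \<in> adic p C n" if "x \<in> adic p (completion p A) n" for x n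
  proof -
    obtain f where f: "cauchy p A f" "x = clim p A f" "f n \<in> adic p A n"
      using adic_completion_imp[OF \<open>x \<in> adic p (completion p A) n\<close>] by blast
    show ?thesis
      using C.adic_of_diff[OF hc[OF clim_closed[OF f(1)]] hl[OF f(1)] fmap_adic[OF h0 f(3)]] f by simp
  qed
  moreover have "h (to_completion p A a) = h0 a" if "a \<in> carrier A" for a
    by (rule separated_eqI[OF complete_separated[OF C] C.module])
      (use hl[OF cauchy_const[OF that]] hc to_completion_closed[OF that] fmap_closed[OF h0 that] in
        \<open>auto simp: to_completion_eq\<close>)
  ultimately show ?thesis by (auto simp: fmap_def)
qed

end

text \<open>The description in \<open>ctensor_lift\<close> ranges over all continuous additive maps,
  so uniqueness has to be proved in this generality, although the maps constructed satisfy
  \<open>fmap\<close>.\<close>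

definition contin :: "nat \<Rightarrow> ('w::comm_ring_1 fps, 'a, 'y) module_scheme \<Rightarrow>
    ('w fps, 'b, 'z) module_scheme \<Rightarrow> ('a \<Rightarrow> 'b) \<Rightarrow> bool"
  where "contin p A C h \<longleftrightarrow> additive A C h \<and> (\<forall>n. \<exists>m. h ` adic p A m \<subseteq> adic p C n)"

lemma fmap_contin: "fmap p A C h \<Longrightarrow> contin p A C h"
  by (auto simp: fmap_def contin_def)

lemma (in rmodule) completion_ext:
  assumes f: "contin p (completion p A) C f" and g: "contin p (completion p A) C g"
    and C: "separated p C" "rmod C"
    and eq: "\<And>a. a \<in> carrier A \<Longrightarrow> f (to_completion p A a) = g (to_completion p A a)"
    and x: "x \<in> carrier (completion p A)"
  shows "f x = g x"
proof (rule separated_eqI[OF C])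
  interpret C: rmodule C by (rule rmodule.intro, rule C(2))
  interpret K: rmodule "completion p A" by (rule rmodule.intro, rule rmod_completion)
  have fa: "additive (completion p A) C f" and ga: "additive (completion p A) C g"
    using f g by (auto simp: contin_def)
  show fx: "f x \<in> carrier C" and gx: "g x \<in> carrier C" using fa ga x additive_closed by metis+
  fix n
  obtain m1 m2 where "f ` adic p (completion p A) m1 \<subseteq> adic p C n"
    "g ` adic p (completion p A) m2 \<subseteq> adic p C n"
    using f g unfolding contin_def by meson
  then have m: "f ` adic p (completion p A) (max m1 m2) \<subseteq> adic p C n"
    "g ` adic p (completion p A) (max m1 m2) \<subseteq> adic p C n"
    using K.adic_antimono[of m1 "max m1 m2" p] K.adic_antimono[of m2 "max m1 m2" p]
    by (meson image_mono order_trans max.cobounded1 max.cobounded2)+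
  obtain a where a: "a \<in> carrier A"
    "x \<ominus>\<^bsub>completion p A\<^esub> to_completion p A a \<in> adic p (completion p A) (max m1 m2)"
    using completion_dense[OF x] by blast
  let ?t = "to_completion p A a"
  have t: "?t \<in> carrier (completion p A)" by (rule to_completion_closed[OF a(1)])
  have "f x \<ominus>\<^bsub>C\<^esub> f ?t \<in> adic p C n" "g x \<ominus>\<^bsub>C\<^esub> g ?t \<in> adic p C n"
    using m a(2) additive_diff[OF fa K.module C(2) x t] additive_diff[OF ga K.module C(2) x t]
    by auto
  moreover have "f ?t \<in> carrier C" using additive_closed[OF fa t] .
  ultimately show "f x \<ominus>\<^bsub>C\<^esub> g x \<in> adic p C n"
    using C.adic_diff_trans[OF fx _ gx] C.adic_diff_swap[OF gx] eq[OF a(1)] by simp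
qed

section \<open>Tensor products of bimodules\<close>

definition bimod :: "('w::comm_ring_1 fps, 'a) bimodule \<Rightarrow> bool" where
  "bimod A \<longleftrightarrow> rmod A \<and> (\<forall>r. additive A A (\<lambda>x. rsmult A x r)) \<and>
    (\<forall>x\<in>carrier A. \<forall>r s. rsmult A (s \<odot>\<^bsub>A\<^esub> x) r = s \<odot>\<^bsub>A\<^esub> rsmult A x r)"

lemma bimod_rmod: "bimod A \<Longrightarrow> rmod A"
  by (simp add: bimod_def)

lemma bimod_additive: "bimod A \<Longrightarrow> additive A A (\<lambda>x. rsmult A x r)"
  by (simp add: bimod_def)

lemma bimod_closed: "bimod A \<Longrightarrow> x \<in> carrier A \<Longrightarrow> rsmult A x r \<in> carrier A"
  by (rule additive_closed[OF bimod_additive])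

lemma bimod_smult: "bimod A \<Longrightarrow> x \<in> carrier A \<Longrightarrow> rsmult A (s \<odot>\<^bsub>A\<^esub> x) r = s \<odot>\<^bsub>A\<^esub> rsmult A x r"
  by (simp add: bimod_def)

lemma bimod_fmap: "bimod A \<Longrightarrow> fmap p A A (\<lambda>x. rsmult A x r)"
  by (rule fmap_linear) (simp_all add: bimod_additive bimod_rmod bimod_smult)

abbreviation pure :: "('r, 'a) bimodule \<Rightarrow> ('r, 'b) bimodule \<Rightarrow> 'a \<Rightarrow> 'b \<Rightarrow> ('a, 'b) tens" where
  "pure A B a b \<equiv> tensor_class A B (frag_of (a, b))"

locale two_bimods =
  fixes A :: "('w::comm_ring_1 fps, 'a) bimodule" and B :: "('w fps, 'b) bimodule"
  assumes bimod_A: "bimod A" and bimod_B: "bimod B"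
begin

sublocale A: rmodule A by (rule rmodule.intro, rule bimod_rmod[OF bimod_A])
sublocale B: rmodule B by (rule rmodule.intro, rule bimod_rmod[OF bimod_B])
sublocale F: comm_group "pairs_group A B" by (rule abelian_free_Abelian_group)

text \<open>The carrier of \<open>pairs_group\<close> as a set of finitely supported functions, so
  that computations use \<open>+\<close> and \<open>-\<close> instead of the multiplicative notation
  of the group.\<close>

definition "frags = {u :: ('a \<times> 'b) \<Rightarrow>\<^sub>0 int. Poly_Mapping.keys u \<subseteq> carrier A \<times> carrier B}"

lemma frags_iff: "u \<in> frags \<longleftrightarrow> u \<in> carrier (pairs_group A B)"
  by (simp add: frags_def)

lemma frags_add [simp]: "u \<in> frags \<Longrightarrow> v \<in> frags \<Longrightarrow> u + v \<in> frags"
  using keys_add[of u v] by (auto simp: frags_def)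

lemma frags_diff [simp]: "u \<in> frags \<Longrightarrow> v \<in> frags \<Longrightarrow> u - v \<in> frags"
  using keys_diff[of u v] by (auto simp: frags_def)

lemma frags_minus [simp]: "u \<in> frags \<Longrightarrow> - u \<in> frags"
  by (simp add: frags_def)

lemma frags_0 [simp]: "0 \<in> frags"
  by (simp add: frags_def)

lemma frags_of [simp]: "a \<in> carrier A \<Longrightarrow> b \<in> carrier B \<Longrightarrow> frag_of (a, b) \<in> frags"
  by (simp add: frags_def)

lemma frags_induct [consumes 1, case_names 0 of diff]:
  assumes "u \<in> frags" "P 0" "\<And>a b. a \<in> carrier A \<Longrightarrow> b \<in> carrier B \<Longrightarrow> P (frag_of (a, b))"
    "\<And>u v. P u \<Longrightarrow> P v \<Longrightarrow> P (u - v)"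
  shows "P u"
  using assms(1) unfolding frags_def
  by (intro frag_induction[of u "carrier A \<times> carrier B" P]) (auto intro: assms)

lemma relations_subset: "tensor_relations A B \<subseteq> frags"
  unfolding tensor_relations_def
  by (auto intro!: frags_diff frags_of bimod_closed[OF bimod_A])

lemma null_subgroup: "subgroup (tensor_null A B) (pairs_group A B)"
  unfolding tensor_null_def
  by (rule F.generate_is_subgroup) (use relations_subset frags_iff in blast)

lemma null_normal: "tensor_null A B \<lhd> pairs_group A B"
  by (rule F.subgroup_imp_normal[OF null_subgroup])

lemma null_frags: "u \<in> tensor_null A B \<Longrightarrow> u \<in> frags"
  using subgroup.subset[OF null_subgroup] frags_iff by blast

lemma null_0 [simp]: "0 \<in> tensor_null A B"
  using subgroup.one_closed[OF null_subgroup] by simp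

lemma null_add: "u \<in> tensor_null A B \<Longrightarrow> v \<in> tensor_null A B \<Longrightarrow> u + v \<in> tensor_null A B"
  using subgroup.m_closed[OF null_subgroup] by simp

lemma null_minus: "u \<in> tensor_null A B \<Longrightarrow> - u \<in> tensor_null A B"
  using subgroup.m_inv_closed[OF null_subgroup, of u] null_frags[of u] by (simp add: frags_def)

lemma null_diff: "u \<in> tensor_null A B \<Longrightarrow> v \<in> tensor_null A B \<Longrightarrow> u - v \<in> tensor_null A B"
  using null_add[OF _ null_minus, of u v] by simp

lemma relations_null: "u \<in> tensor_relations A B \<Longrightarrow> u \<in> tensor_null A B"
  unfolding tensor_null_def by (rule generate.incl)

lemma null_induct [consumes 1, case_names relation 0 add minus]:
  assumes u: "u \<in> tensor_null A B" and rel: "\<And>u. u \<in> tensor_relations A B \<Longrightarrow> P u"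
    and P: "P 0" "\<And>u v. u \<in> frags \<Longrightarrow> v \<in> frags \<Longrightarrow> P u \<Longrightarrow> P v \<Longrightarrow> P (u + v)"
    "\<And>u. u \<in> frags \<Longrightarrow> P u \<Longrightarrow> P (- u)"
  shows "P u"
proof -
  have "subgroup {u \<in> frags. P u} (pairs_group A B)"
    by (rule subgroup.intro)
      (use P in \<open>auto simp: frags_iff[symmetric] subset_iff, auto simp: frags_def\<close>)
  then have "tensor_null A B \<subseteq> {u \<in> frags. P u}"
    unfolding tensor_null_def
    by (intro F.generate_subgroup_incl) (use rel relations_subset in blast)
  then show ?thesis using u by blast
qed

lemma class_eq_iff:
  assumes "u \<in> frags" "v \<in> frags"
  shows "tensor_class A B u = tensor_class A B v \<longleftrightarrow> u - v \<in> tensor_null A B"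
proof -
  have "u \<in> tensor_null A B #>\<^bsub>pairs_group A B\<^esub> v \<longleftrightarrow> u - v \<in> tensor_null A B"
    using subgroup.rcos_module[OF null_subgroup F.group_axioms, of v u] assms
    by (simp add: frags_def)
  then show ?thesis
    unfolding tensor_class_def
    using F.repr_independence[OF _ _ null_subgroup, of u v]
      F.rcos_self[OF _ null_subgroup, of u] assms frags_iff by blast
qed

lemma class_UN:
  assumes "u \<in> frags" "\<And>v. v \<in> frags \<Longrightarrow> v - u \<in> tensor_null A B \<Longrightarrow> g v = c"
  shows "(\<Union>v\<in>tensor_class A B u. g v) = c"
proof -
  have "u \<in> tensor_class A B u"
    unfolding tensor_class_def by (rule F.rcos_self[OF _ null_subgroup]) (use assms frags_iff in blast)
  moreover have "g v = c" if v: "v \<in> tensor_class A B u" for v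
  proof (rule assms(2))
    show fv: "v \<in> frags"
      using v F.r_coset_subset_G[OF subgroup.subset[OF null_subgroup], of u] assms(1) frags_iff
      unfolding tensor_class_def by blast
    show "v - u \<in> tensor_null A B"
      using subgroup.rcos_module[OF null_subgroup F.group_axioms, of u v] assms(1) v fv
      by (simp add: frags_def tensor_class_def)
  qed
  ultimately show ?thesis by blast
qed

lemma carrier_tensor: "x \<in> carrier (tensor A B) \<longleftrightarrow> (\<exists>u\<in>frags. x = tensor_class A B u)"
  by (auto simp: tensor_def FactGroup_def RCOSETS_def tensor_class_def frags_def) blast

lemma class_closed: "u \<in> frags \<Longrightarrow> tensor_class A B u \<in> carrier (tensor A B)"
  using carrier_tensor by blast

lemma class_add: "u \<in> frags \<Longrightarrow> v \<in> frags \<Longrightarrow>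
    tensor_class A B u \<oplus>\<^bsub>tensor A B\<^esub> tensor_class A B v = tensor_class A B (u + v)"
  using normal.rcos_sum[OF null_normal, of u v]
  by (simp add: tensor_def FactGroup_def tensor_class_def frags_def)

lemma class_zero: "\<zero>\<^bsub>tensor A B\<^esub> = tensor_class A B 0"
  using F.coset_mult_one[OF subgroup.subset[OF null_subgroup]]
  by (simp add: tensor_def FactGroup_def tensor_class_def)

lemma pure_closed: "a \<in> carrier A \<Longrightarrow> b \<in> carrier B \<Longrightarrow> pure A B a b \<in> carrier (tensor A B)"
  by (simp add: class_closed)

lemma relation_null:
  "\<lbrakk>a \<in> carrier A; a' \<in> carrier A; b \<in> carrier B\<rbrakk> \<Longrightarrow>
     frag_of (a \<oplus>\<^bsub>A\<^esub> a', b) - frag_of (a, b) - frag_of (a', b) \<in> tensor_null A B"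
  "\<lbrakk>a \<in> carrier A; b \<in> carrier B; b' \<in> carrier B\<rbrakk> \<Longrightarrow>
     frag_of (a, b \<oplus>\<^bsub>B\<^esub> b') - frag_of (a, b) - frag_of (a, b') \<in> tensor_null A B"
  "\<lbrakk>a \<in> carrier A; b \<in> carrier B\<rbrakk> \<Longrightarrow>
     frag_of (rsmult A a r, b) - frag_of (a, r \<odot>\<^bsub>B\<^esub> b) \<in> tensor_null A B"
  by (rule relations_null, unfold tensor_relations_def, blast)+

lemma pure_add_l: "\<lbrakk>a \<in> carrier A; a' \<in> carrier A; b \<in> carrier B\<rbrakk> \<Longrightarrow>
    pure A B (a \<oplus>\<^bsub>A\<^esub> a') b = pure A B a b \<oplus>\<^bsub>tensor A B\<^esub> pure A B a' b"
  using relation_null by (simp add: class_add class_eq_iff diff_diff_eq)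

lemma pure_add_r: "\<lbrakk>a \<in> carrier A; b \<in> carrier B; b' \<in> carrier B\<rbrakk> \<Longrightarrow>
    pure A B a (b \<oplus>\<^bsub>B\<^esub> b') = pure A B a b \<oplus>\<^bsub>tensor A B\<^esub> pure A B a b'"
  using relation_null by (simp add: class_add class_eq_iff diff_diff_eq)

lemma pure_balanced: "\<lbrakk>a \<in> carrier A; b \<in> carrier B\<rbrakk> \<Longrightarrow>
    pure A B (rsmult A a r) b = pure A B a (r \<odot>\<^bsub>B\<^esub> b)"
  by (simp add: class_eq_iff bimod_closed[OF bimod_A] relation_null)

lemma pure_zero: "b \<in> carrier B \<Longrightarrow> pure A B \<zero>\<^bsub>A\<^esub> b = \<zero>\<^bsub>tensor A B\<^esub>"
proof -
  assume b: "b \<in> carrier B"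
  have "frag_of (\<zero>\<^bsub>A\<^esub> \<oplus>\<^bsub>A\<^esub> \<zero>\<^bsub>A\<^esub>, b) - frag_of (\<zero>\<^bsub>A\<^esub>, b) - frag_of (\<zero>\<^bsub>A\<^esub>, b) \<in> tensor_null A B"
    using b by (intro relation_null) simp_all
  then have "- frag_of (\<zero>\<^bsub>A\<^esub>, b) \<in> tensor_null A B" by simp
  from null_minus[OF this] show ?thesis using b by (simp add: class_zero class_eq_iff)
qed

text \<open>Negatives are covered by the pure case, because a sign moves into the left
  entry.\<close>

lemma tensor_induct [consumes 1, case_names pure add]:
  assumes x: "x \<in> carrier (tensor A B)"
    and pure: "\<And>a b. a \<in> carrier A \<Longrightarrow> b \<in> carrier B \<Longrightarrow> P (pure A B a b)"
    and add: "\<And>x y. x \<in> carrier (tensor A B) \<Longrightarrow> y \<in> carrier (tensor A B) \<Longrightarrow> P x \<Longrightarrow> P y \<Longrightarrow>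
        P (x \<oplus>\<^bsub>tensor A B\<^esub> y)"
  shows "P x"
proof -
  obtain u where u: "u \<in> frags" "x = tensor_class A B u" using x carrier_tensor by blast
  \<comment> \<open>Induction on fragments runs over differences, so the property is carried along
    for \<open>u\<close> and \<open>- u\<close> together.\<close>
  have "u \<in> frags \<and> P (tensor_class A B u) \<and> P (tensor_class A B (- u))"
    using u(1)
  proof (induction rule: frags_induct)
    case 0
    then show ?case using pure[of "\<zero>\<^bsub>A\<^esub>" "\<zero>\<^bsub>B\<^esub>"] by (simp add: pure_zero class_zero)
  next
    case (of a b)
    have "pure A B (\<ominus>\<^bsub>A\<^esub> a) b \<oplus>\<^bsub>tensor A B\<^esub> pure A B a b = \<zero>\<^bsub>tensor A B\<^esub>"
      using of by (simp add: pure_add_l[symmetric] A.l_neg pure_zero)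
    then have "frag_of (\<ominus>\<^bsub>A\<^esub> a, b) + frag_of (a, b) \<in> tensor_null A B"
      using of by (simp add: class_add class_zero class_eq_iff)
    from null_minus[OF this] have "- frag_of (a, b) - frag_of (\<ominus>\<^bsub>A\<^esub> a, b) \<in> tensor_null A B"
      by (simp only: minus_add add.commute diff_conv_add_uminus)
    then have "tensor_class A B (- frag_of (a, b)) = pure A B (\<ominus>\<^bsub>A\<^esub> a) b"
      using of by (simp add: class_eq_iff)
    then show ?case using of pure[of a b] pure[of "\<ominus>\<^bsub>A\<^esub> a" b] by simp
  next
    case (diff u v)
    have "P (tensor_class A B u \<oplus>\<^bsub>tensor A B\<^esub> tensor_class A B (- v))"
      "P (tensor_class A B v \<oplus>\<^bsub>tensor A B\<^esub> tensor_class A B (- u))"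
      using diff by (auto intro!: add class_closed)
    then show ?case using diff by (simp add: class_add)
  qed
  then show ?thesis using u by simp
qed

text \<open>The usual criterion for a map on generators to pass to the quotient. The third claim has
  the shape in which \<open>tensor\<close> defines its two scalar actions.\<close>

lemma descend:
  assumes f: "\<And>a b. a \<in> carrier A \<Longrightarrow> b \<in> carrier B \<Longrightarrow> f (a, b) \<in> frags"
    and rel: "\<And>u. u \<in> tensor_relations A B \<Longrightarrow> frag_extend f u \<in> tensor_null A B"
  shows "u \<in> frags \<Longrightarrow> frag_extend f u \<in> frags"
    and "u \<in> tensor_null A B \<Longrightarrow> frag_extend f u \<in> tensor_null A B"
    and "u \<in> frags \<Longrightarrow> (\<Union>u\<in>tensor_class A B u. tensor_class A B (frag_extend f u)) =
      tensor_class A B (frag_extend f u)"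
proof -
  show fr: "frag_extend f u \<in> frags" if "u \<in> frags" for u
    using that by (induction rule: frags_induct) (auto simp: frag_extend_diff f)
  show nu: "frag_extend f u \<in> tensor_null A B" if "u \<in> tensor_null A B" for u
    using that
    by (induction rule: null_induct)
      (auto simp: rel frag_extend_add frag_extend_minus intro: null_add null_minus)
  show "(\<Union>u\<in>tensor_class A B u. tensor_class A B (frag_extend f u)) =
      tensor_class A B (frag_extend f u)" if u: "u \<in> frags"
    by (rule class_UN[OF u])
      (use u fr nu in \<open>auto simp: class_eq_iff frag_extend_diff[symmetric]\<close>)
qed

lemma relation_cases:
  assumes "u \<in> tensor_relations A B"
    and "\<And>a a' b. a \<in> carrier A \<Longrightarrow> a' \<in> carrier A \<Longrightarrow> b \<in> carrier B \<Longrightarrow>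
        P (frag_of (a \<oplus>\<^bsub>A\<^esub> a', b) - frag_of (a, b) - frag_of (a', b))"
    and "\<And>a b b'. a \<in> carrier A \<Longrightarrow> b \<in> carrier B \<Longrightarrow> b' \<in> carrier B \<Longrightarrow>
        P (frag_of (a, b \<oplus>\<^bsub>B\<^esub> b') - frag_of (a, b) - frag_of (a, b'))"
    and "\<And>a r b. a \<in> carrier A \<Longrightarrow> b \<in> carrier B \<Longrightarrow>
        P (frag_of (rsmult A a r, b) - frag_of (a, r \<odot>\<^bsub>B\<^esub> b))"
  shows "P u"
  using assms(1) unfolding tensor_relations_def
  by (elim UnE CollectE exE conjE) (simp_all only: assms(2-4))

lemma smult_rel:
  assumes "u \<in> tensor_relations A B"
  shows "frag_extend (\<lambda>(a, b). frag_of (r \<odot>\<^bsub>A\<^esub> a, b)) u \<in> tensor_null A B"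
  using assms
  by (rule relation_cases)
    (simp_all add: frag_extend_diff A.smult_add_r relation_null bimod_smult[OF bimod_A, symmetric])

lemma rsmult_rel:
  assumes "u \<in> tensor_relations A B"
  shows "frag_extend (\<lambda>(a, b). frag_of (a, rsmult B b r)) u \<in> tensor_null A B"
  using assms
  by (rule relation_cases)
    (simp_all add: frag_extend_diff additive_add[OF bimod_additive[OF bimod_B]] relation_null
      bimod_smult[OF bimod_B] bimod_closed[OF bimod_B])

lemma class_smult: "u \<in> frags \<Longrightarrow> r \<odot>\<^bsub>tensor A B\<^esub> tensor_class A B u =
    tensor_class A B (frag_extend (\<lambda>(a, b). frag_of (r \<odot>\<^bsub>A\<^esub> a, b)) u)"
  using descend(3)[of "\<lambda>(a, b). frag_of (r \<odot>\<^bsub>A\<^esub> a, b)" u, OF _ smult_rel]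
  by (simp add: tensor_def)

lemma class_rsmult: "u \<in> frags \<Longrightarrow> rsmult (tensor A B) (tensor_class A B u) r =
    tensor_class A B (frag_extend (\<lambda>(a, b). frag_of (a, rsmult B b r)) u)"
  using descend(3)[of "\<lambda>(a, b). frag_of (a, rsmult B b r)" u, OF _ rsmult_rel]
  by (simp add: tensor_def bimod_closed[OF bimod_B])

lemma smult_frags: "u \<in> frags \<Longrightarrow> frag_extend (\<lambda>(a, b). frag_of (r \<odot>\<^bsub>A\<^esub> a, b)) u \<in> frags"
  by (rule descend(1)[OF _ smult_rel]) simp_all

lemma rsmult_frags: "u \<in> frags \<Longrightarrow> frag_extend (\<lambda>(a, b). frag_of (a, rsmult B b r)) u \<in> frags"
  by (rule descend(1)[OF _ rsmult_rel]) (simp_all add: bimod_closed[OF bimod_B])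

lemma smult_additive: "additive (tensor A B) (tensor A B) (\<lambda>x. r \<odot>\<^bsub>tensor A B\<^esub> x)"
  by (rule additiveI)
    (auto simp: carrier_tensor class_smult smult_frags class_add frag_extend_add)

lemma rsmult_additive: "additive (tensor A B) (tensor A B) (\<lambda>x. rsmult (tensor A B) x r)"
  by (rule additiveI)
    (auto simp: carrier_tensor class_rsmult rsmult_frags class_add frag_extend_add)

lemma pure_smult: "a \<in> carrier A \<Longrightarrow> b \<in> carrier B \<Longrightarrow>
    r \<odot>\<^bsub>tensor A B\<^esub> pure A B a b = pure A B (r \<odot>\<^bsub>A\<^esub> a) b"
  by (simp add: class_smult)

lemma pure_rsmult: "a \<in> carrier A \<Longrightarrow> b \<in> carrier B \<Longrightarrow>
    rsmult (tensor A B) (pure A B a b) r = pure A B a (rsmult B b r)"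
  by (simp add: class_rsmult)

lemma tensor_ext:
  assumes "additive (tensor A B) C f" "additive (tensor A B) C g"
    "\<And>a b. a \<in> carrier A \<Longrightarrow> b \<in> carrier B \<Longrightarrow> f (pure A B a b) = g (pure A B a b)"
    "x \<in> carrier (tensor A B)"
  shows "f x = g x"
  using assms(4)
  by (induction rule: tensor_induct)
    (simp_all add: assms additive_add[OF assms(1)] additive_add[OF assms(2)])

lemma tensor_assoc: "\<lbrakk>x \<in> carrier (tensor A B); y \<in> carrier (tensor A B); z \<in> carrier (tensor A B)\<rbrakk> \<Longrightarrow>
    x \<oplus>\<^bsub>tensor A B\<^esub> y \<oplus>\<^bsub>tensor A B\<^esub> z = x \<oplus>\<^bsub>tensor A B\<^esub> (y \<oplus>\<^bsub>tensor A B\<^esub> z)"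
  by (auto simp: carrier_tensor class_add add.assoc)

lemma tensor_comm: "\<lbrakk>x \<in> carrier (tensor A B); y \<in> carrier (tensor A B)\<rbrakk> \<Longrightarrow>
    x \<oplus>\<^bsub>tensor A B\<^esub> y = y \<oplus>\<^bsub>tensor A B\<^esub> x"
  by (auto simp: carrier_tensor class_add add.commute)

lemma tensor_add_closed: "\<lbrakk>x \<in> carrier (tensor A B); y \<in> carrier (tensor A B)\<rbrakk> \<Longrightarrow>
    x \<oplus>\<^bsub>tensor A B\<^esub> y \<in> carrier (tensor A B)"
  by (auto simp: carrier_tensor class_add)

lemma tensor_add_left_comm: "\<lbrakk>x \<in> carrier (tensor A B); y \<in> carrier (tensor A B); z \<in> carrier (tensor A B)\<rbrakk> \<Longrightarrow>
    x \<oplus>\<^bsub>tensor A B\<^esub> (y \<oplus>\<^bsub>tensor A B\<^esub> z) = y \<oplus>\<^bsub>tensor A B\<^esub> (x \<oplus>\<^bsub>tensor A B\<^esub> z)"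
  by (metis tensor_assoc tensor_comm)

lemma tensor_l_zero: "x \<in> carrier (tensor A B) \<Longrightarrow> \<zero>\<^bsub>tensor A B\<^esub> \<oplus>\<^bsub>tensor A B\<^esub> x = x"
  by (auto simp: carrier_tensor class_add class_zero)

lemma tensor_zero_closed: "\<zero>\<^bsub>tensor A B\<^esub> \<in> carrier (tensor A B)"
  by (simp add: class_zero class_closed)

lemmas tensor_smult_closed = additive_closed[OF smult_additive]
lemmas tensor_smult_add = additive_add[OF smult_additive]

lemma tensor_rmod: "rmod (tensor A B)"
proof (rule rmodI)
  fix x assume x: "x \<in> carrier (tensor A B)"
  show "1 \<odot>\<^bsub>tensor A B\<^esub> x = x"
    by (rule tensor_ext[OF smult_additive _ _ x])
      (simp_all add: additive_def pure_smult)
  show "0 \<odot>\<^bsub>tensor A B\<^esub> x = \<zero>\<^bsub>tensor A B\<^esub>"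
    by (rule tensor_ext[OF smult_additive _ _ x])
      (simp_all add: additive_def pure_smult pure_zero tensor_l_zero tensor_zero_closed)
  fix r s
  show "r \<odot>\<^bsub>tensor A B\<^esub> x \<in> carrier (tensor A B)"
    by (rule additive_closed[OF smult_additive x])
  show "(r * s) \<odot>\<^bsub>tensor A B\<^esub> x = r \<odot>\<^bsub>tensor A B\<^esub> (s \<odot>\<^bsub>tensor A B\<^esub> x)"
    by (rule tensor_ext[OF smult_additive additive_comp[OF smult_additive smult_additive] _ x])
      (simp add: pure_smult A.smult_smult)
  have "additive (tensor A B) (tensor A B)
      (\<lambda>x. r \<odot>\<^bsub>tensor A B\<^esub> x \<oplus>\<^bsub>tensor A B\<^esub> s \<odot>\<^bsub>tensor A B\<^esub> x)"
    by (rule additiveI)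
      (simp_all add: tensor_smult_closed tensor_add_closed tensor_smult_add tensor_assoc
        tensor_comm tensor_add_left_comm)
  from tensor_ext[OF smult_additive this _ x]
  show "(r + s) \<odot>\<^bsub>tensor A B\<^esub> x = r \<odot>\<^bsub>tensor A B\<^esub> x \<oplus>\<^bsub>tensor A B\<^esub> s \<odot>\<^bsub>tensor A B\<^esub> x"
    by (simp add: pure_smult A.smult_add_l pure_add_l)
  show "\<zero>\<^bsub>tensor A B\<^esub> \<oplus>\<^bsub>tensor A B\<^esub> x = x" by (rule tensor_l_zero[OF x])
  fix y assume y: "y \<in> carrier (tensor A B)"
  show "x \<oplus>\<^bsub>tensor A B\<^esub> y \<in> carrier (tensor A B)" by (rule tensor_add_closed[OF x y])
  show "x \<oplus>\<^bsub>tensor A B\<^esub> y = y \<oplus>\<^bsub>tensor A B\<^esub> x" by (rule tensor_comm[OF x y])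
  show "r \<odot>\<^bsub>tensor A B\<^esub> (x \<oplus>\<^bsub>tensor A B\<^esub> y) =
      r \<odot>\<^bsub>tensor A B\<^esub> x \<oplus>\<^bsub>tensor A B\<^esub> r \<odot>\<^bsub>tensor A B\<^esub> y"
    by (rule tensor_smult_add[OF x y])
qed (rule tensor_zero_closed, rule tensor_assoc)

lemma tensor_bimod: "bimod (tensor A B)"
  unfolding bimod_def
proof (intro conjI allI ballI)
  fix x r s assume x: "x \<in> carrier (tensor A B)"
  show "rsmult (tensor A B) (s \<odot>\<^bsub>tensor A B\<^esub> x) r = s \<odot>\<^bsub>tensor A B\<^esub> rsmult (tensor A B) x r"
    by (rule tensor_ext[OF additive_comp[OF smult_additive rsmult_additive]
          additive_comp[OF rsmult_additive smult_additive] _ x])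
      (simp add: pure_smult pure_rsmult bimod_closed[OF bimod_B])
qed (rule tensor_rmod, rule rsmult_additive)

text \<open>The free group supplies a map on fragments; additivity in each variable and balancing
  make it vanish on the three kinds of relations, hence on \<open>tensor_null\<close>.\<close>

lemma tensor_lift:
  assumes C: "rmod C"
    and l: "\<And>b. b \<in> carrier B \<Longrightarrow> additive A C (\<lambda>a. \<beta> a b)"
    and r: "\<And>a. a \<in> carrier A \<Longrightarrow> additive B C (\<beta> a)"
    and bal: "\<And>a b r. a \<in> carrier A \<Longrightarrow> b \<in> carrier B \<Longrightarrow> \<beta> (rsmult A a r) b = \<beta> a (r \<odot>\<^bsub>B\<^esub> b)"
  shows "\<exists>h. additive (tensor A B) C h \<and>
    (\<forall>a\<in>carrier A. \<forall>b\<in>carrier B. h (pure A B a b) = \<beta> a b)"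
proof -
  interpret C: rmodule C by (rule rmodule.intro, rule C)
  have bc: "\<beta> a b \<in> carrier C" if "a \<in> carrier A" "b \<in> carrier B" for a b
    using additive_closed[OF l] that by blast
  obtain h0 where h0: "h0 \<in> hom (pairs_group A B) (add_monoid C)"
    "\<And>x. x \<in> carrier A \<times> carrier B \<Longrightarrow> h0 (frag_of x) = (\<lambda>(a, b). \<beta> a b) x"
  proof (rule comm_group.free_Abelian_group_universal[OF C.a_comm_group, of "\<lambda>(a, b). \<beta> a b" "carrier A \<times> carrier B"])
    show "(\<lambda>(a, b). \<beta> a b) ` (carrier A \<times> carrier B) \<subseteq> carrier (add_monoid C)"
      using bc by auto
  qed blast
  have h0c: "h0 u \<in> carrier C" if "u \<in> frags" for u
    using hom_in_carrier[OF h0(1), of u] that frags_iff by simp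
  have h0a: "h0 (u + v) = h0 u \<oplus>\<^bsub>C\<^esub> h0 v" if "u \<in> frags" "v \<in> frags" for u v
    using hom_mult[OF h0(1), of u v] that frags_iff by simp
  have h00: "h0 0 = \<zero>\<^bsub>C\<^esub>"
    using h0a[of 0 0] h0c[of 0] by (metis frags_0 add.right_neutral C.add.l_cancel_one')
  have h0m: "h0 (- u) = \<ominus>\<^bsub>C\<^esub> h0 u" if "u \<in> frags" for u
    using h0a[of "- u" u] that h0c h00 by (simp add: C.minus_equality)
  have h0d: "h0 (u - v) = h0 u \<ominus>\<^bsub>C\<^esub> h0 v" if "u \<in> frags" "v \<in> frags" for u v
    using h0a[of u "- v"] that by (simp add: h0m C.minus_eq)
  have h0N: "h0 u = \<zero>\<^bsub>C\<^esub>" if "u \<in> tensor_null A B" for u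
    using that
  proof (induction rule: null_induct)
    case (relation u)
    then show ?case
    proof (rule relation_cases)
      fix a a' b assume "a \<in> carrier A" "a' \<in> carrier A" "b \<in> carrier B"
      then show "h0 (frag_of (a \<oplus>\<^bsub>A\<^esub> a', b) - frag_of (a, b) - frag_of (a', b)) = \<zero>\<^bsub>C\<^esub>"
        by (simp add: h0d h0(2) additive_add[OF l] bc C.add_diff_left)
    next
      fix a b b' assume "a \<in> carrier A" "b \<in> carrier B" "b' \<in> carrier B"
      then show "h0 (frag_of (a, b \<oplus>\<^bsub>B\<^esub> b') - frag_of (a, b) - frag_of (a, b')) = \<zero>\<^bsub>C\<^esub>"
        by (simp add: h0d h0(2) additive_add[OF r] bc C.add_diff_left)
    next
      fix a r b assume "a \<in> carrier A" "b \<in> carrier B"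
      then show "h0 (frag_of (rsmult A a r, b) - frag_of (a, r \<odot>\<^bsub>B\<^esub> b)) = \<zero>\<^bsub>C\<^esub>"
        by (simp add: h0d h0(2) bal bimod_closed[OF bimod_A] bc)
    qed
  qed (simp_all add: h00 h0a h0m)
  define h where "h x = h0 (SOME u. u \<in> frags \<and> x = tensor_class A B u)" for x
  have h: "h (tensor_class A B u) = h0 u" if u: "u \<in> frags" for u
  proof -
    define v where "v = (SOME v. v \<in> frags \<and> tensor_class A B u = tensor_class A B v)"
    have v: "v \<in> frags \<and> tensor_class A B u = tensor_class A B v"
      unfolding v_def by (rule someI[of _ u]) (use u in simp)
    then have "u - v \<in> tensor_null A B" using u class_eq_iff by blast
    then have "h0 u \<ominus>\<^bsub>C\<^esub> h0 v = \<zero>\<^bsub>C\<^esub>" using h0N[of "u - v"] h0d[of u v] u v by simp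
    then have "h0 u = h0 v" using C.diff_eq_zero_iff[of "h0 u" "h0 v"] h0c u v by simp
    then show ?thesis by (simp add: h_def v_def)
  qed
  have "additive (tensor A B) C h"
    by (rule additiveI) (auto simp: carrier_tensor h h0c class_add h0a)
  then show ?thesis using h h0(2) by auto
qed

text \<open>Sums of pure tensors with left entry in \<open>S\<close>. For \<open>S\<close> a step of
  the filtration of \<open>A\<close> they contain the same step of the tensor product, since scalars
  act on the left entry; filtration conditions can therefore be tested on left entries.\<close>

inductive_set pure_span :: "'a set \<Rightarrow> ('a, 'b) tens set" for S where
  span_pure: "a \<in> S \<Longrightarrow> b \<in> carrier B \<Longrightarrow> pure A B a b \<in> pure_span S"
| span_add: "x \<in> pure_span S \<Longrightarrow> y \<in> pure_span S \<Longrightarrow> x \<oplus>\<^bsub>tensor A B\<^esub> y \<in> pure_span S"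

lemma pure_span_closed: "x \<in> pure_span S \<Longrightarrow> S \<subseteq> carrier A \<Longrightarrow> x \<in> carrier (tensor A B)"
  by (induction rule: pure_span.induct) (auto intro: pure_closed tensor_add_closed)

lemma pure_span_smult:
  assumes "x \<in> pure_span S" "S \<subseteq> carrier A" "\<And>a. a \<in> S \<Longrightarrow> r \<odot>\<^bsub>A\<^esub> a \<in> S'"
  shows "r \<odot>\<^bsub>tensor A B\<^esub> x \<in> pure_span S'"
  using assms(1)
proof (induction rule: pure_span.induct)
  case (span_pure a b)
  then show ?case using pure_span.span_pure[OF assms(3), of a b] assms(2)
    by (simp add: pure_smult subset_iff)
next
  case (span_add x y)
  then show ?case
    using tensor_smult_add[of x y r] pure_span_closed[OF _ assms(2)] pure_span.span_add by metis
qed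

lemma adic_tensor_span: "adic p (tensor A B) n \<subseteq> pure_span (adic p A n)"
proof (induction n)
  case 0
  have "x \<in> pure_span (carrier A)" if "x \<in> carrier (tensor A B)" for x
    using that by (induction rule: tensor_induct) (auto intro: pure_span.intros)
  then show ?case by auto
next
  case (Suc n)
  interpret T: rmodule "tensor A B" by (rule rmodule.intro, rule tensor_rmod)
  show ?case
  proof
    fix x assume "x \<in> adic p (tensor A B) (Suc n)"
    then obtain y z where yz: "y \<in> adic p (tensor A B) n" "z \<in> adic p (tensor A B) n"
      "x = of_nat p \<odot>\<^bsub>tensor A B\<^esub> y \<oplus>\<^bsub>tensor A B\<^esub> fps_X \<odot>\<^bsub>tensor A B\<^esub> z"
      by (rule T.adic_SucE)
    then have "y \<in> pure_span (adic p A n)" "z \<in> pure_span (adic p A n)" using Suc by auto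
    then have "of_nat p \<odot>\<^bsub>tensor A B\<^esub> y \<in> pure_span (adic p A (Suc n))"
      "fps_X \<odot>\<^bsub>tensor A B\<^esub> z \<in> pure_span (adic p A (Suc n))"
      using pure_span_smult[OF _ A.adic_subset] A.adic_p A.adic_X by blast+
    then show "x \<in> pure_span (adic p A (Suc n))"
      unfolding yz(3) by (rule pure_span.span_add)
  qed
qed

lemma fmap_tensor_lift:
  assumes C: "rmod C" and h: "additive (tensor A B) C h"
    and ad: "\<And>a b n. a \<in> adic p A n \<Longrightarrow> b \<in> carrier B \<Longrightarrow> h (pure A B a b) \<in> adic p C n"
  shows "fmap p (tensor A B) C h"
proof -
  interpret C: rmodule C by (rule rmodule.intro, rule C)
  have "h x \<in> adic p C n" if "x \<in> pure_span (adic p A n)" for x n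
    using that
  proof (induction rule: pure_span.induct)
    case (span_add x y)
    then have "x \<in> carrier (tensor A B)" "y \<in> carrier (tensor A B)"
      using pure_span_closed[OF _ A.adic_subset] by auto
    then show ?case using span_add C.adic_add by (simp add: additive_add[OF h])
  qed (rule ad)
  then show ?thesis unfolding fmap_def using h subsetD[OF adic_tensor_span] by blast
qed

lemma pure_additive_l: "b \<in> carrier B \<Longrightarrow> additive A (tensor A B) (\<lambda>a. pure A B a b)"
  by (rule additiveI) (simp_all add: pure_closed pure_add_l)

lemma pure_additive_r: "a \<in> carrier A \<Longrightarrow> additive B (tensor A B) (\<lambda>b. pure A B a b)"
  by (rule additiveI) (simp_all add: pure_closed pure_add_r)

lemma pure_fmap: "b \<in> carrier B \<Longrightarrow> fmap p A (tensor A B) (\<lambda>a. pure A B a b)"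
  by (rule fmap_linear) (simp_all add: pure_additive_l pure_smult A.module tensor_rmod)

end

section \<open>Multiplication on tensor products and completions\<close>

text \<open>Bilinearity of the product alone, which passes to tensor products and completions.
  Associativity, commutativity and the unit are kept in \<open>cring\<close>, proved for the algebra
  itself.\<close>

definition ralg :: "('w::comm_ring_1 fps, 'a, 'z) module_scheme \<Rightarrow> bool" where
  "ralg A \<longleftrightarrow> rmod A \<and> (\<forall>x\<in>carrier A. additive A A (\<lambda>y. x \<otimes>\<^bsub>A\<^esub> y)) \<and>
    (\<forall>y\<in>carrier A. additive A A (\<lambda>x. x \<otimes>\<^bsub>A\<^esub> y)) \<and>
    (\<forall>x\<in>carrier A. \<forall>y\<in>carrier A. \<forall>r. (r \<odot>\<^bsub>A\<^esub> x) \<otimes>\<^bsub>A\<^esub> y = r \<odot>\<^bsub>A\<^esub> (x \<otimes>\<^bsub>A\<^esub> y) \<and>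
      x \<otimes>\<^bsub>A\<^esub> (r \<odot>\<^bsub>A\<^esub> y) = r \<odot>\<^bsub>A\<^esub> (x \<otimes>\<^bsub>A\<^esub> y))"

lemma ralg_rmod: "ralg A \<Longrightarrow> rmod A" by (simp add: ralg_def)
lemma ralg_additive_l: "ralg A \<Longrightarrow> y \<in> carrier A \<Longrightarrow> additive A A (\<lambda>x. x \<otimes>\<^bsub>A\<^esub> y)" by (simp add: ralg_def)
lemma ralg_additive_r: "ralg A \<Longrightarrow> x \<in> carrier A \<Longrightarrow> additive A A (\<lambda>y. x \<otimes>\<^bsub>A\<^esub> y)" by (simp add: ralg_def)
lemma ralg_closed: "ralg A \<Longrightarrow> x \<in> carrier A \<Longrightarrow> y \<in> carrier A \<Longrightarrow> x \<otimes>\<^bsub>A\<^esub> y \<in> carrier A"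
  by (rule additive_closed[OF ralg_additive_l])
lemma ralg_smult:
  assumes "ralg A" "x \<in> carrier A" "y \<in> carrier A"
  shows "(r \<odot>\<^bsub>A\<^esub> x) \<otimes>\<^bsub>A\<^esub> y = r \<odot>\<^bsub>A\<^esub> (x \<otimes>\<^bsub>A\<^esub> y)" "x \<otimes>\<^bsub>A\<^esub> (r \<odot>\<^bsub>A\<^esub> y) = r \<odot>\<^bsub>A\<^esub> (x \<otimes>\<^bsub>A\<^esub> y)"
  using assms by (simp_all add: ralg_def)
lemma ralg_fmap_l: "ralg A \<Longrightarrow> y \<in> carrier A \<Longrightarrow> fmap p A A (\<lambda>x. x \<otimes>\<^bsub>A\<^esub> y)"
  by (rule fmap_linear) (simp_all add: ralg_additive_l ralg_smult ralg_rmod)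
lemma ralg_fmap_r: "ralg A \<Longrightarrow> x \<in> carrier A \<Longrightarrow> fmap p A A (\<lambda>y. x \<otimes>\<^bsub>A\<^esub> y)"
  by (rule fmap_linear) (simp_all add: ralg_additive_r ralg_smult ralg_rmod)

definition balg :: "('w::comm_ring_1 fps, 'a) bimodule \<Rightarrow> bool" where
  "balg A \<longleftrightarrow> bimod A \<and> ralg A \<and> (\<forall>x\<in>carrier A. \<forall>y\<in>carrier A. \<forall>r.
     rsmult A x r \<otimes>\<^bsub>A\<^esub> y = rsmult A (x \<otimes>\<^bsub>A\<^esub> y) r \<and>
     x \<otimes>\<^bsub>A\<^esub> rsmult A y r = rsmult A (x \<otimes>\<^bsub>A\<^esub> y) r)"

locale two_balgs = two_bimods A B
  for A :: "('w::comm_ring_1 fps, 'a) bimodule" and B :: "('w fps, 'b) bimodule" +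
  assumes balg_A: "balg A" and balg_B: "balg B"
begin

lemma ralgs: "ralg A" "ralg B"
  using balg_A balg_B by (simp_all add: balg_def)

lemma mults_closed [simp]:
  "\<lbrakk>a \<in> carrier A; c \<in> carrier A\<rbrakk> \<Longrightarrow> a \<otimes>\<^bsub>A\<^esub> c \<in> carrier A"
  "\<lbrakk>b \<in> carrier B; d \<in> carrier B\<rbrakk> \<Longrightarrow> b \<otimes>\<^bsub>B\<^esub> d \<in> carrier B"
  by (simp_all add: ralg_closed ralgs)

definition fmult :: "(('a \<times> 'b) \<Rightarrow>\<^sub>0 int) \<Rightarrow> (('a \<times> 'b) \<Rightarrow>\<^sub>0 int) \<Rightarrow> (('a \<times> 'b) \<Rightarrow>\<^sub>0 int)" where
  "fmult u v = frag_extend (\<lambda>(a, b). frag_extend (\<lambda>(c, d). frag_of (a \<otimes>\<^bsub>A\<^esub> c, b \<otimes>\<^bsub>B\<^esub> d)) v) u"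

lemma fmult_add_l: "fmult (u + u') v = fmult u v + fmult u' v"
  by (simp add: fmult_def frag_extend_add)

lemma fmult_diff_l: "fmult (u - u') v = fmult u v - fmult u' v"
  by (simp add: fmult_def frag_extend_diff)

lemma fmult_add_r: "fmult u (v + v') = fmult u v + fmult u v'"
proof -
  have "fmult u (v + v') = frag_extend (\<lambda>x.
      (case x of (a, b) \<Rightarrow> frag_extend (\<lambda>(c, d). frag_of (a \<otimes>\<^bsub>A\<^esub> c, b \<otimes>\<^bsub>B\<^esub> d)) v) +
      (case x of (a, b) \<Rightarrow> frag_extend (\<lambda>(c, d). frag_of (a \<otimes>\<^bsub>A\<^esub> c, b \<otimes>\<^bsub>B\<^esub> d)) v')) u"
    unfolding fmult_def by (rule frag_extend_eq) (auto simp: frag_extend_add)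
  also have "\<dots> = fmult u v + fmult u v'"
    by (simp add: fmult_def frag_extend_def frag_cmul_distrib2 sum.distrib)
  finally show ?thesis .
qed

lemma fmult_diff_r: "fmult u (v - v') = fmult u v - fmult u v'"
  using fmult_add_r[of u "v - v'" v'] by simp

lemma fmult_0 [simp]: "fmult 0 v = 0" "fmult u 0 = 0"
  using fmult_diff_l[of 0 0 v] fmult_diff_r[of u 0 0] by simp_all

lemma fmult_frags: "u \<in> frags \<Longrightarrow> v \<in> frags \<Longrightarrow> fmult u v \<in> frags"
proof (induction rule: frags_induct)
  case (of a b)
  from of(3) show ?case
    by (induction rule: frags_induct) (use of in \<open>simp_all add: fmult_diff_r fmult_def[of "frag_of _" "frag_of _"]\<close>)
qed (simp_all add: fmult_diff_l)

text \<open>The relations generate an ideal. For the balancing relation this uses both factors: in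
  \<open>A\<close> the right action is compatible with the product, and in \<open>B\<close> the
  product is linear over left scalars.\<close>

lemma fmult_null_l:
  assumes "u \<in> tensor_null A B" "v \<in> frags" shows "fmult u v \<in> tensor_null A B"
  using assms(2)
proof (induction rule: frags_induct)
  case (of c d)
  have eq: "fmult u (frag_of (c, d)) = frag_extend (\<lambda>(a, b). frag_of (a \<otimes>\<^bsub>A\<^esub> c, b \<otimes>\<^bsub>B\<^esub> d)) u" for u
    by (simp add: fmult_def)
  show ?case unfolding eq
  proof (rule descend(2)[OF _ _ assms(1)])
    fix u assume "u \<in> tensor_relations A B"
    then show "frag_extend (\<lambda>(a, b). frag_of (a \<otimes>\<^bsub>A\<^esub> c, b \<otimes>\<^bsub>B\<^esub> d)) u \<in> tensor_null A B"
      by (rule relation_cases)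
        (use of balg_A in \<open>simp_all add: frag_extend_diff relation_null ralg_smult[OF ralgs(2)]
           additive_add[OF ralg_additive_l[OF ralgs(1)]] additive_add[OF ralg_additive_l[OF ralgs(2)]] balg_def\<close>)
  qed (use of in simp)
qed (simp_all add: fmult_diff_r null_diff)

lemma fmult_null_r:
  assumes "v \<in> tensor_null A B" "u \<in> frags" shows "fmult u v \<in> tensor_null A B"
  using assms(2)
proof (induction rule: frags_induct)
  case (of a b)
  have eq: "fmult (frag_of (a, b)) u = frag_extend (\<lambda>(c, d). frag_of (a \<otimes>\<^bsub>A\<^esub> c, b \<otimes>\<^bsub>B\<^esub> d)) u" for u
    by (simp add: fmult_def)
  show ?case unfolding eq
  proof (rule descend(2)[OF _ _ assms(1)])
    fix u assume "u \<in> tensor_relations A B"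
    then show "frag_extend (\<lambda>(c, d). frag_of (a \<otimes>\<^bsub>A\<^esub> c, b \<otimes>\<^bsub>B\<^esub> d)) u \<in> tensor_null A B"
      by (rule relation_cases)
        (use of balg_A in \<open>simp_all add: frag_extend_diff relation_null ralg_smult[OF ralgs(2)]
           additive_add[OF ralg_additive_r[OF ralgs(1)]] additive_add[OF ralg_additive_r[OF ralgs(2)]] balg_def\<close>)
  qed (use of in simp)
qed (simp_all add: fmult_diff_l null_diff)

lemma class_mult:
  assumes u: "u \<in> frags" and v: "v \<in> frags"
  shows "tensor_class A B u \<otimes>\<^bsub>tensor A B\<^esub> tensor_class A B v = tensor_class A B (fmult u v)"
proof -
  have "(\<Union>u\<in>tensor_class A B u. \<Union>v\<in>tensor_class A B v. tensor_class A B (fmult u v)) =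
      tensor_class A B (fmult u v)"
  proof (rule class_UN[OF u], rule class_UN[OF v])
    fix u' v' assume uv: "u' \<in> frags" "u' - u \<in> tensor_null A B" "v' \<in> frags" "v' - v \<in> tensor_null A B"
    have "fmult u' v' - fmult u v = fmult (u' - u) v' + fmult u (v' - v)"
      by (simp add: fmult_diff_l fmult_diff_r)
    also have "\<dots> \<in> tensor_null A B"
      using uv u by (intro null_add fmult_null_l fmult_null_r)
    finally show "tensor_class A B (fmult u' v') = tensor_class A B (fmult u v)"
      using uv u v by (simp add: class_eq_iff fmult_frags)
  qed
  then show ?thesis by (simp add: tensor_def fmult_def)
qed

lemma pure_mult: "\<lbrakk>a \<in> carrier A; b \<in> carrier B; c \<in> carrier A; d \<in> carrier B\<rbrakk> \<Longrightarrow>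
    pure A B a b \<otimes>\<^bsub>tensor A B\<^esub> pure A B c d = pure A B (a \<otimes>\<^bsub>A\<^esub> c) (b \<otimes>\<^bsub>B\<^esub> d)"
  by (simp add: class_mult fmult_def)

lemma tensor_mult_additive_l: "y \<in> carrier (tensor A B) \<Longrightarrow>
    additive (tensor A B) (tensor A B) (\<lambda>x. x \<otimes>\<^bsub>tensor A B\<^esub> y)"
  by (rule additiveI)
    (auto simp: carrier_tensor class_mult class_add fmult_add_l fmult_frags)

lemma tensor_mult_additive_r: "x \<in> carrier (tensor A B) \<Longrightarrow>
    additive (tensor A B) (tensor A B) (\<lambda>y. x \<otimes>\<^bsub>tensor A B\<^esub> y)"
  by (rule additiveI)
    (auto simp: carrier_tensor class_mult class_add fmult_add_r fmult_frags)

lemma tensor_ralg: "ralg (tensor A B)"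
  unfolding ralg_def
proof (intro conjI ballI allI)
  note cl = smult_additive tensor_mult_additive_l tensor_mult_additive_r
  fix x y r assume x: "x \<in> carrier (tensor A B)" and y: "y \<in> carrier (tensor A B)"
  have 1: "(r \<odot>\<^bsub>tensor A B\<^esub> pure A B a b) \<otimes>\<^bsub>tensor A B\<^esub> y = r \<odot>\<^bsub>tensor A B\<^esub> (pure A B a b \<otimes>\<^bsub>tensor A B\<^esub> y)"
    if ab: "a \<in> carrier A" "b \<in> carrier B" for a b
    by (rule tensor_ext[OF tensor_mult_additive_r additive_comp[OF tensor_mult_additive_r smult_additive] _ y])
      (use ab in \<open>simp_all add: pure_smult pure_mult ralg_smult[OF ralgs(1)] pure_closed\<close>)
  show "(r \<odot>\<^bsub>tensor A B\<^esub> x) \<otimes>\<^bsub>tensor A B\<^esub> y = r \<odot>\<^bsub>tensor A B\<^esub> (x \<otimes>\<^bsub>tensor A B\<^esub> y)"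
    by (rule tensor_ext[OF additive_comp[OF smult_additive tensor_mult_additive_l[OF y]]
          additive_comp[OF tensor_mult_additive_l[OF y] smult_additive] 1 x])
  have 2: "pure A B a b \<otimes>\<^bsub>tensor A B\<^esub> (r \<odot>\<^bsub>tensor A B\<^esub> y) = r \<odot>\<^bsub>tensor A B\<^esub> (pure A B a b \<otimes>\<^bsub>tensor A B\<^esub> y)"
    if ab: "a \<in> carrier A" "b \<in> carrier B" for a b
    by (rule tensor_ext[OF additive_comp[OF smult_additive tensor_mult_additive_r]
          additive_comp[OF tensor_mult_additive_r smult_additive] _ y])
      (use ab in \<open>simp_all add: pure_smult pure_mult ralg_smult[OF ralgs(1)] pure_closed\<close>)
  show "x \<otimes>\<^bsub>tensor A B\<^esub> (r \<odot>\<^bsub>tensor A B\<^esub> y) = r \<odot>\<^bsub>tensor A B\<^esub> (x \<otimes>\<^bsub>tensor A B\<^esub> y)"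
    by (rule tensor_ext[OF tensor_mult_additive_l
          additive_comp[OF tensor_mult_additive_l[OF y] smult_additive] 2 x])
      (rule tensor_smult_closed[OF y])
qed (auto intro: tensor_rmod tensor_mult_additive_l tensor_mult_additive_r)

end

section \<open>Completed tensor products\<close>

lemma a_minus_cong:
  fixes A :: "('w::comm_ring_1 fps, 'a, 'y) module_scheme" and B :: "('w fps, 'a, 'z) module_scheme"
  assumes "carrier A = carrier B" "add A = add B" "\<zero>\<^bsub>A\<^esub> = \<zero>\<^bsub>B\<^esub>"
  shows "x \<ominus>\<^bsub>A\<^esub> y = x \<ominus>\<^bsub>B\<^esub> y"
  using assms by (simp add: a_minus_def a_inv_def m_inv_def)

lemma rmod_cong:
  fixes A :: "('w::comm_ring_1 fps, 'a, 'y) module_scheme" and B :: "('w fps, 'a, 'z) module_scheme"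
  assumes eq: "carrier A = carrier B" "add A = add B" "\<zero>\<^bsub>A\<^esub> = \<zero>\<^bsub>B\<^esub>" "module.smult A = module.smult B"
    and A: "rmod A"
  shows "rmod B"
proof -
  interpret A: rmodule A by (rule rmodule.intro, rule A)
  show ?thesis
    by (rule rmodI)
      (simp_all add: eq[symmetric] A.a_ac A.smult_add_l A.smult_add_r A.smult_smult)
qed

lemma complete_cong:
  fixes A :: "('w::comm_ring_1 fps, 'a, 'y) module_scheme" and B :: "('w fps, 'a, 'z) module_scheme"
  assumes eq: "carrier A = carrier B" "add A = add B" "\<zero>\<^bsub>A\<^esub> = \<zero>\<^bsub>B\<^esub>" "module.smult A = module.smult B"
    and A: "complete p A"
  shows "complete p B"
  using A rmod_cong[OF eq]
  unfolding complete_def separated_def cauchy_def a_minus_cong[OF eq(1-3)]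
    adic_cong[OF eq(1,2,4)] eq by blast

text \<open>The topology is defined by left scalars; this condition controls the right action of q -
  1, while \<open>p\<close> crosses a tensor sign by additivity. For \<open>P\<close> below it says
  that \<theta>(q - 1) lies in (p, q - 1).\<close>

definition tbimod :: "nat \<Rightarrow> ('w::comm_ring_1 fps, 'a) bimodule \<Rightarrow> bool" where
  "tbimod p A \<longleftrightarrow> bimod A \<and> (\<forall>n. \<forall>x\<in>adic p A n. rsmult A x fps_X \<in> adic p A (Suc n))"

lemma tbimod_bimod: "tbimod p A \<Longrightarrow> bimod A"
  by (simp add: tbimod_def)

lemma tbimod_rmod: "tbimod p A \<Longrightarrow> rmod A"
  by (rule bimod_rmod[OF tbimod_bimod])

lemma tbimod_X: "tbimod p A \<Longrightarrow> x \<in> adic p A n \<Longrightarrow> rsmult A x fps_X \<in> adic p A (Suc n)"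
  by (simp add: tbimod_def)

lemma bimodule_completion_simps [simp]:
  "carrier (bimodule_completion p A) = carrier (completion p A)"
  "add (bimodule_completion p A) = add (completion p A)"
  "ring.zero (bimodule_completion p A) = ring.zero (completion p A)"
  "monoid.mult (bimodule_completion p A) = monoid.mult (completion p A)"
  "monoid.one (bimodule_completion p A) = monoid.one (completion p A)"
  "module.smult (bimodule_completion p A) = module.smult (completion p A)"
  "rsmult (bimodule_completion p A) = (\<lambda>x r n. \<Union>a\<in>x n. adic p A n +>\<^bsub>A\<^esub> rsmult A a r)"
  by (simp_all add: bimodule_completion_def module.defs bimodule.defs)

lemma adic_bimodule_completion [simp]: "adic p (bimodule_completion p A) n = adic p (completion p A) n"
  by (rule adic_cong) simp_all

lemma complete_bimodule_completion: "rmod A \<Longrightarrow> complete p (bimodule_completion p A)"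
  by (rule complete_cong[OF _ _ _ _ rmodule.complete_completion[OF rmodule.intro]]) simp_all

lemma fmap_bimodule_completion:
  "fmap p (bimodule_completion p A) C f \<longleftrightarrow> fmap p (completion p A) C f"
  "fmap p D (bimodule_completion p A) g \<longleftrightarrow> fmap p D (completion p A) g"
  "contin p (bimodule_completion p A) E h \<longleftrightarrow> contin p (completion p A) E h"
  by (simp_all add: fmap_def additive_def contin_def)

lemma clim_rsmult:
  assumes A: "bimod A" and f: "cauchy p A f"
  shows "rsmult (bimodule_completion p A) (clim p A f) r = clim p A (\<lambda>n. rsmult A (f n) r)"
proof -
  interpret A: rmodule A by (rule rmodule.intro, rule bimod_rmod[OF A])
  have "(\<Union>a\<in>adic p A n +>\<^bsub>A\<^esub> f n. adic p A n +>\<^bsub>A\<^esub> rsmult A a r) = adic p A n +>\<^bsub>A\<^esub> rsmult A (f n) r" for n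
  proof (rule A.coset_UN[OF cauchyD(1)[OF f]])
    fix y assume y: "y \<in> carrier A" "y \<ominus>\<^bsub>A\<^esub> f n \<in> adic p A n"
    have "rsmult A y r \<ominus>\<^bsub>A\<^esub> rsmult A (f n) r \<in> adic p A n"
      using fmap_adic[OF bimod_fmap[OF A] y(2)]
        additive_diff[OF bimod_additive[OF A] A.module A.module y(1) cauchyD(1)[OF f]] by simp
    then show "adic p A n +>\<^bsub>A\<^esub> rsmult A y r = adic p A n +>\<^bsub>A\<^esub> rsmult A (f n) r"
      using y cauchyD(1)[OF f] by (simp add: A.coset_eq_iff bimod_closed[OF A])
  qed
  then show ?thesis by (simp add: clim_def)
qed

lemma cauchy_rsmult: "bimod A \<Longrightarrow> cauchy p A f \<Longrightarrow> cauchy p A (\<lambda>n. rsmult A (f n) r)"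
  by (rule rmodule.cauchy_fmap[OF rmodule.intro bimod_fmap]) (simp_all add: bimod_rmod)

lemma bimod_bimodule_completion:
  assumes A: "bimod A" shows "bimod (bimodule_completion p A)"
proof -
  interpret A: rmodule A by (rule rmodule.intro, rule bimod_rmod[OF A])
  let ?C = "bimodule_completion p A"
  note [simp] = clim_rsmult[OF A] cauchy_rsmult[OF A] A.clim_closed A.clim_add A.cauchy_add
    A.cauchy_smult A.clim_smult
  show ?thesis
    unfolding bimod_def
  proof (intro conjI allI ballI additiveI)
    show "rmod ?C" by (rule complete_rmod[OF complete_bimodule_completion[OF A.module]])
    fix x r assume "x \<in> carrier ?C"
    then obtain f where f: "cauchy p A f" "x = clim p A f" using A.completion_cases by auto
    then show "rsmult ?C x r \<in> carrier ?C"
      by (simp del: bimodule_completion_simps(7))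
    show "rsmult ?C (s \<odot>\<^bsub>?C\<^esub> x) r = s \<odot>\<^bsub>?C\<^esub> rsmult ?C x r" for s
      using f by (simp del: bimodule_completion_simps(7) add: bimod_smult[OF A] cauchyD)
    fix y assume "y \<in> carrier ?C"
    then obtain g where g: "cauchy p A g" "y = clim p A g" using A.completion_cases by auto
    show "rsmult ?C (x \<oplus>\<^bsub>?C\<^esub> y) r = rsmult ?C x r \<oplus>\<^bsub>?C\<^esub> rsmult ?C y r"
      using f g by (simp del: bimodule_completion_simps(7) add: additive_add[OF bimod_additive[OF A]] cauchyD)
  qed
qed

lemma rsmult_to_completion:
  assumes A: "bimod A" and a: "a \<in> carrier A"
  shows "rsmult (bimodule_completion p A) (to_completion p A a) r = to_completion p A (rsmult A a r)"
  unfolding to_completion_eq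
  by (rule clim_rsmult[OF A]) (rule rmodule.cauchy_const[OF rmodule.intro[OF bimod_rmod[OF A]] a])

lemma tbimod_bimodule_completion:
  assumes A: "tbimod p A" shows "tbimod p (bimodule_completion p A)"
  unfolding tbimod_def
proof (intro conjI allI ballI)
  interpret A: rmodule A by (rule rmodule.intro, rule tbimod_rmod[OF A])
  note bA = tbimod_bimod[OF A]
  show "bimod (bimodule_completion p A)" by (rule bimod_bimodule_completion[OF bA])
  fix n x assume "x \<in> adic p (bimodule_completion p A) n"
  then obtain f where f: "cauchy p A f" "x = clim p A f" "f n \<in> adic p A n"
    using A.adic_completion_imp[of x p n] by auto
  have "f (Suc n) \<in> adic p A n"
    by (rule A.adic_of_diff[OF cauchyD(1)[OF f(1)] cauchyD(2)[OF f(1)] f(3)])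
  then have "rsmult A (f (Suc n)) fps_X \<in> adic p A (Suc n)" by (rule tbimod_X[OF A])
  then show "rsmult (bimodule_completion p A) x fps_X \<in> adic p (bimodule_completion p A) (Suc n)"
    unfolding f(2) clim_rsmult[OF bA f(1)]
    by (simp add: A.adic_completion_iff cauchy_rsmult[OF bA f(1)])
qed

text \<open>The filtration is tested in the left variable, in accordance with
  \<open>adic_tensor_span\<close>: step n of a tensor product is spanned by pure tensors with left
  entry in step n.\<close>

definition balanced :: "nat \<Rightarrow> ('w::comm_ring_1 fps, 'a) bimodule \<Rightarrow> ('w fps, 'b) bimodule \<Rightarrow>
    ('w fps, 'c, 'z) module_scheme \<Rightarrow> ('a \<Rightarrow> 'b \<Rightarrow> 'c) \<Rightarrow> bool" where
  "balanced p A B C \<beta> \<longleftrightarrow> (\<forall>b\<in>carrier B. fmap p A C (\<lambda>a. \<beta> a b)) \<and>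
    (\<forall>a\<in>carrier A. additive B C (\<beta> a)) \<and>
    (\<forall>a\<in>carrier A. \<forall>b\<in>carrier B. \<forall>r. \<beta> (rsmult A a r) b = \<beta> a (r \<odot>\<^bsub>B\<^esub> b))"

lemma balancedI:
  assumes "\<And>b. b \<in> carrier B \<Longrightarrow> fmap p A C (\<lambda>a. \<beta> a b)"
    "\<And>a. a \<in> carrier A \<Longrightarrow> additive B C (\<beta> a)"
    "\<And>a b r. a \<in> carrier A \<Longrightarrow> b \<in> carrier B \<Longrightarrow> \<beta> (rsmult A a r) b = \<beta> a (r \<odot>\<^bsub>B\<^esub> b)"
  shows "balanced p A B C \<beta>"
  using assms by (simp add: balanced_def)

lemma continuous_maps_iff:
  "h \<in> continuous_maps p A B \<longleftrightarrow> contin p A B h \<and> h \<in> extensional (carrier A)"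
  unfolding continuous_maps_def contin_def additive_def by (auto simp: PiE_def)

section \<open>The universal property of the completed tensor product\<close>

locale ct =
  fixes p :: nat and A :: "('w::comm_ring_1 fps, 'a) bimodule" and B :: "('w fps, 'b) bimodule"
  assumes tA: "tbimod p A" and tB: "tbimod p B"

sublocale ct \<subseteq> two_bimods A B
  by (rule two_bimods.intro) (use tA tB tbimod_bimod in auto)

context ct
begin

sublocale T: rmodule "tensor A B" by (rule rmodule.intro, rule tensor_rmod)

lemma complete: "complete p (ctensor p A B)"
  unfolding ctensor_def by (rule complete_bimodule_completion[OF tensor_rmod])

lemma separated: "separated p (ctensor p A B)"
  by (rule complete_separated[OF complete])

lemma rmod: "rmod (ctensor p A B)"
  by (rule complete_rmod[OF complete])

sublocale C: rmodule "ctensor p A B" by (rule rmodule.intro, rule rmod)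

text \<open>The step of the right entry is moved across the tensor sign: \<open>p\<close> by
  additivity, q - 1 by balancing, after which \<open>tbimod\<close> raises the step of the left
  entry.\<close>

lemma pure_adic: "a \<in> adic p A m \<Longrightarrow> b \<in> adic p B n \<Longrightarrow> pure A B a b \<in> adic p (tensor A B) (m + n)"
proof (induction n arbitrary: m a b)
  case 0
  then show ?case using fmap_adic[OF pure_fmap] by simp
next
  case (Suc n)
  obtain c d where cd: "c \<in> adic p B n" "d \<in> adic p B n"
    "b = of_nat p \<odot>\<^bsub>B\<^esub> c \<oplus>\<^bsub>B\<^esub> fps_X \<odot>\<^bsub>B\<^esub> d" "c \<in> carrier B" "d \<in> carrier B"
    using Suc.prems(2) by (rule B.adic_SucE)
  have a: "a \<in> carrier A" using Suc.prems(1) by (rule A.adic_closed)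
  have "pure A B a b = of_nat p \<odot>\<^bsub>tensor A B\<^esub> pure A B a c \<oplus>\<^bsub>tensor A B\<^esub> pure A B (rsmult A a fps_X) d"
    using cd a additive_of_nat[OF pure_additive_r[OF a] B.module T.module, of c p]
    by (simp add: pure_add_r pure_balanced)
  moreover have "of_nat p \<odot>\<^bsub>tensor A B\<^esub> pure A B a c \<in> adic p (tensor A B) (Suc (m + n))"
    using T.adic_p[OF Suc.IH[OF Suc.prems(1) cd(1)]] .
  moreover have "pure A B (rsmult A a fps_X) d \<in> adic p (tensor A B) (Suc (m + n))"
    using Suc.IH[OF tbimod_X[OF tA Suc.prems(1)] cd(2)] by simp
  ultimately show ?case using T.adic_add by simp
qed

lemma tbimod_tensor: "tbimod p (tensor A B)"
  unfolding tbimod_def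
proof (intro conjI allI ballI)
  fix n x assume "x \<in> adic p (tensor A B) n"
  then have "x \<in> pure_span (adic p A n)" using adic_tensor_span by blast
  then show "rsmult (tensor A B) x fps_X \<in> adic p (tensor A B) (Suc n)"
  proof (induction rule: pure_span.induct)
    case (span_pure a b)
    have "rsmult B b fps_X \<in> adic p B 1" using tbimod_X[OF tB, of b 0] span_pure(2) by simp
    from pure_adic[OF span_pure(1) this] show ?case
      using span_pure A.adic_closed by (simp add: pure_rsmult)
  next
    case (span_add x y)
    have "x \<in> carrier (tensor A B)" "y \<in> carrier (tensor A B)"
      using pure_span_closed[OF _ A.adic_subset] span_add(1,2) by auto
    then show ?case
      using T.adic_add[OF span_add(3,4)] by (simp add: additive_add[OF rsmult_additive])
  qed
qed (rule tensor_bimod)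

lemma tbimod: "tbimod p (ctensor p A B)"
  unfolding ctensor_def by (rule tbimod_bimodule_completion[OF tbimod_tensor])

lemma cpure_closed [simp]: "a \<in> carrier A \<Longrightarrow> b \<in> carrier B \<Longrightarrow> cpure p A B a b \<in> carrier (ctensor p A B)"
  by (simp add: cpure_def ctensor_def T.to_completion_closed pure_closed)

lemma cpure_fmap_l: "b \<in> carrier B \<Longrightarrow> fmap p A (ctensor p A B) (\<lambda>a. cpure p A B a b)"
  unfolding cpure_def ctensor_def fmap_bimodule_completion
  by (rule fmap_comp[OF pure_fmap T.to_completion_fmap])

lemma cpure_fmap_r: "a \<in> carrier A \<Longrightarrow> fmap p B (ctensor p A B) (\<lambda>b. cpure p A B a b)"
proof -
  assume a: "a \<in> carrier A"
  have "fmap p B (tensor A B) (\<lambda>b. pure A B a b)"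
    using pure_additive_r[OF a] pure_adic[of a 0] a by (auto simp: fmap_def)
  then show ?thesis
    unfolding cpure_def ctensor_def fmap_bimodule_completion
    by (rule fmap_comp[OF _ T.to_completion_fmap])
qed

lemmas cpure_additive_l = fmap_additive[OF cpure_fmap_l]
lemmas cpure_additive_r = fmap_additive[OF cpure_fmap_r]

lemma cpure_balanced: "a \<in> carrier A \<Longrightarrow> b \<in> carrier B \<Longrightarrow>
    cpure p A B (rsmult A a r) b = cpure p A B a (r \<odot>\<^bsub>B\<^esub> b)"
  by (simp add: cpure_def pure_balanced)

lemma cpure_smult: "a \<in> carrier A \<Longrightarrow> b \<in> carrier B \<Longrightarrow>
    cpure p A B (r \<odot>\<^bsub>A\<^esub> a) b = r \<odot>\<^bsub>ctensor p A B\<^esub> cpure p A B a b"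
  using T.to_completion_smult[of "pure A B a b" p r] pure_smult[of a b r]
  by (simp add: cpure_def ctensor_def pure_closed)

lemma cpure_rsmult: "a \<in> carrier A \<Longrightarrow> b \<in> carrier B \<Longrightarrow>
    rsmult (ctensor p A B) (cpure p A B a b) r = cpure p A B a (rsmult B b r)"
  using rsmult_to_completion[OF tensor_bimod, of "pure A B a b" p r] pure_rsmult[of a b r]
  unfolding cpure_def ctensor_def by (simp add: pure_closed)

lemma ext_contin:
  assumes "contin p (ctensor p A B) D f" "contin p (ctensor p A B) D g"
    and D: "separated p D" "rmod D"
    and eq: "\<And>a b. a \<in> carrier A \<Longrightarrow> b \<in> carrier B \<Longrightarrow> f (cpure p A B a b) = g (cpure p A B a b)"
    and x: "x \<in> carrier (ctensor p A B)"
  shows "f x = g x"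
proof (rule T.completion_ext[OF _ _ D])
  show "contin p (completion p (tensor A B)) D f" "contin p (completion p (tensor A B)) D g"
    using assms(1,2) by (simp_all add: ctensor_def fmap_bimodule_completion)
  then have ad: "additive (completion p (tensor A B)) D f" "additive (completion p (tensor A B)) D g"
    by (simp_all add: contin_def)
  show "x \<in> carrier (completion p (tensor A B))" using x by (simp add: ctensor_def)
  fix t assume t: "t \<in> carrier (tensor A B)"
  show "f (to_completion p (tensor A B) t) = g (to_completion p (tensor A B) t)"
    by (rule tensor_ext[OF additive_comp[OF fmap_additive[OF T.to_completion_fmap] ad(1)]
          additive_comp[OF fmap_additive[OF T.to_completion_fmap] ad(2)] _ t])
      (use eq in \<open>simp add: cpure_def\<close>)
qed

lemmas ext = ext_contin[OF fmap_contin fmap_contin]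

text \<open>Gives meaning to the description \<open>ctensor_lift\<close>. Existence comes from the
  algebraic tensor product followed by completion, uniqueness from the density of sums of pure
  tensors.\<close>

lemma lift:
  assumes D: "complete p D" and \<beta>: "balanced p A B D \<beta>"
  shows "fmap p (ctensor p A B) D (ctensor_lift p A B D \<beta>)"
    and "\<And>a b. a \<in> carrier A \<Longrightarrow> b \<in> carrier B \<Longrightarrow> ctensor_lift p A B D \<beta> (cpure p A B a b) = \<beta> a b"
    and "ctensor_lift p A B D \<beta> \<in> extensional (carrier (ctensor p A B))"
proof -
  let ?P = "\<lambda>h. h \<in> continuous_maps p (ctensor p A B) D \<and>
    (\<forall>a\<in>carrier A. \<forall>b\<in>carrier B. h (cpure p A B a b) = \<beta> a b)"
  have b1: "fmap p A D (\<lambda>a. \<beta> a b)" if "b \<in> carrier B" for b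
    using \<beta> that unfolding balanced_def by blast
  have b2: "additive B D (\<beta> a)" if "a \<in> carrier A" for a
    using \<beta> that unfolding balanced_def by blast
  have b3: "\<beta> (rsmult A a r) b = \<beta> a (r \<odot>\<^bsub>B\<^esub> b)" if "a \<in> carrier A" "b \<in> carrier B" for a b r
    using \<beta> that unfolding balanced_def by blast
  obtain h0 where h0: "additive (tensor A B) D h0"
    "\<And>a b. a \<in> carrier A \<Longrightarrow> b \<in> carrier B \<Longrightarrow> h0 (pure A B a b) = \<beta> a b"
    using tensor_lift[of D \<beta>, OF complete_rmod[OF D] fmap_additive[OF b1] b2 b3] by blast
  have "fmap p (tensor A B) D h0"
  proof (rule fmap_tensor_lift[OF complete_rmod[OF D] h0(1)])
    fix a b n assume ab: "a \<in> adic p A n" "b \<in> carrier B"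
    show "h0 (pure A B a b) \<in> adic p D n"
      unfolding h0(2)[OF A.adic_closed[OF ab(1)] ab(2)] by (rule fmap_adic[OF b1[OF ab(2)] ab(1)])
  qed
  then obtain h where h: "fmap p (completion p (tensor A B)) D h"
    "\<And>t. t \<in> carrier (tensor A B) \<Longrightarrow> h (to_completion p (tensor A B) t) = h0 t"
    using T.completion_lift[OF D] by blast
  \<comment> \<open>\<open>continuous_maps\<close> consists of extensional functions, so the
    extension is cut off outside the carrier; values there would otherwise spoil uniqueness.\<close>
  define h' where "h' = restrict h (carrier (ctensor p A B))"
  have h': "fmap p (ctensor p A B) D h'"
  proof (rule fmap_cong[OF _ rmod])
    show "fmap p (ctensor p A B) D h" using h by (simp add: ctensor_def fmap_bimodule_completion)
  qed (simp add: h'_def)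
  have h'e: "h' \<in> extensional (carrier (ctensor p A B))" by (simp add: h'_def)
  have "h' (cpure p A B a b) = \<beta> a b" if "a \<in> carrier A" "b \<in> carrier B" for a b
    using that cpure_closed[OF that] h(2)[OF pure_closed[OF that]] h0(2)[OF that]
    by (simp add: h'_def) (simp add: cpure_def)
  then have Ph': "?P h'"
    using fmap_contin[OF h'] h'e by (simp add: continuous_maps_iff)
  have uniq: "g = h'" if g: "?P g" for g
  proof (rule extensionalityI)
    show "g \<in> extensional (carrier (ctensor p A B))" "h' \<in> extensional (carrier (ctensor p A B))"
      using g h'e by (simp_all add: continuous_maps_iff)
    fix x assume x: "x \<in> carrier (ctensor p A B)"
    have gc: "contin p (ctensor p A B) D g"
      using g by (simp add: continuous_maps_iff)
    show "g x = h' x"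
      by (rule ext_contin[OF gc fmap_contin[OF h'] complete_separated[OF D] complete_rmod[OF D] _ x])
        (use g Ph' in simp)
  qed
  have "ctensor_lift p A B D \<beta> = h'"
    unfolding ctensor_lift_def by (rule the_equality[of ?P, OF Ph' uniq])
  then show "fmap p (ctensor p A B) D (ctensor_lift p A B D \<beta>)"
    "\<And>a b. a \<in> carrier A \<Longrightarrow> b \<in> carrier B \<Longrightarrow> ctensor_lift p A B D \<beta> (cpure p A B a b) = \<beta> a b"
    "ctensor_lift p A B D \<beta> \<in> extensional (carrier (ctensor p A B))"
    using h' Ph' h'e by simp_all
qed

end

section \<open>Functoriality and associativity of completed tensor products\<close>

definition left_linear :: "('w::comm_ring_1 fps, 'a, 'y) module_scheme \<Rightarrow> ('w fps, 'b, 'z) module_scheme \<Rightarrow>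
    ('a \<Rightarrow> 'b) \<Rightarrow> bool" where
  "left_linear A B f \<longleftrightarrow> additive A B f \<and> (\<forall>x\<in>carrier A. \<forall>r. f (r \<odot>\<^bsub>A\<^esub> x) = r \<odot>\<^bsub>B\<^esub> f x)"

definition right_linear :: "nat \<Rightarrow> ('w::comm_ring_1 fps, 'a) bimodule \<Rightarrow> ('w fps, 'b) bimodule \<Rightarrow>
    ('a \<Rightarrow> 'b) \<Rightarrow> bool" where
  "right_linear p A B f \<longleftrightarrow> fmap p A B f \<and> (\<forall>x\<in>carrier A. \<forall>r. f (rsmult A x r) = rsmult B (f x) r)"

lemma right_linear_id: "right_linear p A A (\<lambda>x. x)"
  by (simp add: right_linear_def fmap_id)

lemma left_linear_id: "left_linear A A (\<lambda>x. x)"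
  by (simp add: left_linear_def additive_def)

text \<open>For f \<otimes> g to respect balancing, \<open>f\<close> must commute with right scalars
  and \<open>g\<close> with left scalars. \<open>right_linear\<close> includes the filtration
  condition because that concerns the left entry.\<close>

lemma ctensor_map:
  assumes ct: "ct p A B" and ct': "ct p A' B'" and f: "right_linear p A A' f" and g: "left_linear B B' g"
  shows "fmap p (ctensor p A B) (ctensor p A' B') (ctensor_map p A B A' B' f g)"
    and "\<And>a b. a \<in> carrier A \<Longrightarrow> b \<in> carrier B \<Longrightarrow>
      ctensor_map p A B A' B' f g (cpure p A B a b) = cpure p A' B' (f a) (g b)"
    and "ctensor_map p A B A' B' f g \<in> extensional (carrier (ctensor p A B))"
proof -
  interpret ct p A B by fact
  interpret D: ct p A' B' by fact
  have fc: "\<And>a. a \<in> carrier A \<Longrightarrow> f a \<in> carrier A'" and gc: "\<And>b. b \<in> carrier B \<Longrightarrow> g b \<in> carrier B'"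
    using f g fmap_closed additive_closed unfolding right_linear_def left_linear_def by metis+
  have "balanced p A B (ctensor p A' B') (\<lambda>a b. cpure p A' B' (f a) (g b))"
  proof (rule balancedI)
    show "fmap p A (ctensor p A' B') (\<lambda>a. cpure p A' B' (f a) (g b))" if "b \<in> carrier B" for b
      by (rule fmap_comp[OF _ D.cpure_fmap_l[OF gc[OF that]]]) (use f in \<open>simp add: right_linear_def\<close>)
    show "additive B (ctensor p A' B') (\<lambda>b. cpure p A' B' (f a) (g b))" if "a \<in> carrier A" for a
      by (rule additive_comp[OF _ D.cpure_additive_r[OF fc[OF that]]]) (use g in \<open>simp add: left_linear_def\<close>)
  qed (use f g fc gc in \<open>simp add: right_linear_def left_linear_def D.cpure_balanced\<close>)
  note l = lift[OF D.complete this]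
  show "fmap p (ctensor p A B) (ctensor p A' B') (ctensor_map p A B A' B' f g)"
    "\<And>a b. a \<in> carrier A \<Longrightarrow> b \<in> carrier B \<Longrightarrow>
      ctensor_map p A B A' B' f g (cpure p A B a b) = cpure p A' B' (f a) (g b)"
    "ctensor_map p A B A' B' f g \<in> extensional (carrier (ctensor p A B))"
    unfolding ctensor_map_def using l by simp_all
qed

lemma fmap_smult: "rmod C \<Longrightarrow> fmap p C C (\<lambda>x. r \<odot>\<^bsub>C\<^esub> x)"
proof -
  assume C: "rmod C"
  interpret C: rmodule C by (rule rmodule.intro, rule C)
  show ?thesis
    by (rule fmap_linear) (simp_all add: additive_def C.smult_add_r C.module C.smult_smult mult.commute)
qed

lemma fmap_plus:
  assumes "fmap p A C f" "fmap p A C g" "rmod C"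
  shows "fmap p A C (\<lambda>x. f x \<oplus>\<^bsub>C\<^esub> g x)"
proof -
  interpret C: rmodule C by (rule rmodule.intro) fact
  show ?thesis
    unfolding fmap_def using additive_plus[OF fmap_additive[OF assms(1)] fmap_additive[OF assms(2)] assms(3)]
      C.adic_add[OF fmap_adic[OF assms(1)] fmap_adic[OF assms(2)]] by auto
qed

text \<open>A lift of lifts: for fixed \<open>c\<close> the inner universal property gives a map on
  the tensor product of \<open>A\<close> and \<open>B\<close>, and its dependence on
  \<open>c\<close> is checked on pure tensors. Right scalars of that product act on
  \<open>B\<close>, from where balancing passes them on to \<open>c\<close>.\<close>

lemma assoc_r:
  assumes A: "tbimod p A" and B: "tbimod p B" and C: "tbimod p C"
  shows "fmap p (ctensor p (ctensor p A B) C) (ctensor p A (ctensor p B C)) (assoc_r p A B C)"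
    and "\<And>a b c. a \<in> carrier A \<Longrightarrow> b \<in> carrier B \<Longrightarrow> c \<in> carrier C \<Longrightarrow>
      assoc_r p A B C (cpure p (ctensor p A B) C (cpure p A B a b) c) = cpure p A (ctensor p B C) a (cpure p B C b c)"
proof -
  interpret AB: ct p A B using A B by (rule ct.intro)
  interpret BC: ct p B C using B C by (rule ct.intro)
  interpret AB_C: ct p "ctensor p A B" C using AB.tbimod C by (rule ct.intro)
  interpret A_BC: ct p A "ctensor p B C" using A BC.tbimod by (rule ct.intro)
  let ?D = "ctensor p A (ctensor p B C)"
  define \<beta> where "\<beta> c a b = cpure p A (ctensor p B C) a (cpure p B C b c)" for c a b
  have \<beta>: "balanced p A B ?D (\<beta> c)" if c: "c \<in> carrier C" for c
  proof (rule balancedI)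
    show "fmap p A ?D (\<lambda>a. \<beta> c a b)" if "b \<in> carrier B" for b
      unfolding \<beta>_def by (rule A_BC.cpure_fmap_l[OF BC.cpure_closed[OF that c]])
    show "additive B ?D (\<beta> c a)" if "a \<in> carrier A" for a
      unfolding \<beta>_def by (rule additive_comp[OF BC.cpure_additive_l[OF c] A_BC.cpure_additive_r[OF that]])
    show "\<beta> c (rsmult A a r) b = \<beta> c a (r \<odot>\<^bsub>B\<^esub> b)" if "a \<in> carrier A" "b \<in> carrier B" for a b r
      using that c by (simp add: \<beta>_def A_BC.cpure_balanced BC.cpure_smult)
  qed
  define L where "L c = ctensor_lift p A B ?D (\<beta> c)" for c
  note L = AB.lift[OF A_BC.complete \<beta>, folded L_def]
  have Lc: "L c x \<in> carrier ?D" if "c \<in> carrier C" "x \<in> carrier (ctensor p A B)" for c x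
    by (rule fmap_closed[OF L(1)[OF that(1)] that(2)])
  have bal: "balanced p (ctensor p A B) C ?D (\<lambda>x c. L c x)"
  proof (rule balancedI)
    show "fmap p (ctensor p A B) ?D (\<lambda>x. L c x)" if "c \<in> carrier C" for c
      by (rule L(1)[OF that])
    show "additive C ?D (\<lambda>c. L c x)" if x: "x \<in> carrier (ctensor p A B)" for x
    proof (rule additiveI)
      fix c d assume cd: "c \<in> carrier C" "d \<in> carrier C"
      show "L (c \<oplus>\<^bsub>C\<^esub> d) x = L c x \<oplus>\<^bsub>?D\<^esub> L d x"
      proof (rule AB.ext[OF L(1) fmap_plus[OF L(1)[OF cd(1)] L(1)[OF cd(2)]] A_BC.separated A_BC.rmod _ x])
        fix a b assume "a \<in> carrier A" "b \<in> carrier B"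
        then show "L (c \<oplus>\<^bsub>C\<^esub> d) (cpure p A B a b) = L c (cpure p A B a b) \<oplus>\<^bsub>?D\<^esub> L d (cpure p A B a b)"
          using cd by (simp add: L(2) \<beta>_def additive_add[OF BC.cpure_additive_r]
              additive_add[OF A_BC.cpure_additive_r])
      qed (use cd A_BC.rmod in auto)
    qed (rule Lc[OF _ x])
    fix x c r assume x: "x \<in> carrier (ctensor p A B)" and c: "c \<in> carrier C"
    show "L c (rsmult (ctensor p A B) x r) = L (r \<odot>\<^bsub>C\<^esub> c) x"
    proof (rule AB.ext[OF fmap_comp[OF bimod_fmap L(1)] L(1) A_BC.separated A_BC.rmod _ x])
      fix a b assume "a \<in> carrier A" "b \<in> carrier B"
      then show "L c (rsmult (ctensor p A B) (cpure p A B a b) r) = L (r \<odot>\<^bsub>C\<^esub> c) (cpure p A B a b)"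
        using c by (simp add: AB.cpure_rsmult L(2) \<beta>_def bimod_closed[OF AB.bimod_B] BC.cpure_balanced)
    qed (use c tbimod_bimod[OF AB.tbimod] in auto)
  qed
  have eq: "assoc_r p A B C = ctensor_lift p (ctensor p A B) C ?D (\<lambda>x c. L c x)"
    unfolding assoc_r_def L_def \<beta>_def[abs_def] Let_def ..
  show "fmap p (ctensor p (ctensor p A B) C) ?D (assoc_r p A B C)"
    unfolding eq by (rule AB_C.lift(1)[OF A_BC.complete bal])
  show "assoc_r p A B C (cpure p (ctensor p A B) C (cpure p A B a b) c) = cpure p A (ctensor p B C) a (cpure p B C b c)"
    if "a \<in> carrier A" "b \<in> carrier B" "c \<in> carrier C" for a b c
    unfolding eq using that by (simp add: AB_C.lift(2)[OF A_BC.complete bal] L(2) \<beta>_def)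
qed

text \<open>Here the inner lift depends on the left variable \<open>a\<close>, so its filtration
  condition in \<open>a\<close> has to be derived; it follows from linearity in \<open>a\<close>,
  again checked on pure tensors.\<close>

lemma assoc_l:
  assumes A: "tbimod p A" and B: "tbimod p B" and C: "tbimod p C"
  shows "fmap p (ctensor p A (ctensor p B C)) (ctensor p (ctensor p A B) C) (assoc_l p A B C)"
    and "\<And>a b c. a \<in> carrier A \<Longrightarrow> b \<in> carrier B \<Longrightarrow> c \<in> carrier C \<Longrightarrow>
      assoc_l p A B C (cpure p A (ctensor p B C) a (cpure p B C b c)) = cpure p (ctensor p A B) C (cpure p A B a b) c"
proof -
  interpret AB: ct p A B using A B by (rule ct.intro)
  interpret BC: ct p B C using B C by (rule ct.intro)
  interpret AB_C: ct p "ctensor p A B" C using AB.tbimod C by (rule ct.intro)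
  interpret A_BC: ct p A "ctensor p B C" using A BC.tbimod by (rule ct.intro)
  let ?D = "ctensor p (ctensor p A B) C"
  define \<beta> where "\<beta> a b c = cpure p (ctensor p A B) C (cpure p A B a b) c" for a b c
  have \<beta>: "balanced p B C ?D (\<beta> a)" if a: "a \<in> carrier A" for a
  proof (rule balancedI)
    show "fmap p B ?D (\<lambda>b. \<beta> a b c)" if "c \<in> carrier C" for c
      unfolding \<beta>_def by (rule fmap_comp[OF AB.cpure_fmap_r[OF a] AB_C.cpure_fmap_l[OF that]])
    show "additive C ?D (\<beta> a b)" if "b \<in> carrier B" for b
      unfolding \<beta>_def by (rule AB_C.cpure_additive_r[OF AB.cpure_closed[OF a that]])
    show "\<beta> a (rsmult B b r) c = \<beta> a b (r \<odot>\<^bsub>C\<^esub> c)" if "b \<in> carrier B" "c \<in> carrier C" for b c r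
      using that a by (simp add: \<beta>_def AB_C.cpure_balanced[symmetric] AB.cpure_rsmult)
  qed
  define L where "L a = ctensor_lift p B C ?D (\<beta> a)" for a
  note L = BC.lift[OF AB_C.complete \<beta>, folded L_def]
  have Lc: "L a y \<in> carrier ?D" if "a \<in> carrier A" "y \<in> carrier (ctensor p B C)" for a y
    by (rule fmap_closed[OF L(1)[OF that(1)] that(2)])
  have bal: "balanced p A (ctensor p B C) ?D L"
  proof (rule balancedI)
    show "additive (ctensor p B C) ?D (L a)" if "a \<in> carrier A" for a
      by (rule fmap_additive[OF L(1)[OF that]])
    show "fmap p A ?D (\<lambda>a. L a y)" if y: "y \<in> carrier (ctensor p B C)" for y
    proof (rule fmap_linear)
      show "additive A ?D (\<lambda>a. L a y)"
      proof (rule additiveI)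
        fix a a' assume aa: "a \<in> carrier A" "a' \<in> carrier A"
        show "L (a \<oplus>\<^bsub>A\<^esub> a') y = L a y \<oplus>\<^bsub>?D\<^esub> L a' y"
        proof (rule BC.ext[OF L(1) fmap_plus[OF L(1)[OF aa(1)] L(1)[OF aa(2)]] AB_C.separated AB_C.rmod _ y])
          fix b c assume "b \<in> carrier B" "c \<in> carrier C"
          then show "L (a \<oplus>\<^bsub>A\<^esub> a') (cpure p B C b c) = L a (cpure p B C b c) \<oplus>\<^bsub>?D\<^esub> L a' (cpure p B C b c)"
            using aa by (simp add: L(2) \<beta>_def additive_add[OF AB.cpure_additive_l]
                additive_add[OF AB_C.cpure_additive_l])
        qed (use aa AB_C.rmod in auto)
      qed (rule Lc[OF _ y])
      fix r a assume a: "a \<in> carrier A"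
      show "L (r \<odot>\<^bsub>A\<^esub> a) y = r \<odot>\<^bsub>?D\<^esub> L a y"
      proof (rule BC.ext[OF L(1) fmap_comp[OF L(1)[OF a] fmap_smult] AB_C.separated AB_C.rmod _ y])
        fix b c assume "b \<in> carrier B" "c \<in> carrier C"
        then show "L (r \<odot>\<^bsub>A\<^esub> a) (cpure p B C b c) = r \<odot>\<^bsub>?D\<^esub> L a (cpure p B C b c)"
          using a by (simp add: L(2) \<beta>_def AB.cpure_smult AB_C.cpure_smult)
      qed (use a AB_C.rmod in auto)
    qed (auto simp: AB_C.rmod AB.A.module)
    fix a y r assume a: "a \<in> carrier A" and y: "y \<in> carrier (ctensor p B C)"
    show "L (rsmult A a r) y = L a (r \<odot>\<^bsub>ctensor p B C\<^esub> y)"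
    proof (rule BC.ext[OF L(1) fmap_comp[OF fmap_smult L(1)[OF a]] AB_C.separated AB_C.rmod _ y])
      fix b c assume "b \<in> carrier B" "c \<in> carrier C"
      then show "L (rsmult A a r) (cpure p B C b c) = L a (r \<odot>\<^bsub>ctensor p B C\<^esub> cpure p B C b c)"
        using a by (simp add: BC.cpure_smult[symmetric] L(2) \<beta>_def bimod_closed[OF AB.bimod_A] AB.cpure_balanced)
    qed (use a bimod_closed[OF AB.bimod_A] BC.rmod in auto)
  qed
  have eq: "assoc_l p A B C = ctensor_lift p A (ctensor p B C) ?D L"
    unfolding assoc_l_def L_def[abs_def] \<beta>_def[abs_def] Let_def ..
  show "fmap p (ctensor p A (ctensor p B C)) ?D (assoc_l p A B C)"
    unfolding eq by (rule A_BC.lift(1)[OF AB_C.complete bal])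
  show "assoc_l p A B C (cpure p A (ctensor p B C) a (cpure p B C b c)) = cpure p (ctensor p A B) C (cpure p A B a b) c"
    if "a \<in> carrier A" "b \<in> carrier B" "c \<in> carrier C" for a b c
    unfolding eq using that by (simp add: A_BC.lift(2)[OF AB_C.complete bal] L(2) \<beta>_def)
qed

section \<open>Multiplication on completions\<close>

lemma cauchy_mult:
  assumes A: "ralg A" and f: "cauchy p A f" and g: "cauchy p A g"
  shows "cauchy p A (\<lambda>n. f n \<otimes>\<^bsub>A\<^esub> g n)"
    and "clim p A f \<otimes>\<^bsub>completion p A\<^esub> clim p A g = clim p A (\<lambda>n. f n \<otimes>\<^bsub>A\<^esub> g n)"
proof -
  interpret A: rmodule A by (rule rmodule.intro, rule ralg_rmod[OF A])
  have *: "a \<otimes>\<^bsub>A\<^esub> b \<ominus>\<^bsub>A\<^esub> c \<otimes>\<^bsub>A\<^esub> d \<in> adic p A n"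
    if "a \<in> carrier A" "b \<in> carrier A" "c \<in> carrier A" "d \<in> carrier A"
      "a \<ominus>\<^bsub>A\<^esub> c \<in> adic p A n" "b \<ominus>\<^bsub>A\<^esub> d \<in> adic p A n" for a b c d n
  proof (rule A.adic_diff_trans)
    show "a \<otimes>\<^bsub>A\<^esub> b \<ominus>\<^bsub>A\<^esub> c \<otimes>\<^bsub>A\<^esub> b \<in> adic p A n"
      using fmap_adic[OF ralg_fmap_l[OF A that(2)] that(5)]
        additive_diff[OF ralg_additive_l[OF A that(2)] A.module A.module that(1,3)] by simp
    show "c \<otimes>\<^bsub>A\<^esub> b \<ominus>\<^bsub>A\<^esub> c \<otimes>\<^bsub>A\<^esub> d \<in> adic p A n"
      using fmap_adic[OF ralg_fmap_r[OF A that(3)] that(6)]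
        additive_diff[OF ralg_additive_r[OF A that(3)] A.module A.module that(2,4)] by simp
  qed (use that ralg_closed[OF A] in auto)
  show "cauchy p A (\<lambda>n. f n \<otimes>\<^bsub>A\<^esub> g n)"
    unfolding cauchy_def
    by (intro allI conjI * ralg_closed[OF A] cauchyD[OF f] cauchyD[OF g])
  have "(\<Union>a\<in>adic p A n +>\<^bsub>A\<^esub> f n. \<Union>b\<in>adic p A n +>\<^bsub>A\<^esub> g n. adic p A n +>\<^bsub>A\<^esub> (a \<otimes>\<^bsub>A\<^esub> b)) =
      adic p A n +>\<^bsub>A\<^esub> (f n \<otimes>\<^bsub>A\<^esub> g n)" for n
  proof (rule A.coset_UN[OF cauchyD(1)[OF f]], rule A.coset_UN[OF cauchyD(1)[OF g]])
    fix y z assume "y \<in> carrier A" "y \<ominus>\<^bsub>A\<^esub> f n \<in> adic p A n" "z \<in> carrier A" "z \<ominus>\<^bsub>A\<^esub> g n \<in> adic p A n"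
    then show "adic p A n +>\<^bsub>A\<^esub> (y \<otimes>\<^bsub>A\<^esub> z) = adic p A n +>\<^bsub>A\<^esub> (f n \<otimes>\<^bsub>A\<^esub> g n)"
      using *[of y z "f n" "g n" n] cauchyD(1)[OF f] cauchyD(1)[OF g]
      by (simp add: A.coset_eq_iff ralg_closed[OF A])
  qed
  then show "clim p A f \<otimes>\<^bsub>completion p A\<^esub> clim p A g = clim p A (\<lambda>n. f n \<otimes>\<^bsub>A\<^esub> g n)"
    by (simp add: completion_def clim_def rcoset_mult_def)
qed

lemma ralg_completion:
  assumes A: "ralg A" shows "ralg (completion p A)"
proof -
  interpret A: rmodule A by (rule rmodule.intro, rule ralg_rmod[OF A])
  let ?C = "completion p A"
  note [simp] = cauchy_mult[OF A] A.clim_closed A.clim_add A.cauchy_add A.cauchy_smult A.clim_smult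
    cauchyD(1) ralg_smult[OF A] additive_add[OF ralg_additive_l[OF A]] additive_add[OF ralg_additive_r[OF A]]
  have *: "x \<otimes>\<^bsub>?C\<^esub> y \<in> carrier ?C" "(x \<oplus>\<^bsub>?C\<^esub> z) \<otimes>\<^bsub>?C\<^esub> y = x \<otimes>\<^bsub>?C\<^esub> y \<oplus>\<^bsub>?C\<^esub> z \<otimes>\<^bsub>?C\<^esub> y"
    "x \<otimes>\<^bsub>?C\<^esub> (y \<oplus>\<^bsub>?C\<^esub> z) = x \<otimes>\<^bsub>?C\<^esub> y \<oplus>\<^bsub>?C\<^esub> x \<otimes>\<^bsub>?C\<^esub> z"
    "(r \<odot>\<^bsub>?C\<^esub> x) \<otimes>\<^bsub>?C\<^esub> y = r \<odot>\<^bsub>?C\<^esub> (x \<otimes>\<^bsub>?C\<^esub> y)" "x \<otimes>\<^bsub>?C\<^esub> (r \<odot>\<^bsub>?C\<^esub> y) = r \<odot>\<^bsub>?C\<^esub> (x \<otimes>\<^bsub>?C\<^esub> y)"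
    if xyz: "x \<in> carrier ?C" "y \<in> carrier ?C" "z \<in> carrier ?C" for x y z r
  proof -
    obtain f where f: "cauchy p A f" "x = clim p A f" using A.completion_cases[OF xyz(1)] .
    obtain g where g: "cauchy p A g" "y = clim p A g" using A.completion_cases[OF xyz(2)] .
    obtain h where h: "cauchy p A h" "z = clim p A h" using A.completion_cases[OF xyz(3)] .
    show "x \<otimes>\<^bsub>?C\<^esub> y \<in> carrier ?C" "(x \<oplus>\<^bsub>?C\<^esub> z) \<otimes>\<^bsub>?C\<^esub> y = x \<otimes>\<^bsub>?C\<^esub> y \<oplus>\<^bsub>?C\<^esub> z \<otimes>\<^bsub>?C\<^esub> y"
      "x \<otimes>\<^bsub>?C\<^esub> (y \<oplus>\<^bsub>?C\<^esub> z) = x \<otimes>\<^bsub>?C\<^esub> y \<oplus>\<^bsub>?C\<^esub> x \<otimes>\<^bsub>?C\<^esub> z"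
      "(r \<odot>\<^bsub>?C\<^esub> x) \<otimes>\<^bsub>?C\<^esub> y = r \<odot>\<^bsub>?C\<^esub> (x \<otimes>\<^bsub>?C\<^esub> y)" "x \<otimes>\<^bsub>?C\<^esub> (r \<odot>\<^bsub>?C\<^esub> y) = r \<odot>\<^bsub>?C\<^esub> (x \<otimes>\<^bsub>?C\<^esub> y)"
      using f g h by simp_all
  qed
  show ?thesis
    unfolding ralg_def
    by (intro conjI ballI allI additiveI A.rmod_completion) (use * in auto)
qed

lemma ralg_cong:
  fixes A :: "('w::comm_ring_1 fps, 'a, 'y) module_scheme" and B :: "('w fps, 'a, 'z) module_scheme"
  assumes eq: "carrier A = carrier B" "add A = add B" "\<zero>\<^bsub>A\<^esub> = \<zero>\<^bsub>B\<^esub>" "module.smult A = module.smult B"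
    "monoid.mult A = monoid.mult B" and A: "ralg A"
  shows "ralg B"
  using A rmod_cong[OF eq(1-4)] unfolding ralg_def additive_def eq by blast

lemma ralg_ctensor:
  assumes "ct p A B" "balg A" "balg B"
  shows "ralg (ctensor p A B)"
    and "\<lbrakk>a \<in> carrier A; b \<in> carrier B; c \<in> carrier A; d \<in> carrier B\<rbrakk> \<Longrightarrow>
      cpure p A B a b \<otimes>\<^bsub>ctensor p A B\<^esub> cpure p A B c d = cpure p A B (a \<otimes>\<^bsub>A\<^esub> c) (b \<otimes>\<^bsub>B\<^esub> d)"
proof -
  interpret ct p A B by fact
  interpret two_balgs A B by unfold_locales fact+
  show "ralg (ctensor p A B)"
    unfolding ctensor_def
    by (rule ralg_cong[OF _ _ _ _ _ ralg_completion[OF tensor_ralg]]) simp_all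
  show "cpure p A B a b \<otimes>\<^bsub>ctensor p A B\<^esub> cpure p A B c d = cpure p A B (a \<otimes>\<^bsub>A\<^esub> c) (b \<otimes>\<^bsub>B\<^esub> d)"
    if "a \<in> carrier A" "b \<in> carrier B" "c \<in> carrier A" "d \<in> carrier B"
    using that cauchy_mult(2)[OF tensor_ralg T.cauchy_const T.cauchy_const, of "pure A B a b" "pure A B c d" p]
    by (simp add: cpure_def ctensor_def to_completion_eq pure_mult pure_closed)
qed

section \<open>Gaussian binomials\<close>

lemma qint_0 [simp]: "qint t 0 = 0"
  by (simp add: qint_def)

lemma qint_1 [simp]: "qint t (Suc 0) = 1"
  by (simp add: qint_def)

lemma qint_Suc: "qint t (Suc n) = qint t n + t ^ n"
  by (simp add: qint_def)

lemma qint_add: "qint t (a + b) = qint t a + t ^ a * qint t b"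
  by (induction b) (simp_all add: qint_Suc algebra_simps power_add)

lemma qint_mult: "(t - 1) * qint t n = t ^ n - 1"
  by (induction n) (simp_all add: qint_Suc algebra_simps)

definition qfac :: "'a::comm_ring_1 \<Rightarrow> nat \<Rightarrow> 'a" where
  "qfac t n = (\<Prod>k<n. qint t (Suc k))"

lemma qfac_0 [simp]: "qfac t 0 = 1"
  by (simp add: qfac_def)

lemma qfac_Suc: "qfac t (Suc n) = qfac t n * qint t (Suc n)"
  by (simp add: qfac_def)

lemma qbinom_gt [simp]: "n < k \<Longrightarrow> qbinom t n k = 0"
  by (induction t n k rule: qbinom.induct) auto

lemma qbinom_self [simp]: "qbinom t n n = 1"
  by (induction n) auto

lemma qbinom_1 [simp]: "qbinom t n (Suc 0) = qint t n"
proof (induction n)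
  case (Suc n)
  show ?case using Suc qint_add[of t 1 n] by simp
qed simp

text \<open>The factorial formula in product form. Where q-factorials are regular it determines the
  Gaussian binomial.\<close>

lemma qbinom_qfac: "k \<le> n \<Longrightarrow> qbinom t n k * (qfac t k * qfac t (n - k)) = qfac t n"
proof (induction t n k rule: qbinom.induct)
  case (3 t n k)
  show ?case
  proof (cases "k = n")
    case False
    then have k: "Suc k \<le> n" using 3 by simp
    then have nk: "n - k = Suc (n - Suc k)" by simp
    have "qbinom t (Suc n) (Suc k) * (qfac t (Suc k) * qfac t (Suc n - Suc k)) =
        (qbinom t n k * (qfac t k * qfac t (n - k))) * qint t (Suc k) +
        t ^ Suc k * qint t (n - k) * (qbinom t n (Suc k) * (qfac t (Suc k) * qfac t (n - Suc k)))"
      by (simp add: qfac_Suc nk algebra_simps)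
    also have "\<dots> = qfac t n * (qint t (Suc k) + t ^ Suc k * qint t (n - k))"
      using 3 k by (simp add: algebra_simps)
    also have "qint t (Suc k) + t ^ Suc k * qint t (n - k) = qint t (Suc n)"
      using qint_add[of t "Suc k" "n - k"] k by simp
    finally show ?thesis by (simp add: qfac_Suc)
  qed simp
qed simp_all

text \<open>Induction on \<open>m\<close> by the Pascal rule: each summand with index
  \<open>Suc i\<close> splits into one for (\<open>m\<close>, \<open>k\<close>) and
  \<open>t ^ Suc k\<close> times one for (\<open>m\<close>, \<open>Suc k\<close>).\<close>

lemma q_Vandermonde:
  "(\<Sum>i\<le>n. t ^ ((m - i) * (n - i)) * qbinom t m i * qbinom t l (n - i)) = qbinom t (m + l) n"
proof (induction m arbitrary: n)
  case 0
  have "(\<Sum>i\<le>n. t ^ ((0 - i) * (n - i)) * qbinom t 0 i * qbinom t l (n - i)) =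
      (\<Sum>i\<in>{0}. t ^ ((0 - i) * (n - i)) * qbinom t 0 i * qbinom t l (n - i))"
    by (rule sum.mono_neutral_right) auto
  then show ?case by simp
next
  case (Suc m)
  show ?case
  proof (cases n)
    case (Suc k)
    let ?f = "\<lambda>m n i. t ^ ((m - i) * (n - i)) * qbinom t m i * qbinom t l (n - i)"
    have sh: "?f (Suc m) (Suc k) (Suc i) = ?f m k i + t ^ Suc k * ?f m (Suc k) (Suc i)" if "i \<le> k" for i
    proof (cases "Suc i \<le> m")
      case True
      \<comment> \<open>The subtractions are genuine here because \<open>Suc i \<le> m\<close>;
        beyond \<open>m\<close> the second binomial vanishes.\<close>
      then have "(m - i) * (k - i) + Suc i = Suc k + (m - Suc i) * (k - i)"
        using that by (auto simp: algebra_simps dest!: le_Suc_ex)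
      then have "t ^ ((m - i) * (k - i)) * t ^ Suc i = t ^ Suc k * t ^ ((m - Suc i) * (k - i))"
        by (simp only: power_add[symmetric])
      then show ?thesis by (simp add: distrib_left distrib_right mult.assoc[symmetric])
    qed simp
    have "(\<Sum>i\<le>n. ?f (Suc m) n i) = ?f (Suc m) (Suc k) 0 + (\<Sum>i\<le>k. ?f (Suc m) (Suc k) (Suc i))"
      unfolding Suc by (rule sum.atMost_Suc_shift)
    also have "\<dots> = t ^ Suc k * ?f m (Suc k) 0 + (\<Sum>i\<le>k. ?f m k i + t ^ Suc k * ?f m (Suc k) (Suc i))"
      using sh by (simp add: power_add[symmetric] algebra_simps)
    also have "\<dots> = (\<Sum>i\<le>k. ?f m k i) + t ^ Suc k * (\<Sum>i\<le>Suc k. ?f m (Suc k) i)"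
      by (simp only: sum.distrib sum_distrib_left[symmetric] sum.atMost_Suc_shift distrib_left ac_simps)
    also have "\<dots> = qbinom t (Suc m + l) n"
      unfolding Suc.IH by (simp add: Suc)
    finally show ?thesis .
  qed simp
qed

definition tri :: "nat \<Rightarrow> nat" where "tri n = n * (n - 1) div 2"

lemma tri_0 [simp]: "tri 0 = 0" by (simp add: tri_def)

lemma tri_Suc: "tri (Suc n) = tri n + n"
proof -
  have "Suc n * n = n * (n - 1) + 2 * n" by (cases n) (simp_all add: algebra_simps)
  then show ?thesis by (simp add: tri_def)
qed

lemma tri_add: "tri (a + b) = tri a + tri b + a * b"
  by (induction b) (simp_all add: tri_Suc algebra_simps)

section \<open>Regular elements of the base ring\<close>

text \<open>\<open>W\<close> is not a domain in general, so the right to cancel is tracked element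
  by element.\<close>

definition regular :: "'a::comm_ring_1 \<Rightarrow> bool" where
  "regular f \<longleftrightarrow> (\<forall>g. f * g = 0 \<longrightarrow> g = 0)"

lemma regularI: "(\<And>g. f * g = 0 \<Longrightarrow> g = 0) \<Longrightarrow> regular f"
  unfolding regular_def by blast

lemma regular_0D: "regular f \<Longrightarrow> f * g = 0 \<Longrightarrow> g = 0"
  unfolding regular_def by blast

lemma regularD:
  assumes "regular f" "f * g = f * h" shows "g = h"
proof -
  have "f * (g - h) = 0" using assms(2) by (simp add: right_diff_distrib)
  then have "g - h = 0" by (rule regular_0D[OF assms(1)])
  then show ?thesis by simp
qed

lemma regular_mult:
  assumes "regular f" "regular g" shows "regular (f * g)"
proof (rule regularI)
  fix h assume "f * g * h = 0"
  then have "f * (g * h) = 0" by (simp only: mult.assoc)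
  from regular_0D[OF assms(2) regular_0D[OF assms(1) this]] show "h = 0" .
qed

lemma regular_factor:
  assumes "regular (f * g)" shows "regular g"
proof (rule regularI)
  fix h assume "g * h = 0"
  then have "f * g * h = 0" by (simp only: mult.assoc mult_zero_right)
  then show "h = 0" by (rule regular_0D[OF assms])
qed

lemma regular_1 [simp]: "regular 1"
  by (rule regularI) simp

lemma regular_power: "regular f \<Longrightarrow> regular (f ^ n)"
  by (induction n) (simp_all add: regular_mult)

lemma regular_prod: "(\<And>i. i \<in> S \<Longrightarrow> regular (f i)) \<Longrightarrow> regular (\<Prod>i\<in>S. f i)"
  by (induction S rule: infinite_finite_induct) (simp_all add: regular_mult)

lemma regular_X: "regular (fps_X :: 'w::comm_ring_1 fps)"
proof (rule regularI)
  fix g :: "'w fps" assume "fps_X * g = 0"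
  then have "(fps_X * g) $ Suc n = 0" for n by simp
  then show "g = 0" by (simp add: fps_eq_iff)
qed

lemma dvd_power_diff_power:
  fixes a b d :: "'a::comm_ring_1"
  assumes "d dvd a - b" shows "d dvd a ^ n - b ^ n"
proof (induction n)
  case (Suc n)
  have "a ^ Suc n - b ^ Suc n = (a - b) * a ^ n + b * (a ^ n - b ^ n)" by (simp add: algebra_simps)
  then show ?case using assms Suc by simp
qed simp

lemma binomial_mod_prime:
  assumes p: "Factorial_Ring.prime p"
  shows "(of_nat p :: 'a::comm_ring_1) dvd (1 + y) ^ p - (1 + y ^ p)"
proof -
  have p2: "p \<ge> 2" using p by (rule prime_ge_2_nat)
  have "(1 + y) ^ p = (\<Sum>k\<le>p. of_nat (p choose k) * y ^ k)"
    using binomial_ring[of y 1 p] by (simp add: add.commute)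
  also have "{..p} = insert 0 (insert p {1..<p})" using p2 by auto
  also have "(\<Sum>k\<in>\<dots>. of_nat (p choose k) * y ^ k) = 1 + (y ^ p + (\<Sum>k\<in>{1..<p}. of_nat (p choose k) * y ^ k))"
    using p2 by (subst sum.insert; simp)
  finally have "(1 + y) ^ p - (1 + y ^ p) = (\<Sum>k\<in>{1..<p}. of_nat (p choose k) * y ^ k)"
    by simp
  also have "of_nat p dvd \<dots>"
  proof (rule dvd_sum)
    fix k assume "k \<in> {1..<p}"
    then have "p dvd p choose k" using p by (intro dvd_choose_prime) auto
    then show "(of_nat p :: 'a) dvd of_nat (p choose k) * y ^ k"
      by (metis dvd_def dvd_mult2 of_nat_mult)
  qed
  finally show ?thesis .
qed

text \<open>The congruence for exponent \<open>p\<close> is iterated with \<open>y\<close> replaced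
  by its p-powers; congruence modulo \<open>p\<close> survives taking powers.\<close>

lemma frobenius_power:
  assumes p: "Factorial_Ring.prime p"
  shows "(of_nat p :: 'a::comm_ring_1) dvd (1 + y) ^ (p ^ v) - (1 + y ^ (p ^ v))"
proof (induction v)
  case (Suc v)
  have "of_nat p dvd ((1 + y) ^ (p ^ v)) ^ p - (1 + y ^ (p ^ v)) ^ p"
    by (rule dvd_power_diff_power[OF Suc])
  moreover have "of_nat p dvd (1 + y ^ (p ^ v)) ^ p - (1 + (y ^ (p ^ v)) ^ p)"
    by (rule binomial_mod_prime[OF p])
  ultimately have "of_nat p dvd (((1 + y) ^ (p ^ v)) ^ p - (1 + y ^ (p ^ v)) ^ p) +
      ((1 + y ^ (p ^ v)) ^ p - (1 + (y ^ (p ^ v)) ^ p))"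
    by (rule dvd_add)
  moreover have "((1 + y) ^ (p ^ v)) ^ p - (1 + y ^ (p ^ v)) ^ p + ((1 + y ^ (p ^ v)) ^ p - (1 + (y ^ (p ^ v)) ^ p)) =
      (1 + y) ^ (p ^ Suc v) - (1 + y ^ (p ^ Suc v))"
    by (simp only: diff_add_eq diff_diff_eq2 add_diff_cancel_left' power_mult[symmetric] power_Suc2 diff_add_cancel add_diff_eq add_diff_cancel_right')
  ultimately show ?case by simp
qed simp

lemma one_plus_power:
  "\<exists>k. (1 + y) ^ n = 1 + of_nat n * y + y ^ 2 * (k :: 'a::comm_ring_1)"
proof (induction n)
  case (Suc n)
  then obtain k where k: "(1 + y) ^ n = 1 + of_nat n * y + y ^ 2 * k" by blast
  have "(1 + y) ^ Suc n = 1 + of_nat (Suc n) * y + y ^ 2 * (of_nat n + k + y * k)"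
    by (simp add: k algebra_simps power2_eq_square)
  then show ?case by blast
qed (auto intro: exI[of _ 0])

lemma fps_of_nat_dvd_iff: "(of_nat c :: 'w::comm_ring_1 fps) dvd g \<longleftrightarrow> (\<forall>i. of_nat c dvd g $ i)"
proof
  assume "of_nat c dvd g"
  then obtain h where "g = of_nat c * h" by blast
  then show "\<forall>i. of_nat c dvd g $ i" by (simp add: fps_of_nat[symmetric])
next
  assume "\<forall>i. of_nat c dvd g $ i"
  then obtain h where h: "\<And>i. g $ i = of_nat c * h i" unfolding dvd_def by metis
  have "g = of_nat c * Abs_fps h" by (simp add: fps_eq_iff h fps_of_nat[symmetric])
  then show "of_nat c dvd g" by simp
qed

text \<open>Bezout takes the place of cancellation: \<open>n\<close> is a unit modulo
  \<open>c\<close>.\<close>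

lemma coprime_of_nat_dvd:
  assumes "coprime n c" "of_nat c dvd of_nat n * (w :: 'w::comm_ring_1)"
  shows "of_nat c dvd w"
proof -
  obtain a b where ab: "a * int n + b * int c = 1"
    using assms(1) bezout_int[of "int n" "int c"] by (metis coprime_int_iff coprime_iff_gcd_eq_1)
  have "w = of_int (a * int n + b * int c) * w" by (simp add: ab)
  also have "\<dots> = of_int a * (of_nat n * w) + of_nat c * (of_int b * w)"
    by (simp add: algebra_simps)
  also have "of_nat c dvd \<dots>" using assms(2) by simp
  finally show ?thesis .
qed

text \<open>Write $N = p^v n'$ with $n'$ prime to $p$. Modulo $p$ the element $q^N - 1$ is
  $(q-1)^{p^v}$ times a power series with constant term $n'$.\<close>

lemma regular_q_power:
  assumes p: "Factorial_Ring.prime p" and W: "p_adically_complete p TYPE('w::comm_ring_1)" and N: "N > 0"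
  shows "regular ((1 + fps_X :: 'w fps) ^ N - 1)"
proof (rule regularI)
  fix g :: "'w fps" assume g: "((1 + fps_X) ^ N - 1) * g = 0"
  obtain v n where N': "N = p ^ v * n" "\<not> p dvd n"
    using N p by (metis multiplicity_decompose' not_prime_unit order_less_irrefl)
  have cop: "coprime n (p ^ j)" for j
    using prime_imp_coprime[OF p N'(2)] by (simp add: coprime_commute)
  define d where "d = p ^ v"
  have "of_nat p dvd ((1 + fps_X :: 'w fps) ^ d) ^ n - (1 + fps_X ^ d) ^ n"
    unfolding d_def by (rule dvd_power_diff_power[OF frobenius_power[OF p]])
  then obtain h where h: "(1 + fps_X :: 'w fps) ^ N - (1 + fps_X ^ d) ^ n = of_nat p * h"
    by (auto simp: N' d_def power_mult)
  obtain k where k: "(1 + fps_X ^ d :: 'w fps) ^ n = 1 + of_nat n * fps_X ^ d + (fps_X ^ d) ^ 2 * k"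
    using one_plus_power by blast
  \<comment> \<open>Its constant term is \<open>n\<close>, the part of \<open>N\<close> prime to
    \<open>p\<close>; all that is divisible by \<open>p\<close> has been collected in
    \<open>h\<close>.\<close>
  define u where "u = of_nat n + fps_X ^ d * k"
  have d0: "d > 0" using p by (simp add: d_def prime_gt_0_nat)
  have f: "(1 + fps_X) ^ N - 1 = fps_X ^ d * u + of_nat p * h"
    using h k by (simp add: u_def algebra_simps power2_eq_square)
  \<comment> \<open>If p^j divides \<open>g\<close>, then the term with \<open>h\<close> shows that
    p^(j+1) divides X^d u g, and the factors X^d and \<open>u\<close> are removed in turn.
    Separatedness of \<open>W\<close> then forces \<open>g = 0\<close>.\<close>
  have "of_nat (p ^ j) dvd g" for j
  proof (induction j)
    case (Suc j)
    then obtain g' where g': "g = of_nat (p ^ j) * g'" by blast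
    have "fps_X ^ d * (u * g) = of_nat (p ^ Suc j) * (- h * g')"
      using g unfolding f by (simp add: g' algebra_simps eq_neg_iff_add_eq_0)
    then have "of_nat (p ^ Suc j) dvd fps_X ^ d * (u * g)" by simp
    then have "of_nat (p ^ Suc j) dvd (fps_X ^ d * (u * g)) $ (d + i)" for i
      unfolding fps_of_nat_dvd_iff by blast
    then have ug: "of_nat (p ^ Suc j) dvd (u * g) $ i" for i
      by (simp add: fps_X_power_mult_nth)
    \<comment> \<open>The constant term of \<open>u\<close> is a unit modulo powers of
      \<open>p\<close>, so the coefficients of \<open>g\<close> are recovered from those of
      \<open>u * g\<close> in increasing order.\<close>
    have "of_nat (p ^ Suc j) dvd g $ i" for i
    proof (induction i rule: less_induct)
      case (less i)
      have u0: "u $ 0 = of_nat n" using d0 by (simp add: u_def fps_of_nat[symmetric])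
      have "(u * g) $ i = (\<Sum>l=0..i. u $ l * g $ (i - l))" by (simp add: fps_mult_nth)
      also have "\<dots> = of_nat n * g $ i + (\<Sum>l=1..i. u $ l * g $ (i - l))"
        by (subst sum.atLeast_Suc_atMost) (simp_all add: u0)
      finally have "of_nat n * g $ i = (u * g) $ i - (\<Sum>l=1..i. u $ l * g $ (i - l))" by simp
      also have "of_nat (p ^ Suc j) dvd \<dots>"
        using ug less by (intro dvd_diff dvd_sum dvd_mult) auto
      finally show ?case by (rule coprime_of_nat_dvd[OF cop])
    qed
    then show ?case unfolding fps_of_nat_dvd_iff by blast
  qed simp
  then have "of_nat p ^ j dvd g $ i" for i j
    unfolding fps_of_nat_dvd_iff by simp
  then have "g $ i = 0" for i
    using W by (auto simp: p_adically_complete_def)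
  then show "g = 0" by (simp add: fps_eq_iff)
qed

section \<open>Regular q-integers and q-factorials\<close>

locale pcomplete =
  fixes p :: nat and W :: "'w::comm_ring_1 itself"
  assumes prime: "Factorial_Ring.prime p" and W: "p_adically_complete p TYPE('w)"
begin

abbreviation q :: "'w fps" where "q \<equiv> 1 + fps_X"
abbreviation Q :: "'w fps" where "Q \<equiv> q ^ p"

lemma p0: "p > 0" using prime by (rule prime_gt_0_nat)

text \<open>A factor of the regular element q^p - 1.\<close>

lemma regular_qint_p: "regular (qint q p)"
  using regular_q_power[OF prime W p0] qint_mult[of q p] regular_factor by metis

lemma regular_qint_Q: "n > 0 \<Longrightarrow> regular (qint Q n)"
  using regular_q_power[OF prime W, of "p * n"] qint_mult[of Q n] regular_factor p0
  by (metis nat_0_less_mult_iff power_mult)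

lemma regular_qfac: "regular (qfac Q n)"
  unfolding qfac_def by (rule regular_prod) (simp add: regular_qint_Q)

lemma regular_q: "regular (q ^ n)"
proof (rule regular_power, rule regularI)
  fix g :: "'w fps" assume g: "q * g = 0"
  have c: "(q * g) $ i = g $ i + (fps_X * g) $ i" for i
    by (simp add: distrib_right)
  have "g $ i = 0" for i
  proof (induction i)
    case 0
    then show ?case using c[of 0] g by simp
  next
    case (Suc i)
    then show ?case using c[of "Suc i"] g by simp
  qed
  then show "g = 0" by (simp add: fps_eq_iff)
qed

text \<open>Both sides become \<open>qfac Q j\<close> after multiplication by the same three
  q-factorials, which are regular.\<close>

lemma trinomial_revision:
  assumes "m \<le> k" "k \<le> j"
  shows "qbinom Q j k * qbinom Q k m = qbinom Q j m * qbinom Q (j - m) (k - m)"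
proof -
  let ?F = "qfac Q m * (qfac Q (k - m) * qfac Q (j - k))"
  have "?F * (qbinom Q j k * qbinom Q k m) =
      qbinom Q j k * ((qbinom Q k m * (qfac Q m * qfac Q (k - m))) * qfac Q (j - k))"
    by (simp add: ac_simps)
  also have "\<dots> = qfac Q j" using assms by (simp only: qbinom_qfac)
  finally have 1: "?F * (qbinom Q j k * qbinom Q k m) = qfac Q j" .
  have "?F * (qbinom Q j m * qbinom Q (j - m) (k - m)) =
      qbinom Q j m * (qfac Q m * (qbinom Q (j - m) (k - m) * (qfac Q (k - m) * qfac Q (j - m - (k - m)))))"
    using assms by (simp add: ac_simps)
  also have "\<dots> = qfac Q j" using assms by (simp only: qbinom_qfac diff_le_mono order_trans)
  finally have "?F * (qbinom Q j k * qbinom Q k m) = ?F * (qbinom Q j m * qbinom Q (j - m) (k - m))"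
    using 1 by simp
  then show ?thesis by (rule regularD[rotated]) (intro regular_mult regular_qfac)
qed

section \<open>The ring of twisted divided powers\<close>

abbreviation s :: "'w fps" where "s \<equiv> fps_X * q"

lemma omega_coeff_eq: "omega_coeff p m n i = Q ^ tri i * qbinom Q (m + n - i) m * qbinom Q m i * s ^ i"
  by (simp add: omega_coeff_def tri_def power_mult power_mult_distrib ac_simps)

text \<open>The value of the n-th divided power under the character that sends q + (p)_q \<omega> to
  q^(pj+1): the product of the differences q^(pj+1) - q^(pk+1) over k < n equals (p)_q^n (n)_{q^p}!
  times this element.\<close>

definition bv :: "nat \<Rightarrow> nat \<Rightarrow> 'w fps" where
  "bv n j = s ^ n * Q ^ tri n * qbinom Q j n"

text \<open>The structure constants are exactly those that make the characters multiplicative.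
  Trinomial revision extracts \<open>qbinom Q j m\<close> from every summand, and what remains is
  the q-Vandermonde sum in base \<open>Q\<close>. For \<open>m > j\<close> all terms vanish.\<close>

lemma bv_mult: "bv m j * bv n j = (\<Sum>i\<le>min m n. omega_coeff p m n i * bv (m + n - i) j)"
proof (cases "m \<le> j")
  case True
  have "(\<Sum>i\<le>min m n. omega_coeff p m n i * bv (m + n - i) j) =
      (\<Sum>i\<le>min m n. s ^ (m + n) * Q ^ tri m * Q ^ tri n * qbinom Q j m *
        (Q ^ ((m - i) * (n - i)) * qbinom Q m i * qbinom Q (j - m) (n - i)))"
  proof (rule sum.cong[OF refl])
    fix i assume i: "i \<in> {..min m n}"
    define k where "k = m + n - i"
    have rev: "qbinom Q j k * qbinom Q k m = qbinom Q j m * qbinom Q (j - m) (n - i)"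
    proof (cases "k \<le> j")
      case True
      have "k - m = n - i" "m \<le> k" using i by (auto simp: k_def)
      then show ?thesis using trinomial_revision[of m k j] True by simp
    next
      case False
      then have "j - m < n - i" using i \<open>m \<le> j\<close> by (auto simp: k_def)
      then show ?thesis using False by simp
    qed
    obtain a b where ab: "m = i + a" "n = i + b" using i by (auto dest!: le_Suc_ex)
    have "tri i + tri k = tri m + tri n + (m - i) * (n - i)"
      using tri_add[of i a] tri_add[of i b] tri_add[of "i + a" b]
      by (simp add: k_def ab algebra_simps)
    then have Qe: "Q ^ tri i * Q ^ tri k = Q ^ tri m * Q ^ tri n * Q ^ ((m - i) * (n - i))"
      by (simp only: power_add[symmetric])
    have "i + k = m + n" using i by (auto simp: k_def)
    then have se: "s ^ i * s ^ k = s ^ (m + n)" by (simp only: power_add[symmetric])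
    have "omega_coeff p m n i * bv k j =
        (s ^ i * s ^ k) * (Q ^ tri i * Q ^ tri k) * (qbinom Q j k * qbinom Q k m) * qbinom Q m i"
      unfolding omega_coeff_eq bv_def k_def[symmetric] by (simp only: ac_simps)
    also have "\<dots> = s ^ (m + n) * Q ^ tri m * Q ^ tri n * qbinom Q j m *
        (Q ^ ((m - i) * (n - i)) * qbinom Q m i * qbinom Q (j - m) (n - i))"
      unfolding se Qe rev by (simp only: ac_simps)
    finally show "omega_coeff p m n i * bv (m + n - i) j = s ^ (m + n) * Q ^ tri m * Q ^ tri n * qbinom Q j m *
        (Q ^ ((m - i) * (n - i)) * qbinom Q m i * qbinom Q (j - m) (n - i))"
      by (simp add: k_def)
  qed
  also have "\<dots> = s ^ (m + n) * Q ^ tri m * Q ^ tri n * qbinom Q j m *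
      (\<Sum>i\<le>n. Q ^ ((m - i) * (n - i)) * qbinom Q m i * qbinom Q (j - m) (n - i))"
    unfolding sum_distrib_left[symmetric]
  proof (rule arg_cong[where f = "(*) _"], rule sum.mono_neutral_left)
    show "\<forall>i\<in>{..n} - {..min m n}. Q ^ ((m - i) * (n - i)) * qbinom Q m i * qbinom Q (j - m) (n - i) = 0"
    proof
      fix i assume "i \<in> {..n} - {..min m n}"
      then have "m < i" by auto
      then show "Q ^ ((m - i) * (n - i)) * qbinom Q m i * qbinom Q (j - m) (n - i) = 0" by simp
    qed
  qed auto
  also have "\<dots> = bv m j * bv n j"
    unfolding q_Vandermonde using True by (simp add: bv_def power_add ac_simps)
  finally show ?thesis by simp
qed (auto simp: bv_def intro!: sum.neutral)

text \<open>The linear extension of the character. Cutting the sum at \<open>j\<close> loses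
  nothing, since \<open>bv n j\<close> vanishes for \<open>n > j\<close>, and makes the family
  visibly triangular.\<close>

definition ev :: "(nat \<Rightarrow>\<^sub>0 'w fps) \<Rightarrow> nat \<Rightarrow> 'w fps" where
  "ev f j = (\<Sum>n\<le>j. Poly_Mapping.lookup f n * bv n j)"

lemma bv_gt [simp]: "j < n \<Longrightarrow> bv n j = 0"
  by (simp add: bv_def)

lemma ev_add: "ev (f + g) j = ev f j + ev g j"
  by (simp add: ev_def lookup_add distrib_right sum.distrib)

lemma ev_0 [simp]: "ev 0 j = 0"
  by (simp add: ev_def)

lemma ev_sum: "ev (sum h S) j = (\<Sum>x\<in>S. ev (h x) j)"
  by (induction S rule: infinite_finite_induct) (simp_all add: ev_add)

lemma ev_single: "ev (Poly_Mapping.single n a) j = a * bv n j"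
proof -
  have "ev (Poly_Mapping.single n a) j = (\<Sum>m\<le>j. if n = m then a * bv m j else 0)"
    unfolding ev_def by (rule sum.cong) (auto simp: lookup_single)
  then show ?thesis by (auto simp: not_le)
qed

lemma ev_keys: "ev f j = (\<Sum>n\<in>Poly_Mapping.keys f. Poly_Mapping.lookup f n * bv n j)"
proof -
  have "(\<Sum>n\<le>j. Poly_Mapping.lookup f n * bv n j) =
      (\<Sum>n\<in>Poly_Mapping.keys f \<union> {..j}. Poly_Mapping.lookup f n * bv n j)"
    by (rule sum.mono_neutral_left) auto
  also have "\<dots> = (\<Sum>n\<in>Poly_Mapping.keys f. Poly_Mapping.lookup f n * bv n j)"
    by (rule sum.mono_neutral_right) (auto simp: in_keys_iff)
  finally show ?thesis by (simp add: ev_def)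
qed

text \<open>Triangularity: at \<open>j = n\<close> the lower coefficients are already zero, and the
  diagonal entry \<open>bv n n\<close>, a product of powers of q - 1 and q, is regular.\<close>

lemma ev_eq_0:
  assumes "\<And>j. ev f j = 0" shows "f = 0"
proof (rule poly_mapping_eqI)
  fix n
  have "Poly_Mapping.lookup f n = 0"
  proof (induction n rule: less_induct)
    case (less n)
    have "ev f n = (\<Sum>m\<in>{n}. Poly_Mapping.lookup f m * bv m n)"
      unfolding ev_def by (rule sum.mono_neutral_right) (use less in auto)
    then have "bv n n * Poly_Mapping.lookup f n = 0" using assms[of n] by (simp add: mult.commute)
    moreover have "regular (bv n n)"
      unfolding bv_def
      by (simp add: regular_mult regular_power regular_X regular_q[of 1, simplified])
    ultimately show ?case using regular_0D by blast
  qed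
  then show "Poly_Mapping.lookup f n = Poly_Mapping.lookup 0 n" by simp
qed

lemma ev_eqI:
  assumes "\<And>j. ev f j = ev g j" shows "f = g"
proof -
  have "ev (f - g) j + ev g j = ev f j" for j
    using ev_add[of "f - g" g j] by simp
  then have "f - g = 0" using assms by (intro ev_eq_0) (metis add_cancel_left_left)
  then show ?thesis by simp
qed

section \<open>The algebra of twisted divided powers as a commutative ring\<close>

abbreviation Om :: "('w fps, nat \<Rightarrow>\<^sub>0 'w fps) module" where "Om \<equiv> omega_alg p"

lemma omega_alg_simps [simp]:
  "carrier Om = UNIV" "\<zero>\<^bsub>Om\<^esub> = 0" "f \<oplus>\<^bsub>Om\<^esub> g = f + g" "\<one>\<^bsub>Om\<^esub> = 1"
  "r \<odot>\<^bsub>Om\<^esub> f = Poly_Mapping.map ((*) r) f"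
  by (simp_all add: omega_alg_def)

lemma lookup_smult [simp]: "Poly_Mapping.lookup (Poly_Mapping.map ((*) r) f) n = r * Poly_Mapping.lookup f (n :: nat)"
  for r :: "'w fps"
  by (simp add: Poly_Mapping.map.rep_eq when_def)

lemma ev_smult: "ev (Poly_Mapping.map ((*) r) f) j = r * ev f j"
  by (simp add: ev_def sum_distrib_left mult.assoc)

lemma ev_mult: "ev (f \<otimes>\<^bsub>Om\<^esub> g) j = ev f j * ev g j"
proof -
  have "ev (f \<otimes>\<^bsub>Om\<^esub> g) j = (\<Sum>m\<in>Poly_Mapping.keys f. \<Sum>n\<in>Poly_Mapping.keys g.
      Poly_Mapping.lookup f m * Poly_Mapping.lookup g n * (bv m j * bv n j))"
    by (simp add: omega_alg_def ev_sum ev_single bv_mult sum_distrib_left mult.assoc)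
  also have "\<dots> = ev f j * ev g j"
    by (simp add: ev_keys sum_product ac_simps)
  finally show ?thesis .
qed

lemma ev_one: "ev 1 j = 1"
  using ev_single[of 0 1 j] by (simp add: bv_def)

lemma omega_rmod: "rmod Om"
  by (rule rmodI) (auto intro!: poly_mapping_eqI simp: lookup_add algebra_simps)

text \<open>The axioms hold in \<open>R\<close> and are pulled back along the jointly injective
  characters, so the structure constants are never multiplied out.\<close>

lemma omega_cring: "cring Om"
proof (rule cringI)
  show "abelian_group Om"
    by (rule Module.module.axioms(2)[OF omega_rmod])
  show "Group.comm_monoid Om"
    by (rule comm_monoidI) (auto intro!: ev_eqI simp: ev_mult ev_one ac_simps)
qed (auto intro!: ev_eqI simp: ev_mult ev_add algebra_simps)

lemma omega_ralg: "ralg Om"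
  unfolding ralg_def
  by (auto simp: omega_rmod additive_def intro!: ev_eqI) (simp_all add: ev_mult ev_add ev_smult algebra_simps)

lemma omega_single_mult: "Poly_Mapping.single m a \<otimes>\<^bsub>Om\<^esub> Poly_Mapping.single n b =
    (\<Sum>i\<le>min m n. Poly_Mapping.single (m + n - i) (a * b * omega_coeff p m n i))"
proof (rule ev_eqI)
  fix j
  have "(a * bv m j) * (b * bv n j) = (a * b) * (bv m j * bv n j)" by (simp only: ac_simps)
  then show "ev (Poly_Mapping.single m a \<otimes>\<^bsub>Om\<^esub> Poly_Mapping.single n b) j =
      ev (\<Sum>i\<le>min m n. Poly_Mapping.single (m + n - i) (a * b * omega_coeff p m n i)) j"
    unfolding ev_mult ev_single ev_sum bv_mult sum_distrib_left by (simp only: mult.assoc)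
qed

end

lemma cring_completion:
  assumes A: "ralg A" and cr: "cring A" shows "cring (completion p A)"
proof -
  interpret A: rmodule A by (rule rmodule.intro, rule ralg_rmod[OF A])
  interpret R: cring A by (rule cr)
  let ?C = "completion p A"
  note rC = ralg_completion[OF A, of p]
  have one: "\<one>\<^bsub>?C\<^esub> = clim p A (\<lambda>_. \<one>\<^bsub>A\<^esub>)"
    by (simp add: completion_def clim_def)
  note c1 = A.cauchy_const[OF R.one_closed]
  show ?thesis
  proof (rule cringI)
    show "abelian_group ?C" by (rule Module.module.axioms(2)[OF A.rmod_completion])
    show "Group.comm_monoid ?C"
    proof (rule comm_monoidI)
      show "\<one>\<^bsub>?C\<^esub> \<in> carrier ?C" unfolding one by (rule A.clim_closed[OF c1])
      fix x assume x: "x \<in> carrier ?C"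
      obtain f where f: "cauchy p A f" "x = clim p A f" using A.completion_cases[OF x] .
      show "\<one>\<^bsub>?C\<^esub> \<otimes>\<^bsub>?C\<^esub> x = x"
        unfolding one f(2) cauchy_mult(2)[OF A c1 f(1)] using cauchyD(1)[OF f(1)] by simp
      fix y assume y: "y \<in> carrier ?C"
      obtain g where g: "cauchy p A g" "y = clim p A g" using A.completion_cases[OF y] .
      show "x \<otimes>\<^bsub>?C\<^esub> y \<in> carrier ?C" by (rule ralg_closed[OF rC x y])
      show "x \<otimes>\<^bsub>?C\<^esub> y = y \<otimes>\<^bsub>?C\<^esub> x"
        using f g cauchyD(1)[OF f(1)] cauchyD(1)[OF g(1)] by (simp add: cauchy_mult(2)[OF A] R.m_comm)
      fix z assume z: "z \<in> carrier ?C"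
      obtain h where h: "cauchy p A h" "z = clim p A h" using A.completion_cases[OF z] .
      show "x \<otimes>\<^bsub>?C\<^esub> y \<otimes>\<^bsub>?C\<^esub> z = x \<otimes>\<^bsub>?C\<^esub> (y \<otimes>\<^bsub>?C\<^esub> z)"
        using f g h cauchyD(1)[OF f(1)] cauchyD(1)[OF g(1)] cauchyD(1)[OF h(1)]
        by (simp add: cauchy_mult[OF A] R.m_assoc)
    qed
    show "(x \<oplus>\<^bsub>?C\<^esub> y) \<otimes>\<^bsub>?C\<^esub> z = x \<otimes>\<^bsub>?C\<^esub> z \<oplus>\<^bsub>?C\<^esub> y \<otimes>\<^bsub>?C\<^esub> z"
      if "x \<in> carrier ?C" "y \<in> carrier ?C" "z \<in> carrier ?C" for x y z
      by (rule additive_add[OF ralg_additive_l[OF rC that(3)] that(1,2)])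
  qed
qed

section \<open>Completeness of the base ring\<close>

lemma base_algebra_simps [simp]:
  "carrier base_algebra = UNIV" "r \<odot>\<^bsub>base_algebra\<^esub> x = r * x" "x \<oplus>\<^bsub>base_algebra\<^esub> y = x + y"
  "\<zero>\<^bsub>base_algebra\<^esub> = 0" "\<one>\<^bsub>base_algebra\<^esub> = 1" "x \<otimes>\<^bsub>base_algebra\<^esub> y = x * y"
  by (simp_all add: base_algebra_def ring_of_type_algebra_def module.defs ring.defs)

lemma base_rmod: "rmod (base_algebra :: ('w::comm_ring_1 fps, 'w fps) module)"
  by (rule rmodI) (simp_all add: algebra_simps)

lemma base_minus [simp]: "x \<ominus>\<^bsub>base_algebra\<^esub> y = x - (y :: 'w::comm_ring_1 fps)"
proof -
  interpret rmodule "base_algebra :: ('w fps, 'w fps) module" by (rule rmodule.intro, rule base_rmod)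
  have "(x \<ominus>\<^bsub>base_algebra\<^esub> y) \<oplus>\<^bsub>base_algebra\<^esub> y = x" by (rule add_diff_cancel) simp_all
  then show ?thesis by (simp add: eq_diff_eq)
qed

text \<open>A series splits into its constant term and \<open>fps_X\<close> times its shift. If the
  divisibilities hold, the constant term is \<open>p\<close> times an element of step n and the
  shift lies in step n, which are the two generators at work.\<close>

lemma base_adic: "f \<in> adic p base_algebra n \<longleftrightarrow> (\<forall>i<n. of_nat p ^ (n - i) dvd (f :: 'w::comm_ring_1 fps) $ i)"
proof (induction n arbitrary: f)
  case (Suc n)
  show ?case
  proof
    assume "f \<in> adic p base_algebra (Suc n)"
    then obtain a b where ab: "a \<in> adic p base_algebra n" "b \<in> adic p base_algebra n" "f = of_nat p * a + fps_X * b"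
      by (auto simp: adic.simps(2))
    show "\<forall>i<Suc n. of_nat p ^ (Suc n - i) dvd f $ i"
    proof (intro allI impI)
      fix i assume i: "i < Suc n"
      have "of_nat p ^ (Suc n - i) dvd of_nat p * a $ i"
      proof (cases "i < n")
        case True
        then have "of_nat p ^ (n - i) dvd a $ i" using ab(1) Suc.IH by blast
        then show ?thesis using True by (simp add: Suc_diff_le mult_dvd_mono)
      next
        case False
        then have "i = n" using i by simp
        then show ?thesis by simp
      qed
      moreover have "of_nat p ^ (Suc n - i) dvd (fps_X * b) $ i"
        using ab(2) Suc.IH i by (cases i) auto
      moreover have "f $ i = of_nat p * a $ i + (fps_X * b) $ i"
        by (simp add: ab(3) fps_of_nat[symmetric])
      ultimately show "of_nat p ^ (Suc n - i) dvd f $ i" by simp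
    qed
  next
    assume f: "\<forall>i<Suc n. of_nat p ^ (Suc n - i) dvd f $ i"
    then have "of_nat p ^ Suc n dvd f $ 0" by (metis diff_zero zero_less_Suc)
    then obtain w where w: "f $ 0 = of_nat p * (of_nat p ^ n * w)" by (auto simp: mult.assoc)
    define a where "a = fps_const (of_nat p ^ n * w)"
    define b where "b = fps_shift 1 f"
    have "a $ i = (if i = 0 then of_nat p ^ n * w else 0)" for i by (simp add: a_def)
    then have "a \<in> adic p base_algebra n" using Suc.IH by auto
    moreover have "of_nat p ^ (n - i) dvd b $ i" if "i < n" for i
      using f that by (auto simp: b_def dest: spec[of _ "Suc i"])
    then have "b \<in> adic p base_algebra n" using Suc.IH by blast
    moreover have "f = of_nat p * a + fps_X * b"
    proof (rule fps_ext)
      fix i show "f $ i = (of_nat p * a + fps_X * b) $ i"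
        by (cases i) (simp_all add: a_def b_def w fps_of_nat[symmetric])
    qed
    ultimately show "f \<in> adic p base_algebra (Suc n)" by (auto simp: adic.simps(2))
  qed
qed simp

lemma base_complete:
  assumes W: "p_adically_complete p TYPE('w::comm_ring_1)"
  shows "complete p (base_algebra :: ('w fps, 'w fps) module)"
  unfolding complete_def
proof (intro conjI allI impI)
  show "separated p (base_algebra :: ('w fps, 'w fps) module)"
    unfolding separated_def
  proof (intro ballI impI)
    fix x :: "'w fps" assume x: "\<forall>n. x \<in> adic p base_algebra n"
    have "of_nat p ^ n dvd x $ i" for n i
    proof -
      have "x \<in> adic p base_algebra (n + Suc i)" using x by blast
      then have "of_nat p ^ (n + Suc i - i) dvd x $ i" by (simp only: base_adic)
      moreover have "n + Suc i - i = Suc n" by simp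
      ultimately show ?thesis by (metis dvd_trans le_imp_power_dvd le_SucI order_refl)
    qed
    then have "x $ i = 0" for i using W unfolding p_adically_complete_def by blast
    then show "x = \<zero>\<^bsub>base_algebra\<^esub>" by (simp add: fps_eq_iff)
  qed
  fix f :: "nat \<Rightarrow> 'w fps" assume f: "cauchy p base_algebra f"
  \<comment> \<open>Coefficient \<open>i\<close> sees the n-th power of the ideal only as the (n -
    i)-th power of \<open>p\<close>; reading the sequence at \<open>n + i\<close> makes up for this
    delay.\<close>
  have fi: "of_nat p ^ n dvd f (Suc (n + i)) $ i - f (n + i) $ i" for n i
  proof (cases n)
    case (Suc m)
    have "i < n + i" using Suc by simp
    moreover have "\<forall>j<n + i. of_nat p ^ (n + i - j) dvd (f (Suc (n + i)) - f (n + i)) $ j"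
      using cauchyD(2)[OF f, of "n + i"] by (simp only: base_adic base_minus)
    ultimately have "of_nat p ^ (n + i - i) dvd (f (Suc (n + i)) - f (n + i)) $ i" by blast
    then show ?thesis by simp
  qed simp
  have "\<exists>a. \<forall>n. of_nat p ^ n dvd a - f (n + i) $ i" for i
    using W fi[of _ i] by (simp add: p_adically_complete_def)
  then obtain a where a: "\<And>i n. of_nat p ^ n dvd a i - f (n + i) $ i" by metis
  have "Abs_fps a - f n \<in> adic p base_algebra n" for n
    unfolding base_adic
  proof (intro allI impI)
    fix i assume "i < n"
    then show "of_nat p ^ (n - i) dvd (Abs_fps a - f n) $ i" using a[of "n - i" i] by simp
  qed
  then show "\<exists>a\<in>carrier base_algebra. \<forall>n. a \<ominus>\<^bsub>base_algebra\<^esub> f n \<in> adic p base_algebra n" by auto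
qed (rule base_rmod)

section \<open>The completed algebra of twisted divided powers\<close>

text \<open>On the first n terms of \<open>r\<close> the two maps agree, because \<open>Y\<close>
  governs both; the remaining multiple of \<open>fps_X ^ n\<close> is mapped into step n by each of
  them. Separatedness then gives equality.\<close>

lemma base_ext:
  fixes f g :: "'w::comm_ring_1 fps \<Rightarrow> 'c"
  assumes f: "fmap p base_algebra C f" and g: "fmap p base_algebra C g"
    and C: "separated p C" "rmod C"
    and X: "\<And>r. f (fps_X * r) = Y (f r)" "\<And>r. g (fps_X * r) = Y (g r)"
    and c: "\<And>w. f (fps_const w) = g (fps_const w)"
  shows "f r = g r"
proof (rule separated_eqI[OF C])
  interpret C: rmodule C by (rule rmodule.intro, rule C(2))
  have cl: "f r \<in> carrier C" "g r \<in> carrier C" for r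
    using fmap_closed[OF f] fmap_closed[OF g] by simp_all
  show "f r \<in> carrier C" "g r \<in> carrier C" by (rule cl)+
  fix n
  have "\<exists>u. f r \<ominus>\<^bsub>C\<^esub> f (fps_X ^ n * u) = g r \<ominus>\<^bsub>C\<^esub> g (fps_X ^ n * u)"
  proof (induction n arbitrary: r)
    case 0
    show ?case by (rule exI[of _ r]) (simp add: cl)
  next
    case (Suc n)
    obtain u where u: "f r \<ominus>\<^bsub>C\<^esub> f (fps_X ^ n * u) = g r \<ominus>\<^bsub>C\<^esub> g (fps_X ^ n * u)" using Suc by blast
    define v where "v = fps_shift 1 u"
    have uv: "u = fps_const (u $ 0) + fps_X * v"
    proof (rule fps_ext)
      fix i show "u $ i = (fps_const (u $ 0) + fps_X * v) $ i" by (cases i) (simp_all add: v_def)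
    qed
    have eq: "f (fps_X ^ n * fps_const w) = g (fps_X ^ n * fps_const w)" for w
      by (induction n) (simp_all add: c X mult.assoc)
    have split: "h (fps_X ^ n * u) = h (fps_X ^ n * fps_const (u $ 0)) \<oplus>\<^bsub>C\<^esub> h (fps_X ^ Suc n * v)"
      if "fmap p base_algebra C h" for h
    proof -
      have "fps_X ^ n * u = fps_X ^ n * fps_const (u $ 0) + fps_X ^ Suc n * v"
        by (subst uv) (simp only: distrib_left power_Suc2 mult.assoc)
      then show ?thesis using fmap_add[OF that, of "fps_X ^ n * fps_const (u $ 0)" "fps_X ^ Suc n * v"] by simp
    qed
    have aux: "a \<ominus>\<^bsub>C\<^esub> b \<oplus>\<^bsub>C\<^esub> c = a \<ominus>\<^bsub>C\<^esub> d" if "a \<in> carrier C" "b = c \<oplus>\<^bsub>C\<^esub> d" "c \<in> carrier C" "d \<in> carrier C" for a b c d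
      using that by (simp add: C.minus_eq C.minus_add C.a_ac C.r_neg2)
    have "f r \<ominus>\<^bsub>C\<^esub> f (fps_X ^ Suc n * v) = g r \<ominus>\<^bsub>C\<^esub> g (fps_X ^ Suc n * v)"
      using aux[OF cl(1) split[OF f] cl(1) cl(1)] aux[OF cl(2) split[OF g] cl(2) cl(2)] u eq by metis
    then show ?case by blast
  qed
  then obtain u where u: "f r \<ominus>\<^bsub>C\<^esub> f (fps_X ^ n * u) = g r \<ominus>\<^bsub>C\<^esub> g (fps_X ^ n * u)" by blast
  interpret B: rmodule "base_algebra :: ('w fps, 'w fps) module" by (rule rmodule.intro, rule base_rmod)
  have Xn: "fps_X ^ n * u \<in> adic p base_algebra n" for u :: "'w fps"
  proof (induction n)
    case (Suc n)
    then show ?case using B.adic_X[OF Suc] by (simp add: mult.assoc)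
  qed simp
  have 1: "f r \<ominus>\<^bsub>C\<^esub> (f r \<ominus>\<^bsub>C\<^esub> f (fps_X ^ n * u)) \<in> adic p C n"
    using fmap_adic[OF f Xn] cl by (simp add: C.minus_eq C.minus_add C.r_neg2)
  have 2: "g r \<ominus>\<^bsub>C\<^esub> (g r \<ominus>\<^bsub>C\<^esub> g (fps_X ^ n * u)) \<in> adic p C n"
    using fmap_adic[OF g Xn] cl by (simp add: C.minus_eq C.minus_add C.r_neg2)
  show "f r \<ominus>\<^bsub>C\<^esub> g r \<in> adic p C n"
    using C.adic_diff_trans[OF cl(1) _ cl(2) 1[unfolded u] C.adic_diff_swap[OF cl(2) _ 2]] cl by simp
qed

lemma adic_base_smult:
  assumes C: "rmod C" and r: "r \<in> adic p base_algebra m" and x: "x \<in> adic p C n"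
  shows "r \<odot>\<^bsub>C\<^esub> x \<in> adic p C (m + n)"
  using r
proof (induction m arbitrary: r)
  case 0
  interpret C: rmodule C by (rule rmodule.intro, rule C)
  show ?case using C.adic_smult[OF x] by simp
next
  case (Suc m)
  interpret C: rmodule C by (rule rmodule.intro, rule C)
  obtain a b where ab: "a \<in> adic p base_algebra m" "b \<in> adic p base_algebra m" "r = of_nat p * a + fps_X * b"
    using Suc.prems by (auto simp: adic.simps(2))
  have xc: "x \<in> carrier C" by (rule C.adic_closed[OF x])
  have "r \<odot>\<^bsub>C\<^esub> x = of_nat p \<odot>\<^bsub>C\<^esub> (a \<odot>\<^bsub>C\<^esub> x) \<oplus>\<^bsub>C\<^esub> fps_X \<odot>\<^bsub>C\<^esub> (b \<odot>\<^bsub>C\<^esub> x)"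
    using xc by (simp add: ab(3) C.smult_add_l C.smult_smult)
  then show ?case using C.adic_SucI[OF Suc.IH[OF ab(1)] Suc.IH[OF ab(2)]] by simp
qed

lemma adic_mult:
  assumes A: "ralg A" and x: "x \<in> adic p A m" and y: "y \<in> adic p A n"
  shows "x \<otimes>\<^bsub>A\<^esub> y \<in> adic p A (m + n)"
  using x
proof (induction m arbitrary: x)
  case 0
  then show ?case using fmap_adic[OF ralg_fmap_r[OF A] y] by simp
next
  case (Suc m)
  interpret A: rmodule A by (rule rmodule.intro, rule ralg_rmod[OF A])
  obtain a b where ab: "a \<in> adic p A m" "b \<in> adic p A m" "x = of_nat p \<odot>\<^bsub>A\<^esub> a \<oplus>\<^bsub>A\<^esub> fps_X \<odot>\<^bsub>A\<^esub> b"
    "a \<in> carrier A" "b \<in> carrier A" using Suc.prems by (rule A.adic_SucE)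
  have yc: "y \<in> carrier A" by (rule A.adic_closed[OF y])
  have "x \<otimes>\<^bsub>A\<^esub> y = of_nat p \<odot>\<^bsub>A\<^esub> (a \<otimes>\<^bsub>A\<^esub> y) \<oplus>\<^bsub>A\<^esub> fps_X \<odot>\<^bsub>A\<^esub> (b \<otimes>\<^bsub>A\<^esub> y)"
    using ab yc by (simp add: additive_add[OF ralg_additive_l[OF A yc]] ralg_smult[OF A])
  then show ?case using A.adic_SucI[OF Suc.IH[OF ab(1)] Suc.IH[OF ab(2)]] by simp
qed

context pcomplete
begin

abbreviation H :: "('w fps, 'w omega) module" where "H \<equiv> omega_hat p"

lemma H_def: "H = completion p Om" by (simp add: omega_hat_def)

lemma H_complete: "complete p H"
  unfolding H_def by (rule rmodule.complete_completion[OF rmodule.intro[OF omega_rmod]])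

lemma H_ralg: "ralg H"
  unfolding H_def by (rule ralg_completion[OF omega_ralg])

lemma H_cring: "cring H"
  unfolding H_def by (rule cring_completion[OF omega_ralg omega_cring])

lemma H_rmod: "rmod H" by (rule ralg_rmod[OF H_ralg])

lemma H_separated: "separated p H" by (rule complete_separated[OF H_complete])

end

sublocale pcomplete \<subseteq> H: cring "omega_hat p :: ('w fps, 'w omega) module" by (rule H_cring)
sublocale pcomplete \<subseteq> HM: rmodule "omega_hat p :: ('w fps, 'w omega) module" by (rule rmodule.intro, rule H_rmod)
sublocale pcomplete \<subseteq> O: rmodule "omega_alg p :: ('w fps, nat \<Rightarrow>\<^sub>0 'w fps) module" by (rule rmodule.intro, rule omega_rmod)
sublocale pcomplete \<subseteq> OR: cring "omega_alg p :: ('w fps, nat \<Rightarrow>\<^sub>0 'w fps) module" by (rule omega_cring)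
sublocale pcomplete \<subseteq> B: rmodule "base_algebra :: ('w fps, 'w fps) module" by (rule rmodule.intro, rule base_rmod)

context pcomplete
begin

abbreviation tc :: "(nat \<Rightarrow>\<^sub>0 'w fps) \<Rightarrow> 'w omega" where "tc \<equiv> to_completion p Om"
abbreviation \<omega> :: "nat \<Rightarrow> 'w omega" where "\<omega> \<equiv> omega_pow p"

lemma tc_fmap: "fmap p Om H tc"
  unfolding H_def by (rule O.to_completion_fmap)

lemma tc_closed [simp]: "tc f \<in> carrier H"
  using fmap_closed[OF tc_fmap] by simp

lemma tc_add: "tc (f + g) = tc f \<oplus>\<^bsub>H\<^esub> tc g"
  using fmap_add[OF tc_fmap] by simp

lemma tc_mult: "tc (f \<otimes>\<^bsub>Om\<^esub> g) = tc f \<otimes>\<^bsub>H\<^esub> tc g"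
  unfolding H_def to_completion_eq
  by (rule cauchy_mult(2)[OF omega_ralg O.cauchy_const O.cauchy_const, symmetric]) simp_all

lemma tc_smult: "tc (Poly_Mapping.map ((*) r) f) = r \<odot>\<^bsub>H\<^esub> tc f"
  using O.to_completion_smult[of f p r] by (simp add: H_def)

lemma tc_one: "tc 1 = \<one>\<^bsub>H\<^esub>"
  by (simp add: H_def completion_def to_completion_def)

lemma omega_pow_closed [simp]: "\<omega> n \<in> carrier H"
  by (simp add: omega_pow_def)

lemma omega_pow_0: "\<omega> 0 = \<one>\<^bsub>H\<^esub>"
  using tc_one by (simp add: omega_pow_def)

lemma tc_single: "tc (Poly_Mapping.single n r) = r \<odot>\<^bsub>H\<^esub> \<omega> n"
proof -
  have "Poly_Mapping.single n r = Poly_Mapping.map ((*) r) (Poly_Mapping.single n 1)"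
    by (rule poly_mapping_eqI) (simp add: lookup_single when_def)
  then show ?thesis using tc_smult[of r "Poly_Mapping.single n 1"] by (simp add: omega_pow_def)
qed

lemma poly_mapping_sum_single: "f = (\<Sum>n\<in>Poly_Mapping.keys f. Poly_Mapping.single n (Poly_Mapping.lookup f n))"
  for f :: "nat \<Rightarrow>\<^sub>0 'w fps"
proof (rule poly_mapping_eqI)
  fix k
  have "Poly_Mapping.lookup (\<Sum>n\<in>Poly_Mapping.keys f. Poly_Mapping.single n (Poly_Mapping.lookup f n)) k =
      (\<Sum>n\<in>Poly_Mapping.keys f. if n = k then Poly_Mapping.lookup f n else 0)"
    by (simp add: lookup_sum lookup_single when_def)
  also have "\<dots> = Poly_Mapping.lookup f k" by (simp add: in_keys_iff)
  finally show "Poly_Mapping.lookup f k =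
      Poly_Mapping.lookup (\<Sum>n\<in>Poly_Mapping.keys f. Poly_Mapping.single n (Poly_Mapping.lookup f n)) k" by simp
qed

lemma omega_induct [case_names 0 single add]:
  fixes P :: "(nat \<Rightarrow>\<^sub>0 'w fps) \<Rightarrow> bool"
  assumes "P 0" and single: "\<And>n r. P (Poly_Mapping.single n r)" and add: "\<And>f g. P f \<Longrightarrow> P g \<Longrightarrow> P (f + g)"
  shows "P f"
proof -
  have "P (\<Sum>n\<in>S. Poly_Mapping.single n (h n))" for S h
    by (induction S rule: infinite_finite_induct) (simp_all add: assms)
  then show ?thesis using poly_mapping_sum_single[of f] by metis
qed

lemma omega_adic_iff: "f \<in> adic p Om k \<longleftrightarrow> (\<forall>n. Poly_Mapping.lookup f n \<in> adic p base_algebra k)"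
proof
  have lk: "fmap p Om base_algebra (\<lambda>f. Poly_Mapping.lookup f n)" for n
    by (rule fmap_linear) (simp_all add: additive_def lookup_add O.module B.module)
  show "\<forall>n. Poly_Mapping.lookup f n \<in> adic p base_algebra k" if "f \<in> adic p Om k"
    using fmap_adic[OF lk that] by simp
  assume *: "\<forall>n. Poly_Mapping.lookup f n \<in> adic p base_algebra k"
  have sing: "fmap p base_algebra Om (Poly_Mapping.single n)" for n
    by (rule fmap_linear)
      (auto simp: additive_def single_add O.module B.module lookup_single when_def intro!: poly_mapping_eqI)
  have "(\<Sum>n\<in>S. Poly_Mapping.single n (Poly_Mapping.lookup f n)) \<in> adic p Om k" for S
  proof (induction S rule: infinite_finite_induct)
    case (insert n S)
    then show ?case
      using O.adic_add[OF fmap_adic[OF sing[of n] spec[OF *, of n]]] by simp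
  qed (use O.adic_zero in simp_all)
  then show "f \<in> adic p Om k" using poly_mapping_sum_single[of f] by metis
qed

lemma H_ext:
  assumes f: "contin p H C f" and g: "contin p H C g" and C: "separated p C" "rmod C"
    and eq: "\<And>r n. f (r \<odot>\<^bsub>H\<^esub> \<omega> n) = g (r \<odot>\<^bsub>H\<^esub> \<omega> n)" and x: "x \<in> carrier H"
  shows "f x = g x"
  using f g C _ x unfolding H_def
proof (rule O.completion_ext)
  have fa: "additive Om C (\<lambda>h. f (tc h))" and ga: "additive Om C (\<lambda>h. g (tc h))"
    using f g additive_comp[OF fmap_additive[OF tc_fmap]] by (auto simp: contin_def)
  show "f (tc h) = g (tc h)" for h
  proof (induction h rule: omega_induct)
    case 0
    show ?case using eq[of 0 0] tc_single[of 0 0] by simp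
  next
    case (single n r)
    show ?case using eq by (simp add: tc_single)
  next
    case (add h k)
    then show ?case using additive_add[OF fa, of h k] additive_add[OF ga, of h k] by simp
  qed
qed

section \<open>Coefficients and the augmentation\<close>

lemma coef_ex: "\<exists>h. fmap p H base_algebra h \<and> (\<forall>f. h (tc f) = Poly_Mapping.lookup f n)"
proof -
  have "fmap p Om base_algebra (\<lambda>f. Poly_Mapping.lookup f n)"
    by (rule fmap_linear) (simp_all add: additive_def lookup_add O.module B.module)
  from O.completion_lift[OF base_complete[OF W] this] show ?thesis by (simp add: H_def)
qed

text \<open>\<open>lookup\<close> extends to the completion because \<open>R\<close> itself is
  complete; density makes the chosen extension the only one on the carrier.\<close>

definition coef :: "nat \<Rightarrow> 'w omega \<Rightarrow> 'w fps" where
  "coef n = (SOME h. fmap p H base_algebra h \<and> (\<forall>f. h (tc f) = Poly_Mapping.lookup f n))"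

lemma coef_fmap: "fmap p H base_algebra (coef n)" and coef_tc: "coef n (tc f) = Poly_Mapping.lookup f n"
  using someI_ex[OF coef_ex, of n, folded coef_def] by blast+

lemma coef_add: "x \<in> carrier H \<Longrightarrow> y \<in> carrier H \<Longrightarrow> coef n (x \<oplus>\<^bsub>H\<^esub> y) = coef n x + coef n y"
  using fmap_add[OF coef_fmap] by simp

lemma coef_omega: "coef m (r \<odot>\<^bsub>H\<^esub> \<omega> n) = (if m = n then r else 0)"
  using coef_tc[of m "Poly_Mapping.single n r"] by (simp add: tc_single lookup_single when_def)

lemma base_separated: "separated p (base_algebra :: ('w fps, 'w fps) module)"
  by (rule complete_separated[OF base_complete[OF W]])

lemma coef_smult:
  assumes x: "x \<in> carrier H" shows "coef n (r \<odot>\<^bsub>H\<^esub> x) = r * coef n x"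
proof (rule H_ext[OF fmap_contin[OF fmap_comp[OF fmap_smult[OF H_rmod] coef_fmap]] fmap_contin
      base_separated B.module _ x])
  show "fmap p H base_algebra (\<lambda>x. r * coef n x)"
    using fmap_comp[OF coef_fmap fmap_smult[OF B.module]] by simp
qed (simp add: HM.smult_smult coef_omega)

text \<open>A finite approximation of order \<open>k\<close> to \<open>x\<close> has all its
  coefficients in step \<open>k\<close> and so lies in step \<open>k\<close>, as the topology of the
  free module is coefficientwise. Hence \<open>x\<close> lies in every step.\<close>

lemma coef_eq_0:
  assumes x: "x \<in> carrier H" and c: "\<And>n. coef n x = 0" shows "x = \<zero>\<^bsub>H\<^esub>"
proof -
  have "x \<in> adic p H k" for k
  proof -
    obtain f where f: "x \<ominus>\<^bsub>H\<^esub> tc f \<in> adic p H k"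
      using O.completion_dense[of x p k] x by (auto simp: H_def)
    have "coef n (x \<ominus>\<^bsub>H\<^esub> tc f) \<in> adic p base_algebra k" for n
      by (rule fmap_adic[OF coef_fmap f])
    moreover have "coef n (x \<ominus>\<^bsub>H\<^esub> tc f) = - Poly_Mapping.lookup f n" for n
      using additive_diff[OF fmap_additive[OF coef_fmap] H_rmod B.module x tc_closed, of n f] c
      by (simp add: coef_tc)
    ultimately have "- Poly_Mapping.lookup f n \<in> adic p base_algebra k" for n
      by metis
    then have "(- 1) * - Poly_Mapping.lookup f n \<in> adic p base_algebra k" for n
      using B.adic_smult by (metis base_algebra_simps(2))
    then have "f \<in> adic p Om k" by (simp add: omega_adic_iff)
    then have "tc f \<in> adic p H k" by (rule fmap_adic[OF tc_fmap])
    then show ?thesis using HM.adic_of_diff[OF x f] by blast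
  qed
  then show ?thesis using H_separated x by (simp add: separated_def)
qed

text \<open>The coefficients embed \<open>H\<close> into a product of copies of \<open>R\<close>,
  where \<open>r\<close> can be cancelled; completing has therefore not created torsion.\<close>

lemma regular_H:
  assumes "regular r" "x \<in> carrier H" "r \<odot>\<^bsub>H\<^esub> x = \<zero>\<^bsub>H\<^esub>" shows "x = \<zero>\<^bsub>H\<^esub>"
proof (rule coef_eq_0[OF assms(2)])
  fix n
  have "r * coef n x = 0"
    using coef_smult[OF assms(2), of n r] assms(3) additive_zero[OF fmap_additive[OF coef_fmap] H_rmod B.module]
    by simp
  then show "coef n x = 0" by (rule regular_0D[OF assms(1)])
qed

text \<open>The augmentation is the character with \<open>j = 0\<close>, at which \<theta>(q)
  becomes q. This is why the coefficient of the unit is multiplicative.\<close>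

lemma coef_0_tc: "coef 0 (tc f) = ev f 0"
  by (simp add: coef_tc ev_def bv_def)

lemma coef_0_mult:
  assumes x: "x \<in> carrier H" and y: "y \<in> carrier H"
  shows "coef 0 (x \<otimes>\<^bsub>H\<^esub> y) = coef 0 x * coef 0 y"
proof -
  have lin: "fmap p H base_algebra (\<lambda>x. coef 0 x * r)" for r
    using fmap_comp[OF coef_fmap[of 0] fmap_smult[OF B.module, where r = r]] by (simp add: mult.commute)
  have 1: "coef 0 (x \<otimes>\<^bsub>H\<^esub> tc g) = coef 0 x * coef 0 (tc g)" for g
  proof (rule H_ext[OF fmap_contin[OF fmap_comp[OF ralg_fmap_l[OF H_ralg tc_closed] coef_fmap]]
        fmap_contin[OF lin] base_separated B.module _ x])
    fix r n
    show "coef 0 ((r \<odot>\<^bsub>H\<^esub> \<omega> n) \<otimes>\<^bsub>H\<^esub> tc g) = coef 0 (r \<odot>\<^bsub>H\<^esub> \<omega> n) * coef 0 (tc g)"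
      unfolding tc_single[symmetric] tc_mult[symmetric] coef_0_tc ev_mult ..
  qed
  show ?thesis
  proof (rule H_ext[OF fmap_contin[OF fmap_comp[OF ralg_fmap_r[OF H_ralg x] coef_fmap]]
        fmap_contin base_separated B.module _ y])
    show "fmap p H base_algebra (\<lambda>y. coef 0 x * coef 0 y)" using lin[of "coef 0 x"] by (simp add: mult.commute)
    show "coef 0 (x \<otimes>\<^bsub>H\<^esub> (r \<odot>\<^bsub>H\<^esub> \<omega> n)) = coef 0 x * coef 0 (r \<odot>\<^bsub>H\<^esub> \<omega> n)" for r n
      using 1[of "Poly_Mapping.single n r"] by (simp add: tc_single)
  qed
qed

lemma coef_one: "coef 0 \<one>\<^bsub>H\<^esub> = 1"
  using coef_0_tc[of 1] by (simp add: ev_one tc_one)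

text \<open>\<open>augmentation\<close> is a definite description, so existence and uniqueness are
  both at stake; for uniqueness, linearity makes any competitor continuous and density
  applies.\<close>

lemma augmentation_eq: "x \<in> carrier H \<Longrightarrow> augmentation p x = coef 0 x"
proof -
  assume x: "x \<in> carrier H"
  let ?e = "restrict (coef 0) (carrier H)"
  have "augmentation p = ?e"
    unfolding augmentation_def
  proof (rule the_equality)
    have "?e \<in> ring_hom H base_algebra"
      by (rule ring_hom_memI) (simp_all add: coef_0_mult coef_add coef_one)
    moreover have "?e \<in> linear_maps H base_algebra"
      by (simp add: linear_maps_def coef_add coef_smult)
    moreover have "?e (\<omega> n) = 0" if "n > 0" for n
      using coef_omega[of 0 1 n] that by simp
    ultimately show "?e \<in> algebra_maps H base_algebra \<and> (\<forall>n>0. ?e (\<omega> n) = 0)"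
      by (simp add: algebra_maps_def)
  next
    fix e assume e: "e \<in> algebra_maps H base_algebra \<and> (\<forall>n>0. e (\<omega> n) = 0)"
    then have lin: "additive H base_algebra e" "\<And>r x. x \<in> carrier H \<Longrightarrow> e (r \<odot>\<^bsub>H\<^esub> x) = r * e x"
      and ex: "e \<in> extensional (carrier H)" and e1: "e \<one>\<^bsub>H\<^esub> = 1"
      by (auto simp: algebra_maps_def linear_maps_def additive_def ring_hom_def PiE_def)
    have ef: "fmap p H base_algebra e" by (rule fmap_linear[OF lin(1) H_rmod B.module]) (simp add: lin(2))
    show "e = ?e"
    proof (rule extensionalityI[OF ex restrict_extensional])
      fix x assume "x \<in> carrier H"
      then show "e x = ?e x"
        using H_ext[OF fmap_contin[OF ef] fmap_contin[OF coef_fmap[of 0]] base_separated B.module, of x]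
          e e1 by (auto simp: lin(2) coef_omega omega_pow_0[symmetric])
    qed
  qed
  then show ?thesis using x by simp
qed

text \<open>An element of $\widehat{R\langle\omega\rangle}$ with augmentation $1$ is invertible, because
  modulo $(p, q-1)$ the divided powers $\omega^{\{n\}}$ with $n > 0$ are nilpotent.\<close>

lemma omega_mult_mod: "\<exists>h. Poly_Mapping.single m a \<otimes>\<^bsub>Om\<^esub> Poly_Mapping.single n b =
    Poly_Mapping.single (m + n) (a * b * of_nat (m + n choose m)) + h \<and> h \<in> adic p Om 1"
proof -
  \<comment> \<open>Modulo q - 1 the base \<open>Q\<close> becomes 1, and Gaussian binomials become
    ordinary ones.\<close>
  have qb: "\<exists>u. qbinom Q n k = of_nat (n choose k) + fps_X * u" for n k
  proof (induction Q n k rule: qbinom.induct)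
    case (1 n)
    show ?case by (rule exI[of _ 0]) simp
  next
    case (2 k)
    show ?case by (rule exI[of _ 0]) simp
  next
    case (3 n k)
    then obtain u v where uv: "qbinom Q n k = of_nat (n choose k) + fps_X * u"
      "qbinom Q n (Suc k) = of_nat (n choose Suc k) + fps_X * v" by blast
    have "fps_X dvd q ^ (p * Suc k) - 1 ^ (p * Suc k)" by (rule dvd_power_diff_power) simp
    then obtain w where "q ^ (p * Suc k) - 1 = fps_X * w" by (auto simp: dvd_def)
    then have w: "Q ^ Suc k = 1 + fps_X * w" by (simp only: power_mult[symmetric] diff_eq_eq add.commute)
    show ?case
      by (rule exI[of _ "u + v + w * (of_nat (n choose Suc k) + fps_X * v)"])
        (simp only: qbinom.simps uv w, simp add: algebra_simps)
  qed
  obtain u where u: "qbinom Q (m + n) m = of_nat (m + n choose m) + fps_X * u" using qb by blast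
  define h where "h = Poly_Mapping.single (m + n) (a * b * (fps_X * u)) +
     (\<Sum>i\<in>{0<..min m n}. Poly_Mapping.single (m + n - i) (a * b * omega_coeff p m n i))"
  have "{..min m n} = insert 0 {0<..min m n}" by auto
  then have "Poly_Mapping.single m a \<otimes>\<^bsub>Om\<^esub> Poly_Mapping.single n b =
      Poly_Mapping.single (m + n) (a * b * qbinom Q (m + n) m) +
      (\<Sum>i\<in>{0<..min m n}. Poly_Mapping.single (m + n - i) (a * b * omega_coeff p m n i))"
    by (simp add: omega_single_mult omega_coeff_eq)
  then have eq: "Poly_Mapping.single m a \<otimes>\<^bsub>Om\<^esub> Poly_Mapping.single n b =
      Poly_Mapping.single (m + n) (a * b * of_nat (m + n choose m)) + h"
    unfolding h_def u distrib_left single_add by (simp only: ac_simps)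
  have X: "Poly_Mapping.single k (fps_X * r) \<in> adic p Om 1" for k r
    using B.adic_X[of r p 0] by (auto simp: omega_adic_iff lookup_single when_def intro: B.adic_zero[simplified])
  \<comment> \<open>Every term with \<open>i > 0\<close> carries \<open>s ^ i\<close> and hence a
    factor q - 1, so only the leading term survives modulo the ideal.\<close>
  have "Poly_Mapping.single (m + n - i) (a * b * omega_coeff p m n i) \<in> adic p Om 1" if i: "i > 0" for i
  proof -
    obtain j where j: "i = Suc j" using i by (cases i) auto
    have "a * b * omega_coeff p m n i = fps_X * (a * b * (Q ^ tri i * qbinom Q (m + n - i) m * qbinom Q m i * (q * s ^ j)))"
      unfolding omega_coeff_eq j power_Suc by (simp only: ac_simps)
    then show ?thesis using X by metis
  qed
  then have "(\<Sum>i\<in>S. Poly_Mapping.single (m + n - i) (a * b * omega_coeff p m n i)) \<in> adic p Om 1"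
    if "\<And>i. i \<in> S \<Longrightarrow> i > 0" for S
    using that by (induction S rule: infinite_finite_induct) (use O.adic_zero O.adic_add in auto)
  from this[of "{0<..min m n}"]
  have "(\<Sum>i\<in>{0<..min m n}. Poly_Mapping.single (m + n - i) (a * b * omega_coeff p m n i)) \<in> adic p Om 1"
    by simp
  moreover have "Poly_Mapping.single (m + n) (a * b * (fps_X * u)) \<in> adic p Om 1"
    using X[of "m + n" "a * b * u"] by (simp only: ac_simps)
  ultimately have "h \<in> adic p Om 1"
    unfolding h_def using O.adic_add[of _ p 1] by (metis omega_alg_simps(3))
  then show ?thesis using eq by blast
qed

lemma ev_diff: "ev (f - g) j = ev f j - ev g j"
  using ev_add[of "f - g" g j] by simp

lemma ev_minus: "ev (- g) j = - ev g j"
  using ev_diff[of 0 g j] by simp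

lemma omega_one_mult [simp]: "1 \<otimes>\<^bsub>Om\<^esub> f = f"
  by (rule ev_eqI) (simp add: ev_mult ev_one)

lemma ev_pow: "ev (f [^]\<^bsub>Om\<^esub> (k::nat)) j = ev f j ^ k"
  by (induction k) (simp_all add: ev_mult ev_one mult.commute)

lemmas ev_simps = ev_add ev_diff ev_minus ev_mult ev_one ev_pow

lemma omega_ideal: "f \<in> adic p Om k \<Longrightarrow> f \<otimes>\<^bsub>Om\<^esub> g \<in> adic p Om k"
  by (rule fmap_adic[OF ralg_fmap_l[OF omega_ralg]]) simp_all

lemma omega_ideal_add: "f \<in> adic p Om k \<Longrightarrow> g \<in> adic p Om k \<Longrightarrow> f + g \<in> adic p Om k"
  using O.adic_add[of f p k g] by simp

text \<open>Modulo (p, q - 1) these are ordinary divided powers, and the p-th power of one of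
  positive degree is divisible by \<open>p\<close>. The last multiplication alone supplies that
  factor, through the binomial coefficient \<open>p * n choose n\<close>.\<close>

lemma omega_single_nilpotent:
  assumes n: "n > 0"
  shows "Poly_Mapping.single n r [^]\<^bsub>Om\<^esub> p \<in> adic p Om 1"
proof -
  let ?w = "Poly_Mapping.single n r"
  have *: "\<exists>c h. ?w [^]\<^bsub>Om\<^esub> Suc j = Poly_Mapping.single (Suc j * n) c + h \<and> h \<in> adic p Om 1" for j
  proof (induction j)
    case 0
    have "?w [^]\<^bsub>Om\<^esub> Suc 0 = ?w" by (rule ev_eqI) (simp add: ev_pow)
    then show ?case using O.adic_zero[of p 1] by (intro exI[of _ r] exI[of _ 0]) simp
  next
    case (Suc j)
    then obtain c h where ch: "?w [^]\<^bsub>Om\<^esub> Suc j = Poly_Mapping.single (Suc j * n) c + h" "h \<in> adic p Om 1" by blast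
    obtain h' where h': "Poly_Mapping.single (Suc j * n) c \<otimes>\<^bsub>Om\<^esub> ?w =
      Poly_Mapping.single (Suc j * n + n) (c * r * of_nat (Suc j * n + n choose (Suc j * n))) + h'" "h' \<in> adic p Om 1"
      using omega_mult_mod by blast
    have "?w [^]\<^bsub>Om\<^esub> Suc (Suc j) = Poly_Mapping.single (Suc j * n) c \<otimes>\<^bsub>Om\<^esub> ?w + h \<otimes>\<^bsub>Om\<^esub> ?w"
      using arg_cong[OF ch(1), of "\<lambda>f. f \<otimes>\<^bsub>Om\<^esub> ?w"]
      by (simp only: OR.nat_pow_Suc) (rule ev_eqI, simp add: ev_simps algebra_simps)
    also have "\<dots> = Poly_Mapping.single (Suc (Suc j) * n) (c * r * of_nat (Suc j * n + n choose (Suc j * n))) + (h' + h \<otimes>\<^bsub>Om\<^esub> ?w)"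
    proof -
      have "Suc j * n + n = Suc (Suc j) * n" by simp
      then show ?thesis using h'(1) by (simp only: add.assoc)
    qed
    finally show ?case using omega_ideal_add[OF h'(2) omega_ideal[OF ch(2), of ?w]] by blast
  qed
  obtain j where "p = 2 + j" using le_Suc_ex[OF prime_ge_2_nat[OF prime]] by blast
  then have j: "p = Suc (Suc j)" by simp
  obtain c h where ch: "?w [^]\<^bsub>Om\<^esub> Suc j = Poly_Mapping.single (Suc j * n) c + h" "h \<in> adic p Om 1"
    using * by blast
  obtain h' where h': "Poly_Mapping.single (Suc j * n) c \<otimes>\<^bsub>Om\<^esub> ?w =
    Poly_Mapping.single (Suc j * n + n) (c * r * of_nat (Suc j * n + n choose (Suc j * n))) + h'" "h' \<in> adic p Om 1"
    using omega_mult_mod by blast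
  have pn: "Suc j * n + n = p * n" by (simp add: j)
  \<comment> \<open>Absorption; the factor \<open>n\<close> is then cancelled in the natural
    numbers, leaving a multiple of \<open>p\<close>.\<close>
  have "n * (p * n choose n) = p * n * (p * n - 1 choose (n - 1))"
    using times_binomial_minus1_eq[OF n, of "p * n"] .
  then have "(p * n choose n) = p * (p * n - 1 choose (n - 1))" using n by (simp add: mult.left_commute)
  moreover have "(p * n choose (Suc j * n)) = (p * n choose n)"
  proof -
    have "p * n - n = Suc j * n" using pn by simp
    moreover have "n \<le> p * n" unfolding pn[symmetric] by simp
    ultimately show ?thesis using binomial_symmetric[of n "p * n"] by simp
  qed
  ultimately obtain m where m: "(Suc j * n + n choose (Suc j * n)) = p * m" using pn by metis
  have "Poly_Mapping.single (p * n) (c * r * of_nat (p * m)) \<in> adic p Om 1"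
    using B.adic_p[of "c * r * of_nat m" p 0] B.adic_zero[of p 1]
    by (simp add: omega_adic_iff lookup_single when_def ac_simps)
  moreover have "?w [^]\<^bsub>Om\<^esub> p = Poly_Mapping.single (Suc j * n) c \<otimes>\<^bsub>Om\<^esub> ?w + h \<otimes>\<^bsub>Om\<^esub> ?w"
  proof -
    have "?w [^]\<^bsub>Om\<^esub> p = ?w [^]\<^bsub>Om\<^esub> Suc j \<otimes>\<^bsub>Om\<^esub> ?w"
      using OR.nat_pow_Suc[of ?w "Suc j"] by (simp only: j[symmetric])
    then show ?thesis unfolding ch(1) by (simp only:) (rule ev_eqI, simp add: ev_simps algebra_simps)
  qed
  ultimately show ?thesis
    using omega_ideal_add[OF omega_ideal_add[OF _ h'(2)] omega_ideal[OF ch(2), of ?w]]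
    unfolding h'(1) m unfolding pn by metis
qed

definition unit_mod :: "(nat \<Rightarrow>\<^sub>0 'w fps) \<Rightarrow> bool" where
  "unit_mod f \<longleftrightarrow> (\<exists>v h. f \<otimes>\<^bsub>Om\<^esub> v = 1 + h \<and> h \<in> adic p Om 1)"

text \<open>A finite geometric series in the negative of \<open>x\<close>, whose remainder is a
  multiple of the k-th power of \<open>x\<close>.\<close>

lemma unit_mod_nilpotent:
  assumes x: "x [^]\<^bsub>Om\<^esub> (k::nat) \<in> adic p Om 1" shows "unit_mod (1 + x)"
proof -
  have "\<exists>w. (1 + x) \<otimes>\<^bsub>Om\<^esub> w = 1 - (0 - x) [^]\<^bsub>Om\<^esub> k" for k :: nat
  proof (induction k)
    case 0
    show ?case by (rule exI[of _ 0]) (rule ev_eqI, simp add: ev_simps)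
  next
    case (Suc k)
    then obtain w where w: "(1 + x) \<otimes>\<^bsub>Om\<^esub> w = 1 - (0 - x) [^]\<^bsub>Om\<^esub> k" by blast
    have "(1 + x) \<otimes>\<^bsub>Om\<^esub> (1 - x \<otimes>\<^bsub>Om\<^esub> w) = 1 - (0 - x) [^]\<^bsub>Om\<^esub> Suc k"
    proof (rule ev_eqI)
      fix j
      have "(1 + ev x j) * ev w j = 1 - (- ev x j) ^ k"
        using arg_cong[OF w, of "\<lambda>f. ev f j"] by (simp add: ev_simps)
      moreover have "(1 + ev x j) * (1 - ev x j * ev w j) = 1 + ev x j - ev x j * ((1 + ev x j) * ev w j)"
        by (simp add: algebra_simps)
      ultimately have "(1 + ev x j) * (1 - ev x j * ev w j) = 1 + ev x j - ev x j * (1 - (- ev x j) ^ k)"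
        by simp
      then show "ev ((1 + x) \<otimes>\<^bsub>Om\<^esub> (1 - x \<otimes>\<^bsub>Om\<^esub> w)) j = ev (1 - (0 - x) [^]\<^bsub>Om\<^esub> Suc k) j"
        by (simp add: ev_simps algebra_simps del: OR.nat_pow_Suc)
    qed
    then show ?case by blast
  qed
  then obtain w where w: "(1 + x) \<otimes>\<^bsub>Om\<^esub> w = 1 - (0 - x) [^]\<^bsub>Om\<^esub> k" by blast
  have "0 - (0 - x) [^]\<^bsub>Om\<^esub> k = x [^]\<^bsub>Om\<^esub> k \<otimes>\<^bsub>Om\<^esub> (0 - (0 - 1) [^]\<^bsub>Om\<^esub> k)"
    by (rule ev_eqI) (simp add: ev_simps power_mult_distrib[symmetric])
  then have "0 - (0 - x) [^]\<^bsub>Om\<^esub> k \<in> adic p Om 1" using omega_ideal[OF x] by simp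
  moreover have "(1 + x) \<otimes>\<^bsub>Om\<^esub> w = 1 + (0 - (0 - x) [^]\<^bsub>Om\<^esub> k)" using w by simp
  ultimately show ?thesis unfolding unit_mod_def by blast
qed

text \<open>A unit plus a nilpotent. After multiplication by an inverse \<open>v\<close> of
  \<open>u\<close> modulo the ideal, what is added to 1 is \<open>h\<close> plus a multiple of
  \<open>a\<close>; its k-th power is that of the multiple of \<open>a\<close> up to a multiple of
  \<open>h\<close>.\<close>

lemma unit_mod_add:
  assumes u: "unit_mod u" and a: "a [^]\<^bsub>Om\<^esub> (k::nat) \<in> adic p Om 1" shows "unit_mod (u + a)"
proof -
  obtain v h where v: "u \<otimes>\<^bsub>Om\<^esub> v = 1 + h" "h \<in> adic p Om 1" using u by (auto simp: unit_mod_def)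
  let ?y = "a \<otimes>\<^bsub>Om\<^esub> v"
  have "?y [^]\<^bsub>Om\<^esub> k = a [^]\<^bsub>Om\<^esub> k \<otimes>\<^bsub>Om\<^esub> v [^]\<^bsub>Om\<^esub> k"
    by (rule ev_eqI) (simp add: ev_simps power_mult_distrib)
  then have y: "?y [^]\<^bsub>Om\<^esub> k \<in> adic p Om 1" using omega_ideal[OF a] by simp
  have "\<exists>z. (h + ?y) [^]\<^bsub>Om\<^esub> k = ?y [^]\<^bsub>Om\<^esub> k + h \<otimes>\<^bsub>Om\<^esub> z" for k :: nat
  proof (induction k)
    case 0
    show ?case by (rule exI[of _ 0]) (rule ev_eqI, simp add: ev_simps)
  next
    case (Suc k)
    then obtain z where z: "(h + ?y) [^]\<^bsub>Om\<^esub> k = ?y [^]\<^bsub>Om\<^esub> k + h \<otimes>\<^bsub>Om\<^esub> z" by blast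
    have "(h + ?y) [^]\<^bsub>Om\<^esub> Suc k = (?y [^]\<^bsub>Om\<^esub> k + h \<otimes>\<^bsub>Om\<^esub> z) \<otimes>\<^bsub>Om\<^esub> (h + ?y)"
      unfolding OR.nat_pow_Suc z ..
    also have "\<dots> = ?y [^]\<^bsub>Om\<^esub> Suc k + h \<otimes>\<^bsub>Om\<^esub> (?y [^]\<^bsub>Om\<^esub> k + z \<otimes>\<^bsub>Om\<^esub> (h + ?y))"
      by (rule ev_eqI) (simp add: ev_simps algebra_simps)
    finally show ?case by blast
  qed
  then obtain z where "(h + ?y) [^]\<^bsub>Om\<^esub> k = ?y [^]\<^bsub>Om\<^esub> k + h \<otimes>\<^bsub>Om\<^esub> z" by blast
  then have "(h + ?y) [^]\<^bsub>Om\<^esub> k \<in> adic p Om 1"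
    using omega_ideal_add[OF y omega_ideal[OF v(2)]] by simp
  then have "unit_mod (1 + (h + ?y))" by (rule unit_mod_nilpotent)
  then obtain w h' where w: "(1 + (h + ?y)) \<otimes>\<^bsub>Om\<^esub> w = 1 + h'" "h' \<in> adic p Om 1"
    by (auto simp: unit_mod_def)
  have "(u + a) \<otimes>\<^bsub>Om\<^esub> (v \<otimes>\<^bsub>Om\<^esub> w) = (u \<otimes>\<^bsub>Om\<^esub> v + ?y) \<otimes>\<^bsub>Om\<^esub> w"
    by (rule ev_eqI) (simp add: ev_simps algebra_simps)
  also have "\<dots> = 1 + h'" using w(1) by (simp add: v(1) add.assoc)
  finally show ?thesis using w(2) unfolding unit_mod_def by blast
qed

lemma unit_mod_finite:
  assumes f: "Poly_Mapping.lookup f 0 - 1 \<in> adic p base_algebra 1" shows "unit_mod f"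
proof -
  let ?c = "Poly_Mapping.single 0 (Poly_Mapping.lookup f 0 - 1)"
  have c: "?c [^]\<^bsub>Om\<^esub> (1::nat) \<in> adic p Om 1"
    using f B.adic_zero[of p 1] by (simp add: omega_adic_iff lookup_single when_def)
  have "unit_mod (1 + ?c)" by (rule unit_mod_nilpotent[OF c])
  then have "unit_mod (1 + ?c + (\<Sum>n\<in>S. Poly_Mapping.single n (Poly_Mapping.lookup f n)))" if "0 \<notin> S" for S
    using that
  proof (induction S rule: infinite_finite_induct)
    case (insert n S)
    then have n: "n > 0" by (cases n) auto
    have "unit_mod (1 + ?c + (\<Sum>n\<in>S. Poly_Mapping.single n (Poly_Mapping.lookup f n)) + Poly_Mapping.single n (Poly_Mapping.lookup f n))"
      by (rule unit_mod_add[OF _ omega_single_nilpotent[OF n]]) (use insert in simp)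
    then show ?case using insert by (simp add: ac_simps)
  qed simp_all
  moreover have "1 + ?c + (\<Sum>n\<in>Poly_Mapping.keys f - {0}. Poly_Mapping.single n (Poly_Mapping.lookup f n)) = f"
  proof -
    have "1 + ?c = Poly_Mapping.single 0 (Poly_Mapping.lookup f 0)"
      by (rule poly_mapping_eqI) (simp add: lookup_add lookup_single lookup_one when_def)
    moreover have "(\<Sum>n\<in>Poly_Mapping.keys f. Poly_Mapping.single n (Poly_Mapping.lookup f n)) =
        Poly_Mapping.single 0 (Poly_Mapping.lookup f 0) +
        (\<Sum>n\<in>Poly_Mapping.keys f - {0}. Poly_Mapping.single n (Poly_Mapping.lookup f n))"
    proof (cases "0 \<in> Poly_Mapping.keys f")
      case True
      then show ?thesis by (simp add: sum.remove)
    next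
      case False
      then have "Poly_Mapping.lookup f 0 = 0" by (simp add: in_keys_iff)
      then show ?thesis using False by simp
    qed
    ultimately show ?thesis using poly_mapping_sum_single[of f] by metis
  qed
  ultimately show ?thesis by (metis (no_types, lifting) DiffE singletonI)
qed

text \<open>The solution is the fixed point of t |-> 1 - c t; since \<open>c\<close> lies in step 1,
  each iteration gains one step.\<close>

lemma H_geometric:
  assumes c: "c \<in> adic p H 1" shows "\<exists>t\<in>carrier H. (\<one>\<^bsub>H\<^esub> \<oplus>\<^bsub>H\<^esub> c) \<otimes>\<^bsub>H\<^esub> t = \<one>\<^bsub>H\<^esub>"
proof -
  have cc: "c \<in> carrier H" by (rule HM.adic_closed[OF c])
  define t where "t n = ((\<lambda>t. \<one>\<^bsub>H\<^esub> \<ominus>\<^bsub>H\<^esub> c \<otimes>\<^bsub>H\<^esub> t) ^^ n) \<zero>\<^bsub>H\<^esub>" for n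
  have t_Suc: "t (Suc n) = \<one>\<^bsub>H\<^esub> \<ominus>\<^bsub>H\<^esub> c \<otimes>\<^bsub>H\<^esub> t n" for n by (simp add: t_def)
  have tc: "t n \<in> carrier H" for n by (induction n) (simp_all add: t_Suc cc, simp add: t_def)
  have "t (Suc n) \<ominus>\<^bsub>H\<^esub> t n \<in> adic p H n" for n
  proof (induction n)
    case (Suc n)
    have "t n \<ominus>\<^bsub>H\<^esub> t (Suc n) \<in> adic p H n" by (rule HM.adic_diff_swap[OF tc tc Suc])
    from adic_mult[OF H_ralg c this] have "c \<otimes>\<^bsub>H\<^esub> (t n \<ominus>\<^bsub>H\<^esub> t (Suc n)) \<in> adic p H (Suc n)" by simp
    moreover have "t (Suc (Suc n)) \<ominus>\<^bsub>H\<^esub> t (Suc n) = c \<otimes>\<^bsub>H\<^esub> (t n \<ominus>\<^bsub>H\<^esub> t (Suc n))"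
      unfolding t_Suc[of "Suc n"] using tc[of n] tc[of "Suc n"] cc t_Suc[of n] by algebra
    ultimately show ?case by simp
  qed (simp add: tc)
  then have "cauchy p H t" using tc by (simp add: cauchy_def)
  then obtain l where l: "l \<in> carrier H" "\<And>n. l \<ominus>\<^bsub>H\<^esub> t n \<in> adic p H n"
    using H_complete unfolding complete_def by blast
  have "(\<one>\<^bsub>H\<^esub> \<oplus>\<^bsub>H\<^esub> c) \<otimes>\<^bsub>H\<^esub> l = \<one>\<^bsub>H\<^esub>"
  proof (rule separated_eqI[OF H_separated H_rmod])
    fix n
    have "l \<ominus>\<^bsub>H\<^esub> t (Suc n) \<in> adic p H n" using l(2)[of "Suc n"] HM.adic_Suc_subset by blast
    moreover have "c \<otimes>\<^bsub>H\<^esub> (l \<ominus>\<^bsub>H\<^esub> t n) \<in> adic p H n"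
      by (rule fmap_adic[OF ralg_fmap_r[OF H_ralg cc] l(2)])
    ultimately have "(l \<ominus>\<^bsub>H\<^esub> t (Suc n)) \<oplus>\<^bsub>H\<^esub> c \<otimes>\<^bsub>H\<^esub> (l \<ominus>\<^bsub>H\<^esub> t n) \<in> adic p H n" by (rule HM.adic_add)
    moreover have "(l \<ominus>\<^bsub>H\<^esub> t (Suc n)) \<oplus>\<^bsub>H\<^esub> c \<otimes>\<^bsub>H\<^esub> (l \<ominus>\<^bsub>H\<^esub> t n) = (\<one>\<^bsub>H\<^esub> \<oplus>\<^bsub>H\<^esub> c) \<otimes>\<^bsub>H\<^esub> l \<ominus>\<^bsub>H\<^esub> \<one>\<^bsub>H\<^esub>"
    proof -
      have "(\<one>\<^bsub>H\<^esub> \<oplus>\<^bsub>H\<^esub> c) \<otimes>\<^bsub>H\<^esub> l = l \<oplus>\<^bsub>H\<^esub> c \<otimes>\<^bsub>H\<^esub> l" using l(1) cc by (simp add: H.l_distr)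
      then show ?thesis unfolding t_Suc using tc[of n] l(1) cc H.one_closed by algebra
    qed
    ultimately show "(\<one>\<^bsub>H\<^esub> \<oplus>\<^bsub>H\<^esub> c) \<otimes>\<^bsub>H\<^esub> l \<ominus>\<^bsub>H\<^esub> \<one>\<^bsub>H\<^esub> \<in> adic p H n" by simp
  qed (use cc l in simp_all)
  then show ?thesis using l(1) by blast
qed

text \<open>By density \<open>x\<close> is congruent modulo the ideal to a finite sum with constant
  term congruent to 1. An inverse of that sum modulo the ideal is corrected by a geometric
  series.\<close>

lemma H_unit:
  assumes x: "x \<in> carrier H" and e: "coef 0 x = 1"
  shows "\<exists>y\<in>carrier H. x \<otimes>\<^bsub>H\<^esub> y = \<one>\<^bsub>H\<^esub>"
proof -
  obtain f where f: "x \<ominus>\<^bsub>H\<^esub> tc f \<in> adic p H 1"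
    using O.completion_dense[of x p 1] x by (auto simp: H_def)
  have "coef 0 (x \<ominus>\<^bsub>H\<^esub> tc f) \<in> adic p base_algebra 1" by (rule fmap_adic[OF coef_fmap f])
  then have "1 - Poly_Mapping.lookup f 0 \<in> adic p base_algebra 1"
    using additive_diff[OF fmap_additive[OF coef_fmap] H_rmod B.module x tc_closed, of 0 f] e by (simp add: coef_tc)
  then have "Poly_Mapping.lookup f 0 - 1 \<in> adic p base_algebra 1"
    using B.adic_diff_swap[of 1 "Poly_Mapping.lookup f 0" p 1] by simp
  then obtain v h where v: "f \<otimes>\<^bsub>Om\<^esub> v = 1 + h" "h \<in> adic p Om 1"
    using unit_mod_finite unfolding unit_mod_def by blast
  define c where "c = tc h \<oplus>\<^bsub>H\<^esub> (x \<ominus>\<^bsub>H\<^esub> tc f) \<otimes>\<^bsub>H\<^esub> tc v"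
  have "c \<in> adic p H 1"
    unfolding c_def
    by (rule HM.adic_add[OF fmap_adic[OF tc_fmap v(2)] fmap_adic[OF ralg_fmap_l[OF H_ralg] f]]) simp
  then obtain t where t: "t \<in> carrier H" "(\<one>\<^bsub>H\<^esub> \<oplus>\<^bsub>H\<^esub> c) \<otimes>\<^bsub>H\<^esub> t = \<one>\<^bsub>H\<^esub>" using H_geometric by blast
  have fv: "tc f \<otimes>\<^bsub>H\<^esub> tc v = \<one>\<^bsub>H\<^esub> \<oplus>\<^bsub>H\<^esub> tc h" by (simp add: tc_mult[symmetric] v tc_add tc_one)
  have "x \<otimes>\<^bsub>H\<^esub> tc v = tc f \<otimes>\<^bsub>H\<^esub> tc v \<oplus>\<^bsub>H\<^esub> (x \<ominus>\<^bsub>H\<^esub> tc f) \<otimes>\<^bsub>H\<^esub> tc v"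
    using x tc_closed[of f] tc_closed[of v] by algebra
  also have "\<dots> = \<one>\<^bsub>H\<^esub> \<oplus>\<^bsub>H\<^esub> c"
    unfolding fv c_def using x by (simp add: H.a_assoc)
  finally have "x \<otimes>\<^bsub>H\<^esub> (tc v \<otimes>\<^bsub>H\<^esub> t) = \<one>\<^bsub>H\<^esub>"
    using t x by (simp add: H.m_assoc[symmetric])
  then show ?thesis using t by (intro bexI[of _ "tc v \<otimes>\<^bsub>H\<^esub> t"]) simp_all
qed

end

section \<open>The Taylor homomorphism\<close>

lemma omega_bimodule_simps [simp]:
  "carrier (omega_bimodule p \<theta>) = carrier (omega_hat p)"
  "add (omega_bimodule p \<theta>) = add (omega_hat p)"
  "ring.zero (omega_bimodule p \<theta>) = ring.zero (omega_hat p)"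
  "monoid.mult (omega_bimodule p \<theta>) = monoid.mult (omega_hat p)"
  "monoid.one (omega_bimodule p \<theta>) = monoid.one (omega_hat p)"
  "module.smult (omega_bimodule p \<theta>) = module.smult (omega_hat p)"
  "rsmult (omega_bimodule p \<theta>) x r = x \<otimes>\<^bsub>omega_hat p\<^esub> \<theta> r"
  by (simp_all add: omega_bimodule_def module.defs bimodule.defs)

locale taylor = pcomplete p W
  for p :: nat and W :: "'w::comm_ring_1 itself" +
  fixes \<theta> :: "'w fps \<Rightarrow> 'w omega"
  assumes \<theta>: "is_Taylor_hom p \<theta>"
begin

abbreviation P :: "('w fps, 'w omega) bimodule" where "P \<equiv> omega_bimodule p \<theta>"
abbreviation y :: "'w omega" where "y \<equiv> \<theta> q"

lemma adic_P [simp]: "adic p P n = adic p H n"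
  by (rule adic_cong) simp_all

lemma fmap_P: "fmap p P C f \<longleftrightarrow> fmap p H C f" "fmap p D P g \<longleftrightarrow> fmap p D H g"
  by (simp_all add: fmap_def additive_def)

lemma additive_P: "additive P C f \<longleftrightarrow> additive H C f" "additive D P g \<longleftrightarrow> additive D H g"
  by (simp_all add: additive_def)

lemma \<theta>_closed [simp]: "\<theta> r \<in> carrier H"
  and \<theta>_add: "\<theta> (r + t) = \<theta> r \<oplus>\<^bsub>H\<^esub> \<theta> t"
  and \<theta>_mult: "\<theta> (r * t) = \<theta> r \<otimes>\<^bsub>H\<^esub> \<theta> t"
  and \<theta>_one [simp]: "\<theta> 1 = \<one>\<^bsub>H\<^esub>"
  and \<theta>_const: "\<theta> (fps_const w) = fps_const w \<odot>\<^bsub>H\<^esub> \<one>\<^bsub>H\<^esub>"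
  and \<theta>_q: "y = q \<odot>\<^bsub>H\<^esub> \<one>\<^bsub>H\<^esub> \<oplus>\<^bsub>H\<^esub> xi p"
  using \<theta> by (auto simp: is_Taylor_hom_def ring_hom_def)

lemma xi_closed [simp]: "xi p \<in> carrier H"
  by (simp add: xi_def)

lemma smult_mult_l: "a \<in> carrier H \<Longrightarrow> b \<in> carrier H \<Longrightarrow> (r \<odot>\<^bsub>H\<^esub> a) \<otimes>\<^bsub>H\<^esub> b = r \<odot>\<^bsub>H\<^esub> (a \<otimes>\<^bsub>H\<^esub> b)"
  and smult_mult_r: "a \<in> carrier H \<Longrightarrow> b \<in> carrier H \<Longrightarrow> a \<otimes>\<^bsub>H\<^esub> (r \<odot>\<^bsub>H\<^esub> b) = r \<odot>\<^bsub>H\<^esub> (a \<otimes>\<^bsub>H\<^esub> b)"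
  by (simp_all add: ralg_smult[OF H_ralg])

lemma smult_one_mult: "a \<in> carrier H \<Longrightarrow> (r \<odot>\<^bsub>H\<^esub> \<one>\<^bsub>H\<^esub>) \<otimes>\<^bsub>H\<^esub> a = r \<odot>\<^bsub>H\<^esub> a"
  by (simp add: smult_mult_l)

lemma \<theta>_X: "\<theta> fps_X = fps_X \<odot>\<^bsub>H\<^esub> \<one>\<^bsub>H\<^esub> \<oplus>\<^bsub>H\<^esub> xi p"
proof -
  have "\<one>\<^bsub>H\<^esub> \<oplus>\<^bsub>H\<^esub> \<theta> fps_X = \<one>\<^bsub>H\<^esub> \<oplus>\<^bsub>H\<^esub> (fps_X \<odot>\<^bsub>H\<^esub> \<one>\<^bsub>H\<^esub> \<oplus>\<^bsub>H\<^esub> xi p)"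
    using \<theta>_add[of 1 fps_X] \<theta>_q by (simp add: HM.smult_add_l H.a_assoc)
  then show ?thesis by (simp add: H.add.l_cancel)
qed

text \<open>As a power series in q - 1 the element (p)_q has constant term \<open>p\<close>, so both
  terms of \<theta>(q - 1) = (q - 1) + (p)_q \<omega> lie in the ideal. Continuity of \<theta> and
  of the right action rests on this.\<close>

lemma \<theta>_X_adic: "\<theta> fps_X \<in> adic p H 1"
proof -
  have "qint q p $ 0 = of_nat p"
    unfolding qint_def by (simp add: fps_sum_nth fps_nth_power_0)
  then have "qint q p \<in> adic p base_algebra 1"
    unfolding base_adic by simp
  from adic_base_smult[OF H_rmod this, of "\<omega> 1" 0] have "xi p \<in> adic p H 1" by (simp add: xi_def)
  moreover have "fps_X \<odot>\<^bsub>H\<^esub> \<one>\<^bsub>H\<^esub> \<in> adic p H 1" using HM.adic_X[of "\<one>\<^bsub>H\<^esub>" p 0] by simp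
  ultimately show ?thesis unfolding \<theta>_X using HM.adic_add by simp
qed

lemma \<theta>_fmap: "fmap p base_algebra H \<theta>"
proof (rule fmap_semilinear[OF _ B.module H_rmod, where Y = "\<lambda>z. \<theta> fps_X \<otimes>\<^bsub>H\<^esub> z"])
  show "additive base_algebra H \<theta>" by (simp add: additive_def \<theta>_add)
  show "\<theta> fps_X \<otimes>\<^bsub>H\<^esub> c \<in> adic p H (Suc n)" if "c \<in> adic p H n" for c n
    using adic_mult[OF H_ralg \<theta>_X_adic that] by simp
qed (simp add: \<theta>_mult)

lemma \<theta>_zero [simp]: "\<theta> 0 = \<zero>\<^bsub>H\<^esub>"
  using additive_zero[OF fmap_additive[OF \<theta>_fmap] B.module H_rmod] by simp

lemma coef_\<theta>: "coef 0 (\<theta> r) = r"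
proof (rule base_ext[OF fmap_comp[OF \<theta>_fmap coef_fmap] fmap_id base_separated B.module,
      where Y = "\<lambda>r. fps_X * r"])
  have "coef 0 (xi p) = 0" using coef_omega[of 0 "qint q p" 1] by (simp add: xi_def)
  then have "coef 0 (\<theta> fps_X) = fps_X"
    by (simp add: \<theta>_X coef_add coef_smult coef_one)
  then show "coef 0 (\<theta> (fps_X * r)) = fps_X * coef 0 (\<theta> r)" for r
    by (simp add: \<theta>_mult coef_0_mult)
qed (simp_all add: \<theta>_const coef_smult coef_one)

lemma P_rmod: "rmod P"
  by (rule rmod_cong[OF _ _ _ _ H_rmod]) simp_all

lemma P_ralg: "ralg P"
  by (rule ralg_cong[OF _ _ _ _ _ H_ralg]) simp_all

lemma P_tbimod: "tbimod p P"
  unfolding tbimod_def bimod_def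
proof (intro conjI allI ballI)
  show "additive P P (\<lambda>x. rsmult P x r)" for r
    by (simp add: additive_P ralg_additive_l[OF H_ralg])
  show "rsmult P x fps_X \<in> adic p P (Suc n)" if "x \<in> adic p P n" for x n
    using adic_mult[OF H_ralg _ \<theta>_X_adic, of x n] that by simp
qed (simp_all add: P_rmod smult_mult_l)

lemma P_balg: "balg P"
  unfolding balg_def using tbimod_bimod[OF P_tbimod] P_ralg
  by (simp add: H.m_ac)

section \<open>The completed tensor square of the algebra\<close>

lemma PP: "ct p P P"
  by (rule ct.intro[OF P_tbimod P_tbimod])

end

sublocale taylor \<subseteq> PP: ct p "omega_bimodule p \<theta>" "omega_bimodule p \<theta>" by (rule PP)

context taylor
begin

abbreviation "PP \<equiv> ctensor p P P"
abbreviation "cp \<equiv> cpure p P P"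

lemma PP_ralg: "ralg PP"
  by (rule ralg_ctensor(1)[OF PP P_balg P_balg])

lemma cp_mult: "\<lbrakk>a \<in> carrier H; b \<in> carrier H; c \<in> carrier H; d \<in> carrier H\<rbrakk> \<Longrightarrow>
    cp a b \<otimes>\<^bsub>PP\<^esub> cp c d = cp (a \<otimes>\<^bsub>H\<^esub> c) (b \<otimes>\<^bsub>H\<^esub> d)"
  using ralg_ctensor(2)[OF PP P_balg P_balg, of a b c d] by simp

lemma cp_add_l: "\<lbrakk>a \<in> carrier H; a' \<in> carrier H; b \<in> carrier H\<rbrakk> \<Longrightarrow> cp (a \<oplus>\<^bsub>H\<^esub> a') b = cp a b \<oplus>\<^bsub>PP\<^esub> cp a' b"
  using additive_add[OF PP.cpure_additive_l, of b a a'] by simp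

lemma cp_add_r: "\<lbrakk>a \<in> carrier H; b \<in> carrier H; b' \<in> carrier H\<rbrakk> \<Longrightarrow> cp a (b \<oplus>\<^bsub>H\<^esub> b') = cp a b \<oplus>\<^bsub>PP\<^esub> cp a b'"
  using additive_add[OF PP.cpure_additive_r, of a b b'] by simp

lemma cp_balanced: "a \<in> carrier H \<Longrightarrow> b \<in> carrier H \<Longrightarrow> cp a (r \<odot>\<^bsub>H\<^esub> b) = cp (a \<otimes>\<^bsub>H\<^esub> \<theta> r) b"
  using PP.cpure_balanced[of a b r] by simp

lemma cp_smult: "a \<in> carrier H \<Longrightarrow> b \<in> carrier H \<Longrightarrow> r \<odot>\<^bsub>PP\<^esub> cp a b = cp (r \<odot>\<^bsub>H\<^esub> a) b"
  using PP.cpure_smult[of a b r] by simp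

lemma cp_rsmult: "a \<in> carrier H \<Longrightarrow> b \<in> carrier H \<Longrightarrow> rsmult PP (cp a b) r = cp a (b \<otimes>\<^bsub>H\<^esub> \<theta> r)"
  using PP.cpure_rsmult[of a b r] by simp

lemma PP_ext:
  assumes "fmap p PP C f" "fmap p PP C g" "separated p C" "rmod C"
    "\<And>a b. a \<in> carrier H \<Longrightarrow> b \<in> carrier H \<Longrightarrow> f (cp a b) = g (cp a b)" "z \<in> carrier PP"
  shows "f z = g z"
  by (rule PP.ext[OF assms(1-4) _ assms(6)]) (use assms(5) in simp)

lemma PP_one: "\<one>\<^bsub>PP\<^esub> = cp \<one>\<^bsub>H\<^esub> \<one>\<^bsub>H\<^esub>"
  by (simp add: ctensor_def cpure_def to_completion_def completion_def tensor_def)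

lemma PP_lift:
  assumes l: "\<And>b. b \<in> carrier H \<Longrightarrow> fmap p H C (\<lambda>a. \<beta> a b)"
    and r: "\<And>a. a \<in> carrier H \<Longrightarrow> additive H C (\<beta> a)"
    and bal: "\<And>a b r. a \<in> carrier H \<Longrightarrow> b \<in> carrier H \<Longrightarrow> \<beta> (a \<otimes>\<^bsub>H\<^esub> \<theta> r) b = \<beta> a (r \<odot>\<^bsub>H\<^esub> b)"
    and C: "complete p C"
  shows "\<exists>h. fmap p PP C h \<and> (\<forall>a\<in>carrier H. \<forall>b\<in>carrier H. h (cp a b) = \<beta> a b)"
proof -
  have "balanced p P P C \<beta>"
    by (rule balancedI) (simp_all add: l r bal fmap_P additive_P)
  from PP.lift[OF C this] show ?thesis by auto
qed

text \<open>\<open>E n\<close> is $(p)_q^n\,(n)_{q^p}!$; up to this factor $\omega^{\{n\}}$ is the product of the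
  $\theta(q) - q^{pj+1}$ for $j < n$.\<close>

definition E :: "nat \<Rightarrow> 'w fps" where "E n = qint q p ^ n * qfac Q n"

definition Ew :: "nat \<Rightarrow> 'w omega" where "Ew n = E n \<odot>\<^bsub>H\<^esub> \<omega> n"

lemma Ew_closed [simp]: "Ew n \<in> carrier H" by (simp add: Ew_def)

lemma E_regular: "regular (E n)"
  unfolding E_def by (intro regular_mult regular_power regular_qint_p regular_qfac)

lemma E_0 [simp]: "E 0 = 1" by (simp add: E_def)

lemma Ew_0 [simp]: "Ew 0 = \<one>\<^bsub>H\<^esub>" by (simp add: Ew_def omega_pow_0)

lemma omega_mult_1 [simp]: "f \<otimes>\<^bsub>Om\<^esub> 1 = f"
  by (rule ev_eqI) (simp add: ev_mult ev_one)

lemma omega_mult_one: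
  "\<omega> 1 \<otimes>\<^bsub>H\<^esub> \<omega> n = qint Q (Suc n) \<odot>\<^bsub>H\<^esub> \<omega> (Suc n) \<oplus>\<^bsub>H\<^esub> (qint Q n * s) \<odot>\<^bsub>H\<^esub> \<omega> n"
proof -
  have "Poly_Mapping.single 1 1 \<otimes>\<^bsub>Om\<^esub> Poly_Mapping.single n 1 =
      Poly_Mapping.single (Suc n) (qint Q (Suc n)) + Poly_Mapping.single n (qint Q n * s)"
  proof (cases n)
    case 0
    then show ?thesis by (simp add: omega_single_mult omega_coeff_eq)
  next
    case (Suc m)
    have "{..min 1 n} = {0, 1}" using Suc by auto
    then show ?thesis by (simp add: omega_single_mult omega_coeff_eq tri_def)
  qed
  from arg_cong[OF this, of tc] show ?thesis
    unfolding tc_mult tc_add tc_single[of "Suc n" "qint Q (Suc n)"] tc_single[of n "qint Q n * s"]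
      omega_pow_def[symmetric] .
qed

text \<open>The recursion behind the product formula: multiplication by \<theta>(q) - q^(pn+1)
  raises \<open>n\<close> by one. The diagonal coefficient q + (p)_q (n)_{q^p} (q - 1) q telescopes
  to q^(pn+1).\<close>

lemma y_mult_Ew: "y \<otimes>\<^bsub>H\<^esub> Ew n = Ew (Suc n) \<oplus>\<^bsub>H\<^esub> q ^ (p * n + 1) \<odot>\<^bsub>H\<^esub> Ew n"
proof -
  have c: "q + qint q p * (qint Q n * s) = q ^ (p * n + 1)"
  proof -
    have "qint q p * (qint Q n * s) = q * (((q - 1) * qint q p) * qint Q n)" by (simp add: ac_simps)
    also have "\<dots> = q * (Q ^ n - 1)" by (simp only: qint_mult)
    finally have e: "qint q p * (qint Q n * s) = q * (Q ^ n - 1)" .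
    have "a + a * (b - 1) = b * a" for a b :: "'w fps" by (simp add: algebra_simps)
    then show ?thesis unfolding e power_add power_one_right power_mult .
  qed
  have "y \<otimes>\<^bsub>H\<^esub> Ew n = (q * E n) \<odot>\<^bsub>H\<^esub> \<omega> n \<oplus>\<^bsub>H\<^esub> (qint q p * E n) \<odot>\<^bsub>H\<^esub> (\<omega> 1 \<otimes>\<^bsub>H\<^esub> \<omega> n)"
    by (simp add: \<theta>_q Ew_def H.l_distr smult_mult_l smult_mult_r HM.smult_smult HM.smult_add_r xi_def mult.commute)
  also have "\<dots> = (E (Suc n)) \<odot>\<^bsub>H\<^esub> \<omega> (Suc n) \<oplus>\<^bsub>H\<^esub> (q * E n + qint q p * E n * (qint Q n * s)) \<odot>\<^bsub>H\<^esub> \<omega> n"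
    unfolding omega_mult_one
    by (simp add: HM.smult_add_r HM.smult_add_l HM.smult_smult H.a_ac E_def qfac_Suc ac_simps)
  also have "q * E n + qint q p * E n * (qint Q n * s) = q ^ (p * n + 1) * E n"
    unfolding c[symmetric] by (simp add: algebra_simps)
  finally show ?thesis by (simp add: Ew_def HM.smult_smult)
qed

text \<open>The recursion for \<open>Ew\<close> propagates agreement from 1 to every
  \<open>Ew n\<close>, and cancelling \<open>l (E n)\<close> reaches the divided powers themselves.
  The scalars \<open>l\<close> will be those of \<open>R\<close> or the map \<theta>, which covers
  linear and semilinear identities alike.\<close>

lemma H_unique:
  assumes f: "fmap p H H f" and g: "fmap p H H g"
    and fl: "\<And>r x. x \<in> carrier H \<Longrightarrow> f (r \<odot>\<^bsub>H\<^esub> x) = l r \<otimes>\<^bsub>H\<^esub> f x"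
    and gl: "\<And>r x. x \<in> carrier H \<Longrightarrow> g (r \<odot>\<^bsub>H\<^esub> x) = l r \<otimes>\<^bsub>H\<^esub> g x"
    and fy: "\<And>x. x \<in> carrier H \<Longrightarrow> f (y \<otimes>\<^bsub>H\<^esub> x) = Y \<otimes>\<^bsub>H\<^esub> f x"
    and gy: "\<And>x. x \<in> carrier H \<Longrightarrow> g (y \<otimes>\<^bsub>H\<^esub> x) = Y \<otimes>\<^bsub>H\<^esub> g x"
    and one: "f \<one>\<^bsub>H\<^esub> = g \<one>\<^bsub>H\<^esub>"
    and l: "\<And>r. l r \<in> carrier H"
    and reg: "\<And>n x. x \<in> carrier H \<Longrightarrow> l (E n) \<otimes>\<^bsub>H\<^esub> x = \<zero>\<^bsub>H\<^esub> \<Longrightarrow> x = \<zero>\<^bsub>H\<^esub>"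
    and x: "x \<in> carrier H"
  shows "f x = g x"
proof -
  note cl = fmap_closed[OF f] fmap_closed[OF g]
  have E: "f (Ew n) = g (Ew n)" for n
  proof (induction n)
    case (Suc n)
    have "f (Ew (Suc n)) \<oplus>\<^bsub>H\<^esub> l (q ^ (p * n + 1)) \<otimes>\<^bsub>H\<^esub> f (Ew n) = Y \<otimes>\<^bsub>H\<^esub> f (Ew n)"
      using fy[OF Ew_closed, of n] unfolding y_mult_Ew
      by (subst (asm) fmap_add[OF f]) (simp_all add: fl)
    moreover have "g (Ew (Suc n)) \<oplus>\<^bsub>H\<^esub> l (q ^ (p * n + 1)) \<otimes>\<^bsub>H\<^esub> g (Ew n) = Y \<otimes>\<^bsub>H\<^esub> g (Ew n)"
      using gy[OF Ew_closed, of n] unfolding y_mult_Ew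
      by (subst (asm) fmap_add[OF g]) (simp_all add: gl)
    ultimately have "f (Ew (Suc n)) \<oplus>\<^bsub>H\<^esub> l (q ^ (p * n + 1)) \<otimes>\<^bsub>H\<^esub> g (Ew n) =
        g (Ew (Suc n)) \<oplus>\<^bsub>H\<^esub> l (q ^ (p * n + 1)) \<otimes>\<^bsub>H\<^esub> g (Ew n)"
      using Suc by simp
    then show ?case by (simp add: H.add.r_cancel cl l)
  qed (simp add: one)
  have w: "f (\<omega> n) = g (\<omega> n)" for n
  proof -
    have "l (E n) \<otimes>\<^bsub>H\<^esub> (f (\<omega> n) \<ominus>\<^bsub>H\<^esub> g (\<omega> n)) = l (E n) \<otimes>\<^bsub>H\<^esub> f (\<omega> n) \<ominus>\<^bsub>H\<^esub> l (E n) \<otimes>\<^bsub>H\<^esub> g (\<omega> n)"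
      using additive_diff[OF ralg_additive_r[OF H_ralg l] H_rmod H_rmod cl(1) cl(2)] by simp
    also have "\<dots> = f (Ew n) \<ominus>\<^bsub>H\<^esub> g (Ew n)"
      by (simp add: Ew_def fl gl)
    also have "\<dots> = \<zero>\<^bsub>H\<^esub>" using E[of n] cl by simp
    finally have "f (\<omega> n) \<ominus>\<^bsub>H\<^esub> g (\<omega> n) = \<zero>\<^bsub>H\<^esub>" by (rule reg[rotated]) (simp add: cl)
    then show ?thesis by (simp add: HM.diff_eq_zero_iff cl)
  qed
  show ?thesis
    by (rule H_ext[OF fmap_contin[OF f] fmap_contin[OF g] H_separated H_rmod _ x]) (simp add: fl gl w)
qed

lemma regular_E_smult: "x \<in> carrier H \<Longrightarrow> (E n \<odot>\<^bsub>H\<^esub> \<one>\<^bsub>H\<^esub>) \<otimes>\<^bsub>H\<^esub> x = \<zero>\<^bsub>H\<^esub> \<Longrightarrow> x = \<zero>\<^bsub>H\<^esub>"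
  using regular_H[OF E_regular, of x n] by (simp add: smult_one_mult)

text \<open>Values on the divided powers can be prescribed without any convergence condition:
  \<theta> maps the steps of \<open>R\<close> into those of \<open>H\<close>, so the semilinear map
  on finite sums extends to the completion.\<close>

lemma semilinear_ex:
  assumes b: "\<And>n. b n \<in> carrier H"
  shows "\<exists>S. fmap p H H S \<and> (\<forall>x\<in>carrier H. \<forall>r. S (r \<odot>\<^bsub>H\<^esub> x) = \<theta> r \<otimes>\<^bsub>H\<^esub> S x) \<and> (\<forall>n. S (\<omega> n) = b n)"
proof -
  define h where "h f = finsum H (\<lambda>n. \<theta> (Poly_Mapping.lookup f n) \<otimes>\<^bsub>H\<^esub> b n) (Poly_Mapping.keys f)" for f
  have h: "h f = finsum H (\<lambda>n. \<theta> (Poly_Mapping.lookup f n) \<otimes>\<^bsub>H\<^esub> b n) S"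
    if "finite S" "Poly_Mapping.keys f \<subseteq> S" for f S
    unfolding h_def
    by (rule H.add.finprod_mono_neutral_cong_left) (use that b in \<open>auto simp: in_keys_iff\<close>)
  have hc: "h f \<in> carrier H" for f
    unfolding h_def by (rule H.finsum_closed) (use b in auto)
  have hadd: "h (f + g) = h f \<oplus>\<^bsub>H\<^esub> h g" for f g
  proof -
    let ?S = "Poly_Mapping.keys f \<union> Poly_Mapping.keys g"
    have "h (f + g) = finsum H (\<lambda>n. \<theta> (Poly_Mapping.lookup f n) \<otimes>\<^bsub>H\<^esub> b n \<oplus>\<^bsub>H\<^esub> \<theta> (Poly_Mapping.lookup g n) \<otimes>\<^bsub>H\<^esub> b n) ?S"
      using h[of ?S "f + g"] keys_add[of f g] b by (simp add: lookup_add \<theta>_add H.l_distr)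
    also have "\<dots> = h f \<oplus>\<^bsub>H\<^esub> h g"
      using h[of ?S f] h[of ?S g] b by (subst H.finsum_addf) auto
    finally show ?thesis .
  qed
  have hs: "h (Poly_Mapping.map ((*) r) f) = \<theta> r \<otimes>\<^bsub>H\<^esub> h f" for r f
  proof -
    have "Poly_Mapping.keys (Poly_Mapping.map ((*) r) f) \<subseteq> Poly_Mapping.keys f"
      by (auto simp: in_keys_iff)
    then have "h (Poly_Mapping.map ((*) r) f) =
        finsum H (\<lambda>n. \<theta> r \<otimes>\<^bsub>H\<^esub> (\<theta> (Poly_Mapping.lookup f n) \<otimes>\<^bsub>H\<^esub> b n)) (Poly_Mapping.keys f)"
      using h[of "Poly_Mapping.keys f" "Poly_Mapping.map ((*) r) f"] b
      by (simp add: \<theta>_mult H.m_assoc)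
    then show ?thesis
      using b by (simp add: h_def H.finsum_rdistr Pi_iff)
  qed
  have "fmap p Om H h"
  proof (rule fmap_semilinear[OF _ O.module H_rmod, where Y = "\<lambda>z. \<theta> fps_X \<otimes>\<^bsub>H\<^esub> z"])
    show "additive Om H h" by (simp add: additive_def hadd hc)
    show "\<theta> fps_X \<otimes>\<^bsub>H\<^esub> c \<in> adic p H (Suc n)" if "c \<in> adic p H n" for c n
      using adic_mult[OF H_ralg \<theta>_X_adic that] by simp
  qed (simp add: hs)
  then obtain S where S: "fmap p H H S" "\<And>f. S (tc f) = h f"
    using O.completion_lift[OF H_complete, of h] by (auto simp: H_def)
  have hsing: "h (Poly_Mapping.single n r) = \<theta> r \<otimes>\<^bsub>H\<^esub> b n" for n r
    using h[of "{n}" "Poly_Mapping.single n r"] b by simp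
  have Sw: "S (r \<odot>\<^bsub>H\<^esub> \<omega> n) = \<theta> r \<otimes>\<^bsub>H\<^esub> b n" for r n
    using S(2)[of "Poly_Mapping.single n r"] by (simp add: tc_single hsing)
  have "S (r \<odot>\<^bsub>H\<^esub> x) = \<theta> r \<otimes>\<^bsub>H\<^esub> S x" if x: "x \<in> carrier H" for r x
    by (rule H_ext[OF fmap_contin[OF fmap_comp[OF fmap_smult[OF H_rmod] S(1)]]
          fmap_contin[OF fmap_comp[OF S(1) ralg_fmap_r[OF H_ralg \<theta>_closed]]] H_separated H_rmod _ x])
      (simp add: HM.smult_smult Sw \<theta>_mult H.m_assoc b)
  moreover have "S (\<omega> n) = b n" for n
    using Sw[of 1 n] b by simp
  ultimately show ?thesis using S(1) by blast
qed

end

section \<open>The comultiplication and the antipode\<close>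

locale taylor_comult = taylor p W \<theta>
  for p :: nat and W :: "'w::comm_ring_1 itself" and \<theta> +
  fixes \<Delta> :: "'w omega \<Rightarrow> ('w omega, 'w omega) ctens"
  assumes \<Delta>: "is_comultiplication p \<theta> \<Delta>"
begin

lemma \<Delta>_closed [simp]: "x \<in> carrier H \<Longrightarrow> \<Delta> x \<in> carrier PP"
  and \<Delta>_add: "\<lbrakk>x \<in> carrier H; x' \<in> carrier H\<rbrakk> \<Longrightarrow> \<Delta> (x \<oplus>\<^bsub>H\<^esub> x') = \<Delta> x \<oplus>\<^bsub>PP\<^esub> \<Delta> x'"
  and \<Delta>_mult: "\<lbrakk>x \<in> carrier H; x' \<in> carrier H\<rbrakk> \<Longrightarrow> \<Delta> (x \<otimes>\<^bsub>H\<^esub> x') = \<Delta> x \<otimes>\<^bsub>PP\<^esub> \<Delta> x'"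
  and \<Delta>_one: "\<Delta> \<one>\<^bsub>H\<^esub> = cp \<one>\<^bsub>H\<^esub> \<one>\<^bsub>H\<^esub>"
  and \<Delta>_smult: "x \<in> carrier H \<Longrightarrow> \<Delta> (r \<odot>\<^bsub>H\<^esub> x) = r \<odot>\<^bsub>PP\<^esub> \<Delta> x"
  and \<Delta>_xi: "\<Delta> (xi p) = cp \<one>\<^bsub>H\<^esub> (xi p) \<oplus>\<^bsub>PP\<^esub> cp (xi p) \<one>\<^bsub>H\<^esub>"
  using \<Delta> by (auto simp: is_comultiplication_def Let_def algebra_maps_def linear_maps_def ring_hom_def PP_one)

lemma \<Delta>_fmap: "fmap p H PP \<Delta>"
  by (rule fmap_linear[OF _ H_rmod PP.rmod]) (simp_all add: additive_def \<Delta>_add \<Delta>_smult)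

lemma cp_const: "cp \<one>\<^bsub>H\<^esub> (\<theta> (fps_const w)) = cp (\<theta> (fps_const w)) \<one>\<^bsub>H\<^esub>"
  by (simp add: \<theta>_const cp_balanced)

text \<open>The left scalar q - 1 together with \<xi> \<otimes> 1 makes \<theta>(q - 1) \<otimes> 1,
  which balancing turns into 1 \<otimes> (q - 1); adding 1 \<otimes> \<xi> completes this to 1
  \<otimes> \<theta>(q - 1).\<close>

lemma \<Delta>_X: "\<Delta> (\<theta> fps_X) = cp \<one>\<^bsub>H\<^esub> (\<theta> fps_X)"
proof -
  have "cp \<one>\<^bsub>H\<^esub> (fps_X \<odot>\<^bsub>H\<^esub> \<one>\<^bsub>H\<^esub>) = cp (fps_X \<odot>\<^bsub>H\<^esub> \<one>\<^bsub>H\<^esub>) \<one>\<^bsub>H\<^esub> \<oplus>\<^bsub>PP\<^esub> cp (xi p) \<one>\<^bsub>H\<^esub>"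
    by (simp add: cp_balanced \<theta>_X cp_add_l)
  then show ?thesis
    by (simp add: \<theta>_X \<Delta>_add \<Delta>_smult \<Delta>_one \<Delta>_xi cp_smult cp_add_r PP.C.a_ac)
qed

lemma \<Delta>_\<theta>: "\<Delta> (\<theta> r) = cp \<one>\<^bsub>H\<^esub> (\<theta> r)"
proof (rule base_ext[OF fmap_comp[OF \<theta>_fmap \<Delta>_fmap] fmap_comp[OF \<theta>_fmap] PP.separated PP.rmod,
      where Y = "\<lambda>z. cp \<one>\<^bsub>H\<^esub> (\<theta> fps_X) \<otimes>\<^bsub>PP\<^esub> z"])
  show "fmap p H PP (\<lambda>b. cp \<one>\<^bsub>H\<^esub> b)" using PP.cpure_fmap_r[of "\<one>\<^bsub>H\<^esub>"] by (simp add: fmap_P)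
  show "\<Delta> (\<theta> (fps_const w)) = cp \<one>\<^bsub>H\<^esub> (\<theta> (fps_const w))" for w
    unfolding cp_const by (simp add: \<theta>_const \<Delta>_smult \<Delta>_one cp_smult)
qed (simp_all add: \<theta>_mult \<Delta>_mult \<Delta>_X cp_mult)

lemma PP_rsmult: "z \<in> carrier PP \<Longrightarrow> rsmult PP z r = cp \<one>\<^bsub>H\<^esub> (\<theta> r) \<otimes>\<^bsub>PP\<^esub> z"
  by (rule PP_ext[OF bimod_fmap[OF tbimod_bimod[OF PP.tbimod]] ralg_fmap_r[OF PP_ralg] PP.separated PP.rmod])
    (simp_all add: cp_rsmult cp_mult H.m_comm)

lemma \<Delta>_right: "right_linear p P PP \<Delta>"
  unfolding right_linear_def
proof (intro conjI ballI allI)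
  show "fmap p P PP \<Delta>" using \<Delta>_fmap by (simp add: fmap_P)
  fix x r assume "x \<in> carrier P"
  then have x: "x \<in> carrier H" by simp
  have "rsmult P x r = \<theta> r \<otimes>\<^bsub>H\<^esub> x" using x by (simp add: H.m_comm)
  then show "\<Delta> (rsmult P x r) = rsmult PP (\<Delta> x) r"
    using x by (simp add: PP_rsmult \<Delta>_mult \<Delta>_\<theta>)
qed

lemma \<Delta>_left: "left_linear P PP \<Delta>"
  using fmap_additive[OF \<Delta>_fmap] by (simp add: left_linear_def additive_P \<Delta>_smult)

lemma \<Delta>_y: "x \<in> carrier H \<Longrightarrow> \<Delta> (y \<otimes>\<^bsub>H\<^esub> x) = cp \<one>\<^bsub>H\<^esub> y \<otimes>\<^bsub>PP\<^esub> \<Delta> x"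
  by (simp add: \<Delta>_mult \<Delta>_\<theta>)

text \<open>\<open>d n\<close> is the product of the $q - \theta(q)^{pj+1}$ for $j < n$, which the antipode must assign
  to \<open>Ew n\<close>.\<close>

primrec d :: "nat \<Rightarrow> 'w omega" where
  "d 0 = \<one>\<^bsub>H\<^esub>"
| "d (Suc n) = q \<odot>\<^bsub>H\<^esub> d n \<ominus>\<^bsub>H\<^esub> \<theta> (q ^ (p * n + 1)) \<otimes>\<^bsub>H\<^esub> d n"

lemma d_closed [simp]: "d n \<in> carrier H"
  by (induction n) simp_all

text \<open>\<open>K n z a\<close> says that $z = \sum_{k<n} g_k \otimes E_k\omega^{\{k\}}$ and $a = \sum_{k<n} g_k d_k$ for
  common coefficients $g_k$. Expanding $\prod_{j<n}(z - x^{pj+1})$ in the products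
  $\prod_{j<k}(z - y^{pj+1})$ shows that $\Delta(E_n\omega^{\{n\}}) - 1 \otimes E_n\omega^{\{n\}}$ is such a $z$.
  The same expansion at $z = x$ gives $a + d_n = 0$ for $n > 0$.\<close>

inductive K :: "nat \<Rightarrow> ('w omega, 'w omega) ctens \<Rightarrow> 'w omega \<Rightarrow> bool" for n where
  K_zero: "K n \<zero>\<^bsub>PP\<^esub> \<zero>\<^bsub>H\<^esub>"
| K_gen: "g \<in> carrier H \<Longrightarrow> k < n \<Longrightarrow> K n (cp g (Ew k)) (g \<otimes>\<^bsub>H\<^esub> d k)"
| K_add: "K n z a \<Longrightarrow> K n z' a' \<Longrightarrow> K n (z \<oplus>\<^bsub>PP\<^esub> z') (a \<oplus>\<^bsub>H\<^esub> a')"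

lemma K_closed: "K n z a \<Longrightarrow> z \<in> carrier PP \<and> a \<in> carrier H"
  by (induction rule: K.induct) simp_all

lemma cp_y_mult: "g \<in> carrier H \<Longrightarrow> cp \<one>\<^bsub>H\<^esub> y \<otimes>\<^bsub>PP\<^esub> cp g (Ew k) =
    cp g (Ew (Suc k)) \<oplus>\<^bsub>PP\<^esub> cp (g \<otimes>\<^bsub>H\<^esub> \<theta> (q ^ (p * k + 1))) (Ew k)"
  by (simp only: cp_mult \<theta>_closed Ew_closed H.one_closed y_mult_Ew)
    (simp add: cp_add_r cp_balanced)

lemma cp_add_cancel: "\<lbrakk>g \<in> carrier H; x \<in> carrier H; b \<in> carrier H\<rbrakk> \<Longrightarrow>
    cp (g \<ominus>\<^bsub>H\<^esub> r \<odot>\<^bsub>H\<^esub> x) b \<oplus>\<^bsub>PP\<^esub> r \<odot>\<^bsub>PP\<^esub> cp x b = cp g b"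
  by (simp add: cp_smult cp_add_l[symmetric] HM.add_diff_cancel)

lemma smult_diff_cancel:
  assumes "a \<in> carrier H" "b \<in> carrier H" "g \<in> carrier H" "t \<in> carrier H"
  shows "(g \<otimes>\<^bsub>H\<^esub> (u \<odot>\<^bsub>H\<^esub> a \<ominus>\<^bsub>H\<^esub> t \<otimes>\<^bsub>H\<^esub> a) \<oplus>\<^bsub>H\<^esub> (g \<otimes>\<^bsub>H\<^esub> t \<ominus>\<^bsub>H\<^esub> r \<odot>\<^bsub>H\<^esub> g) \<otimes>\<^bsub>H\<^esub> a) \<oplus>\<^bsub>H\<^esub>
      r \<odot>\<^bsub>H\<^esub> (g \<otimes>\<^bsub>H\<^esub> a) = u \<odot>\<^bsub>H\<^esub> (g \<otimes>\<^bsub>H\<^esub> a)"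
proof -
  \<comment> \<open>Scalars become the ring elements \<open>r \<odot> 1\<close> and
    \<open>u \<odot> 1\<close>, so that the identity can be left to \<open>algebra\<close>.\<close>
  define r' u' where "r' = r \<odot>\<^bsub>H\<^esub> \<one>\<^bsub>H\<^esub>" "u' = u \<odot>\<^bsub>H\<^esub> \<one>\<^bsub>H\<^esub>"
  have c: "r' \<in> carrier H" "u' \<in> carrier H" by (simp_all add: r'_u'_def)
  have "r \<odot>\<^bsub>H\<^esub> x = r' \<otimes>\<^bsub>H\<^esub> x" "u \<odot>\<^bsub>H\<^esub> x = u' \<otimes>\<^bsub>H\<^esub> x" if "x \<in> carrier H" for x
    using that by (simp_all add: r'_u'_def smult_one_mult)
  then show ?thesis using c assms by simp algebra
qed

text \<open>Multiplying \<open>z\<close> by 1 \<otimes> \<theta>(q) - r multiplies \<open>a\<close>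
  by q - r. On a generator with coefficient g, both the recursion for \<open>Ew\<close> and the one
  for \<open>d\<close> produce the coefficients g at k + 1 and g (\<theta>(q^(pk+1)) - r) at k.
  Differences are written as sums to avoid subtraction.\<close>

lemma K_step:
  assumes "K n z a"
  shows "\<exists>z' a'. K (Suc n) z' a' \<and> z' \<oplus>\<^bsub>PP\<^esub> r \<odot>\<^bsub>PP\<^esub> z = cp \<one>\<^bsub>H\<^esub> y \<otimes>\<^bsub>PP\<^esub> z \<and> a' \<oplus>\<^bsub>H\<^esub> r \<odot>\<^bsub>H\<^esub> a = q \<odot>\<^bsub>H\<^esub> a"
  using assms
proof (induction rule: K.induct)
  case K_zero
  have "cp \<one>\<^bsub>H\<^esub> y \<otimes>\<^bsub>PP\<^esub> \<zero>\<^bsub>PP\<^esub> = \<zero>\<^bsub>PP\<^esub>"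
    using additive_zero[OF ralg_additive_r[OF PP_ralg] PP.rmod PP.rmod] by simp
  then show ?case using K.K_zero[of "Suc n"] by (intro exI[of _ "\<zero>\<^bsub>PP\<^esub>"] exI[of _ "\<zero>\<^bsub>H\<^esub>"]) simp
next
  case (K_gen g k)
  let ?t = "\<theta> (q ^ (p * k + 1))"
  let ?z = "cp g (Ew (Suc k)) \<oplus>\<^bsub>PP\<^esub> cp (g \<otimes>\<^bsub>H\<^esub> ?t \<ominus>\<^bsub>H\<^esub> r \<odot>\<^bsub>H\<^esub> g) (Ew k)"
  let ?a = "g \<otimes>\<^bsub>H\<^esub> d (Suc k) \<oplus>\<^bsub>H\<^esub> (g \<otimes>\<^bsub>H\<^esub> ?t \<ominus>\<^bsub>H\<^esub> r \<odot>\<^bsub>H\<^esub> g) \<otimes>\<^bsub>H\<^esub> d k"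
  have "K (Suc n) ?z ?a"
    using K_gen by (intro K.K_add K.K_gen) simp_all
  moreover have "?z \<oplus>\<^bsub>PP\<^esub> r \<odot>\<^bsub>PP\<^esub> cp g (Ew k) = cp \<one>\<^bsub>H\<^esub> y \<otimes>\<^bsub>PP\<^esub> cp g (Ew k)"
    using K_gen by (simp add: cp_y_mult PP.C.a_assoc cp_add_cancel)
  moreover have "?a \<oplus>\<^bsub>H\<^esub> r \<odot>\<^bsub>H\<^esub> (g \<otimes>\<^bsub>H\<^esub> d k) = q \<odot>\<^bsub>H\<^esub> (g \<otimes>\<^bsub>H\<^esub> d k)"
    using smult_diff_cancel[of "d k" \<open>\<one>\<^bsub>H\<^esub>\<close> g ?t q r] K_gen by simp
  ultimately show ?case by blast
next
  case (K_add z a w b)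
  then obtain z' a' w' b' where h: "K (Suc n) z' a'" "z' \<oplus>\<^bsub>PP\<^esub> r \<odot>\<^bsub>PP\<^esub> z = cp \<one>\<^bsub>H\<^esub> y \<otimes>\<^bsub>PP\<^esub> z"
    "a' \<oplus>\<^bsub>H\<^esub> r \<odot>\<^bsub>H\<^esub> a = q \<odot>\<^bsub>H\<^esub> a" "K (Suc n) w' b'" "w' \<oplus>\<^bsub>PP\<^esub> r \<odot>\<^bsub>PP\<^esub> w = cp \<one>\<^bsub>H\<^esub> y \<otimes>\<^bsub>PP\<^esub> w"
    "b' \<oplus>\<^bsub>H\<^esub> r \<odot>\<^bsub>H\<^esub> b = q \<odot>\<^bsub>H\<^esub> b" by blast
  note cl = K_closed[OF h(1)] K_closed[OF h(4)] K_closed[OF K_add(1)] K_closed[OF K_add(2)]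
  have "(z' \<oplus>\<^bsub>PP\<^esub> w') \<oplus>\<^bsub>PP\<^esub> r \<odot>\<^bsub>PP\<^esub> (z \<oplus>\<^bsub>PP\<^esub> w) = (z' \<oplus>\<^bsub>PP\<^esub> r \<odot>\<^bsub>PP\<^esub> z) \<oplus>\<^bsub>PP\<^esub> (w' \<oplus>\<^bsub>PP\<^esub> r \<odot>\<^bsub>PP\<^esub> w)"
    using cl by (simp add: PP.C.smult_add_r PP.C.a_ac)
  also have "\<dots> = cp \<one>\<^bsub>H\<^esub> y \<otimes>\<^bsub>PP\<^esub> (z \<oplus>\<^bsub>PP\<^esub> w)"
    unfolding h using cl by (simp add: additive_add[OF ralg_additive_r[OF PP_ralg]])
  finally have 1: "(z' \<oplus>\<^bsub>PP\<^esub> w') \<oplus>\<^bsub>PP\<^esub> r \<odot>\<^bsub>PP\<^esub> (z \<oplus>\<^bsub>PP\<^esub> w) = cp \<one>\<^bsub>H\<^esub> y \<otimes>\<^bsub>PP\<^esub> (z \<oplus>\<^bsub>PP\<^esub> w)" .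
  have "(a' \<oplus>\<^bsub>H\<^esub> b') \<oplus>\<^bsub>H\<^esub> r \<odot>\<^bsub>H\<^esub> (a \<oplus>\<^bsub>H\<^esub> b) = (a' \<oplus>\<^bsub>H\<^esub> r \<odot>\<^bsub>H\<^esub> a) \<oplus>\<^bsub>H\<^esub> (b' \<oplus>\<^bsub>H\<^esub> r \<odot>\<^bsub>H\<^esub> b)"
    using cl by (simp add: HM.smult_add_r H.a_ac)
  also have "\<dots> = q \<odot>\<^bsub>H\<^esub> (a \<oplus>\<^bsub>H\<^esub> b)"
    unfolding h using cl by (simp add: HM.smult_add_r)
  finally show ?case using 1 K.K_add[OF h(1) h(4)] by blast
qed

text \<open>Induction by the factor 1 \<otimes> \<theta>(q) - r with r = q^(pn+1). On the top term
  it leaves 1 \<otimes> \<open>Ew (Suc n)\<close> and the remainder (\<theta>(r) - r) \<otimes>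
  \<open>Ew n\<close>, again of index below \<open>Suc n\<close>. The sum of \<open>a\<close> and
  \<open>d n\<close> is the product of the q - q^(pj+1) for j < n, which vanishes for n > 0 through
  the factor j = 0.\<close>

lemma \<Delta>_Ew: "\<exists>z a. K n z a \<and> \<Delta> (Ew n) = z \<oplus>\<^bsub>PP\<^esub> cp \<one>\<^bsub>H\<^esub> (Ew n) \<and>
    (if n = 0 then \<one>\<^bsub>H\<^esub> else \<zero>\<^bsub>H\<^esub>) = a \<oplus>\<^bsub>H\<^esub> d n"
proof (induction n)
  case 0
  show ?case
    by (intro exI[of _ "\<zero>\<^bsub>PP\<^esub>"] exI[of _ "\<zero>\<^bsub>H\<^esub>"]) (simp add: K.K_zero \<Delta>_one)
next
  case (Suc n)
  then obtain z a where za: "K n z a" "\<Delta> (Ew n) = z \<oplus>\<^bsub>PP\<^esub> cp \<one>\<^bsub>H\<^esub> (Ew n)"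
    "(if n = 0 then \<one>\<^bsub>H\<^esub> else \<zero>\<^bsub>H\<^esub>) = a \<oplus>\<^bsub>H\<^esub> d n" by blast
  let ?r = "q ^ (p * n + 1)"
  obtain z' a' where z': "K (Suc n) z' a'" "z' \<oplus>\<^bsub>PP\<^esub> ?r \<odot>\<^bsub>PP\<^esub> z = cp \<one>\<^bsub>H\<^esub> y \<otimes>\<^bsub>PP\<^esub> z"
    "a' \<oplus>\<^bsub>H\<^esub> ?r \<odot>\<^bsub>H\<^esub> a = q \<odot>\<^bsub>H\<^esub> a" using K_step[OF za(1)] by blast
  note cl = K_closed[OF z'(1)] K_closed[OF za(1)]
  let ?g = "\<theta> ?r \<ominus>\<^bsub>H\<^esub> ?r \<odot>\<^bsub>H\<^esub> \<one>\<^bsub>H\<^esub>"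
  let ?z = "z' \<oplus>\<^bsub>PP\<^esub> cp ?g (Ew n)" and ?a = "a' \<oplus>\<^bsub>H\<^esub> ?g \<otimes>\<^bsub>H\<^esub> d n"
  have K: "K (Suc n) ?z ?a" by (rule K.K_add[OF z'(1) K.K_gen]) simp_all
  let ?u = "?r \<odot>\<^bsub>PP\<^esub> z \<oplus>\<^bsub>PP\<^esub> ?r \<odot>\<^bsub>PP\<^esub> cp \<one>\<^bsub>H\<^esub> (Ew n)"
  have "\<Delta> (Ew (Suc n)) \<oplus>\<^bsub>PP\<^esub> ?u = \<Delta> (Ew (Suc n)) \<oplus>\<^bsub>PP\<^esub> ?r \<odot>\<^bsub>PP\<^esub> \<Delta> (Ew n)"
    using cl by (simp add: za(2) PP.C.smult_add_r)
  also have "\<dots> = \<Delta> (y \<otimes>\<^bsub>H\<^esub> Ew n)"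
    unfolding y_mult_Ew by (simp add: \<Delta>_add \<Delta>_smult)
  also have "\<dots> = cp \<one>\<^bsub>H\<^esub> y \<otimes>\<^bsub>PP\<^esub> z \<oplus>\<^bsub>PP\<^esub> cp \<one>\<^bsub>H\<^esub> y \<otimes>\<^bsub>PP\<^esub> cp \<one>\<^bsub>H\<^esub> (Ew n)"
    using cl by (simp add: \<Delta>_y za(2) additive_add[OF ralg_additive_r[OF PP_ralg]])
  also have "\<dots> = (z' \<oplus>\<^bsub>PP\<^esub> ?r \<odot>\<^bsub>PP\<^esub> z) \<oplus>\<^bsub>PP\<^esub> (cp \<one>\<^bsub>H\<^esub> (Ew (Suc n)) \<oplus>\<^bsub>PP\<^esub> cp (\<theta> ?r) (Ew n))"
    unfolding z'(2) by (subst cp_y_mult) simp_all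
  also have "cp (\<theta> ?r) (Ew n) = cp ?g (Ew n) \<oplus>\<^bsub>PP\<^esub> ?r \<odot>\<^bsub>PP\<^esub> cp \<one>\<^bsub>H\<^esub> (Ew n)"
    by (rule cp_add_cancel[symmetric]) simp_all
  also have "(z' \<oplus>\<^bsub>PP\<^esub> ?r \<odot>\<^bsub>PP\<^esub> z) \<oplus>\<^bsub>PP\<^esub> (cp \<one>\<^bsub>H\<^esub> (Ew (Suc n)) \<oplus>\<^bsub>PP\<^esub> (cp ?g (Ew n) \<oplus>\<^bsub>PP\<^esub> ?r \<odot>\<^bsub>PP\<^esub> cp \<one>\<^bsub>H\<^esub> (Ew n))) =
      (?z \<oplus>\<^bsub>PP\<^esub> cp \<one>\<^bsub>H\<^esub> (Ew (Suc n))) \<oplus>\<^bsub>PP\<^esub> ?u"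
    using cl by (simp add: PP.C.a_ac del: d.simps)
  finally have D: "\<Delta> (Ew (Suc n)) = ?z \<oplus>\<^bsub>PP\<^esub> cp \<one>\<^bsub>H\<^esub> (Ew (Suc n))"
    using cl by (simp add: PP.C.add.r_cancel del: d.simps)
  have "\<zero>\<^bsub>H\<^esub> = ?a \<oplus>\<^bsub>H\<^esub> d (Suc n)"
  proof -
    define r' q' where "r' = ?r \<odot>\<^bsub>H\<^esub> \<one>\<^bsub>H\<^esub>" and "q' = q \<odot>\<^bsub>H\<^esub> \<one>\<^bsub>H\<^esub>"
    have c: "r' \<in> carrier H" "q' \<in> carrier H" by (simp_all add: r'_def q'_def)
    have sm: "?r \<odot>\<^bsub>H\<^esub> x = r' \<otimes>\<^bsub>H\<^esub> x" "q \<odot>\<^bsub>H\<^esub> x = q' \<otimes>\<^bsub>H\<^esub> x" if "x \<in> carrier H" for x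
      using that smult_one_mult by (simp_all add: r'_def q'_def)
    have ac: "a \<in> carrier H" "a' \<in> carrier H" "d n \<in> carrier H" "\<theta> ?r \<in> carrier H" using cl by simp_all
    have a': "a' = q' \<otimes>\<^bsub>H\<^esub> a \<ominus>\<^bsub>H\<^esub> r' \<otimes>\<^bsub>H\<^esub> a"
    proof -
      have "q' \<otimes>\<^bsub>H\<^esub> a = a' \<oplus>\<^bsub>H\<^esub> r' \<otimes>\<^bsub>H\<^esub> a" using z'(3) sm ac by simp
      then have "q' \<otimes>\<^bsub>H\<^esub> a = r' \<otimes>\<^bsub>H\<^esub> a \<oplus>\<^bsub>H\<^esub> a'" using c ac by (simp add: H.a_comm)
      then show ?thesis using c ac by (simp add: HM.add_diff_left)
    qed
    have eq: "?a \<oplus>\<^bsub>H\<^esub> d (Suc n) = (q' \<ominus>\<^bsub>H\<^esub> r') \<otimes>\<^bsub>H\<^esub> (a \<oplus>\<^bsub>H\<^esub> d n)"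
    proof -
      have "?a \<oplus>\<^bsub>H\<^esub> d (Suc n) = (a' \<oplus>\<^bsub>H\<^esub> (\<theta> ?r \<ominus>\<^bsub>H\<^esub> r') \<otimes>\<^bsub>H\<^esub> d n) \<oplus>\<^bsub>H\<^esub> (q' \<otimes>\<^bsub>H\<^esub> d n \<ominus>\<^bsub>H\<^esub> \<theta> ?r \<otimes>\<^bsub>H\<^esub> d n)"
        using sm ac by (simp only: d.simps r'_def)
      then show ?thesis unfolding a' using c ac by algebra
    qed
    show ?thesis
    proof (cases "n = 0")
      case True
      then have "q' = r'" by (simp add: r'_def q'_def)
      then show ?thesis unfolding eq using c ac by simp
    next
      case False
      then have "a \<oplus>\<^bsub>H\<^esub> d n = \<zero>\<^bsub>H\<^esub>" using za(3) by simp
      then show ?thesis unfolding eq using c by simp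
    qed
  qed
  then show ?case using K D by (metis nat.distinct(1))
qed

text \<open>The coefficient extraction \<open>\<mu>\<close> below is $a \otimes b \mapsto a\,S(b)$.\<close>

lemma mu_ex:
  assumes S: "fmap p H H S" "\<And>x r. x \<in> carrier H \<Longrightarrow> S (r \<odot>\<^bsub>H\<^esub> x) = \<theta> r \<otimes>\<^bsub>H\<^esub> S x"
  shows "\<exists>\<mu>. fmap p PP H \<mu> \<and> (\<forall>a\<in>carrier H. \<forall>b\<in>carrier H. \<mu> (cp a b) = a \<otimes>\<^bsub>H\<^esub> S b) \<and>
    (\<forall>z\<in>carrier PP. \<forall>r. \<mu> (r \<odot>\<^bsub>PP\<^esub> z) = r \<odot>\<^bsub>H\<^esub> \<mu> z)"
proof -
  note Sc = fmap_closed[OF S(1)]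
  obtain \<mu> where m: "fmap p PP H \<mu>" "\<And>a b. a \<in> carrier H \<Longrightarrow> b \<in> carrier H \<Longrightarrow> \<mu> (cp a b) = a \<otimes>\<^bsub>H\<^esub> S b"
    using PP_lift[OF ralg_fmap_l[OF H_ralg Sc] additive_comp[OF fmap_additive[OF S(1)] ralg_additive_r[OF H_ralg]] _ H_complete]
    by (auto simp: S(2) H.m_assoc Sc)
  have "\<mu> (r \<odot>\<^bsub>PP\<^esub> z) = r \<odot>\<^bsub>H\<^esub> \<mu> z" if z: "z \<in> carrier PP" for z r
    by (rule PP_ext[OF fmap_comp[OF fmap_smult[OF PP.rmod] m(1)] fmap_comp[OF m(1) fmap_smult[OF H_rmod]]
          H_separated H_rmod _ z]) (simp add: cp_smult m(2) smult_mult_l Sc)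
  then show ?thesis using m by blast
qed

text \<open>Integrality enters here: \<Delta>(\<open>Ew n\<close>) is \<open>E n\<close> times
  \<Delta>(\<open>\<omega> n\<close>), so its contraction is a multiple of \<open>E n\<close>,
  whatever values \<open>b\<close> the semilinear map takes on the divided powers. Different choices
  of \<open>b\<close> yield different divisibilities.\<close>

lemma mu_\<Delta>_Ew:
  assumes b: "\<And>n. b n \<in> carrier H"
  shows "\<exists>m\<in>carrier H. \<exists>z a \<mu>. K n z a \<and> fmap p PP H \<mu> \<and>
    (\<forall>g\<in>carrier H. \<forall>k. \<mu> (cp g (Ew k)) = g \<otimes>\<^bsub>H\<^esub> (\<theta> (E k) \<otimes>\<^bsub>H\<^esub> b k)) \<and>
    E n \<odot>\<^bsub>H\<^esub> m = \<mu> z \<oplus>\<^bsub>H\<^esub> \<theta> (E n) \<otimes>\<^bsub>H\<^esub> b n \<and> (if n = 0 then \<one>\<^bsub>H\<^esub> else \<zero>\<^bsub>H\<^esub>) = a \<oplus>\<^bsub>H\<^esub> d n"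
proof -
  obtain S where S: "fmap p H H S" "\<And>x r. x \<in> carrier H \<Longrightarrow> S (r \<odot>\<^bsub>H\<^esub> x) = \<theta> r \<otimes>\<^bsub>H\<^esub> S x" "\<And>n. S (\<omega> n) = b n"
    using semilinear_ex[of b, OF b] by blast
  obtain \<mu> where m: "fmap p PP H \<mu>" "\<And>a b. a \<in> carrier H \<Longrightarrow> b \<in> carrier H \<Longrightarrow> \<mu> (cp a b) = a \<otimes>\<^bsub>H\<^esub> S b"
    "\<And>z r. z \<in> carrier PP \<Longrightarrow> \<mu> (r \<odot>\<^bsub>PP\<^esub> z) = r \<odot>\<^bsub>H\<^esub> \<mu> z"
    using mu_ex[OF S(1,2)] by blast
  obtain z a where za: "K n z a" "\<Delta> (Ew n) = z \<oplus>\<^bsub>PP\<^esub> cp \<one>\<^bsub>H\<^esub> (Ew n)"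
    "(if n = 0 then \<one>\<^bsub>H\<^esub> else \<zero>\<^bsub>H\<^esub>) = a \<oplus>\<^bsub>H\<^esub> d n" using \<Delta>_Ew by blast
  have g: "\<mu> (cp g (Ew k)) = g \<otimes>\<^bsub>H\<^esub> (\<theta> (E k) \<otimes>\<^bsub>H\<^esub> b k)" if "g \<in> carrier H" for g k
    using that by (simp add: m(2)) (simp add: Ew_def S(2,3))
  have "E n \<odot>\<^bsub>H\<^esub> \<mu> (\<Delta> (\<omega> n)) = \<mu> (\<Delta> (Ew n))"
    by (simp add: Ew_def \<Delta>_smult m(3))
  also have "\<dots> = \<mu> z \<oplus>\<^bsub>H\<^esub> \<theta> (E n) \<otimes>\<^bsub>H\<^esub> b n"
    unfolding za(2) using K_closed[OF za(1)] g[OF H.one_closed, of n] by (simp add: fmap_add[OF m(1)] b)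
  finally have "E n \<odot>\<^bsub>H\<^esub> \<mu> (\<Delta> (\<omega> n)) = \<mu> z \<oplus>\<^bsub>H\<^esub> \<theta> (E n) \<otimes>\<^bsub>H\<^esub> b n" .
  moreover have "\<mu> (\<Delta> (\<omega> n)) \<in> carrier H" using fmap_closed[OF m(1)] by simp
  ultimately show ?thesis using za m(1) g by blast
qed

text \<open>With \<open>b\<close> supported at \<open>n\<close>, the part \<open>z\<close> of index
  below \<open>n\<close> contributes nothing, and \<theta>(E n) itself becomes a multiple of
  \<open>E n\<close>. The quotient has augmentation 1, since the augmentation splits \<theta> and
  \<open>E n\<close> is regular; hence it is a unit.\<close>

lemma E_unit: "\<exists>B\<in>carrier H. \<exists>v\<in>carrier H. E n \<odot>\<^bsub>H\<^esub> B = \<theta> (E n) \<and> B \<otimes>\<^bsub>H\<^esub> v = \<one>\<^bsub>H\<^esub>"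
proof -
  let ?b = "\<lambda>k. if k = n then \<one>\<^bsub>H\<^esub> else \<zero>\<^bsub>H\<^esub>"
  obtain B z a \<mu> where B: "B \<in> carrier H" "K n z a" "fmap p PP H \<mu>"
    "\<And>g k. g \<in> carrier H \<Longrightarrow> \<mu> (cp g (Ew k)) = g \<otimes>\<^bsub>H\<^esub> (\<theta> (E k) \<otimes>\<^bsub>H\<^esub> ?b k)"
    "E n \<odot>\<^bsub>H\<^esub> B = \<mu> z \<oplus>\<^bsub>H\<^esub> \<theta> (E n) \<otimes>\<^bsub>H\<^esub> ?b n"
  proof -
    have "?b k \<in> carrier H" for k by simp
    from mu_\<Delta>_Ew[of ?b n, OF this] show thesis using that by blast
  qed
  have "\<mu> z = \<zero>\<^bsub>H\<^esub>"
    using B(2)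
  proof (induction rule: K.induct)
    case K_zero
    show ?case by (rule additive_zero[OF fmap_additive[OF B(3)] PP.rmod H_rmod])
  next
    case (K_gen g k)
    then show ?case by (simp add: B(4))
  next
    case (K_add z a z' a')
    then show ?case using K_closed[OF K_add(1)] K_closed[OF K_add(2)] by (simp add: fmap_add[OF B(3)])
  qed
  then have EB: "E n \<odot>\<^bsub>H\<^esub> B = \<theta> (E n)" using B(5) by simp
  then have "E n * coef 0 B = E n * 1" using coef_smult[OF B(1), of 0 "E n"] coef_\<theta> by simp
  then have "coef 0 B = 1" by (rule regularD[OF E_regular])
  then obtain v where "v \<in> carrier H" "B \<otimes>\<^bsub>H\<^esub> v = \<one>\<^bsub>H\<^esub>" using H_unit[OF B(1)] by blast
  then show ?thesis using B(1) EB by blast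
qed

lemma regular_\<theta>E:
  assumes x: "x \<in> carrier H" and 0: "\<theta> (E n) \<otimes>\<^bsub>H\<^esub> x = \<zero>\<^bsub>H\<^esub>" shows "x = \<zero>\<^bsub>H\<^esub>"
proof -
  obtain B v where B: "B \<in> carrier H" "v \<in> carrier H" "E n \<odot>\<^bsub>H\<^esub> B = \<theta> (E n)" "B \<otimes>\<^bsub>H\<^esub> v = \<one>\<^bsub>H\<^esub>"
    using E_unit by blast
  have "E n \<odot>\<^bsub>H\<^esub> (B \<otimes>\<^bsub>H\<^esub> x) = \<zero>\<^bsub>H\<^esub>" using 0 B x by (simp add: smult_mult_l[symmetric])
  then have "B \<otimes>\<^bsub>H\<^esub> x = \<zero>\<^bsub>H\<^esub>" using regular_H[OF E_regular] B x by blast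
  then have "(B \<otimes>\<^bsub>H\<^esub> v) \<otimes>\<^bsub>H\<^esub> x = \<zero>\<^bsub>H\<^esub>" using B(1,2) x by (metis H.m_assoc H.m_comm H.r_null H.m_closed)
  then show ?thesis using B x by simp
qed

text \<open>For \<open>b\<close> take the quotients already found below \<open>n\<close>, and 0 at
  \<open>n\<close>. The contraction then sends \<open>z\<close> to its companion a, which for n > 0
  is the negative of \<open>d n\<close>. So \<open>E n\<close> divides \<open>d n\<close>, and it is
  exchanged for \<theta>(E n) at the cost of a unit.\<close>

lemma d_divisible: "\<exists>b\<in>carrier H. \<theta> (E n) \<otimes>\<^bsub>H\<^esub> b = d n"
proof (induction n rule: less_induct)
  case (less n)
  show ?case
  proof (cases "n = 0")
    case True
    then show ?thesis by (intro bexI[of _ "\<one>\<^bsub>H\<^esub>"]) simp_all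
  next
    case False
    have "\<forall>k. \<exists>b. b \<in> carrier H \<and> (k < n \<longrightarrow> \<theta> (E k) \<otimes>\<^bsub>H\<^esub> b = d k) \<and> (k \<ge> n \<longrightarrow> b = \<zero>\<^bsub>H\<^esub>)"
      using less by (metis H.zero_closed leD)
    then obtain b where b: "\<And>k. b k \<in> carrier H" "\<And>k. k < n \<Longrightarrow> \<theta> (E k) \<otimes>\<^bsub>H\<^esub> b k = d k" "b n = \<zero>\<^bsub>H\<^esub>"
      by (metis order_refl)
    obtain m z a \<mu> where m: "m \<in> carrier H" "K n z a" "fmap p PP H \<mu>"
      "\<And>g k. g \<in> carrier H \<Longrightarrow> \<mu> (cp g (Ew k)) = g \<otimes>\<^bsub>H\<^esub> (\<theta> (E k) \<otimes>\<^bsub>H\<^esub> b k)"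
      "E n \<odot>\<^bsub>H\<^esub> m = \<mu> z \<oplus>\<^bsub>H\<^esub> \<theta> (E n) \<otimes>\<^bsub>H\<^esub> b n" "\<zero>\<^bsub>H\<^esub> = a \<oplus>\<^bsub>H\<^esub> d n"
      using mu_\<Delta>_Ew[of b n, OF b(1)] False by auto
    have "\<mu> z = a"
      using m(2)
    proof (induction rule: K.induct)
      case K_zero
      show ?case by (rule additive_zero[OF fmap_additive[OF m(3)] PP.rmod H_rmod])
    next
      case (K_gen g k)
      then show ?case by (simp add: m(4) b(2))
    next
      case (K_add z a z' a')
      then show ?case using K_closed[OF K_add(1)] K_closed[OF K_add(2)] by (simp add: fmap_add[OF m(3)])
    qed
    then have "E n \<odot>\<^bsub>H\<^esub> m = a" using m(5) b(3) K_closed[OF m(2)] by simp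
    then have Em: "E n \<odot>\<^bsub>H\<^esub> m \<oplus>\<^bsub>H\<^esub> d n = \<zero>\<^bsub>H\<^esub>" using m(6) by metis
    obtain B v where B: "B \<in> carrier H" "v \<in> carrier H" "E n \<odot>\<^bsub>H\<^esub> B = \<theta> (E n)" "B \<otimes>\<^bsub>H\<^esub> v = \<one>\<^bsub>H\<^esub>"
      using E_unit by blast
    have "\<theta> (E n) \<otimes>\<^bsub>H\<^esub> (v \<otimes>\<^bsub>H\<^esub> (\<ominus>\<^bsub>H\<^esub> m)) = E n \<odot>\<^bsub>H\<^esub> ((B \<otimes>\<^bsub>H\<^esub> v) \<otimes>\<^bsub>H\<^esub> (\<ominus>\<^bsub>H\<^esub> m))"
      unfolding B(3)[symmetric] using B(1,2) m(1) by (simp add: smult_mult_l H.m_assoc)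
    also have "\<dots> = \<ominus>\<^bsub>H\<^esub> (E n \<odot>\<^bsub>H\<^esub> m)" using B m(1) by (simp add: HM.smult_neg)
    also have "\<dots> = d n" using Em m(1) by (metis H.minus_equality H.minus_minus HM.smult_closed' d_closed H.a_comm)
    finally show ?thesis using B(2) m(1) by (intro bexI[of _ "v \<otimes>\<^bsub>H\<^esub> (\<ominus>\<^bsub>H\<^esub> m)"]) simp_all
  qed
qed

text \<open>Prescribing the values on divided powers builds in semilinearity over \<theta>. That
  \<theta>(q) is turned into q is the recursion for \<open>d\<close> after cancelling \<theta>(E n),
  and this extends to all of \<theta>(R) because \<open>base_ext\<close> only has to be checked at q
  - 1 and on constants.\<close>

lemma antipode_ex: "\<exists>S. fmap p H H S \<and> S \<one>\<^bsub>H\<^esub> = \<one>\<^bsub>H\<^esub> \<and>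
    (\<forall>x\<in>carrier H. \<forall>r. S (r \<odot>\<^bsub>H\<^esub> x) = \<theta> r \<otimes>\<^bsub>H\<^esub> S x \<and> S (x \<otimes>\<^bsub>H\<^esub> \<theta> r) = r \<odot>\<^bsub>H\<^esub> S x)"
proof -
  obtain b where b: "\<And>n. b n \<in> carrier H" "\<And>n. \<theta> (E n) \<otimes>\<^bsub>H\<^esub> b n = d n"
    using d_divisible by metis
  obtain S where S: "fmap p H H S" "\<And>x r. x \<in> carrier H \<Longrightarrow> S (r \<odot>\<^bsub>H\<^esub> x) = \<theta> r \<otimes>\<^bsub>H\<^esub> S x" "\<And>n. S (\<omega> n) = b n"
    using semilinear_ex[of b, OF b(1)] by blast
  note Sc = fmap_closed[OF S(1)]
  have SE: "S (Ew n) = d n" for n by (simp add: Ew_def S(2,3) b(2))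
  have S1: "S \<one>\<^bsub>H\<^esub> = \<one>\<^bsub>H\<^esub>" using SE[of 0] by simp
  have Syw: "S (y \<otimes>\<^bsub>H\<^esub> \<omega> n) = q \<odot>\<^bsub>H\<^esub> S (\<omega> n)" for n
  proof -
    have "\<theta> (E n) \<otimes>\<^bsub>H\<^esub> S (y \<otimes>\<^bsub>H\<^esub> \<omega> n) = S (y \<otimes>\<^bsub>H\<^esub> Ew n)"
      by (simp add: Ew_def smult_mult_r S(2))
    also have "\<dots> = d (Suc n) \<oplus>\<^bsub>H\<^esub> \<theta> (q ^ (p * n + 1)) \<otimes>\<^bsub>H\<^esub> d n"
      unfolding y_mult_Ew by (subst fmap_add[OF S(1)]) (simp_all only: S(2) SE Ew_closed HM.smult_closed')
    also have "\<dots> = q \<odot>\<^bsub>H\<^esub> d n"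
      by (simp add: HM.add_diff_cancel)
    also have "\<dots> = \<theta> (E n) \<otimes>\<^bsub>H\<^esub> (q \<odot>\<^bsub>H\<^esub> S (\<omega> n))"
      by (simp add: smult_mult_r S(3) b)
    finally have eq: "\<theta> (E n) \<otimes>\<^bsub>H\<^esub> S (y \<otimes>\<^bsub>H\<^esub> \<omega> n) = \<theta> (E n) \<otimes>\<^bsub>H\<^esub> (q \<odot>\<^bsub>H\<^esub> S (\<omega> n))" .
    have "\<theta> (E n) \<otimes>\<^bsub>H\<^esub> (S (y \<otimes>\<^bsub>H\<^esub> \<omega> n) \<ominus>\<^bsub>H\<^esub> q \<odot>\<^bsub>H\<^esub> S (\<omega> n)) = \<zero>\<^bsub>H\<^esub>"
      using additive_diff[OF ralg_additive_r[OF H_ralg \<theta>_closed] H_rmod H_rmod, of "S (y \<otimes>\<^bsub>H\<^esub> \<omega> n)" "q \<odot>\<^bsub>H\<^esub> S (\<omega> n)" "E n"] eq Sc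
      by simp
    then have "S (y \<otimes>\<^bsub>H\<^esub> \<omega> n) \<ominus>\<^bsub>H\<^esub> q \<odot>\<^bsub>H\<^esub> S (\<omega> n) = \<zero>\<^bsub>H\<^esub>" using regular_\<theta>E Sc by simp
    then show ?thesis by (simp add: HM.diff_eq_zero_iff Sc)
  qed
  have Sy: "S (y \<otimes>\<^bsub>H\<^esub> x) = q \<odot>\<^bsub>H\<^esub> S x" if x: "x \<in> carrier H" for x
    by (rule H_ext[OF fmap_contin[OF fmap_comp[OF ralg_fmap_r[OF H_ralg \<theta>_closed] S(1)]]
          fmap_contin[OF fmap_comp[OF S(1) fmap_smult[OF H_rmod]]] H_separated H_rmod _ x])
      (simp add: smult_mult_r S(2) Syw Sc)
  have SX: "S (\<theta> fps_X \<otimes>\<^bsub>H\<^esub> x) = fps_X \<odot>\<^bsub>H\<^esub> S x" if x: "x \<in> carrier H" for x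
  proof -
    have "y = \<one>\<^bsub>H\<^esub> \<oplus>\<^bsub>H\<^esub> \<theta> fps_X" using \<theta>_add[of 1 fps_X] by simp
    then have "S x \<oplus>\<^bsub>H\<^esub> S (\<theta> fps_X \<otimes>\<^bsub>H\<^esub> x) = S (y \<otimes>\<^bsub>H\<^esub> x)"
      using x by (simp add: H.l_distr fmap_add[OF S(1)])
    also have "\<dots> = S x \<oplus>\<^bsub>H\<^esub> fps_X \<odot>\<^bsub>H\<^esub> S x"
      unfolding Sy[OF x] using x Sc by (simp add: HM.smult_add_l)
    finally show ?thesis using x Sc by (simp add: H.add.l_cancel)
  qed
  have "S (\<theta> r \<otimes>\<^bsub>H\<^esub> x) = r \<odot>\<^bsub>H\<^esub> S x" if x: "x \<in> carrier H" for x r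
  proof (rule base_ext[OF fmap_comp[OF fmap_comp[OF \<theta>_fmap ralg_fmap_l[OF H_ralg x]] S(1)] _ H_separated H_rmod,
        where Y = "\<lambda>z. fps_X \<odot>\<^bsub>H\<^esub> z"])
    show "fmap p base_algebra H (\<lambda>r. r \<odot>\<^bsub>H\<^esub> S x)"
      by (rule fmap_linear[OF _ B.module H_rmod]) (simp_all add: additive_def HM.smult_add_l HM.smult_smult Sc x)
  qed (use x Sc in \<open>simp_all add: \<theta>_mult H.m_assoc SX HM.smult_smult \<theta>_const smult_one_mult S(2)\<close>)
  then have "S (x \<otimes>\<^bsub>H\<^esub> \<theta> r) = r \<odot>\<^bsub>H\<^esub> S x" if "x \<in> carrier H" for x r
    using that by (simp add: H.m_comm)
  then show ?thesis using S(1,2) S1 by blast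
qed

section \<open>The antipode and counit identities\<close>

definition S :: "'w omega \<Rightarrow> 'w omega" where
  "S = (SOME S. fmap p H H S \<and> S \<one>\<^bsub>H\<^esub> = \<one>\<^bsub>H\<^esub> \<and>
    (\<forall>x\<in>carrier H. \<forall>r. S (r \<odot>\<^bsub>H\<^esub> x) = \<theta> r \<otimes>\<^bsub>H\<^esub> S x \<and> S (x \<otimes>\<^bsub>H\<^esub> \<theta> r) = r \<odot>\<^bsub>H\<^esub> S x))"

lemma S_fmap: "fmap p H H S"
  and S_one: "S \<one>\<^bsub>H\<^esub> = \<one>\<^bsub>H\<^esub>"
  and S_smult: "x \<in> carrier H \<Longrightarrow> S (r \<odot>\<^bsub>H\<^esub> x) = \<theta> r \<otimes>\<^bsub>H\<^esub> S x"
  and S_\<theta>: "x \<in> carrier H \<Longrightarrow> S (x \<otimes>\<^bsub>H\<^esub> \<theta> r) = r \<odot>\<^bsub>H\<^esub> S x"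
  using someI_ex[OF antipode_ex, folded S_def] by blast+

lemma S_closed [simp]: "x \<in> carrier H \<Longrightarrow> S x \<in> carrier H"
  by (rule fmap_closed[OF S_fmap])

lemma S_y: "x \<in> carrier H \<Longrightarrow> S (y \<otimes>\<^bsub>H\<^esub> x) = q \<odot>\<^bsub>H\<^esub> S x"
  using S_\<theta>[of x q] by (simp add: H.m_comm)

lemma coef_\<theta>_mult: "x \<in> carrier H \<Longrightarrow> coef 0 (x \<otimes>\<^bsub>H\<^esub> \<theta> r) = coef 0 x * r"
  by (simp add: coef_0_mult coef_\<theta>)

lemma smult_fmap_base: "x \<in> carrier H \<Longrightarrow> fmap p base_algebra H (\<lambda>r. r \<odot>\<^bsub>H\<^esub> x)"
  by (rule fmap_linear[OF _ B.module H_rmod]) (simp_all add: additive_def HM.smult_add_l HM.smult_smult)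

text \<open>Both sides are linear over \<open>R\<close>, send 1 to 1 and turn multiplication by
  \<theta>(q) into multiplication by q, because \<Delta>(\<theta>(q)) = 1 \<otimes> \<theta>(q) and
  \<open>S\<close> takes \<theta>(q) back to q; so \<open>H_unique\<close> applies.\<close>

lemma antipode_r:
  "\<exists>\<mu>. fmap p PP H \<mu> \<and> (\<forall>a\<in>carrier H. \<forall>b\<in>carrier H. \<mu> (cp a b) = a \<otimes>\<^bsub>H\<^esub> S b) \<and>
    (\<forall>z\<in>carrier PP. \<forall>r. \<mu> (r \<odot>\<^bsub>PP\<^esub> z) = r \<odot>\<^bsub>H\<^esub> \<mu> z) \<and>
    (\<forall>x\<in>carrier H. \<mu> (\<Delta> x) = coef 0 x \<odot>\<^bsub>H\<^esub> \<one>\<^bsub>H\<^esub>)"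
proof -
  obtain \<mu> where m: "fmap p PP H \<mu>" "\<And>a b. a \<in> carrier H \<Longrightarrow> b \<in> carrier H \<Longrightarrow> \<mu> (cp a b) = a \<otimes>\<^bsub>H\<^esub> S b"
    "\<And>z r. z \<in> carrier PP \<Longrightarrow> \<mu> (r \<odot>\<^bsub>PP\<^esub> z) = r \<odot>\<^bsub>H\<^esub> \<mu> z"
    using mu_ex[OF S_fmap S_smult] by blast
  note mc = fmap_closed[OF m(1)]
  have my: "\<mu> (cp \<one>\<^bsub>H\<^esub> y \<otimes>\<^bsub>PP\<^esub> z) = q \<odot>\<^bsub>H\<^esub> \<mu> z" if z: "z \<in> carrier PP" for z
    by (rule PP_ext[OF fmap_comp[OF ralg_fmap_r[OF PP_ralg] m(1)] fmap_comp[OF m(1) fmap_smult[OF H_rmod]]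
          H_separated H_rmod _ z]) (simp_all add: cp_mult m(2) S_y smult_mult_r)
  have "\<mu> (\<Delta> x) = coef 0 x \<odot>\<^bsub>H\<^esub> \<one>\<^bsub>H\<^esub>" if x: "x \<in> carrier H" for x
  proof (rule H_unique[OF fmap_comp[OF \<Delta>_fmap m(1)] fmap_comp[OF coef_fmap smult_fmap_base] _ _ _ _ _ _ regular_E_smult x,
        where Y = "q \<odot>\<^bsub>H\<^esub> \<one>\<^bsub>H\<^esub>" and l = "\<lambda>r. r \<odot>\<^bsub>H\<^esub> \<one>\<^bsub>H\<^esub>"])
    show "\<mu> (\<Delta> \<one>\<^bsub>H\<^esub>) = coef 0 \<one>\<^bsub>H\<^esub> \<odot>\<^bsub>H\<^esub> \<one>\<^bsub>H\<^esub>"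
      by (simp add: \<Delta>_one m(2) S_one coef_one)
    show "coef 0 (y \<otimes>\<^bsub>H\<^esub> x) \<odot>\<^bsub>H\<^esub> \<one>\<^bsub>H\<^esub> = q \<odot>\<^bsub>H\<^esub> \<one>\<^bsub>H\<^esub> \<otimes>\<^bsub>H\<^esub> (coef 0 x \<odot>\<^bsub>H\<^esub> \<one>\<^bsub>H\<^esub>)"
      if "x \<in> carrier H" for x
      using that by (simp add: coef_0_mult coef_\<theta> smult_one_mult HM.smult_smult)
    show "\<mu> (\<Delta> (y \<otimes>\<^bsub>H\<^esub> x)) = q \<odot>\<^bsub>H\<^esub> \<one>\<^bsub>H\<^esub> \<otimes>\<^bsub>H\<^esub> \<mu> (\<Delta> x)" if "x \<in> carrier H" for x
      using that by (simp only: \<Delta>_y my \<Delta>_closed smult_one_mult mc)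
  qed (simp_all add: \<Delta>_smult m(3) smult_one_mult mc coef_smult HM.smult_smult)
  then show ?thesis using m by blast
qed

text \<open>The contraction a \<otimes> b |-> S(a) b is semilinear over \<theta>, so uniqueness is
  invoked with \<theta> as scalars and the regular elements \<theta>(E n); both sides commute with
  multiplication by \<theta>(q).\<close>

lemma antipode_l:
  "\<exists>\<mu>. fmap p PP H \<mu> \<and> (\<forall>a\<in>carrier H. \<forall>b\<in>carrier H. \<mu> (cp a b) = S a \<otimes>\<^bsub>H\<^esub> b) \<and>
    (\<forall>z\<in>carrier PP. \<forall>r. \<mu> (r \<odot>\<^bsub>PP\<^esub> z) = \<theta> r \<otimes>\<^bsub>H\<^esub> \<mu> z) \<and>
    (\<forall>x\<in>carrier H. \<mu> (\<Delta> x) = \<theta> (coef 0 x))"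
proof -
  obtain \<mu> where m: "fmap p PP H \<mu>" "\<And>a b. a \<in> carrier H \<Longrightarrow> b \<in> carrier H \<Longrightarrow> \<mu> (cp a b) = S a \<otimes>\<^bsub>H\<^esub> b"
    using PP_lift[OF fmap_comp[OF S_fmap ralg_fmap_l[OF H_ralg]] ralg_additive_r[OF H_ralg S_closed] _ H_complete]
    by (auto simp: S_\<theta> smult_mult_l smult_mult_r)
  note mc = fmap_closed[OF m(1)]
  have ms: "\<mu> (r \<odot>\<^bsub>PP\<^esub> z) = \<theta> r \<otimes>\<^bsub>H\<^esub> \<mu> z" if z: "z \<in> carrier PP" for z r
    by (rule PP_ext[OF fmap_comp[OF fmap_smult[OF PP.rmod] m(1)] fmap_comp[OF m(1) ralg_fmap_r[OF H_ralg \<theta>_closed]]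
          H_separated H_rmod _ z]) (simp add: cp_smult m(2) S_smult H.m_assoc)
  have my: "\<mu> (cp \<one>\<^bsub>H\<^esub> y \<otimes>\<^bsub>PP\<^esub> z) = y \<otimes>\<^bsub>H\<^esub> \<mu> z" if z: "z \<in> carrier PP" for z
    by (rule PP_ext[OF fmap_comp[OF ralg_fmap_r[OF PP_ralg] m(1)] fmap_comp[OF m(1) ralg_fmap_r[OF H_ralg \<theta>_closed]]
          H_separated H_rmod _ z]) (simp_all add: cp_mult m(2) H.m_lcomm)
  have "\<mu> (\<Delta> x) = \<theta> (coef 0 x)" if x: "x \<in> carrier H" for x
  proof (rule H_unique[OF fmap_comp[OF \<Delta>_fmap m(1)] fmap_comp[OF coef_fmap \<theta>_fmap] _ _ _ _ _ \<theta>_closed regular_\<theta>E x,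
        where Y = y])
    show "\<mu> (\<Delta> \<one>\<^bsub>H\<^esub>) = \<theta> (coef 0 \<one>\<^bsub>H\<^esub>)"
      by (simp add: \<Delta>_one m(2) S_one coef_one)
    show "\<theta> (coef 0 (y \<otimes>\<^bsub>H\<^esub> x)) = y \<otimes>\<^bsub>H\<^esub> \<theta> (coef 0 x)" if "x \<in> carrier H" for x
      using that by (simp add: coef_0_mult coef_\<theta> \<theta>_mult)
    show "\<mu> (\<Delta> (y \<otimes>\<^bsub>H\<^esub> x)) = y \<otimes>\<^bsub>H\<^esub> \<mu> (\<Delta> x)" if "x \<in> carrier H" for x
      using that by (simp only: \<Delta>_y my \<Delta>_closed)
  qed (simp_all add: \<Delta>_smult ms coef_smult \<theta>_mult)
  then show ?thesis using m ms by blast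
qed

text \<open>Both sides are \<open>R\<close>-linear and commute with \<theta>(q), which \<Delta>
  places in the right factor, untouched by the augmentation. Used to turn the cocycle condition into
  the counit condition.\<close>

lemma counit_l:
  "\<exists>\<nu>. fmap p PP H \<nu> \<and> (\<forall>a\<in>carrier H. \<forall>b\<in>carrier H. \<nu> (cp a b) = coef 0 a \<odot>\<^bsub>H\<^esub> b) \<and>
    (\<forall>z\<in>carrier PP. \<forall>r. \<nu> (r \<odot>\<^bsub>PP\<^esub> z) = r \<odot>\<^bsub>H\<^esub> \<nu> z) \<and>
    (\<forall>x\<in>carrier H. \<nu> (\<Delta> x) = x)"
proof -
  have sm: "additive H H (\<lambda>b. r \<odot>\<^bsub>H\<^esub> b)" for r
    by (rule fmap_additive[OF fmap_smult[OF H_rmod]])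
  obtain \<nu> where m: "fmap p PP H \<nu>" "\<And>a b. a \<in> carrier H \<Longrightarrow> b \<in> carrier H \<Longrightarrow> \<nu> (cp a b) = coef 0 a \<odot>\<^bsub>H\<^esub> b"
    using PP_lift[OF fmap_comp[OF coef_fmap smult_fmap_base] sm _ H_complete, of 0]
    by (auto simp: coef_\<theta>_mult HM.smult_smult)
  note mc = fmap_closed[OF m(1)]
  have ms: "\<nu> (r \<odot>\<^bsub>PP\<^esub> z) = r \<odot>\<^bsub>H\<^esub> \<nu> z" if z: "z \<in> carrier PP" for z r
    by (rule PP_ext[OF fmap_comp[OF fmap_smult[OF PP.rmod] m(1)] fmap_comp[OF m(1) fmap_smult[OF H_rmod]]
          H_separated H_rmod _ z]) (simp add: cp_smult m(2) coef_smult HM.smult_smult)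
  have my: "\<nu> (cp \<one>\<^bsub>H\<^esub> y \<otimes>\<^bsub>PP\<^esub> z) = y \<otimes>\<^bsub>H\<^esub> \<nu> z" if z: "z \<in> carrier PP" for z
    by (rule PP_ext[OF fmap_comp[OF ralg_fmap_r[OF PP_ralg] m(1)] fmap_comp[OF m(1) ralg_fmap_r[OF H_ralg \<theta>_closed]]
          H_separated H_rmod _ z]) (simp_all add: cp_mult m(2) smult_mult_r)
  have "\<nu> (\<Delta> x) = x" if x: "x \<in> carrier H" for x
  proof (rule H_unique[OF fmap_comp[OF \<Delta>_fmap m(1)] fmap_id _ _ _ _ _ _ regular_E_smult x,
        where Y = y and l = "\<lambda>r. r \<odot>\<^bsub>H\<^esub> \<one>\<^bsub>H\<^esub>"])
    show "\<nu> (\<Delta> \<one>\<^bsub>H\<^esub>) = \<one>\<^bsub>H\<^esub>" by (simp add: \<Delta>_one m(2) coef_one)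
    show "\<nu> (\<Delta> (y \<otimes>\<^bsub>H\<^esub> x)) = y \<otimes>\<^bsub>H\<^esub> \<nu> (\<Delta> x)" if "x \<in> carrier H" for x
      using that by (simp only: \<Delta>_y my \<Delta>_closed)
  qed (simp_all add: \<Delta>_smult ms smult_one_mult mc)
  then show ?thesis using m ms by blast
qed

end

section \<open>Hyperstratifications and Taylor maps on a module\<close>

lemma symmetric_bimodule_simps [simp]:
  "carrier (symmetric_bimodule M) = carrier M"
  "add (symmetric_bimodule M) = add M"
  "ring.zero (symmetric_bimodule M) = ring.zero M"
  "module.smult (symmetric_bimodule M) = module.smult M"
  "rsmult (symmetric_bimodule M) x r = r \<odot>\<^bsub>M\<^esub> x"
  by (simp_all add: symmetric_bimodule_def module.defs bimodule.defs)

lemma adic_symmetric_bimodule [simp]: "adic p (symmetric_bimodule M) n = adic p M n"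
  by (rule adic_cong) simp_all

lemma tbimod_symmetric_bimodule:
  assumes M: "rmod M" shows "tbimod p (symmetric_bimodule M)"
proof -
  interpret M: rmodule M by (rule rmodule.intro, rule M)
  have "rmod (symmetric_bimodule M)" by (rule rmod_cong[OF _ _ _ _ M]) simp_all
  then show ?thesis
    unfolding tbimod_def bimod_def
    by (auto simp: additive_def M.smult_add_r M.smult_smult mult.commute intro: M.adic_X)
qed

section \<open>A module and its two completed tensor products with the algebra\<close>

locale taylor_module = taylor_comult p W \<theta> \<Delta>
  for p :: nat and W :: "'w::comm_ring_1 itself" and \<theta> \<Delta> +
  fixes M :: "('w fps, 'm) module"
  assumes rmod_M: "rmod M"
begin

abbreviation "N \<equiv> symmetric_bimodule M"
abbreviation "PN \<equiv> ctensor p P N"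
abbreviation "NP \<equiv> ctensor p N P"
abbreviation "NPP \<equiv> ctensor p N PP"
abbreviation "pn \<equiv> cpure p P N"
abbreviation "np \<equiv> cpure p N P"
abbreviation "actl \<equiv> act_left p \<theta> M"
abbreviation "actr \<equiv> act_right p \<theta> M"

lemma N_tbimod: "tbimod p N" by (rule tbimod_symmetric_bimodule[OF rmod_M])

end

sublocale taylor_module \<subseteq> M: rmodule M by (rule rmodule.intro, rule rmod_M)
sublocale taylor_module \<subseteq> PN: ct p "omega_bimodule p \<theta>" "symmetric_bimodule M"
  by (rule ct.intro[OF P_tbimod N_tbimod])
sublocale taylor_module \<subseteq> NP: ct p "symmetric_bimodule M" "omega_bimodule p \<theta>"
  by (rule ct.intro[OF N_tbimod P_tbimod])
sublocale taylor_module \<subseteq> NPP: ct p "symmetric_bimodule M" "ctensor p (omega_bimodule p \<theta>) (omega_bimodule p \<theta>)"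
  by (rule ct.intro[OF N_tbimod PP.tbimod])

context taylor_module
begin

lemma fmap_N: "fmap p N C f \<longleftrightarrow> fmap p M C f" "fmap p D N g \<longleftrightarrow> fmap p D M g"
  by (simp_all add: fmap_def additive_def)

lemma additive_N: "additive N C f \<longleftrightarrow> additive M C f" "additive D N g \<longleftrightarrow> additive D M g"
  by (simp_all add: additive_def)

lemma pn_closed [simp]: "a \<in> carrier H \<Longrightarrow> t \<in> carrier M \<Longrightarrow> pn a t \<in> carrier PN"
  and npp_closed [simp]: "t \<in> carrier M \<Longrightarrow> z \<in> carrier PP \<Longrightarrow> cpure p N PP t z \<in> carrier NPP"
  using PN.cpure_closed NPP.cpure_closed by simp_all

lemma pn_balanced: "a \<in> carrier H \<Longrightarrow> t \<in> carrier M \<Longrightarrow> pn a (r \<odot>\<^bsub>M\<^esub> t) = pn (a \<otimes>\<^bsub>H\<^esub> \<theta> r) t"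
  using PN.cpure_balanced[of a t r] by simp

lemma np_balanced: "t \<in> carrier M \<Longrightarrow> a \<in> carrier H \<Longrightarrow> np t (r \<odot>\<^bsub>H\<^esub> a) = np (r \<odot>\<^bsub>M\<^esub> t) a"
  using NP.cpure_balanced[of t a r] by simp

lemma pn_smult: "a \<in> carrier H \<Longrightarrow> t \<in> carrier M \<Longrightarrow> r \<odot>\<^bsub>PN\<^esub> pn a t = pn (r \<odot>\<^bsub>H\<^esub> a) t"
  using PN.cpure_smult[of a t r] by simp

lemma np_smult: "t \<in> carrier M \<Longrightarrow> a \<in> carrier H \<Longrightarrow> r \<odot>\<^bsub>NP\<^esub> np t a = np (r \<odot>\<^bsub>M\<^esub> t) a"
  using NP.cpure_smult[of t a r] by simp

lemma pn_rsmult: "a \<in> carrier H \<Longrightarrow> t \<in> carrier M \<Longrightarrow> rsmult PN (pn a t) r = pn a (r \<odot>\<^bsub>M\<^esub> t)"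
  using PN.cpure_rsmult[of a t r] by simp

lemma np_rsmult: "t \<in> carrier M \<Longrightarrow> a \<in> carrier H \<Longrightarrow> rsmult NP (np t a) r = np t (a \<otimes>\<^bsub>H\<^esub> \<theta> r)"
  using NP.cpure_rsmult[of t a r] by simp

lemma pn_fmap_l: "t \<in> carrier M \<Longrightarrow> fmap p H PN (\<lambda>a. pn a t)"
  and pn_fmap_r: "a \<in> carrier H \<Longrightarrow> fmap p M PN (\<lambda>t. pn a t)"
  and np_fmap_l: "a \<in> carrier H \<Longrightarrow> fmap p M NP (\<lambda>t. np t a)"
  and np_fmap_r: "t \<in> carrier M \<Longrightarrow> fmap p H NP (\<lambda>a. np t a)"
  using PN.cpure_fmap_l[of t] PN.cpure_fmap_r[of a] NP.cpure_fmap_l[of a] NP.cpure_fmap_r[of t]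
  by (simp_all add: fmap_P fmap_N)

lemma PN_ext:
  assumes "fmap p PN C f" "fmap p PN C g" "separated p C" "rmod C"
    "\<And>a t. a \<in> carrier H \<Longrightarrow> t \<in> carrier M \<Longrightarrow> f (pn a t) = g (pn a t)" "z \<in> carrier PN"
  shows "f z = g z"
  by (rule PN.ext[OF assms(1-4) _ assms(6)]) (use assms(5) in simp)

lemma NP_ext:
  assumes "fmap p NP C f" "fmap p NP C g" "separated p C" "rmod C"
    "\<And>t a. t \<in> carrier M \<Longrightarrow> a \<in> carrier H \<Longrightarrow> f (np t a) = g (np t a)" "z \<in> carrier NP"
  shows "f z = g z"
  by (rule NP.ext[OF assms(1-4) _ assms(6)]) (use assms(5) in simp)

lemma NPP_ext:
  assumes "fmap p NPP C f" "fmap p NPP C g" "separated p C" "rmod C"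
    "\<And>t z. t \<in> carrier M \<Longrightarrow> z \<in> carrier PP \<Longrightarrow> f (cpure p N PP t z) = g (cpure p N PP t z)" "u \<in> carrier NPP"
  shows "f u = g u"
  by (rule NPP.ext[OF assms(1-4) _ assms(6)]) (use assms(5) in simp)

lemma NP_lift:
  assumes l: "\<And>a. a \<in> carrier H \<Longrightarrow> fmap p M C (\<lambda>t. \<beta> t a)"
    and r: "\<And>t. t \<in> carrier M \<Longrightarrow> additive H C (\<beta> t)"
    and bal: "\<And>t a r. t \<in> carrier M \<Longrightarrow> a \<in> carrier H \<Longrightarrow> \<beta> (r \<odot>\<^bsub>M\<^esub> t) a = \<beta> t (r \<odot>\<^bsub>H\<^esub> a)"
    and C: "complete p C"
  shows "fmap p NP C (ctensor_lift p N P C \<beta>)"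
    and "\<And>t a. t \<in> carrier M \<Longrightarrow> a \<in> carrier H \<Longrightarrow> ctensor_lift p N P C \<beta> (np t a) = \<beta> t a"
proof -
  have "balanced p N P C \<beta>"
    by (rule balancedI) (simp_all add: l r bal fmap_P fmap_N additive_P)
  from NP.lift[OF C this] show "fmap p NP C (ctensor_lift p N P C \<beta>)"
    "\<And>t a. t \<in> carrier M \<Longrightarrow> a \<in> carrier H \<Longrightarrow> ctensor_lift p N P C \<beta> (np t a) = \<beta> t a" by auto
qed

section \<open>The actions of the algebra on the two tensor products\<close>

lemma actl:
  assumes a: "a \<in> carrier H"
  shows "fmap p PN PN (actl a)" "\<And>b t. b \<in> carrier H \<Longrightarrow> t \<in> carrier M \<Longrightarrow> actl a (pn b t) = pn (a \<otimes>\<^bsub>H\<^esub> b) t"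
proof -
  have "right_linear p P P (\<lambda>b. a \<otimes>\<^bsub>P\<^esub> b)"
    using a ralg_fmap_r[OF H_ralg a] by (simp add: right_linear_def fmap_P H.m_assoc)
  note m = ctensor_map[OF PN.ct_axioms PN.ct_axioms this left_linear_id]
  show "fmap p PN PN (actl a)" "\<And>b t. b \<in> carrier H \<Longrightarrow> t \<in> carrier M \<Longrightarrow> actl a (pn b t) = pn (a \<otimes>\<^bsub>H\<^esub> b) t"
    using m by (simp_all add: act_left_def Let_def)
qed

lemma actr:
  assumes a: "a \<in> carrier H"
  shows "fmap p NP NP (actr a)" "\<And>b t. b \<in> carrier H \<Longrightarrow> t \<in> carrier M \<Longrightarrow> actr a (np t b) = np t (a \<otimes>\<^bsub>H\<^esub> b)"
proof -
  have "left_linear P P (\<lambda>b. a \<otimes>\<^bsub>P\<^esub> b)"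
    using a ralg_additive_r[OF H_ralg a] by (simp add: left_linear_def additive_P smult_mult_r)
  note m = ctensor_map[OF NP.ct_axioms NP.ct_axioms right_linear_id this]
  show "fmap p NP NP (actr a)" "\<And>b t. b \<in> carrier H \<Longrightarrow> t \<in> carrier M \<Longrightarrow> actr a (np t b) = np t (a \<otimes>\<^bsub>H\<^esub> b)"
    using m by (simp_all add: act_right_def Let_def)
qed

lemma actl_closed [simp]: "a \<in> carrier H \<Longrightarrow> x \<in> carrier PN \<Longrightarrow> actl a x \<in> carrier PN"
  by (rule fmap_closed[OF actl(1)])

lemma actr_closed [simp]: "a \<in> carrier H \<Longrightarrow> x \<in> carrier NP \<Longrightarrow> actr a x \<in> carrier NP"
  by (rule fmap_closed[OF actr(1)])

lemma actl_add: "\<lbrakk>a \<in> carrier H; b \<in> carrier H; x \<in> carrier PN\<rbrakk> \<Longrightarrow> actl (a \<oplus>\<^bsub>H\<^esub> b) x = actl a x \<oplus>\<^bsub>PN\<^esub> actl b x"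
  by (rule PN_ext[OF actl(1) fmap_plus[OF actl(1) actl(1) PN.rmod] PN.separated PN.rmod])
    (simp_all add: actl H.l_distr fmap_add[OF pn_fmap_l])

lemma actr_add: "\<lbrakk>a \<in> carrier H; b \<in> carrier H; x \<in> carrier NP\<rbrakk> \<Longrightarrow> actr (a \<oplus>\<^bsub>H\<^esub> b) x = actr a x \<oplus>\<^bsub>NP\<^esub> actr b x"
  by (rule NP_ext[OF actr(1) fmap_plus[OF actr(1) actr(1) NP.rmod] NP.separated NP.rmod])
    (simp_all add: actr H.l_distr fmap_add[OF np_fmap_r])

lemma actl_mult: "\<lbrakk>a \<in> carrier H; b \<in> carrier H; x \<in> carrier PN\<rbrakk> \<Longrightarrow> actl (a \<otimes>\<^bsub>H\<^esub> b) x = actl a (actl b x)"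
  by (rule PN_ext[OF actl(1) fmap_comp[OF actl(1) actl(1)] PN.separated PN.rmod])
    (simp_all add: actl H.m_assoc)

lemma actr_mult: "\<lbrakk>a \<in> carrier H; b \<in> carrier H; x \<in> carrier NP\<rbrakk> \<Longrightarrow> actr (a \<otimes>\<^bsub>H\<^esub> b) x = actr a (actr b x)"
  by (rule NP_ext[OF actr(1) fmap_comp[OF actr(1) actr(1)] NP.separated NP.rmod])
    (simp_all add: actr H.m_assoc)

lemma actr_one: "x \<in> carrier NP \<Longrightarrow> actr \<one>\<^bsub>H\<^esub> x = x"
  by (rule NP_ext[OF actr(1) fmap_id NP.separated NP.rmod]) (simp_all add: actr)

lemma actl_smult: "\<lbrakk>a \<in> carrier H; x \<in> carrier PN\<rbrakk> \<Longrightarrow> actl (r \<odot>\<^bsub>H\<^esub> a) x = r \<odot>\<^bsub>PN\<^esub> actl a x"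
  by (rule PN_ext[OF actl(1) fmap_comp[OF actl(1) fmap_smult[OF PN.rmod]] PN.separated PN.rmod])
    (simp_all add: actl smult_mult_l pn_smult)

lemma actr_smult: "\<lbrakk>a \<in> carrier H; x \<in> carrier NP\<rbrakk> \<Longrightarrow> actr (r \<odot>\<^bsub>H\<^esub> a) x = r \<odot>\<^bsub>NP\<^esub> actr a x"
  by (rule NP_ext[OF actr(1) fmap_comp[OF actr(1) fmap_smult[OF NP.rmod]] NP.separated NP.rmod])
    (simp_all add: actr smult_mult_l np_smult np_balanced)

lemma actr_fmap: "x \<in> carrier NP \<Longrightarrow> fmap p H NP (\<lambda>a. actr a x)"
  by (rule fmap_linear[OF _ H_rmod NP.rmod]) (simp_all add: additive_def actr_add actr_smult)

lemma actl_additive: "x \<in> carrier PN \<Longrightarrow> additive H PN (\<lambda>a. actl a x)"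
  by (simp add: additive_def actl_add)

text \<open>By commutativity of \<open>H\<close> the element \<theta>(r) acts as the right scalar r,
  here through balancing. With the analogous fact on the other tensor product, semilinearity over
  \<theta> becomes right linearity.\<close>

lemma actl_\<theta>: "x \<in> carrier PN \<Longrightarrow> actl (\<theta> r) x = rsmult PN x r"
  by (rule PN_ext[OF actl(1) bimod_fmap[OF tbimod_bimod[OF PN.tbimod]] PN.separated PN.rmod])
    (simp_all add: actl pn_rsmult pn_balanced H.m_comm)

lemma actr_\<theta>: "x \<in> carrier NP \<Longrightarrow> actr (\<theta> r) x = rsmult NP x r"
  by (rule NP_ext[OF actr(1) bimod_fmap[OF tbimod_bimod[OF NP.tbimod]] NP.separated NP.rmod])
    (simp_all add: actr np_rsmult H.m_comm)

section \<open>The counit map, and Taylor maps as right linear maps\<close>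

abbreviation "tcM \<equiv> to_completion p M"
abbreviation "IE \<equiv> id_tensor_augmentation p \<theta> M"
abbreviation "CM \<equiv> completion p M"

lemma CM_complete: "complete p CM" by (rule M.complete_completion)

lemma IE: "fmap p NP CM IE" "\<And>t a. t \<in> carrier M \<Longrightarrow> a \<in> carrier H \<Longrightarrow> IE (np t a) = tcM (coef 0 a \<odot>\<^bsub>M\<^esub> t)"
proof -
  let ?\<beta> = "\<lambda>t a. tcM (augmentation p a \<odot>\<^bsub>M\<^esub> t)"
  have l: "fmap p M CM (\<lambda>t. ?\<beta> t a)" for a
    by (rule fmap_comp[OF fmap_smult[OF M.module] M.to_completion_fmap])
  have r: "additive H CM (?\<beta> t)" if "t \<in> carrier M" for t
    using that
    by (simp add: additive_def augmentation_eq coef_add M.smult_add_l M.to_completion_add M.to_completion_closed)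
  have bal: "?\<beta> (r \<odot>\<^bsub>M\<^esub> t) a = ?\<beta> t (r \<odot>\<^bsub>H\<^esub> a)" if "t \<in> carrier M" "a \<in> carrier H" for t a r
    using that by (simp add: augmentation_eq coef_smult M.smult_smult mult.commute)
  note L = NP_lift[of CM ?\<beta>, OF l r bal CM_complete]
  show "fmap p NP CM IE" "\<And>t a. t \<in> carrier M \<Longrightarrow> a \<in> carrier H \<Longrightarrow> IE (np t a) = tcM (coef 0 a \<odot>\<^bsub>M\<^esub> t)"
    using L by (simp_all add: id_tensor_augmentation_def augmentation_eq)
qed

lemma CM_ext:
  assumes "fmap p CM C f" "fmap p CM C g" "separated p C" "rmod C"
    "\<And>t. t \<in> carrier M \<Longrightarrow> f (tcM t) = g (tcM t)" "m \<in> carrier CM"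
  shows "f m = g m"
  by (rule M.completion_ext[OF fmap_contin[OF assms(1)] fmap_contin[OF assms(2)] assms(3-6)])

text \<open>The insertion m |-> m \<otimes> a on the completion of \<open>M\<close>, which is where
  \<open>IE\<close> takes its values.\<close>

lemma J_ex: "a \<in> carrier H \<Longrightarrow> \<exists>J. fmap p CM NP J \<and> (\<forall>t\<in>carrier M. J (tcM t) = np t a)"
  by (rule M.completion_lift[OF NP.complete np_fmap_l])

definition semilin :: "('m \<Rightarrow> ('m, 'w omega) ctens) \<Rightarrow> bool" where
  "semilin T \<longleftrightarrow> additive M NP T \<and> (\<forall>r. \<forall>t\<in>carrier M. T (r \<odot>\<^bsub>M\<^esub> t) = actr (\<theta> r) (T t))"

text \<open>Right multiplication by q - 1 raises the filtration, so semilinearity over \<theta>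
  already implies continuity. Right linearity is what makes \<theta>_M \<otimes> Id well
  defined.\<close>

lemma semilin_right_linear:
  assumes T: "semilin T" shows "right_linear p N NP T" "fmap p M NP T"
proof -
  have Ta: "additive M NP T" and Ts: "\<And>r t. t \<in> carrier M \<Longrightarrow> T (r \<odot>\<^bsub>M\<^esub> t) = rsmult NP (T t) r"
    using T additive_closed[of M NP T] by (simp_all add: semilin_def actr_\<theta>)
  show f: "fmap p M NP T"
    by (rule fmap_semilinear[OF Ta M.module NP.rmod Ts tbimod_X[OF NP.tbimod]])
  then show "right_linear p N NP T"
    using Ts by (simp add: right_linear_def fmap_N)
qed

abbreviation "cT T \<equiv> ctensor_map p N P NP P T (\<lambda>b. b)"
abbreviation "c\<Delta> \<equiv> ctensor_map p N P N PP (\<lambda>s. s) \<Delta>"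
abbreviation "aN \<equiv> assoc_r p N P P"

lemma NP_P: "ct p NP P" by (rule ct.intro[OF NP.tbimod P_tbimod])

lemma cT:
  assumes T: "semilin T"
  shows "fmap p NP (ctensor p NP P) (cT T)"
    "\<And>t a. t \<in> carrier M \<Longrightarrow> a \<in> carrier H \<Longrightarrow> cT T (np t a) = cpure p NP P (T t) a"
  using ctensor_map[OF NP.ct_axioms NP_P semilin_right_linear(1)[OF T] left_linear_id] by simp_all

lemma c\<Delta>: "fmap p NP NPP c\<Delta>"
    "\<And>t a. t \<in> carrier M \<Longrightarrow> a \<in> carrier H \<Longrightarrow> c\<Delta> (np t a) = cpure p N PP t (\<Delta> a)"
  using ctensor_map[OF NP.ct_axioms NPP.ct_axioms right_linear_id \<Delta>_left] by simp_all

lemma aN: "fmap p (ctensor p NP P) NPP aN"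
    "\<And>t a b. t \<in> carrier M \<Longrightarrow> a \<in> carrier H \<Longrightarrow> b \<in> carrier H \<Longrightarrow>
      aN (cpure p NP P (np t a) b) = cpure p N PP t (cp a b)"
  using assoc_r[OF N_tbimod P_tbimod P_tbimod] by simp_all

lemma NP_P_fmap: "b \<in> carrier H \<Longrightarrow> fmap p NP (ctensor p NP P) (\<lambda>v. cpure p NP P v b)"
  using ct.cpure_fmap_l[OF NP_P, of b] by simp

lemma aN_cT_fmap: "semilin T \<Longrightarrow> fmap p NP NPP (\<lambda>u. aN (cT T u))"
  by (rule fmap_comp[OF cT(1) aN(1)])

lemma map_NPP:
  assumes \<mu>: "fmap p PP H \<mu>" "\<And>z r. z \<in> carrier PP \<Longrightarrow> \<mu> (r \<odot>\<^bsub>PP\<^esub> z) = r \<odot>\<^bsub>H\<^esub> \<mu> z"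
  shows "fmap p NPP NP (ctensor_map p N PP N P (\<lambda>t. t) \<mu>)"
    "\<And>t z. t \<in> carrier M \<Longrightarrow> z \<in> carrier PP \<Longrightarrow>
      ctensor_map p N PP N P (\<lambda>t. t) \<mu> (cpure p N PP t z) = np t (\<mu> z)"
proof -
  have "left_linear PP P \<mu>" using \<mu> fmap_additive[OF \<mu>(1)] by (simp add: left_linear_def additive_P)
  from ctensor_map[OF NPP.ct_axioms NP.ct_axioms right_linear_id this]
  show "fmap p NPP NP (ctensor_map p N PP N P (\<lambda>t. t) \<mu>)"
    "\<And>t z. t \<in> carrier M \<Longrightarrow> z \<in> carrier PP \<Longrightarrow>
      ctensor_map p N PP N P (\<lambda>t. t) \<mu> (cpure p N PP t z) = np t (\<mu> z)" by simp_all
qed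

definition of_taylor :: "('m \<Rightarrow> ('m, 'w omega) ctens) \<Rightarrow> ('w omega, 'm) ctens \<Rightarrow> ('m, 'w omega) ctens" where
  "of_taylor T = ctensor_lift p P N NP (\<lambda>a t. actr a (T t))"

lemma of_taylor:
  assumes T: "semilin T"
  shows "fmap p PN NP (of_taylor T)"
    and "\<And>a t. a \<in> carrier H \<Longrightarrow> t \<in> carrier M \<Longrightarrow> of_taylor T (pn a t) = actr a (T t)"
    and "of_taylor T \<in> extensional (carrier PN)"
proof -
  note Tf = semilin_right_linear(2)[OF T]
  have "balanced p P N NP (\<lambda>a t. actr a (T t))"
  proof (rule balancedI)
    show "fmap p P NP (\<lambda>a. actr a (T t))" if "t \<in> carrier N" for t
      using actr_fmap[OF fmap_closed[OF Tf]] that by (simp add: fmap_P)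
    show "additive N NP (\<lambda>t. actr a (T t))" if "a \<in> carrier P" for a
      using fmap_additive[OF fmap_comp[OF Tf actr(1)]] that by (simp add: additive_N)
    show "actr (rsmult P a r) (T t) = actr a (T (r \<odot>\<^bsub>N\<^esub> t))" if "a \<in> carrier P" "t \<in> carrier N" for a t r
      using that T fmap_closed[OF Tf] by (simp add: actr_mult semilin_def)
  qed
  from PN.lift[OF NP.complete this]
  show "fmap p PN NP (of_taylor T)"
    "\<And>a t. a \<in> carrier H \<Longrightarrow> t \<in> carrier M \<Longrightarrow> of_taylor T (pn a t) = actr a (T t)"
    "of_taylor T \<in> extensional (carrier PN)" by (simp_all add: of_taylor_def)
qed

lemma of_taylor_act:
  assumes T: "semilin T" and a: "a \<in> carrier H" and x: "x \<in> carrier PN"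
  shows "of_taylor T (actl a x) = actr a (of_taylor T x)"
  by (rule PN_ext[OF fmap_comp[OF actl(1)[OF a] of_taylor(1)[OF T]] fmap_comp[OF of_taylor(1)[OF T] actr(1)[OF a]]
        NP.separated NP.rmod _ x])
    (use a T fmap_closed[OF semilin_right_linear(2)[OF T]] in \<open>simp_all add: actl of_taylor actr_mult\<close>)

text \<open>Linearity over the algebra contains both scalar linearities: left scalars act through r
  times 1, right scalars through \<theta>(r). Hence \<epsilon> \<otimes> Id and Id \<otimes>
  \<epsilon> are both defined and continuous.\<close>

lemma act_linear:
  assumes e: "additive PN NP e" "\<And>a x. a \<in> carrier H \<Longrightarrow> x \<in> carrier PN \<Longrightarrow> e (actl a x) = actr a (e x)"
  shows "left_linear PN NP e" "right_linear p PN NP e" "fmap p PN NP e"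
proof -
  have act1: "actl \<one>\<^bsub>H\<^esub> x = x" if "x \<in> carrier PN" for x
    by (rule PN_ext[OF actl(1) fmap_id PN.separated PN.rmod _ that]) (simp_all add: actl)
  have "e (r \<odot>\<^bsub>PN\<^esub> x) = r \<odot>\<^bsub>NP\<^esub> e x" if x: "x \<in> carrier PN" for r x
    using e(2)[OF _ x, of "r \<odot>\<^bsub>H\<^esub> \<one>\<^bsub>H\<^esub>"] x additive_closed[OF e(1) x]
    by (simp add: actl_smult actr_smult act1 actr_one)
  then show l: "left_linear PN NP e" using e(1) by (simp add: left_linear_def)
  then show f: "fmap p PN NP e"
    by (intro fmap_linear[OF e(1) PN.rmod NP.rmod]) (simp add: left_linear_def)
  have "e (rsmult PN x r) = rsmult NP (e x) r" if x: "x \<in> carrier PN" for r x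
    using e(2)[OF _ x, of "\<theta> r"] x additive_closed[OF e(1) x] by (simp add: actl_\<theta> actr_\<theta>)
  then show "right_linear p PN NP e" using f by (simp add: right_linear_def)
qed

abbreviation "coc e x \<equiv> aN (ctensor_map p PN P NP P e (\<lambda>b. b) (assoc_l p P N P
  (ctensor_map p P PN P NP (\<lambda>b. b) e (assoc_r p P P N (ctensor_map p P N PP N \<Delta> (\<lambda>s. s) x)))))"

text \<open>The composite cannot be evaluated on pure tensors in one go, because neither \<Delta>(a)
  nor \<epsilon>(b \<otimes> t) is pure. The claims record continuity at these two places and the
  values on pure tensors in between.\<close>

lemma cocycle_pure:
  assumes e: "left_linear PN NP e" "right_linear p PN NP e" "fmap p PN NP e"
  shows "fmap p PN NPP (coc e)"
    and "\<And>a t. a \<in> carrier H \<Longrightarrow> t \<in> carrier M \<Longrightarrow> coc e (pn a t) = aN (ctensor_map p PN P NP P e (\<lambda>b. b) (assoc_l p P N P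
      (ctensor_map p P PN P NP (\<lambda>b. b) e (assoc_r p P P N (cpure p PP N (\<Delta> a) t)))))"
    and "\<And>t. t \<in> carrier M \<Longrightarrow> fmap p PP NPP (\<lambda>w. aN (ctensor_map p PN P NP P e (\<lambda>b. b) (assoc_l p P N P
      (ctensor_map p P PN P NP (\<lambda>b. b) e (assoc_r p P P N (cpure p PP N w t))))))"
    and "\<And>a b t. a \<in> carrier H \<Longrightarrow> b \<in> carrier H \<Longrightarrow> t \<in> carrier M \<Longrightarrow>
      ctensor_map p P PN P NP (\<lambda>b. b) e (assoc_r p P P N (cpure p PP N (cp a b) t)) = cpure p P NP a (e (pn b t))"
    and "\<And>a. a \<in> carrier H \<Longrightarrow> fmap p NP NPP (\<lambda>u. aN (ctensor_map p PN P NP P e (\<lambda>b. b) (assoc_l p P N P (cpure p P NP a u))))"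
    and "\<And>a b t. a \<in> carrier H \<Longrightarrow> b \<in> carrier H \<Longrightarrow> t \<in> carrier M \<Longrightarrow>
      ctensor_map p PN P NP P e (\<lambda>b. b) (assoc_l p P N P (cpure p P NP a (np t b))) = cpure p NP P (e (pn a t)) b"
proof -
  interpret PPN: ct p PP N by (rule ct.intro[OF PP.tbimod N_tbimod])
  interpret P_PN: ct p P PN by (rule ct.intro[OF P_tbimod PN.tbimod])
  interpret P_NP: ct p P NP by (rule ct.intro[OF P_tbimod NP.tbimod])
  interpret PN_P: ct p PN P by (rule ct.intro[OF PN.tbimod P_tbimod])
  note m1 = ctensor_map[OF PN.ct_axioms PPN.ct_axioms \<Delta>_right left_linear_id]
  note m2 = assoc_r[OF P_tbimod P_tbimod N_tbimod]
  note m3 = ctensor_map[OF P_PN.ct_axioms P_NP.ct_axioms right_linear_id e(1)]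
  note m4 = assoc_l[OF P_tbimod N_tbimod P_tbimod]
  note m5 = ctensor_map[OF PN_P.ct_axioms NP_P e(2) left_linear_id]
  note f23 = fmap_comp[OF m2(1) m3(1)]
  note f45 = fmap_comp[OF fmap_comp[OF m4(1) m5(1)] aN(1)]
  show "fmap p PN NPP (coc e)"
    by (rule fmap_comp[OF fmap_comp[OF m1(1) f23] f45])
  show "coc e (pn a t) = aN (ctensor_map p PN P NP P e (\<lambda>b. b) (assoc_l p P N P
      (ctensor_map p P PN P NP (\<lambda>b. b) e (assoc_r p P P N (cpure p PP N (\<Delta> a) t)))))"
    if "a \<in> carrier H" "t \<in> carrier M" for a t
    using that by (simp add: m1(2))
  show "fmap p PP NPP (\<lambda>w. aN (ctensor_map p PN P NP P e (\<lambda>b. b) (assoc_l p P N P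
      (ctensor_map p P PN P NP (\<lambda>b. b) e (assoc_r p P P N (cpure p PP N w t))))))" if "t \<in> carrier M" for t
    using fmap_comp[OF PPN.cpure_fmap_l fmap_comp[OF f23 f45], of t] that by simp
  show "ctensor_map p P PN P NP (\<lambda>b. b) e (assoc_r p P P N (cpure p PP N (cp a b) t)) = cpure p P NP a (e (pn b t))"
    if "a \<in> carrier H" "b \<in> carrier H" "t \<in> carrier M" for a b t
    using that by (simp add: m2(2) m3(2))
  show "fmap p NP NPP (\<lambda>u. aN (ctensor_map p PN P NP P e (\<lambda>b. b) (assoc_l p P N P (cpure p P NP a u))))"
    if "a \<in> carrier H" for a
    using fmap_comp[OF P_NP.cpure_fmap_r f45, of a] that by simp
  show "ctensor_map p PN P NP P e (\<lambda>b. b) (assoc_l p P N P (cpure p P NP a (np t b))) = cpure p NP P (e (pn a t)) b"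
    if "a \<in> carrier H" "b \<in> carrier H" "t \<in> carrier M" for a b t
    using that by (simp add: m4(2) m5(2))
qed

end

context taylor_module
begin

section \<open>The correspondence on objects\<close>

definition equivariant :: "(('w omega, 'm) ctens \<Rightarrow> ('m, 'w omega) ctens) \<Rightarrow> bool" where
  "equivariant e \<longleftrightarrow> additive PN NP e \<and> (\<forall>a\<in>carrier H. \<forall>x\<in>carrier PN. e (actl a x) = actr a (e x))"

lemma is_hyperstratification_iff:
  "is_hyperstratification p \<theta> \<Delta> M e \<longleftrightarrow> e \<in> extensional (carrier PN) \<and> equivariant e \<and>
    bij_betw e (carrier PN) (carrier NP) \<and> (\<forall>x\<in>carrier PN. coc e x = c\<Delta> (e x))"
  by (simp add: is_hyperstratification_def Let_def equivariant_def additive_def PiE_def conj_ac)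

lemma is_Taylor_map_iff:
  "is_Taylor_map p \<theta> \<Delta> M T \<longleftrightarrow> T \<in> extensional (carrier M) \<and> semilin T \<and>
    (\<forall>s\<in>carrier M. IE (T s) = tcM s) \<and> (\<forall>s\<in>carrier M. aN (cT T (T s)) = c\<Delta> (T s))"
  by (simp add: is_Taylor_map_def Let_def semilin_def additive_def PiE_def conj_ac)

definition to_taylor :: "(('w omega, 'm) ctens \<Rightarrow> ('m, 'w omega) ctens) \<Rightarrow> 'm \<Rightarrow> ('m, 'w omega) ctens" where
  "to_taylor e = (\<lambda>s\<in>carrier M. e (pn \<one>\<^bsub>H\<^esub> s))"

lemma equivariant_linear:
  assumes "equivariant e"
  shows "left_linear PN NP e" "right_linear p PN NP e" "fmap p PN NP e"
  using act_linear[of e] assms by (simp_all add: equivariant_def)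

lemma equivariant_closed: "equivariant e \<Longrightarrow> x \<in> carrier PN \<Longrightarrow> e x \<in> carrier NP"
  by (rule fmap_closed[OF equivariant_linear(3)])

lemma equivariant_pure:
  assumes e: "equivariant e" and at: "a \<in> carrier H" "t \<in> carrier M"
  shows "e (pn a t) = actr a (to_taylor e t)"
proof -
  have "e (actl a (pn \<one>\<^bsub>H\<^esub> t)) = actr a (e (pn \<one>\<^bsub>H\<^esub> t))" using e at by (simp add: equivariant_def)
  then show ?thesis using at by (simp add: actl to_taylor_def)
qed

lemma semilin_to_taylor:
  assumes e: "equivariant e" shows "semilin (to_taylor e)"
  unfolding semilin_def
proof (intro conjI allI ballI additiveI)
  show "to_taylor e s \<in> carrier NP" if "s \<in> carrier M" for s
    using that equivariant_closed[OF e] by (simp add: to_taylor_def)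
  show "to_taylor e (s \<oplus>\<^bsub>M\<^esub> t) = to_taylor e s \<oplus>\<^bsub>NP\<^esub> to_taylor e t" if "s \<in> carrier M" "t \<in> carrier M" for s t
    using that by (simp add: to_taylor_def fmap_add[OF pn_fmap_r] fmap_add[OF equivariant_linear(3)[OF e]])
  show "to_taylor e (r \<odot>\<^bsub>M\<^esub> t) = actr (\<theta> r) (to_taylor e t)" if t: "t \<in> carrier M" for r t
    using equivariant_pure[OF e \<theta>_closed t, of r] t by (simp add: to_taylor_def pn_balanced)
qed

lemma equivariant_of_taylor: "semilin T \<Longrightarrow> equivariant (of_taylor T)"
  using of_taylor_act[of T] fmap_additive[OF of_taylor(1)[of T]] by (simp add: equivariant_def)

lemma to_of_taylor:
  assumes T: "semilin T" "T \<in> extensional (carrier M)" shows "to_taylor (of_taylor T) = T"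
proof (rule extensionalityI[OF _ T(2)])
  show "to_taylor (of_taylor T) s = T s" if "s \<in> carrier M" for s
    using that T(1) fmap_closed[OF semilin_right_linear(2)[OF T(1)]] by (simp add: to_taylor_def of_taylor actr_one)
qed (simp add: to_taylor_def)

lemma of_to_taylor:
  assumes e: "equivariant e" "e \<in> extensional (carrier PN)" shows "of_taylor (to_taylor e) = e"
proof (rule extensionalityI[OF of_taylor(3)[OF semilin_to_taylor[OF e(1)]] e(2)])
  fix x assume x: "x \<in> carrier PN"
  show "of_taylor (to_taylor e) x = e x"
    by (rule PN_ext[OF of_taylor(1)[OF semilin_to_taylor[OF e(1)]] equivariant_linear(3)[OF e(1)] NP.separated NP.rmod _ x])
      (simp add: of_taylor(2)[OF semilin_to_taylor[OF e(1)]] equivariant_pure[OF e(1)])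
qed

abbreviation "actw w \<equiv> ctensor_map p N PP N PP (\<lambda>t. t) (\<lambda>z. w \<otimes>\<^bsub>PP\<^esub> z)"

lemma PP_mult_closed [simp]: "w \<in> carrier PP \<Longrightarrow> z \<in> carrier PP \<Longrightarrow> w \<otimes>\<^bsub>PP\<^esub> z \<in> carrier PP"
  by (rule fmap_closed[OF ralg_fmap_r[OF PP_ralg]])

lemma actw:
  assumes w: "w \<in> carrier PP"
  shows "fmap p NPP NPP (actw w)"
    and "\<And>t z. t \<in> carrier M \<Longrightarrow> z \<in> carrier PP \<Longrightarrow> actw w (cpure p N PP t z) = cpure p N PP t (w \<otimes>\<^bsub>PP\<^esub> z)"
proof -
  have "left_linear PP PP (\<lambda>z. w \<otimes>\<^bsub>PP\<^esub> z)"
    using w ralg_additive_r[OF PP_ralg w] by (simp add: left_linear_def ralg_smult[OF PP_ralg])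
  note m = ctensor_map[OF NPP.ct_axioms NPP.ct_axioms right_linear_id this]
  show "fmap p NPP NPP (actw w)"
    "\<And>t z. t \<in> carrier M \<Longrightarrow> z \<in> carrier PP \<Longrightarrow> actw w (cpure p N PP t z) = cpure p N PP t (w \<otimes>\<^bsub>PP\<^esub> z)"
    using m by simp_all
qed

lemma npp_fmap_r: "t \<in> carrier M \<Longrightarrow> fmap p PP NPP (\<lambda>z. cpure p N PP t z)"
  using NPP.cpure_fmap_r[of t] by simp

lemma npp_balanced: "t \<in> carrier M \<Longrightarrow> z \<in> carrier PP \<Longrightarrow> cpure p N PP t (r \<odot>\<^bsub>PP\<^esub> z) = cpure p N PP (r \<odot>\<^bsub>M\<^esub> t) z"
  using NPP.cpure_balanced[of t z r] by simp

lemma npp_smult: "t \<in> carrier M \<Longrightarrow> z \<in> carrier PP \<Longrightarrow> r \<odot>\<^bsub>NPP\<^esub> cpure p N PP t z = cpure p N PP (r \<odot>\<^bsub>M\<^esub> t) z"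
  using NPP.cpure_smult[of t z r] by simp

lemma actw_fmap:
  assumes u: "u \<in> carrier NPP" shows "fmap p PP NPP (\<lambda>w. actw w u)"
proof (rule fmap_linear[OF additiveI PP.rmod NPP.rmod])
  show "actw w u \<in> carrier NPP" if "w \<in> carrier PP" for w
    by (rule fmap_closed[OF actw(1)[OF that] u])
  show "actw (w \<oplus>\<^bsub>PP\<^esub> w') u = actw w u \<oplus>\<^bsub>NPP\<^esub> actw w' u" if w: "w \<in> carrier PP" "w' \<in> carrier PP" for w w'
    by (rule NPP_ext[OF actw(1) fmap_plus[OF actw(1) actw(1) NPP.rmod] NPP.separated NPP.rmod _ u])
      (simp_all add: w actw(2) additive_add[OF ralg_additive_l[OF PP_ralg]] fmap_add[OF npp_fmap_r])
  show "actw (r \<odot>\<^bsub>PP\<^esub> w) u = r \<odot>\<^bsub>NPP\<^esub> actw w u" if w: "w \<in> carrier PP" for r w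
    by (rule NPP_ext[OF actw(1) fmap_comp[OF actw(1) fmap_smult[OF NPP.rmod]] NPP.separated NPP.rmod _ u])
      (simp_all add: w actw(2) ralg_smult[OF PP_ralg] npp_smult npp_balanced)
qed

lemma c\<Delta>_actr:
  assumes a: "a \<in> carrier H" and u: "u \<in> carrier NP"
  shows "c\<Delta> (actr a u) = actw (\<Delta> a) (c\<Delta> u)"
  by (rule NP_ext[OF fmap_comp[OF actr(1) c\<Delta>(1)] fmap_comp[OF c\<Delta>(1) actw(1)] NPP.separated NPP.rmod _ u])
    (simp_all add: a actr c\<Delta> actw(2) \<Delta>_mult)

lemma aN_actr:
  assumes "v \<in> carrier NP" "a \<in> carrier H" "b \<in> carrier H" "c \<in> carrier H"
  shows "aN (cpure p NP P (actr a v) (b \<otimes>\<^bsub>H\<^esub> c)) = actw (cp a b) (aN (cpure p NP P v c))"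
  by (rule NP_ext[OF fmap_comp[OF fmap_comp[OF actr(1) NP_P_fmap] aN(1)]
        fmap_comp[OF fmap_comp[OF NP_P_fmap aN(1)] actw(1)] NPP.separated NPP.rmod _ assms(1)])
    (simp_all add: assms actr aN actw(2) cp_mult)

text \<open>Both sides of the cocycle condition for $\epsilon$ at $a \otimes s$ are obtained from those of
  the one for $\theta_M$ at $s$ through multiplication by $\Delta(a)$.\<close>

lemma coc_pure:
  assumes e: "equivariant e" and at: "a \<in> carrier H" "t \<in> carrier M"
  shows "coc e (pn a t) = actw (\<Delta> a) (aN (cT (to_taylor e) (to_taylor e t)))"
proof -
  let ?T = "to_taylor e"
  note T = semilin_to_taylor[OF e]
  note C = cocycle_pure[OF equivariant_linear[OF e]]
  have Tc: "?T s \<in> carrier NP" if "s \<in> carrier M" for s by (rule fmap_closed[OF semilin_right_linear(2)[OF T] that])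
  have u: "aN (cT ?T (?T t)) \<in> carrier NPP" by (rule fmap_closed[OF aN_cT_fmap[OF T] Tc[OF at(2)]])
  \<comment> \<open>The inner value of \<epsilon> is only a limit of sums of pure tensors, so the
    formula is proved for an arbitrary \<open>u\<close> by density; the same is then done for an
    arbitrary \<open>w\<close> in place of \<Delta>(a).\<close>
  have in_u: "aN (ctensor_map p PN P NP P e (\<lambda>b. b) (assoc_l p P N P (cpure p P NP b (actr c u)))) =
      actw (cp b c) (aN (cT ?T u))" if bc: "b \<in> carrier H" "c \<in> carrier H" and u: "u \<in> carrier NP" for b c u
    by (rule NP_ext[OF fmap_comp[OF actr(1)[OF bc(2)] C(5)[OF bc(1)]] fmap_comp[OF aN_cT_fmap[OF T] actw(1)]
          NPP.separated NPP.rmod _ u])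
      (simp_all add: bc actr C(6) cT[OF T] equivariant_pure[OF e] aN_actr Tc)
  have "aN (ctensor_map p PN P NP P e (\<lambda>b. b) (assoc_l p P N P
      (ctensor_map p P PN P NP (\<lambda>b. b) e (assoc_r p P P N (cpure p PP N w t))))) = actw w (aN (cT ?T (?T t)))"
    if w: "w \<in> carrier PP" for w
    by (rule PP_ext[OF C(3)[OF at(2)] actw_fmap[OF u] NPP.separated NPP.rmod _ w])
      (simp add: at C(4) equivariant_pure[OF e] in_u Tc)
  then show ?thesis using at by (simp add: C(2))
qed

lemma actw_one: "u \<in> carrier NPP \<Longrightarrow> actw (\<Delta> \<one>\<^bsub>H\<^esub>) u = u"
proof (rule NPP_ext[OF actw(1) fmap_id NPP.separated NPP.rmod])
  fix t z assume tz: "t \<in> carrier M" "z \<in> carrier PP"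
  have "cp \<one>\<^bsub>H\<^esub> \<one>\<^bsub>H\<^esub> \<otimes>\<^bsub>PP\<^esub> z = z"
    by (rule PP_ext[OF ralg_fmap_r[OF PP_ralg] fmap_id PP.separated PP.rmod _ tz(2)]) (simp_all add: cp_mult)
  then show "actw (\<Delta> \<one>\<^bsub>H\<^esub>) (cpure p N PP t z) = cpure p N PP t z"
    using tz by (simp add: actw(2) \<Delta>_one)
qed simp_all

text \<open>One direction is the value at 1 \<otimes> s. In the other, both sides at a \<otimes> s
  arise from those at s through \<Delta>(a), and pure tensors are dense.\<close>

lemma cocycle_iff:
  assumes e: "equivariant e"
  shows "(\<forall>x\<in>carrier PN. coc e x = c\<Delta> (e x)) \<longleftrightarrow>
    (\<forall>s\<in>carrier M. aN (cT (to_taylor e) (to_taylor e s)) = c\<Delta> (to_taylor e s))"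
proof -
  let ?T = "to_taylor e"
  note T = semilin_to_taylor[OF e]
  have Tc: "?T s \<in> carrier NP" if "s \<in> carrier M" for s by (rule fmap_closed[OF semilin_right_linear(2)[OF T] that])
  show ?thesis
  proof (intro iffI ballI)
    fix s assume coc: "\<forall>x\<in>carrier PN. coc e x = c\<Delta> (e x)" and s: "s \<in> carrier M"
    have u: "aN (cT ?T (?T s)) \<in> carrier NPP" by (rule fmap_closed[OF aN_cT_fmap[OF T] Tc[OF s]])
    have "c\<Delta> (?T s) = coc e (pn \<one>\<^bsub>H\<^esub> s)" using coc s by (simp add: to_taylor_def)
    then show "aN (cT ?T (?T s)) = c\<Delta> (?T s)"
      unfolding coc_pure[OF e H.one_closed s] actw_one[OF u] by simp
  next
    fix x assume h: "\<forall>s\<in>carrier M. aN (cT ?T (?T s)) = c\<Delta> (?T s)" and x: "x \<in> carrier PN"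
    show "coc e x = c\<Delta> (e x)"
    proof (rule PN_ext[OF cocycle_pure(1)[OF equivariant_linear[OF e]]
          fmap_comp[OF equivariant_linear(3)[OF e] c\<Delta>(1)] NPP.separated NPP.rmod _ x])
      fix a t assume at: "a \<in> carrier H" "t \<in> carrier M"
      show "coc e (pn a t) = c\<Delta> (e (pn a t))"
        unfolding coc_pure[OF e at] equivariant_pure[OF e at] using at h Tc by (simp add: c\<Delta>_actr)
    qed
  qed
qed

lemma actr_J:
  assumes J: "fmap p CM NP J" "\<And>t. t \<in> carrier M \<Longrightarrow> J (tcM t) = np t b"
    and J': "fmap p CM NP J'" "\<And>t. t \<in> carrier M \<Longrightarrow> J' (tcM t) = np t (a \<otimes>\<^bsub>H\<^esub> b)"
    and ab: "a \<in> carrier H" "b \<in> carrier H" and m: "m \<in> carrier CM"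
  shows "actr a (J m) = J' m"
  by (rule CM_ext[OF fmap_comp[OF J(1) actr(1)] J'(1) NP.separated NP.rmod _ m]) (simp_all add: ab J(2) J'(2) actr)

lemma IE_T_closed: "semilin T \<Longrightarrow> t \<in> carrier M \<Longrightarrow> IE (T t) \<in> carrier CM"
  by (rule fmap_closed[OF fmap_comp[OF semilin_right_linear(2) IE(1)]])

text \<open>Applying $e \otimes \mathrm{Id}$ to the cocycle condition shows that
  $(\mathrm{Id}_M \otimes e) \circ \theta_M$, extended linearly to $M \otimes \widehat{R\langle\omega\rangle}$,
  fixes the image of $\epsilon$, which is everything.\<close>

lemma counit_of_cocycle:
  assumes e: "equivariant e" "e ` carrier PN = carrier NP"
    and coc: "\<And>s. s \<in> carrier M \<Longrightarrow> aN (cT (to_taylor e) (to_taylor e s)) = c\<Delta> (to_taylor e s)"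
    and t: "t \<in> carrier M"
  shows "IE (to_taylor e t) = tcM t"
proof -
  let ?T = "to_taylor e"
  note T = semilin_to_taylor[OF e(1)]
  have Tc: "?T s \<in> carrier NP" if "s \<in> carrier M" for s by (rule fmap_closed[OF semilin_right_linear(2)[OF T] that])
  obtain \<nu> where n: "fmap p PP H \<nu>" "\<And>a b. a \<in> carrier H \<Longrightarrow> b \<in> carrier H \<Longrightarrow> \<nu> (cp a b) = coef 0 a \<odot>\<^bsub>H\<^esub> b"
    "\<And>z r. z \<in> carrier PP \<Longrightarrow> \<nu> (r \<odot>\<^bsub>PP\<^esub> z) = r \<odot>\<^bsub>H\<^esub> \<nu> z" "\<And>x. x \<in> carrier H \<Longrightarrow> \<nu> (\<Delta> x) = x"
    using counit_l by auto
  define Nu where "Nu = ctensor_map p N PP N P (\<lambda>t. t) \<nu>"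
  note Nu = map_NPP[OF n(1) n(3), folded Nu_def]
  have "\<forall>a\<in>carrier H. \<exists>J. fmap p CM NP J \<and> (\<forall>t\<in>carrier M. J (tcM t) = np t a)" using J_ex by simp
  then obtain J where J: "\<And>a. a \<in> carrier H \<Longrightarrow> fmap p CM NP (J a)"
    "\<And>a t. a \<in> carrier H \<Longrightarrow> t \<in> carrier M \<Longrightarrow> J a (tcM t) = np t a" unfolding bchoice_iff by auto
  have Nu_\<Delta>: "Nu (c\<Delta> u) = u" if u: "u \<in> carrier NP" for u
    by (rule NP_ext[OF fmap_comp[OF c\<Delta>(1) Nu(1)] fmap_id NP.separated NP.rmod _ u]) (simp_all add: c\<Delta> Nu(2) n)
  have Nu_aN: "Nu (aN (cpure p NP P v c)) = J c (IE v)" if vc: "v \<in> carrier NP" "c \<in> carrier H" for v c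
    by (rule NP_ext[OF fmap_comp[OF fmap_comp[OF NP_P_fmap aN(1)] Nu(1)] fmap_comp[OF IE(1) J(1)]
          NP.separated NP.rmod _ vc(1)])
      (simp_all add: vc(2) aN Nu(2) n J IE(2) np_balanced)
  \<comment> \<open>\<theta>_M \<otimes> Id followed by the augmentation on the middle factor. On
    pure tensors this inserts the counit of \<theta>_M; on values of \<theta>_M the cocycle
    condition makes it the identity.\<close>
  define G where "G u = Nu (aN (cT ?T u))" for u
  have Gf: "fmap p NP NP G" unfolding G_def by (rule fmap_comp[OF aN_cT_fmap[OF T] Nu(1)])
  have Gp: "G (np t c) = J c (IE (?T t))" if "t \<in> carrier M" "c \<in> carrier H" for t c
    using that Tc by (simp add: G_def cT[OF T] Nu_aN)
  have GT: "G (?T t) = ?T t" if "t \<in> carrier M" for t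
    using that Tc by (simp add: G_def coc Nu_\<Delta>)
  have G_act: "G (actr a u) = actr a (G u)" if a: "a \<in> carrier H" and u: "u \<in> carrier NP" for a u
  proof (rule NP_ext[OF fmap_comp[OF actr(1)[OF a] Gf] fmap_comp[OF Gf actr(1)[OF a]] NP.separated NP.rmod _ u])
    fix t b assume tb: "t \<in> carrier M" "b \<in> carrier H"
    have "actr a (J b (IE (?T t))) = J (a \<otimes>\<^bsub>H\<^esub> b) (IE (?T t))"
      by (rule actr_J[OF J(1) J(2) J(1) J(2) _ _ IE_T_closed[OF T tb(1)]]) (simp_all add: a tb)
    then show "G (actr a (np t b)) = actr a (G (np t b))" using a tb by (simp add: actr Gp)
  qed
  have Ge: "G (e x) = e x" if x: "x \<in> carrier PN" for x
    by (rule PN_ext[OF fmap_comp[OF equivariant_linear(3)[OF e(1)] Gf] equivariant_linear(3)[OF e(1)]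
          NP.separated NP.rmod _ x])
      (simp add: equivariant_pure[OF e(1)] G_act GT Tc)
  \<comment> \<open>Surjectivity enters here: t \<otimes> 1 is a value of the hyperstratification
    and is therefore fixed by \<open>G\<close>.\<close>
  have "np t \<one>\<^bsub>H\<^esub> \<in> e ` carrier PN" unfolding e(2) using t by simp
  then have "G (np t \<one>\<^bsub>H\<^esub>) = np t \<one>\<^bsub>H\<^esub>" using Ge by auto
  then have "J \<one>\<^bsub>H\<^esub> (IE (?T t)) = np t \<one>\<^bsub>H\<^esub>" using t by (simp add: Gp)
  \<comment> \<open>\<open>IE\<close> undoes the insertion of 1, which brings the equality back to
    the completion of \<open>M\<close>.\<close>
  moreover have "IE (J \<one>\<^bsub>H\<^esub> m) = m" if m: "m \<in> carrier CM" for m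
    by (rule CM_ext[OF fmap_comp[OF J(1)[OF H.one_closed] IE(1)] fmap_id complete_separated[OF CM_complete]
          complete_rmod[OF CM_complete] _ m]) (simp add: J(2) IE(2) coef_one)
  ultimately have "IE (?T t) = IE (np t \<one>\<^bsub>H\<^esub>)" using IE_T_closed[OF T t] by metis
  then show ?thesis using t by (simp add: IE(2) coef_one)
qed

text \<open>The inverse of $\epsilon$ is the $\widehat{R\langle\omega\rangle}$-linear extension of
  $s \mapsto \sigma(s)$, where \<open>\<sigma>\<close> is $\theta_M$ followed by $s \otimes b \mapsto S(b) \otimes s$.\<close>

lemma bij_of_taylor:
  assumes T: "semilin T" and counit: "\<And>s. s \<in> carrier M \<Longrightarrow> IE (T s) = tcM s"
    and coc: "\<And>s. s \<in> carrier M \<Longrightarrow> aN (cT T (T s)) = c\<Delta> (T s)"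
  shows "bij_betw (of_taylor T) (carrier PN) (carrier NP)"
proof -
  note Tf = semilin_right_linear(2)[OF T]
  note Tc = fmap_closed[OF Tf]
  define e where "e = of_taylor T"
  note e = of_taylor(1,2)[OF T, folded e_def]
  note e_act = of_taylor_act[OF T, folded e_def]
  \<comment> \<open>The flip s \<otimes> b |-> S(b) \<otimes> s is balanced because the antipode
    turns left scalars into right ones. It also turns right scalars into left ones, so that \<sigma>
    will be linear.\<close>
  define fl where "fl = ctensor_lift p N P PN (\<lambda>s b. pn (S b) s)"
  have fl: "fmap p NP PN fl" "\<And>t b. t \<in> carrier M \<Longrightarrow> b \<in> carrier H \<Longrightarrow> fl (np t b) = pn (S b) t"
    unfolding fl_def
    by (rule NP_lift[OF pn_fmap_r fmap_additive[OF fmap_comp[OF S_fmap pn_fmap_l]] _ PN.complete];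
        simp add: pn_balanced S_smult H.m_comm)+
  have fl_\<theta>: "fl (actr (\<theta> r) u) = r \<odot>\<^bsub>PN\<^esub> fl u" if u: "u \<in> carrier NP" for r u
    by (rule NP_ext[OF fmap_comp[OF actr(1) fl(1)] fmap_comp[OF fl(1) fmap_smult[OF PN.rmod]] PN.separated PN.rmod _ u])
      (simp_all add: actr fl(2) pn_smult H.m_comm[of "\<theta> r"] S_\<theta>)
  define \<sigma> where "\<sigma> s = fl (T s)" for s
  have \<sigma>f: "fmap p M PN \<sigma>" unfolding \<sigma>_def by (rule fmap_comp[OF Tf fl(1)])
  note \<sigma>c = fmap_closed[OF \<sigma>f]
  have \<sigma>_smult: "\<sigma> (r \<odot>\<^bsub>M\<^esub> s) = r \<odot>\<^bsub>PN\<^esub> \<sigma> s" if "s \<in> carrier M" for r s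
    using that T Tc by (simp add: \<sigma>_def semilin_def fl_\<theta>)
  have actl_r: "actl a (r \<odot>\<^bsub>PN\<^esub> x) = actl (r \<odot>\<^bsub>H\<^esub> a) x" if a: "a \<in> carrier H" and x: "x \<in> carrier PN" for a r x
    by (rule PN_ext[OF fmap_comp[OF fmap_smult[OF PN.rmod] actl(1)] actl(1) PN.separated PN.rmod _ x])
      (simp_all add: a actl pn_smult smult_mult_l smult_mult_r)
  define \<Psi> where "\<Psi> = ctensor_lift p N P PN (\<lambda>s a. actl a (\<sigma> s))"
  have \<Psi>: "fmap p NP PN \<Psi>" "\<And>t b. t \<in> carrier M \<Longrightarrow> b \<in> carrier H \<Longrightarrow> \<Psi> (np t b) = actl b (\<sigma> t)"
    unfolding \<Psi>_def
    by (rule NP_lift[OF fmap_comp[OF \<sigma>f actl(1)] actl_additive[OF \<sigma>c] _ PN.complete];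
        simp add: \<sigma>_smult actl_r \<sigma>c)+
  have \<Psi>_act: "\<Psi> (actr a u) = actl a (\<Psi> u)" if a: "a \<in> carrier H" and u: "u \<in> carrier NP" for a u
    by (rule NP_ext[OF fmap_comp[OF actr(1) \<Psi>(1)] fmap_comp[OF \<Psi>(1) actl(1)] PN.separated PN.rmod _ u])
      (simp_all add: a actr \<Psi>(2) actl_mult \<sigma>c)
  \<comment> \<open>By the cocycle condition, \<epsilon>(\<sigma>(s)) is \<theta>_M(s) with a
    \<otimes> b |-> a S(b) applied to \<Delta> of its right factor. The antipode identity reduces
    this to the counit, giving s \<otimes> 1.\<close>
  have e\<Psi>: "e (\<Psi> u) = u" if u: "u \<in> carrier NP" for u
  proof -
    obtain \<mu> where m: "fmap p PP H \<mu>" "\<And>a b. a \<in> carrier H \<Longrightarrow> b \<in> carrier H \<Longrightarrow> \<mu> (cp a b) = a \<otimes>\<^bsub>H\<^esub> S b"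
      "\<And>z r. z \<in> carrier PP \<Longrightarrow> \<mu> (r \<odot>\<^bsub>PP\<^esub> z) = r \<odot>\<^bsub>H\<^esub> \<mu> z"
      "\<And>x. x \<in> carrier H \<Longrightarrow> \<mu> (\<Delta> x) = coef 0 x \<odot>\<^bsub>H\<^esub> \<one>\<^bsub>H\<^esub>"
      using antipode_r by auto
    define \<kappa> where "\<kappa> = ctensor_map p N PP N P (\<lambda>t. t) \<mu>"
    note \<kappa> = map_NPP[OF m(1) m(3), folded \<kappa>_def]
    obtain J where J: "fmap p CM NP J" "\<And>t. t \<in> carrier M \<Longrightarrow> J (tcM t) = np t \<one>\<^bsub>H\<^esub>"
      using J_ex[OF H.one_closed] by auto
    have 1: "\<kappa> (c\<Delta> u) = J (IE u)" if u: "u \<in> carrier NP" for u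
      by (rule NP_ext[OF fmap_comp[OF c\<Delta>(1) \<kappa>(1)] fmap_comp[OF IE(1) J(1)] NP.separated NP.rmod _ u])
        (simp_all add: c\<Delta> \<kappa>(2) m IE(2) J(2) np_balanced)
    have 2: "\<kappa> (aN (cpure p NP P v b)) = actr (S b) v" if vb: "v \<in> carrier NP" "b \<in> carrier H" for v b
      by (rule NP_ext[OF fmap_comp[OF fmap_comp[OF NP_P_fmap aN(1)] \<kappa>(1)] actr(1) NP.separated NP.rmod _ vb(1)])
        (simp_all add: vb aN \<kappa>(2) m actr H.m_comm)
    have 3: "e (fl u) = \<kappa> (aN (cT T u))" if u: "u \<in> carrier NP" for u
      by (rule NP_ext[OF fmap_comp[OF fl(1) e(1)] fmap_comp[OF aN_cT_fmap[OF T] \<kappa>(1)] NP.separated NP.rmod _ u])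
        (simp_all add: fl(2) e(2) cT[OF T] 2 Tc)
    have "e (\<sigma> s) = np s \<one>\<^bsub>H\<^esub>" if "s \<in> carrier M" for s
      using that by (simp add: \<sigma>_def 3 Tc coc 1 counit J(2))
    then show ?thesis
      by (intro NP_ext[OF fmap_comp[OF \<Psi>(1) e(1)] fmap_id NP.separated NP.rmod _ u])
        (simp_all add: \<Psi>(2) e_act \<sigma>c actr)
  qed
  have \<Psi>e: "\<Psi> (e x) = x" if x: "x \<in> carrier PN" for x
  proof -
    obtain \<mu> where m: "fmap p PP H \<mu>" "\<And>a b. a \<in> carrier H \<Longrightarrow> b \<in> carrier H \<Longrightarrow> \<mu> (cp a b) = S a \<otimes>\<^bsub>H\<^esub> b"
      "\<And>z r. z \<in> carrier PP \<Longrightarrow> \<mu> (r \<odot>\<^bsub>PP\<^esub> z) = \<theta> r \<otimes>\<^bsub>H\<^esub> \<mu> z"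
      "\<And>x. x \<in> carrier H \<Longrightarrow> \<mu> (\<Delta> x) = \<theta> (coef 0 x)"
      using antipode_l by auto
    note mc = fmap_closed[OF m(1)]
    \<comment> \<open>The contraction S(a) b is semilinear over \<theta>, so Id \<otimes> \<mu>
      would not be balanced. With the factors swapped, the scalar \<theta>(r) is absorbed by the
      balancing of the tensor product with \<open>M\<close> on the right.\<close>
    define \<kappa> where "\<kappa> = ctensor_lift p N PP PN (\<lambda>t z. pn (\<mu> z) t)"
    have "balanced p N PP PN (\<lambda>t z. pn (\<mu> z) t)"
    proof (rule balancedI)
      show "fmap p N PN (\<lambda>t. pn (\<mu> z) t)" if "z \<in> carrier PP" for z
        using pn_fmap_r[OF mc[OF that]] by (simp add: fmap_N)
      show "additive PP PN (\<lambda>z. pn (\<mu> z) t)" if "t \<in> carrier N" for t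
        using fmap_additive[OF fmap_comp[OF m(1) pn_fmap_l]] that by simp
      show "pn (\<mu> z) (rsmult N t r) = pn (\<mu> (r \<odot>\<^bsub>PP\<^esub> z)) t" if "t \<in> carrier N" "z \<in> carrier PP" for t z r
        using that mc by (simp add: pn_balanced m(3) H.m_comm)
    qed
    note \<kappa> = NPP.lift(1,2)[OF PN.complete this, folded \<kappa>_def]
    obtain J where J: "fmap p CM PN J" "\<And>t. t \<in> carrier M \<Longrightarrow> J (tcM t) = pn \<one>\<^bsub>H\<^esub> t"
      using M.completion_lift[OF PN.complete pn_fmap_r[OF H.one_closed]] by auto
    have 1: "\<kappa> (c\<Delta> u) = J (IE u)" if u: "u \<in> carrier NP" for u
      by (rule NP_ext[OF fmap_comp[OF c\<Delta>(1) \<kappa>(1)] fmap_comp[OF IE(1) J(1)] PN.separated PN.rmod _ u])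
        (simp_all add: c\<Delta> \<kappa>(2) m IE(2) J(2) pn_balanced)
    have 2: "\<kappa> (aN (cpure p NP P v b)) = actl b (fl v)" if vb: "v \<in> carrier NP" "b \<in> carrier H" for v b
      by (rule NP_ext[OF fmap_comp[OF fmap_comp[OF NP_P_fmap aN(1)] \<kappa>(1)] fmap_comp[OF fl(1) actl(1)]
            PN.separated PN.rmod _ vb(1)])
        (simp_all add: vb aN \<kappa>(2) m actl fl(2) H.m_comm)
    have 3: "\<Psi> u = \<kappa> (aN (cT T u))" if u: "u \<in> carrier NP" for u
      by (rule NP_ext[OF \<Psi>(1) fmap_comp[OF aN_cT_fmap[OF T] \<kappa>(1)] PN.separated PN.rmod _ u])
        (simp_all add: \<Psi>(2) cT[OF T] 2 Tc \<sigma>_def)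
    have "\<Psi> (T s) = pn \<one>\<^bsub>H\<^esub> s" if "s \<in> carrier M" for s
      using that by (simp add: 3 Tc coc 1 counit J(2))
    then show ?thesis
      by (intro PN_ext[OF fmap_comp[OF e(1) \<Psi>(1)] fmap_id PN.separated PN.rmod _ x])
        (simp_all add: e(2) \<Psi>_act Tc actl)
  qed
  show ?thesis
    by (rule bij_betwI[of _ _ _ \<Psi>])
      (use e\<Psi> \<Psi>e fmap_closed[OF e(1)] fmap_closed[OF \<Psi>(1)] in \<open>simp_all add: e_def Pi_iff\<close>)
qed

lemma Taylor_map_to_taylor:
  assumes "is_hyperstratification p \<theta> \<Delta> M e"
  shows "is_Taylor_map p \<theta> \<Delta> M (to_taylor e)" "of_taylor (to_taylor e) = e"
proof -
  have e: "e \<in> extensional (carrier PN)" "equivariant e" "e ` carrier PN = carrier NP"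
    and c: "\<forall>x\<in>carrier PN. coc e x = c\<Delta> (e x)"
    using assms by (simp_all add: is_hyperstratification_iff bij_betw_def)
  have c': "aN (cT (to_taylor e) (to_taylor e s)) = c\<Delta> (to_taylor e s)" if "s \<in> carrier M" for s
    using c that unfolding cocycle_iff[OF e(2)] by simp
  show "is_Taylor_map p \<theta> \<Delta> M (to_taylor e)"
    unfolding is_Taylor_map_iff
    using semilin_to_taylor[OF e(2)] c' counit_of_cocycle[OF e(2,3) c'] by (simp add: to_taylor_def)
  show "of_taylor (to_taylor e) = e" by (rule of_to_taylor[OF e(2,1)])
qed

lemma hyperstratification_of_taylor:
  assumes "is_Taylor_map p \<theta> \<Delta> M T"
  shows "is_hyperstratification p \<theta> \<Delta> M (of_taylor T)" "to_taylor (of_taylor T) = T"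
proof -
  have T: "T \<in> extensional (carrier M)" "semilin T" "\<And>s. s \<in> carrier M \<Longrightarrow> IE (T s) = tcM s"
    and c: "\<And>s. s \<in> carrier M \<Longrightarrow> aN (cT T (T s)) = c\<Delta> (T s)"
    using assms by (simp_all add: is_Taylor_map_iff)
  show eq: "to_taylor (of_taylor T) = T" by (rule to_of_taylor[OF T(2,1)])
  note e = equivariant_of_taylor[OF T(2)]
  have "\<forall>x\<in>carrier PN. coc (of_taylor T) x = c\<Delta> (of_taylor T x)"
    unfolding cocycle_iff[OF e] eq using c by simp
  then show "is_hyperstratification p \<theta> \<Delta> M (of_taylor T)"
    unfolding is_hyperstratification_iff using e of_taylor(3)[OF T(2)] bij_of_taylor[OF T(2,3) c] by simp
qed

end

section \<open>Morphisms and the isomorphism of categories\<close>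

locale taylor_linear =
  dom: taylor_module p W \<theta> \<Delta> M + cod: taylor_module p W \<theta> \<Delta> M'
  for p :: nat and W :: "'w::comm_ring_1 itself" and \<theta> \<Delta>
    and M :: "('w fps, 'm) module" and M' :: "('w fps, 'n) module" +
  fixes f :: "'m \<Rightarrow> 'n"
  assumes linear: "f \<in> linear_maps M M'"
begin

abbreviation "fP \<equiv> ctensor_map p dom.N dom.P cod.N dom.P f (\<lambda>b. b)"
abbreviation "Pf \<equiv> ctensor_map p dom.P dom.N dom.P cod.N (\<lambda>b. b) f"

lemma closed [simp]: "t \<in> carrier M \<Longrightarrow> f t \<in> carrier M'"
  using linear by (auto simp: linear_maps_def)

lemma left_linear: "left_linear dom.N cod.N f"
  using linear by (simp add: linear_maps_def left_linear_def additive_def PiE_def)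

lemma right_linear: "right_linear p dom.N cod.N f"
proof -
  have "fmap p M M' f"
    using linear by (intro fmap_linear[OF _ dom.rmod_M cod.rmod_M]) (simp_all add: linear_maps_def additive_def PiE_def)
  then show ?thesis
    using linear by (simp add: right_linear_def dom.fmap_N cod.fmap_N linear_maps_def)
qed

lemma fP: "fmap p dom.NP cod.NP fP"
  and fP_np: "t \<in> carrier M \<Longrightarrow> a \<in> carrier dom.H \<Longrightarrow> fP (dom.np t a) = cod.np (f t) a"
  using ctensor_map(1,2)[OF dom.NP.ct_axioms cod.NP.ct_axioms right_linear left_linear_id] by simp_all

lemma Pf: "fmap p dom.PN cod.PN Pf"
  and Pf_pn: "t \<in> carrier M \<Longrightarrow> a \<in> carrier dom.H \<Longrightarrow> Pf (dom.pn a t) = cod.pn a (f t)"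
  using ctensor_map(1,2)[OF dom.PN.ct_axioms cod.PN.ct_axioms right_linear_id left_linear] by simp_all

lemma fP_actr:
  assumes a: "a \<in> carrier dom.H" and u: "u \<in> carrier dom.NP"
  shows "fP (dom.actr a u) = cod.actr a (fP u)"
  by (rule dom.NP_ext[OF fmap_comp[OF dom.actr(1) fP] fmap_comp[OF fP cod.actr(1)] cod.NP.separated cod.NP.rmod _ u])
    (simp_all add: a dom.actr cod.actr fP_np)

text \<open>Every map in the square for \<epsilon> is compatible with the action of the algebra, so
  the square is determined by its restriction to the elements 1 \<otimes> s.\<close>

lemma morphism_iff:
  assumes e: "dom.equivariant e" and e': "cod.equivariant e'"
  shows "(\<forall>x\<in>carrier dom.PN. fP (e x) = e' (Pf x)) \<longleftrightarrow>
    (\<forall>s\<in>carrier M. fP (dom.to_taylor e s) = cod.to_taylor e' (f s))"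
proof (intro iffI ballI)
  fix s assume h: "\<forall>x\<in>carrier dom.PN. fP (e x) = e' (Pf x)" and s: "s \<in> carrier M"
  have "fP (e (dom.pn \<one>\<^bsub>dom.H\<^esub> s)) = e' (Pf (dom.pn \<one>\<^bsub>dom.H\<^esub> s))" using h s by simp
  then show "fP (dom.to_taylor e s) = cod.to_taylor e' (f s)"
    using s by (simp add: dom.to_taylor_def cod.to_taylor_def Pf_pn)
next
  fix x assume h: "\<forall>s\<in>carrier M. fP (dom.to_taylor e s) = cod.to_taylor e' (f s)" and x: "x \<in> carrier dom.PN"
  note T = fmap_closed[OF dom.semilin_right_linear(2)[OF dom.semilin_to_taylor[OF e]]]
  show "fP (e x) = e' (Pf x)"
    by (rule dom.PN_ext[OF fmap_comp[OF dom.equivariant_linear(3)[OF e] fP]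
          fmap_comp[OF Pf cod.equivariant_linear(3)[OF e']] cod.NP.separated cod.NP.rmod _ x])
      (simp add: dom.equivariant_pure[OF e] cod.equivariant_pure[OF e'] Pf_pn fP_actr T h)
qed

end

lemma linear_maps_id: "(\<lambda>s\<in>carrier M. s) \<in> linear_maps M M" if "rmod M"
proof -
  interpret M: rmodule M by (rule rmodule.intro, rule that)
  show ?thesis by (auto simp: linear_maps_def)
qed

lemma linear_maps_compose:
  assumes "rmod A" "f \<in> linear_maps A B" "g \<in> linear_maps B C"
  shows "compose (carrier A) g f \<in> linear_maps A C"
proof -
  interpret A: rmodule A by (rule rmodule.intro, rule assms)
  show ?thesis using assms by (auto simp: linear_maps_def compose_def Pi_iff PiE_def)
qed

text \<open>Both functors are the identity on morphisms, so equality of the hom sets suffices, and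
  the category axioms of \<open>C\<close> are inherited from those of \<open>D\<close>.\<close>

lemma isomorphic_categoriesI:
  assumes D: "is_category D"
    and F: "\<And>x. x \<in> Ob C \<Longrightarrow> F x \<in> Ob D \<and> G (F x) = x"
    and G: "\<And>y. y \<in> Ob D \<Longrightarrow> G y \<in> Ob C \<and> F (G y) = y"
    and Arr: "\<And>x y. x \<in> Ob C \<Longrightarrow> y \<in> Ob C \<Longrightarrow> Arr C x y = Arr D (F x) (F y)"
    and Ide: "\<And>x. x \<in> Ob C \<Longrightarrow> Ide C x = Ide D (F x)"
    and Cmp: "\<And>x y z. x \<in> Ob C \<Longrightarrow> y \<in> Ob C \<Longrightarrow> z \<in> Ob C \<Longrightarrow> Cmp C x y z = Cmp D (F x) (F y) (F z)"
  shows "isomorphic_categories C D"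
proof -
  have C: "is_category C"
    using D F unfolding is_category_def by (simp add: Arr Ide Cmp)
  have "is_functor C D F (\<lambda>_ _ f. f)"
    using F by (simp add: is_functor_def Arr Ide Cmp)
  moreover have "is_functor D C G (\<lambda>_ _ f. f)"
    using G by (simp add: is_functor_def Arr Ide Cmp)
  ultimately show ?thesis
    unfolding isomorphic_categories_def using C D F G
    by (intro conjI exI[of _ F] exI[of _ G] exI[of _ "\<lambda>_ _ f. f"]) simp_all
qed

section \<open>The two categories\<close>

context taylor_comult
begin

lemma taylor_module: "rmod M \<Longrightarrow> taylor_module p \<theta> \<Delta> M"
  by (rule taylor_module.intro[OF taylor_comult_axioms taylor_module_axioms.intro])

lemma taylor_linear: "rmod M \<Longrightarrow> rmod M' \<Longrightarrow> f \<in> linear_maps M M' \<Longrightarrow> taylor_linear p \<theta> \<Delta> M M' f"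
  by (rule taylor_linear.intro[OF taylor_module taylor_module taylor_linear_axioms.intro])

abbreviation "on_NP M M' f \<equiv>
  ctensor_map p (symmetric_bimodule M) P (symmetric_bimodule M') P f (\<lambda>b. b)"

lemma Taylor_map_closed:
  assumes M: "rmod M" "is_Taylor_map p \<theta> \<Delta> M T" and t: "t \<in> carrier M"
  shows "T t \<in> carrier (ctensor p (symmetric_bimodule M) P)"
proof -
  interpret taylor_module p W \<theta> \<Delta> M by (rule taylor_module[OF M(1)])
  have "semilin T" using M(2) by (simp only: is_Taylor_map_iff)
  from fmap_closed[OF semilin_right_linear(2)[OF this] t] show ?thesis .
qed

lemma Taylor_morphism_id:
  assumes M: "rmod M" "is_Taylor_map p \<theta> \<Delta> M T" and t: "t \<in> carrier M"
  shows "on_NP M M (\<lambda>s\<in>carrier M. s) (T t) = T t"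
proof -
  interpret taylor_linear p W \<theta> \<Delta> M M "\<lambda>s\<in>carrier M. s"
    by (rule taylor_linear[OF M(1) M(1) linear_maps_id[OF M(1)]])
  show ?thesis
    by (rule dom.NP_ext[OF fP fmap_id dom.NP.separated dom.NP.rmod _ Taylor_map_closed[OF M t]]) (simp_all add: fP_np)
qed

lemma Taylor_morphism_compose:
  assumes M: "rmod M" "rmod M'" "rmod M''" and fg: "f \<in> linear_maps M M'" "g \<in> linear_maps M' M''"
    and u: "u \<in> carrier (ctensor p (symmetric_bimodule M) P)"
  shows "on_NP M M'' (compose (carrier M) g f) u = on_NP M' M'' g (on_NP M M' f u)"
proof -
  interpret f: taylor_linear p W \<theta> \<Delta> M M' f by (rule taylor_linear[OF M(1,2) fg(1)])
  interpret g: taylor_linear p W \<theta> \<Delta> M' M'' g by (rule taylor_linear[OF M(2,3) fg(2)])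
  interpret gf: taylor_linear p W \<theta> \<Delta> M M'' "compose (carrier M) g f"
    by (rule taylor_linear[OF M(1,3) linear_maps_compose[OF M(1) fg]])
  show ?thesis
    by (rule f.dom.NP_ext[OF gf.fP fmap_comp[OF f.fP g.fP] g.cod.NP.separated g.cod.NP.rmod _ u])
      (simp add: f.fP_np g.fP_np gf.fP_np compose_eq)
qed

lemma Taylor_morphism_simp:
  "f \<in> Arr (Taylor_modules p \<theta> \<Delta> TYPE('m)) (M, T) (M', T') \<longleftrightarrow>
    f \<in> linear_maps M M' \<and> (\<forall>t\<in>carrier M. on_NP M M' f (T t) = T' (f t))"
  by (simp add: Taylor_modules_def Let_def)

lemma Taylor_object_simp:
  "(M, T) \<in> Ob (Taylor_modules p \<theta> \<Delta> TYPE('m)) \<longleftrightarrow> rmod M \<and> is_Taylor_map p \<theta> \<Delta> M T"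
  by (simp add: Taylor_modules_def Let_def)

text \<open>Checked on the Taylor side, where compatibility is a condition on elements of
  \<open>M\<close>; closure under composition is functoriality of the completed tensor
  product.\<close>

lemma Taylor_category: "is_category (Taylor_modules p \<theta> \<Delta> TYPE('m))" (is "is_category ?C")
proof -
  have Ide: "Ide ?C (M, T) = (\<lambda>s\<in>carrier M. s)" for M and T :: "'m \<Rightarrow> ('m, 'w omega) ctens"
    by (simp add: Taylor_modules_def Let_def)
  have Cmp: "Cmp ?C (M, T) y z g f = compose (carrier M) g f" for M T y z g f
    by (simp add: Taylor_modules_def Let_def)
  have ide: "Ide ?C x \<in> Arr ?C x x" if "x \<in> Ob ?C" for x
  proof (cases x)
    case (Pair M T)
    then show ?thesis using that linear_maps_id[of M] Taylor_morphism_id[of M T]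
      by (simp add: Ide Taylor_morphism_simp Taylor_object_simp)
  qed
  have cmp: "Cmp ?C x y z g f \<in> Arr ?C x z"
    if x: "x \<in> Ob ?C" and y: "y \<in> Ob ?C" and z: "z \<in> Ob ?C" and f: "f \<in> Arr ?C x y" and g: "g \<in> Arr ?C y z" for x y z f g
  proof -
    obtain M T M' T' M'' T'' where eq: "x = (M, T)" "y = (M', T')" "z = (M'', T'')" by (metis surj_pair)
    have M: "rmod M" "rmod M'" "rmod M''" "is_Taylor_map p \<theta> \<Delta> M T"
      using x y z unfolding eq Taylor_object_simp by simp_all
    have f': "f \<in> linear_maps M M'" "\<And>t. t \<in> carrier M \<Longrightarrow> on_NP M M' f (T t) = T' (f t)"
      using f unfolding eq Taylor_morphism_simp by simp_all
    have g': "g \<in> linear_maps M' M''" "\<And>t. t \<in> carrier M' \<Longrightarrow> on_NP M' M'' g (T' t) = T'' (g t)"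
      using g unfolding eq Taylor_morphism_simp by simp_all
    have fc: "f t \<in> carrier M'" if "t \<in> carrier M" for t using f'(1) that by (auto simp: linear_maps_def)
    show ?thesis
      unfolding eq Cmp Taylor_morphism_simp
      using linear_maps_compose[OF M(1) f'(1) g'(1)]
      by (simp add: Taylor_morphism_compose[OF M(1-3) f'(1) g'(1) Taylor_map_closed[OF M(1,4)]] f'(2) g'(2) fc compose_eq)
  qed
  have lin: "f \<in> carrier M \<rightarrow>\<^sub>E carrier M'" if "f \<in> Arr ?C (M, T) (M', T')" for f M T M' T'
    using that by (simp add: Taylor_morphism_simp linear_maps_def)
  show ?thesis
    unfolding is_category_def
  proof (intro conjI ballI)
    fix x y f assume "f \<in> Arr ?C x y"
    then have f: "f \<in> carrier (fst x) \<rightarrow>\<^sub>E carrier (fst y)" using lin[of f "fst x" "snd x" "fst y" "snd y"] by simp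
    show "Cmp ?C x x y f (Ide ?C x) = f"
      using f compose_Id[of f "carrier (fst x)" "carrier (fst y)"] by (cases x) (simp add: Cmp Ide PiE_def)
    show "Cmp ?C x y y (Ide ?C y) f = f"
      using f Id_compose[of f "carrier (fst x)" "carrier (fst y)"] by (cases x; cases y) (simp add: Cmp Ide PiE_def)
  next
    fix x y z t f g h assume "f \<in> Arr ?C x y" "g \<in> Arr ?C y z" "h \<in> Arr ?C z t"
    then have f: "f \<in> carrier (fst x) \<rightarrow> carrier (fst y)"
      using lin[of f "fst x" "snd x" "fst y" "snd y"] by (simp add: PiE_def)
    show "Cmp ?C x z t h (Cmp ?C x y z g f) = Cmp ?C x y t (Cmp ?C y z t h g) f"
      using compose_assoc[OF f, of h g] by (cases x; cases y; cases z) (simp add: Cmp)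
  qed (use ide cmp in auto)
qed

lemma hyperstratified_isomorphic_Taylor:
  "isomorphic_categories (hyperstratified_modules p \<theta> \<Delta> TYPE('m)) (Taylor_modules p \<theta> \<Delta> TYPE('m))"
  (is "isomorphic_categories ?C ?D")
proof (rule isomorphic_categoriesI[OF Taylor_category])
  let ?F = "\<lambda>(M, e). (M, taylor_module.to_taylor p \<theta> M e)"
  let ?G = "\<lambda>(M, T). (M, taylor_module.of_taylor p \<theta> M T)"
  have Ob: "(M, e) \<in> Ob ?C \<longleftrightarrow> rmod M \<and> is_hyperstratification p \<theta> \<Delta> M e" for M e
    by (simp add: hyperstratified_modules_def Let_def)
  show "?F x \<in> Ob ?D \<and> ?G (?F x) = x" if x: "x \<in> Ob ?C" for x
  proof -
    obtain M e where eq: "x = (M, e)" by (cases x)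
    have h: "rmod M" "is_hyperstratification p \<theta> \<Delta> M e" using x unfolding eq Ob by auto
    interpret taylor_module p W \<theta> \<Delta> M by (rule taylor_module[OF h(1)])
    show ?thesis using Taylor_map_to_taylor[OF h(2)] h(1) unfolding eq by (simp add: Taylor_object_simp)
  qed
  show "?G y \<in> Ob ?C \<and> ?F (?G y) = y" if y: "y \<in> Ob ?D" for y
  proof -
    obtain M T where eq: "y = (M, T)" by (cases y)
    have h: "rmod M" "is_Taylor_map p \<theta> \<Delta> M T" using y unfolding eq Taylor_object_simp by auto
    interpret taylor_module p W \<theta> \<Delta> M by (rule taylor_module[OF h(1)])
    show ?thesis using hyperstratification_of_taylor[OF h(2)] h(1) unfolding eq by (simp add: Ob)
  qed
  show "Arr ?C x y = Arr ?D (?F x) (?F y)" if x: "x \<in> Ob ?C" and y: "y \<in> Ob ?C" for x y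
  proof -
    obtain M e M' e' where eq: "x = (M, e)" "y = (M', e')" by (metis surj_pair)
    have h: "rmod M" "is_hyperstratification p \<theta> \<Delta> M e" "rmod M'" "is_hyperstratification p \<theta> \<Delta> M' e'"
      using x y unfolding eq Ob by auto
    have "f \<in> Arr ?C x y \<longleftrightarrow> f \<in> Arr ?D (?F x) (?F y)" for f
    \<comment> \<open>Membership includes linearity in both categories, and it is for linear
      \<open>f\<close> that the tensor maps are known to have their intended values.\<close>
    proof (cases "f \<in> linear_maps M M'")
      case True
      interpret taylor_linear p W \<theta> \<Delta> M M' f by (rule taylor_linear[OF h(1,3) True])
      have "dom.equivariant e" "cod.equivariant e'"
        using h(2,4) by (simp_all add: dom.is_hyperstratification_iff cod.is_hyperstratification_iff)
      from morphism_iff[OF this] show ?thesis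
        using True unfolding eq by (simp add: Taylor_morphism_simp hyperstratified_modules_def Let_def)
    next
      case False
      then show ?thesis unfolding eq by (simp add: Taylor_morphism_simp hyperstratified_modules_def Let_def)
    qed
    then show ?thesis by blast
  qed
  show "Ide ?C x = Ide ?D (?F x)" "Cmp ?C x y z = Cmp ?D (?F x) (?F y) (?F z)" for x y z
    by (cases x; simp add: hyperstratified_modules_def Taylor_modules_def Let_def)+
qed

end

theorem proposition5p3:
  fixes p :: nat
    and \<theta> :: "'w::comm_ring_1 fps \<Rightarrow> 'w omega"
    and \<Delta> :: "'w omega \<Rightarrow> ('w omega, 'w omega) ctens"
  assumes "Factorial_Ring.prime p"
    and "p_adically_complete p TYPE('w)"
    and "is_Taylor_hom p \<theta>"
    and "is_comultiplication p \<theta> \<Delta>"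
  shows "isomorphic_categories
    (hyperstratified_modules p \<theta> \<Delta> TYPE('m))
    (Taylor_modules p \<theta> \<Delta> TYPE('m))"
proof -
  interpret taylor_comult p "TYPE('w)" \<theta> \<Delta>
    by (intro taylor_comult.intro taylor.intro pcomplete.intro taylor_axioms.intro taylor_comult_axioms.intro assms)
  show ?thesis by (rule hyperstratified_isomorphic_Taylor)
qed

end
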